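(* Let $p$ be a prime and let $G$ be a finite group with $G = \mathbf{O}^{p'}(G)$ and $\mathrm{Pr}_p(G) = \frac{p^2+p-1}{p^3}$. Let $Q = \mathbf{O}_p(G)$. Then one of the following holds, where in (iii)--(v) $k$ is some positive integer: (i) $G$ is a $p$-group with $|G : \mathbf{Z}(G)| = p^2$. (ii) $p \geq 5$, $Q$ is abelian and $G = \mathrm{SL}_2(p) \times Q$ or $G = \mathrm{PSL}_2(p) \times Q$. (iii) $p = 2^r - 1 \geq 3$ is a Mersenne prime and $G = ((C_2)^r {:} C_{p^k}) \times A$, where $C_{p^k}$ acts as a Singer cycle of order $p$ on $(C_2)^r$ and $A \leq Q$ is abelian. (iv) $p = 3$ and $G = (Q_8 {:} C_{3^k}) \times A$, where $A \leq Q$ is abelian. (v) $p = 2$ and $G = (C_3 {:} C_{2^k}) \times A$, where $A \leq Q$ is abelian.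
   Context: For a finite group $G$ and a prime $p$, $G_p$ denotes the set of $p$-elements of $G$, i.e. the elements of order $p^m$ for some $m \geq 0$ (so $1 \in G_p$), and $$\mathrm{Pr}_p(G) = \frac{|\{(x,y) \in G_p \times G_p : xy = yx\}|}{|G_p|^2}.$$ $\mathbf{O}^{p'}(G)$ is the subgroup of $G$ generated by $G_p$; $\mathbf{O}_p(G)$ is the largest normal $p$-subgroup of $G$; $\mathbf{Z}(G)$ is the center of $G$. $C_n$ is the cyclic group of order $n$, $Q_8$ is the quaternion group of order $8$, and $N{:}H$ denotes a semidirect product with normal subgroup $N$. Equalities such as $G = \mathrm{SL}_2(p) \times Q$ are up to isomorphism. A Singer cycle on $(C_2)^r$ is an element of $\mathrm{GL}_r(2)$ of order $2^r - 1$ permuting the nonzero vectors of $\mathbb{F}_2^r$ transitively; "$C_{p^k}$ acts as a Singer cycle of order $p$" means that a generator of $C_{p^k}$ induces such an element (of order $p = 2^r-1$) on $(C_2)^r$. *)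

theory Defs
  imports
    "HOL-Algebra.Elementary_Groups"
    "HOL-Algebra.Product_Groups"
    "HOL-Algebra.Bij"
    "HOL-Algebra.SndIsomorphismGrp"
    "HOL-Number_Theory.Residues"
begin

section \<open>\<open>p\<close>-elements and the commuting probability\<close>

definition p_elements :: "('a, 'b) monoid_scheme \<Rightarrow> nat \<Rightarrow> 'a set"
  where "p_elements G p = {x \<in> carrier G. \<exists>m. group.ord G x = p ^ m}"

definition Pr :: "('a, 'b) monoid_scheme \<Rightarrow> nat \<Rightarrow> real"
  where "Pr G p =
    real (card {(x, y) \<in> p_elements G p \<times> p_elements G p. x \<otimes>\<^bsub>G\<^esub> y = y \<otimes>\<^bsub>G\<^esub> x})
      / (real (card (p_elements G p)))\<^sup>2"

section \<open>Characteristic subgroups\<close>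

text \<open>The subgroup usually written \<open>O\<close> with upper index \<open>p'\<close>.\<close>

definition O_upper_p' :: "('a, 'b) monoid_scheme \<Rightarrow> nat \<Rightarrow> 'a set"
  where "O_upper_p' G p = generate G (p_elements G p)"

definition normal_p_subgroup :: "('a, 'b) monoid_scheme \<Rightarrow> nat \<Rightarrow> 'a set \<Rightarrow> bool"
  where "normal_p_subgroup G p N \<longleftrightarrow> N \<lhd> G \<and> (\<exists>m. card N = p ^ m)"

text \<open>Existence and uniqueness of the largest normal \<open>p\<close>-subgroup of a finite group is
  \<open>O_lower_p_greatest\<close> below.\<close>

definition O_lower_p :: "('a, 'b) monoid_scheme \<Rightarrow> nat \<Rightarrow> 'a set"
  where "O_lower_p G p =
    (THE Q. normal_p_subgroup G p Q \<and> (\<forall>N. normal_p_subgroup G p N \<longrightarrow> N \<subseteq> Q))"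

definition center :: "('a, 'b) monoid_scheme \<Rightarrow> 'a set"
  where "center G = {z \<in> carrier G. \<forall>x \<in> carrier G. z \<otimes>\<^bsub>G\<^esub> x = x \<otimes>\<^bsub>G\<^esub> z}"

lemma (in group) normal_p_subgroup_set_mult:
  assumes p: "prime p"
    and M: "normal_p_subgroup G p M" and N: "normal_p_subgroup G p N"
  shows "normal_p_subgroup G p (M <#> N)"
proof -
  have nM: "M \<lhd> G" and nN: "N \<lhd> G"
    using M N by (auto simp: normal_p_subgroup_def)
  obtain a b where a: "card M = p ^ a" and b: "card N = p ^ b"
    using M N by (auto simp: normal_p_subgroup_def)
  interpret S: second_isomorphism_grp M G N
    using nM nN by (simp add: second_isomorphism_grp_def second_isomorphism_grp_axioms_def normal_imp_subgroup)
  let ?K = "G\<lparr>carrier := M <#> N\<rparr>"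
  let ?N = "G\<lparr>carrier := N\<rparr>"
  interpret K: group ?K
    using S.normal_set_mult_subgroup subgroup_imp_group by blast
  interpret N: group ?N
    using nN normal_imp_subgroup subgroup_imp_group by blast
  have subM: "subgroup M ?K"
    using S.H_contained_in_set_mult S.normal_set_mult_subgroup normal_imp_subgroup[OF nM]
    by (simp add: subgroup_incl)
  have subI: "subgroup (M \<inter> N) ?N"
    using S.normal_subgrp_intersection_normal by (simp add: Int_commute normal_imp_subgroup)
  have "bij_betw (\<lambda>X. the_elem ((\<lambda>g. M #> g) ` X)) (carrier (?N Mod (M \<inter> N))) (carrier (?K Mod M))"
    using S.normal_intersection_quotient_isom by (simp add: iso_def)
  then have eq: "card (rcosets\<^bsub>?N\<^esub> (M \<inter> N)) = card (rcosets\<^bsub>?K\<^esub> M)"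
    using bij_betw_same_card by (force simp: FactGroup_def)
  have "card (rcosets\<^bsub>?N\<^esub> (M \<inter> N)) * card (M \<inter> N) = p ^ b"
    using N.lagrange[OF subI] b by (simp add: order_def)
  then have "card (rcosets\<^bsub>?N\<^esub> (M \<inter> N)) dvd p ^ b"
    by (metis dvd_triv_left)
  then obtain c where c: "card (rcosets\<^bsub>?N\<^esub> (M \<inter> N)) = p ^ c"
    using p by (auto simp: divides_primepow_nat)
  have "card (M <#> N) = p ^ (c + a)"
    using K.lagrange[OF subM] a c eq by (simp add: order_def power_add)
  moreover have "M <#> N \<lhd> G"
    using nM nN by (rule normal_subgroup_set_mult_closed)
  ultimately show ?thesis
    by (auto simp: normal_p_subgroup_def)
qed

lemma (in group) O_lower_p_greatest:
  assumes fin: "finite (carrier G)" and p: "prime p"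
  shows "normal_p_subgroup G p (O_lower_p G p)"
    and "normal_p_subgroup G p N \<Longrightarrow> N \<subseteq> O_lower_p G p"
proof -
  let ?S = "{N. normal_p_subgroup G p N}"
  have sub: "N \<subseteq> carrier G" if "normal_p_subgroup G p N" for N
    using that by (auto simp: normal_p_subgroup_def dest: normal_imp_subgroup subgroup.subset)
  then have "finite ?S"
    using fin by (auto intro: finite_subset[of _ "Pow (carrier G)"])
  moreover have "card {\<one>} = p ^ 0" by simp
  then have "{\<one>} \<in> ?S"
    using one_is_normal unfolding normal_p_subgroup_def by blast
  ultimately have "Max (card ` ?S) \<in> card ` ?S"
    by (intro Max_in) auto
  then obtain M where M: "normal_p_subgroup G p M" "card M = Max (card ` ?S)"
    by auto
  then have max: "card N \<le> card M" if "normal_p_subgroup G p N" for N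
    using that \<open>finite ?S\<close> by simp
  note M = M(1)
  have ub: "N \<subseteq> M" if N: "normal_p_subgroup G p N" for N
  proof -
    interpret S: second_isomorphism_grp M G N
      using M N by (simp add: normal_p_subgroup_def second_isomorphism_grp_def
          second_isomorphism_grp_axioms_def normal_imp_subgroup)
    have MN: "normal_p_subgroup G p (M <#> N)"
      using normal_p_subgroup_set_mult[OF p M N] .
    have "finite (M <#> N)"
      using sub[OF MN] fin finite_subset by blast
    then have "M <#> N = M"
      using S.H_contained_in_set_mult max[OF MN] by (metis card_seteq)
    then show ?thesis
      using S.S_contained_in_set_mult by simp
  qed
  have "\<exists>!Q. normal_p_subgroup G p Q \<and> (\<forall>N. normal_p_subgroup G p N \<longrightarrow> N \<subseteq> Q)"
    using M ub by (metis subset_antisym)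
  from theI'[OF this]
  show "normal_p_subgroup G p (O_lower_p G p)"
    and "normal_p_subgroup G p N \<Longrightarrow> N \<subseteq> O_lower_p G p"
    unfolding O_lower_p_def by blast+
qed

section \<open>Semidirect products\<close>

text \<open>For \<open>\<phi> \<in> hom H (AutoGroup N)\<close>: the element \<open>h\<close> acts on \<open>N\<close> by \<open>\<phi> h\<close>, from the left.\<close>

definition semidirect_product ::
    "('a, 'c) monoid_scheme \<Rightarrow> ('b, 'd) monoid_scheme \<Rightarrow> ('b \<Rightarrow> 'a \<Rightarrow> 'a) \<Rightarrow> ('a \<times> 'b) monoid"
  where "semidirect_product N H \<phi> =
    \<lparr>carrier = carrier N \<times> carrier H,
     monoid.mult = (\<lambda>(n, h) (n', h'). (n \<otimes>\<^bsub>N\<^esub> \<phi> h n', h \<otimes>\<^bsub>H\<^esub> h')),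
     one = (\<one>\<^bsub>N\<^esub>, \<one>\<^bsub>H\<^esub>)\<rparr>"

lemma group_semidirect_product:
  assumes N: "group N" and H: "group H" and \<phi>: "\<phi> \<in> hom H (AutoGroup N)"
  shows "group (semidirect_product N H \<phi>)"
proof -
  interpret N: group N by (rule N)
  interpret H: group H by (rule H)
  interpret \<phi>: group_hom H "AutoGroup N" \<phi>
    using H N.AutoGroup \<phi> by (simp add: group_hom_def group_hom_axioms_def)
  have auto: "\<phi> h \<in> hom N N" "\<phi> h \<in> Bij (carrier N)" if "h \<in> carrier H" for h
    using \<phi>.hom_closed[OF that] by (auto simp: AutoGroup_def auto_def)
  have cl: "\<phi> h n \<in> carrier N" if "h \<in> carrier H" "n \<in> carrier N" for h n
    using auto(1)[OF that(1)] that(2) by (rule hom_in_carrier)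
  have mult: "\<phi> h (n \<otimes>\<^bsub>N\<^esub> n') = \<phi> h n \<otimes>\<^bsub>N\<^esub> \<phi> h n'"
    if "h \<in> carrier H" "n \<in> carrier N" "n' \<in> carrier N" for h n n'
    using auto(1)[OF that(1)] that(2,3) by (rule hom_mult)
  have comp: "\<phi> (h \<otimes>\<^bsub>H\<^esub> h') n = \<phi> h (\<phi> h' n)"
    if "h \<in> carrier H" "h' \<in> carrier H" "n \<in> carrier N" for h h' n
    using that auto by (simp add: AutoGroup_def BijGroup_def compose_def)
  have one: "\<phi> \<one>\<^bsub>H\<^esub> n = n" if "n \<in> carrier N" for n
    using that \<phi>.hom_one by (simp add: AutoGroup_def BijGroup_def)
  have one': "\<phi> h \<one>\<^bsub>N\<^esub> = \<one>\<^bsub>N\<^esub>" if "h \<in> carrier H" for h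
    using auto(1)[OF that] N by (simp add: hom_one)
  show ?thesis
  proof (rule groupI)
    fix x assume "x \<in> carrier (semidirect_product N H \<phi>)"
    then obtain n h where x: "x = (n, h)" "n \<in> carrier N" "h \<in> carrier H"
      by (auto simp: semidirect_product_def)
    let ?y = "(\<phi> (inv\<^bsub>H\<^esub> h) (inv\<^bsub>N\<^esub> n), inv\<^bsub>H\<^esub> h)"
    have "?y \<in> carrier (semidirect_product N H \<phi>)"
      using x cl by (simp add: semidirect_product_def del: \<phi>.hom_inv)
    moreover have "?y \<otimes>\<^bsub>semidirect_product N H \<phi>\<^esub> x = \<one>\<^bsub>semidirect_product N H \<phi>\<^esub>"
      using x mult[of "inv\<^bsub>H\<^esub> h" "inv\<^bsub>N\<^esub> n" n] one'[of "inv\<^bsub>H\<^esub> h"]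
      by (simp add: semidirect_product_def del: \<phi>.hom_inv)
    ultimately show "\<exists>y \<in> carrier (semidirect_product N H \<phi>).
        y \<otimes>\<^bsub>semidirect_product N H \<phi>\<^esub> x = \<one>\<^bsub>semidirect_product N H \<phi>\<^esub>"
      by blast
  qed (auto simp: semidirect_product_def cl mult comp one N.m_assoc H.m_assoc
      simp del: \<phi>.hom_mult \<phi>.hom_one)
qed

section \<open>\<open>SL\<^sub>2\<close> and \<open>PSL\<^sub>2\<close>\<close>

text \<open>\<open>(a, b, c, d)\<close> stands for the \<open>2 \<times> 2\<close> matrix with rows \<open>(a, b)\<close> and \<open>(c, d)\<close>.\<close>

definition SL2 :: "('a, 'b) ring_scheme \<Rightarrow> ('a \<times> 'a \<times> 'a \<times> 'a) monoid"
  where "SL2 R =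
    \<lparr>carrier = {(a, b, c, d). a \<in> carrier R \<and> b \<in> carrier R \<and> c \<in> carrier R \<and> d \<in> carrier R \<and>
        a \<otimes>\<^bsub>R\<^esub> d \<ominus>\<^bsub>R\<^esub> b \<otimes>\<^bsub>R\<^esub> c = \<one>\<^bsub>R\<^esub>},
     monoid.mult = (\<lambda>(a, b, c, d) (a', b', c', d').
       (a \<otimes>\<^bsub>R\<^esub> a' \<oplus>\<^bsub>R\<^esub> b \<otimes>\<^bsub>R\<^esub> c', a \<otimes>\<^bsub>R\<^esub> b' \<oplus>\<^bsub>R\<^esub> b \<otimes>\<^bsub>R\<^esub> d',
        c \<otimes>\<^bsub>R\<^esub> a' \<oplus>\<^bsub>R\<^esub> d \<otimes>\<^bsub>R\<^esub> c', c \<otimes>\<^bsub>R\<^esub> b' \<oplus>\<^bsub>R\<^esub> d \<otimes>\<^bsub>R\<^esub> d')),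
     one = (\<one>\<^bsub>R\<^esub>, \<zero>\<^bsub>R\<^esub>, \<zero>\<^bsub>R\<^esub>, \<one>\<^bsub>R\<^esub>)\<rparr>"

definition PSL2 :: "('a, 'b) ring_scheme \<Rightarrow> ('a \<times> 'a \<times> 'a \<times> 'a) set monoid"
  where "PSL2 R = SL2 R Mod center (SL2 R)"

lemma (in cring) group_SL2: "group (SL2 R)"
proof (rule groupI)
  fix x y assume "x \<in> carrier (SL2 R)" "y \<in> carrier (SL2 R)"
  then obtain a b c d a' b' c' d' where xy: "x = (a, b, c, d)" "y = (a', b', c', d')"
    and cl: "a \<in> carrier R" "b \<in> carrier R" "c \<in> carrier R" "d \<in> carrier R"
      "a' \<in> carrier R" "b' \<in> carrier R" "c' \<in> carrier R" "d' \<in> carrier R"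
    and det: "a \<otimes> d \<ominus> b \<otimes> c = \<one>" "a' \<otimes> d' \<ominus> b' \<otimes> c' = \<one>"
    by (auto simp: SL2_def)
  have "(a \<otimes> a' \<oplus> b \<otimes> c') \<otimes> (c \<otimes> b' \<oplus> d \<otimes> d') \<ominus> (a \<otimes> b' \<oplus> b \<otimes> d') \<otimes> (c \<otimes> a' \<oplus> d \<otimes> c')
      = (a \<otimes> d \<ominus> b \<otimes> c) \<otimes> (a' \<otimes> d' \<ominus> b' \<otimes> c')"
    using cl by algebra
  then show "x \<otimes>\<^bsub>SL2 R\<^esub> y \<in> carrier (SL2 R)"
    using cl det by (simp add: xy SL2_def)
next
  show "\<one>\<^bsub>SL2 R\<^esub> \<in> carrier (SL2 R)"
    by (simp add: SL2_def minus_eq)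
next
  fix x y z assume "x \<in> carrier (SL2 R)" "y \<in> carrier (SL2 R)" "z \<in> carrier (SL2 R)"
  then show "x \<otimes>\<^bsub>SL2 R\<^esub> y \<otimes>\<^bsub>SL2 R\<^esub> z = x \<otimes>\<^bsub>SL2 R\<^esub> (y \<otimes>\<^bsub>SL2 R\<^esub> z)"
    by (clarsimp simp: SL2_def) (intro conjI; algebra)
next
  fix x assume "x \<in> carrier (SL2 R)"
  then show "\<one>\<^bsub>SL2 R\<^esub> \<otimes>\<^bsub>SL2 R\<^esub> x = x"
    by (auto simp: SL2_def)
next
  fix x assume "x \<in> carrier (SL2 R)"
  then obtain a b c d where x: "x = (a, b, c, d)"
    and cl: "a \<in> carrier R" "b \<in> carrier R" "c \<in> carrier R" "d \<in> carrier R"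
    and det: "a \<otimes> d \<ominus> b \<otimes> c = \<one>"
    by (auto simp: SL2_def)
  have *: "d \<otimes> a \<ominus> \<ominus> b \<otimes> \<ominus> c = a \<otimes> d \<ominus> b \<otimes> c"
    "d \<otimes> a \<oplus> \<ominus> b \<otimes> c = a \<otimes> d \<ominus> b \<otimes> c" "d \<otimes> b \<oplus> \<ominus> b \<otimes> d = \<zero>"
    "\<ominus> c \<otimes> a \<oplus> a \<otimes> c = \<zero>" "\<ominus> c \<otimes> b \<oplus> a \<otimes> d = a \<otimes> d \<ominus> b \<otimes> c"
    using cl by algebra+
  have "(d, \<ominus> b, \<ominus> c, a) \<in> carrier (SL2 R)"
    "(d, \<ominus> b, \<ominus> c, a) \<otimes>\<^bsub>SL2 R\<^esub> x = \<one>\<^bsub>SL2 R\<^esub>"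
    using cl det * by (simp_all add: x SL2_def)
  then show "\<exists>y \<in> carrier (SL2 R). y \<otimes>\<^bsub>SL2 R\<^esub> x = \<one>\<^bsub>SL2 R\<^esub>"
    by blast
qed

lemma (in group) center_normal: "center G \<lhd> G"
proof (rule normal_invI)
  show "subgroup (center G) G"
  proof (rule subgroupI)
    fix a assume a: "a \<in> center G"
    then have ac: "a \<in> carrier G"
      by (simp add: center_def)
    have "inv a \<otimes> x = x \<otimes> inv a" if "x \<in> carrier G" for x
    proof -
      have "a \<otimes> inv x = inv x \<otimes> a"
        using a that by (simp add: center_def)
      moreover have "inv (a \<otimes> inv x) = x \<otimes> inv a" "inv (inv x \<otimes> a) = inv a \<otimes> x"
        using ac that by (simp_all add: inv_mult_group)
      ultimately show ?thesis
        by simp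
    qed
    then show "inv a \<in> center G"
      using ac unfolding center_def by blast
  next
    fix a b assume ab: "a \<in> center G" "b \<in> center G"
    then have cl: "a \<in> carrier G" "b \<in> carrier G"
      by (simp_all add: center_def)
    have "a \<otimes> b \<otimes> x = x \<otimes> (a \<otimes> b)" if x: "x \<in> carrier G" for x
    proof -
      have "a \<otimes> x = x \<otimes> a" "b \<otimes> x = x \<otimes> b"
        using ab x unfolding center_def by blast+
      then show ?thesis
        using cl x by (metis m_assoc)
    qed
    then show "a \<otimes> b \<in> center G"
      using cl unfolding center_def by blast
  qed (auto simp: center_def)
next
  fix x h assume x: "x \<in> carrier G" and "h \<in> center G"
  then have h: "h \<in> carrier G" "x \<otimes> h = h \<otimes> x"
    unfolding center_def by auto
  then have "x \<otimes> h \<otimes> inv x = h"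
    using x by (simp add: m_assoc)
  then show "x \<otimes> h \<otimes> inv x \<in> center G"
    using \<open>h \<in> center G\<close> by simp
qed

section \<open>The quaternion group\<close>

text \<open>\<open>(a, b, c, d)\<close> stands for the quaternion \<open>a + b i + c j + d k\<close>.\<close>

fun quat_mult :: "int \<times> int \<times> int \<times> int \<Rightarrow> int \<times> int \<times> int \<times> int \<Rightarrow> int \<times> int \<times> int \<times> int"
  where "quat_mult (a, b, c, d) (a', b', c', d') =
    (a * a' - b * b' - c * c' - d * d',
     a * b' + b * a' + c * d' - d * c',
     a * c' - b * d' + c * a' + d * b',
     a * d' + b * c' - c * b' + d * a')"

definition Q8 :: "(int \<times> int \<times> int \<times> int) monoid"
  where "Q8 =
    \<lparr>carrier = {(1, 0, 0, 0), (-1, 0, 0, 0), (0, 1, 0, 0), (0, -1, 0, 0),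
                (0, 0, 1, 0), (0, 0, -1, 0), (0, 0, 0, 1), (0, 0, 0, -1)},
     monoid.mult = quat_mult,
     one = (1, 0, 0, 0)\<rparr>"

lemma group_Q8: "group Q8"
  by (rule groupI) (auto simp: Q8_def)

section \<open>Singer cycles\<close>

definition elementary_abelian_2 :: "nat \<Rightarrow> (nat \<Rightarrow> int) monoid"
  where "elementary_abelian_2 r = product_group {..<r} (\<lambda>_. integer_mod_group 2)"

text \<open>The scalars are 0 and 1, so a bijection of \<open>(C\<^sub>2)\<^sup>r\<close> is linear iff it is additive:
  \<open>GL\<^sub>r(2)\<close> is the automorphism group.\<close>

abbreviation GL_2 :: "nat \<Rightarrow> ((nat \<Rightarrow> int) \<Rightarrow> nat \<Rightarrow> int) monoid"
  where "GL_2 r \<equiv> AutoGroup (elementary_abelian_2 r)"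

definition singer_cycle :: "nat \<Rightarrow> ((nat \<Rightarrow> int) \<Rightarrow> nat \<Rightarrow> int) \<Rightarrow> bool"
  where "singer_cycle r \<sigma> \<longleftrightarrow>
    \<sigma> \<in> carrier (GL_2 r) \<and> group.ord (GL_2 r) \<sigma> = 2 ^ r - 1 \<and>
    (\<forall>v \<in> carrier (elementary_abelian_2 r) - {\<one>\<^bsub>elementary_abelian_2 r\<^esub>}.
     \<forall>w \<in> carrier (elementary_abelian_2 r) - {\<one>\<^bsub>elementary_abelian_2 r\<^esub>}.
       \<exists>n. (\<sigma> ^^ n) v = w)"

definition acts_as_singer_cycle ::
    "nat \<Rightarrow> ('b, 'd) monoid_scheme \<Rightarrow> ('b \<Rightarrow> (nat \<Rightarrow> int) \<Rightarrow> nat \<Rightarrow> int) \<Rightarrow> bool"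
  where "acts_as_singer_cycle r H \<phi> \<longleftrightarrow>
    \<phi> \<in> hom H (GL_2 r) \<and>
    (\<exists>g \<in> carrier H. generate H {g} = carrier H \<and> singer_cycle r (\<phi> g))"

end

(*  Let P(H) be the set of p-elements of H.  Counting the commuting pairs of P(G) by centralizers,
    where P(C(x)) is again of this kind, induction shows that if P(G) is not commutative then at most
    a (p^2+p-1)/p^3 part of the pairs commutes, and that equality forces either P(G) to be a subgroup
    of index p^2 over its center, or the centralizers of the noncentral p-elements to cut P(G) into
    exactly p+1 "blocks": abelian p-groups meeting pairwise in Z = O_p(G), with Z of index p in each,
    permuted doubly transitively by conjugation, a noncentral element of a block S acting as a
    p-cycle on the other blocks.

    If only central elements fix two blocks, this is a Frobenius action on p+1 points modulo the
    center C.  The elements fixing no block form with C a normal subgroup E = C N, where N is C_3,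
    elementary abelian of order p+1 = 2^r, or Q_8 (p = 3), and G = N S with S a block, which is the
    direct product of a cyclic group and a central group A.

    Otherwise a noncentral element fixing two blocks S and T scales S/Z by a nontrivial factor, so
    S = Z x U for a canonical subgroup U = {pt x | x mod p} of order p, and likewise for the
    other blocks.  An element w exchanging S and T permutes the blocks, labelled by the projective
    line over F_p, by a map that has to be x |-> c/x: its additive commutator relations are a
    functional equation, settled by a transfer argument and by polynomial identities mod p.
    Hence U and its conjugate under w satisfy the Steinberg relations of SL_2(p).  *)

theory Submission
  imports
    "HOL-Computational_Algebra.Polynomial"
    "HOL-Number_Theory.Number_Theory"
    "HOL-Algebra.Sylow"
    Defs
begin

section \<open>Polynomials modulo a prime\<close>

text \<open>The constant equals \<open>1/p^2 + (1 - 1/p^2)/p\<close>, the value reached when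
  \<open>Z\<close> makes up a \<open>p^2\<close>-th part of \<open>P(G)\<close> and every other
  element commutes with a \<open>p\<close>-th part of it. Since \<open>P(G)\<close> is in general
  not a subgroup, there are no indices to argue with; their place is taken by right multiplication
  with the powers of a \<open>p\<close>-element and by the overlap of two distinct Sylow subgroups,
  each of which yields a factor \<open>p\<close>. The obstacle in the last case is that
  \<open>w\<close> is known only through two arbitrary functions modulo \<open>p\<close>: the label
  of the image of a block, and the exponent with which the chosen generator is carried along. In
  SL_2(p) they are \<open>c / x\<close> and \<open>- c / y^2\<close>. Exponents become comparable
  because the transfer forces an element fixing \<open>S\<close> and \<open>T\<close> to act
  inversely on their subgroups of order \<open>p\<close>. The equation is then solved by degrees: a
  function modulo \<open>p\<close> is a polynomial of degree below \<open>p\<close>, and one of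
  \<open>g\<close> and \<open>1 / g\<close> turns out to have degree at most
  \<open>(p - 1) / 2\<close>, so that a product of two images still has degree below
  \<open>p\<close>.\<close>

abbreviation (input) carr ("\<G>\<index>") where "carr G \<equiv> carrier G"

text \<open>Residues are kept as integers up to congruence instead of elements of a quotient ring:
  exponents of group elements, labels of blocks and coefficients of polynomials then all live in the
  same type.\<close>

locale prime_nat =
 fixes p :: nat
 assumes prime: "prime p"
begin

abbreviation unit where "unit a \<equiv> \<not> int p dvd a"
abbreviation eqp (infix "\<doteq>" 50) where "a \<doteq> b \<equiv> [a = b] (mod int p)"

lemma p_prime_int: "prime (int p)" using prime by simp

lemma unit_one: "unit 1" by (metis p_prime_int not_prime_unit)

lemma unit_mult_iff: "unit (a * b) \<longleftrightarrow> unit a \<and> unit b"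
 using prime_dvd_mult_iff[OF p_prime_int] by auto

lemma unit_mult: "unit a \<Longrightarrow> unit b \<Longrightarrow> unit (a * b)" by (simp add: unit_mult_iff)

lemma unit_of_inverse: assumes "a * b \<doteq> 1" shows "unit a" "unit b"
 using cong_dvd_iff[OF assms] unit_one by auto

lemma unit_coprime: "unit a \<Longrightarrow> coprime a (int p)"
 using p_prime_int by (metis coprime_commute prime_imp_coprime)

lemma unit_inverse: "unit a \<Longrightarrow> \<exists>b. a * b \<doteq> 1"
 by (rule cong_solve_coprime_int[OF unit_coprime])

lemma unit_inverse_lin: "unit a \<Longrightarrow> \<exists>e q. a * e = 1 + int p * q"
 by (metis unit_inverse cong_iff_lin cong_sym)

lemma cancel: "unit c \<Longrightarrow> c * a \<doteq> c * b \<Longrightarrow> a \<doteq> b"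
 using cong_mult_lcancel[OF unit_coprime] by blast

end

text \<open>Splitting off one root by synthetic division leaves a quotient of smaller degree that
  still vanishes modulo \<open>p\<close> at the other points, because differences of incongruent
  points are units.\<close>

lemma prime_dvd_coeffs_of_roots:
 fixes F :: "int poly" and p :: int
 assumes "prime p" "finite A" "degree F < card A"
  and "\<And>a. a \<in> A \<Longrightarrow> p dvd poly F a"
  and "\<And>a b. a \<in> A \<Longrightarrow> b \<in> A \<Longrightarrow> p dvd a - b \<Longrightarrow> a = b"
 shows "[:p:] dvd F"
 using assms(2-)
proof (induction "degree F" arbitrary: F A)
 case 0
 then obtain a where a: "a \<in> A" by fastforce
 obtain c where "F = [:c:]" using 0 by (metis degree_eq_zeroE)
 then show ?case using 0(4)[OF a] by simp
next
 case (Suc n)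
 then obtain a where a: "a \<in> A" by fastforce
 let ?Q = "synthetic_div F a"
 have F: "F = [:-a, 1:] * ?Q + [:poly F a:]"
  by (rule synthetic_div_correct'[symmetric])
 have dQ: "n = degree ?Q" using Suc(2) by (simp add: degree_synthetic_div)
 have "[:p:] dvd ?Q"
 proof (rule Suc(1)[OF dQ, of "A - {a}"])
  show "finite (A - {a})" using Suc by simp
  show "degree ?Q < card (A - {a})" using Suc a dQ by simp
  fix b assume b: "b \<in> A - {a}"
  have "poly F b = (b - a) * poly ?Q b + poly F a"
   by (subst F) (simp add: algebra_simps)
  then have "p dvd (b - a) * poly ?Q b"
   using Suc(5)[of b] Suc(5)[OF a] b by (metis DiffD1 dvd_add_left_iff)
  then show "p dvd poly ?Q b" using Suc(6)[of b a] a b \<open>prime p\<close> prime_dvd_multD by auto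
 qed (use Suc(6) in auto)
 then show ?case using Suc(5)[OF a] by (subst F) (intro dvd_add dvd_mult; simp)
qed

lemma dvd_coeff: "[:c:] dvd (F :: int poly) \<Longrightarrow> c dvd Polynomial.coeff F i"
 by (simp add: const_poly_dvd_iff)

lemma inj_mod_interval:
 fixes a b p :: int
 assumes "a \<in> {0..<p}" "b \<in> {0..<p}" "p dvd a - b" shows "a = b"
 using assms by (metis atLeastLessThan_iff mod_eq_dvd_iff mod_pos_pos_trivial)

lemma poly_dvd_of_values:
 fixes F :: "int poly" and p :: nat
 assumes "prime p" "degree F < p" "\<And>y. int p dvd poly F y"
 shows "[:int p:] dvd F"
 by (rule prime_dvd_coeffs_of_roots[of _ "{0..<int p}"]) (use assms inj_mod_interval in auto)

lemma poly_cong: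
 fixes F :: "int poly"
 assumes "[x = y] (mod m)" shows "[poly F x = poly F y] (mod m)"
 by (induction F) (use assms in \<open>auto intro!: cong_add cong_mult\<close>)

text \<open>Telescoping \<open>(y + 1)^(k+1) - y^(k+1)\<close> expresses \<open>k + 1\<close> times
  this sum through lower power sums and a power of \<open>p\<close>; as \<open>k + 1 < p\<close>,
  the factor can be cancelled. For \<open>k = 0\<close> the convention \<open>0^0 = 1\<close> makes
  the sum equal to \<open>p\<close>.\<close>

lemma power_sum_dvd:
 fixes p :: nat
 assumes p: "prime p" and "k < p - 1"
 shows "int p dvd (\<Sum>y<p. int y ^ k)"
 using assms(2)
proof (induction k rule: less_induct)
 case (less k)
 have "(\<Sum>y<p. (int y + 1) ^ (k + 1) - int y ^ (k + 1)) = int p ^ (k + 1)"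
  using sum_lessThan_telescope[of "\<lambda>y. int y ^ (k+1)" p] by (simp add: add.commute)
 moreover have "(int y + 1) ^ (k + 1) - int y ^ (k + 1) = (\<Sum>j\<le>k. of_nat ((k+1) choose j) * int y ^ j)" for y
  using binomial_ring[of "int y" 1 "k + 1"] by simp
 ultimately have "int p ^ (k+1) = (\<Sum>y<p. \<Sum>j\<le>k. of_nat ((k+1) choose j) * int y ^ j)"
  by simp
 also have "\<dots> = (\<Sum>j\<le>k. of_nat ((k+1) choose j) * (\<Sum>y<p. int y ^ j))"
  by (subst sum.swap) (simp add: sum_distrib_left)
 also have "\<dots> = (\<Sum>j<k. of_nat ((k+1) choose j) * (\<Sum>y<p. int y ^ j)) + int (k+1) * (\<Sum>y<p. int y ^ k)"
  by (simp add: lessThan_Suc_atMost[symmetric])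
 finally have eq: "int (k+1) * (\<Sum>y<p. int y ^ k) = int p ^ (k+1) - (\<Sum>j<k. of_nat ((k+1) choose j) * (\<Sum>y<p. int y ^ j))"
  by simp
 have "int p dvd (\<Sum>j<k. of_nat ((k+1) choose j) * (\<Sum>y<p. int y ^ j))"
  by (rule dvd_sum, rule dvd_mult) (use less in auto)
 then have "int p dvd int (k+1) * (\<Sum>y<p. int y ^ k)"
  unfolding eq by (intro dvd_diff) auto
 then show ?case
  by (metis less(2) p add.commute dvd_imp_le int_dvd_int_iff less_diff_conv not_less plus_1_eq_Suc zero_less_Suc prime_dvd_multD prime_nat_int_transfer)
qed

lemma sum_nat_int: "(\<Sum>y\<in>{0..<int p}. f y) = (\<Sum>y<p. f (int y))"
 by (rule sum.reindex_bij_witness[of _ int nat]) auto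

lemma int_fermat:
 fixes p :: nat and x :: int
 assumes "prime p" "\<not> int p dvd x" shows "[x ^ (p - 1) = 1] (mod int p)"
proof -
 show ?thesis
  using assms fermat_theorem[of p "nat (x mod int p)"] by (smt (verit, best) Euclidean_Rings.pos_mod_bound Euclidean_Rings.pos_mod_sign cong_def dvd_eq_mod_eq_0
    cong_int_iff int_dvd_int_iff mod_mod_trivial of_nat_0_less_iff of_nat_1 of_nat_power power_mod prime_gt_0_nat zero_le_imp_eq_int nat_0_le)
qed

lemma poly_altdef_le:
 fixes F :: "int poly"
 assumes "degree F \<le> n" shows "poly F y = (\<Sum>i\<le>n. Polynomial.coeff F i * y ^ i)"
 unfolding poly_altdef using assms
 by (intro sum.mono_neutral_left) (auto simp: coeff_eq_0)

text \<open>All power sums below exponent \<open>p - 1\<close> vanish, and by Fermat the one at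
  \<open>p - 1\<close> is \<open>- 1\<close>. So summation over all residues reads off a single
  coefficient.\<close>

lemma poly_sum_cong:
 fixes p :: nat and F :: "int poly"
 assumes p: "prime p" and "degree F \<le> p - 1"
 shows "[(\<Sum>y\<in>{0..<int p}. poly F y) = - Polynomial.coeff F (p - 1)] (mod int p)"
proof -
 have p2: "p \<ge> 2" using p prime_ge_2_nat by blast
 have "(\<Sum>y<p. poly F (int y)) = (\<Sum>y<p. \<Sum>i\<le>p-1. Polynomial.coeff F i * int y ^ i)"
  by (simp add: poly_altdef_le[OF assms(2)])
 also have "\<dots> = (\<Sum>i\<le>p-1. Polynomial.coeff F i * (\<Sum>y<p. int y ^ i))"
  by (subst sum.swap) (simp add: sum_distrib_left)
 also have "\<dots> = (\<Sum>i<p-1. Polynomial.coeff F i * (\<Sum>y<p. int y ^ i)) + Polynomial.coeff F (p-1) * (\<Sum>y<p. int y ^ (p-1))"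
  by (simp add: lessThan_Suc_atMost[symmetric])
 finally have eq: "(\<Sum>y<p. poly F (int y)) = \<dots>" .
 have 1: "[(\<Sum>i<p-1. Polynomial.coeff F i * (\<Sum>y<p. int y ^ i)) = 0] (mod int p)"
  using power_sum_dvd[OF p]
  unfolding cong_0_iff by (intro dvd_sum) (auto intro: dvd_mult)
 have "{..<p} = insert 0 {1..<p}" using p2 by auto
 then have "(\<Sum>y<p. int y ^ (p-1)) = (\<Sum>y\<in>{1..<p}. int y ^ (p-1))"
  using p2 by simp
 also have "[\<dots> = (\<Sum>y\<in>{1..<p}. 1)] (mod int p)" by (intro cong_sum int_fermat[OF p]) (auto dest:)
 also have "(\<Sum>y\<in>{1..<p}. 1::int) = int p - 1" using p2 by simp
 also have "[int p - 1 = -1] (mod int p)" by (simp add: cong_iff_dvd_diff)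
 finally have "[Polynomial.coeff F (p-1) * (\<Sum>y<p. int y ^ (p-1)) = Polynomial.coeff F (p-1) * -1] (mod int p)"
  by (intro cong_mult) auto
 from cong_add[OF 1 this] show ?thesis
  unfolding sum_nat_int eq by simp
qed

lemma coeff_shift_top:
 fixes F :: "int poly"
 assumes "degree F \<le> m"
 shows "Polynomial.coeff (pcompose F [:a, 1:]) m = Polynomial.coeff F m"
proof (cases "degree F = m")
 case True
 then show ?thesis using lead_coeff_comp[of "[:a,1:]" F] by (simp add: degree_pcompose)
next
 case False
 then show ?thesis using assms by (simp add: coeff_eq_0 degree_pcompose)
qed

text \<open>The difference operator acts on the top term like a derivative. Tracking the coefficient
  matters: it remains a unit as long as the degree is positive and below \<open>p\<close>.\<close>

lemma degree_difference:
 fixes F :: "int poly"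
 assumes "degree F \<le> Suc m"
 shows "degree (pcompose F [:1, 1:] - F) \<le> m \<and>
  Polynomial.coeff (pcompose F [:1, 1:] - F) m = int (Suc m) * Polynomial.coeff F (Suc m)"
 using assms
proof (induction F arbitrary: m)
 case 0 then show ?case by simp
next
 case (pCons a Q)
 let ?q = "[:1, 1:] :: int poly"
 have eq: "pcompose (pCons a Q) ?q - pCons a Q = pCons 0 (pcompose Q ?q - Q) + pcompose Q ?q"
  by (simp add: pcompose_pCons)
 have dQ: "degree Q \<le> m" using pCons by (metis degree_pCons_eq degree_0 le0 Suc_le_mono)
 have dq: "degree (pcompose Q ?q) \<le> m" using dQ by (simp add: degree_pcompose)
 show ?case
 proof (cases m)
  case 0
  then obtain c where Q: "Q = [:c:]" using dQ by (metis degree_eq_zeroE le_zero_eq)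
  show ?thesis unfolding eq Q 0 by (simp add: pcompose_pCons)
 next
  case (Suc k)
  show ?thesis
   using Suc dq coeff_shift_top[OF dQ, of 1] pCons(2)[of k] dQ by (simp add: degree_add_le algebra_simps eq)
 qed
qed

lemma lagrange_mod:
 fixes p :: nat and f :: "int \<Rightarrow> int"
 assumes p: "prime p" and f: "\<And>x y. [x = y] (mod int p) \<Longrightarrow> [f x = f y] (mod int p)"
 shows "\<exists>F. degree F \<le> p - 1 \<and> (\<forall>y. [poly F y = f y] (mod int p))"
proof -
 \<comment> \<open>By Fermat this polynomial is the indicator function of the residue class of
   \<open>c\<close>.\<close>
 let ?L = "\<lambda>c. 1 - pcompose (Polynomial.monom 1 (p - 1)) [:-c, 1:] :: int poly"
 define F where "F = (\<Sum>c\<in>{0..<int p}. Polynomial.smult (f c) (?L c))"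
 have p2: "p \<ge> 2" using p prime_ge_2_nat by blast
 have "degree F \<le> p - 1" by (simp add: degree_diff_le degree_pcompose degree_monom_eq degree_sum_le F_def)
 moreover have "[poly F y = f y] (mod int p)" for y
 proof -
  let ?c = "y mod int p"
  have c: "?c \<in> {0..<int p}" using p2 by auto
  have "poly F y = (\<Sum>c\<in>{0..<int p}. f c * (1 - (y - c) ^ (p - 1)))"
   by (simp add: poly_pcompose poly_monom poly_sum F_def)
  also have "[\<dots> = (\<Sum>c\<in>{0..<int p}. if c = ?c then f ?c else 0)] (mod int p)"
  proof (intro cong_sum)
   fix c assume cc: "c \<in> {0..<int p}"
   show "[f c * (1 - (y - c) ^ (p - 1)) = (if c = ?c then f ?c else 0)] (mod int p)"
   proof (cases "c = ?c")
    case True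
    then have "int p dvd y - c" by simp
    then have "[f c * (1 - (y - c) ^ (p - 1)) = f c * (1 - 0)] (mod int p)"
     using p2 by (intro cong_mult cong_diff cong_refl) (simp add: cong_0_iff dvd_power dvd_trans)
    then show ?thesis using True by simp
   next
    case False
    then have "[f c * (1 - (y - c) ^ (p - 1)) = f c * (1 - 1)] (mod int p)"
     by (metis cc atLeastLessThan_iff mod_eq_dvd_iff mod_pos_pos_trivial cong_mult cong_diff cong_refl int_fermat[OF p])
    then show ?thesis using False by simp
   qed
  qed
  also have "(\<Sum>c\<in>{0..<int p}. if c = ?c then f ?c else 0) = f ?c"
   using c by simp
  also have "[f ?c = f y] (mod int p)" by (rule f) simp
  finally show ?thesis .
 qed
 ultimately show ?thesis by blast
qed

text \<open>In a representative of least degree the leading coefficient is a unit, since otherwise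
  the top term could be dropped. In degree 0 dropping it does not lower \<open>degree\<close>; there
  the value that is nonzero modulo \<open>p\<close> excludes the case.\<close>

lemma mod_degree_exists:
 fixes p :: nat and f :: "int \<Rightarrow> int"
 assumes p: "prime p" and f: "\<And>x y. [x = y] (mod int p) \<Longrightarrow> [f x = f y] (mod int p)"
  and nz: "\<not> int p dvd f y"
 shows "\<exists>F. degree F \<le> p - 1 \<and> (\<forall>y. [poly F y = f y] (mod int p)) \<and> \<not> int p dvd lead_coeff F"
proof -
 let ?P = "\<lambda>F. \<forall>y. [poly F y = f y] (mod int p)"
 obtain F0 where F0: "degree F0 \<le> p - 1" "?P F0" using lagrange_mod[OF p, of f] f by blast
 obtain F where F: "?P F" "\<And>H. ?P H \<Longrightarrow> degree F \<le> degree H"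
  using ex_has_least_nat[of ?P F0 degree] F0 by auto
 have "\<not> int p dvd lead_coeff F"
 proof
  assume d: "int p dvd lead_coeff F"
  let ?H = "F - Polynomial.monom (lead_coeff F) (degree F)"
  have "[poly ?H y = f y - 0] (mod int p)" for y
   unfolding poly_diff poly_monom by (intro cong_diff F(1)[rule_format]) (use d in \<open>auto simp: cong_0_iff\<close>)
  then have "?P ?H" by simp
  from F(2)[OF this] have *: "degree F \<le> degree ?H" .
  have le: "degree ?H \<le> degree F" "Polynomial.coeff ?H (degree F) = 0" by (auto simp: degree_diff_le degree_monom_le)
  then have "?H = 0 \<or> degree ?H < degree F" using le by (metis leading_coeff_0_iff order_le_imp_less_or_eq)
  then have "degree F = 0" using * by auto
  then obtain c where "F = [:c:]" by (metis degree_eq_zeroE)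
  then show False using F(1) d nz cong_dvd_iff by fastforce
 qed
 then show ?thesis using F F0 by (metis order.trans)
qed

section \<open>A functional equation forcing \<open>w x = c / x\<close>\<close>

text \<open>\<open>w\<close> stands for the labels of the blocks under an element exchanging two of
  them, \<open>g\<close> for the exponents on the chosen generators, indexed by the image block. The
  solution coming from SL_2(p) is \<open>w x = c / x\<close>, \<open>g y = - c / y^2\<close>;
  \<open>w x = c / x\<close> is also compatible with other powers in place of \<open>y^-2\<close>,
  so the degree of \<open>g\<close> cannot be fixed in advance.\<close>

locale moebius_data = prime_nat p for p +
 fixes w g :: "int \<Rightarrow> int" and d :: int
 assumes odd: "2 < p"
  and w_cong: "x \<doteq> y \<Longrightarrow> w x \<doteq> w y"
  and g_cong: "x \<doteq> y \<Longrightarrow> g x \<doteq> g y"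
  and w_unit: "unit x \<Longrightarrow> unit (w x)"
  and w_inj: "unit x \<Longrightarrow> unit y \<Longrightarrow> w x \<doteq> w y \<Longrightarrow> x \<doteq> y"
  and g_unit: "int p dvd g x \<longleftrightarrow> int p dvd x"
  and FI: "unit x \<Longrightarrow> unit a \<Longrightarrow>
   g (w x) * g (x - a) * g (w a) \<doteq> g (w x - w a)"
  and FI1: "unit x \<Longrightarrow> g (w x) * g x \<doteq> d"
  and FI0: "unit x \<Longrightarrow> g (w x) * g (- x) \<doteq> 1"
begin

definition inv_g where "inv_g x = g x ^ (p - 2)"

lemma inv_g: "unit x \<Longrightarrow> g x * inv_g x \<doteq> 1"
proof -
 assume x: "unit x"
 have "g x * inv_g x = g x ^ (p - 1)"
 proof -
  have "p - 1 = Suc (p - 2)" using odd by simp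
  then show ?thesis unfolding inv_g_def by simp
 qed
 then show ?thesis using int_fermat[OF prime, of "g x"] g_unit x by simp
qed

text \<open>All relations are multiplicative in \<open>g\<close> and so pass to the reciprocal. The
  degree bound of \<open>moebius_core\<close> can be secured for one of the two only; for
  \<open>g y = - c / y^2\<close> the reciprocal is the one of degree 2.\<close>

lemma dual: "moebius_data p w inv_g (d ^ (p - 2))"
proof
 show "2 < p" by (rule odd)
next
 fix x y show "x \<doteq> y \<Longrightarrow> w x \<doteq> w y" by (rule w_cong)
next
 fix x y assume "x \<doteq> y" then show "inv_g x \<doteq> inv_g y" unfolding inv_g_def by (intro cong_pow g_cong)
next
 fix x show "unit x \<Longrightarrow> unit (w x)" by (rule w_unit)
next
 fix x y show "unit x \<Longrightarrow> unit y \<Longrightarrow> w x \<doteq> w y \<Longrightarrow> x \<doteq> y" by (rule w_inj)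
next
 fix x show "int p dvd inv_g x \<longleftrightarrow> int p dvd x"
  unfolding inv_g_def using odd g_unit p_prime_int by (simp add: prime_dvd_power_iff)
next
 fix x a assume "unit x" "unit a"
 from cong_pow[OF FI[OF this], of "p-2"] show "inv_g (w x) * inv_g (x - a) * inv_g (w a) \<doteq> inv_g (w x - w a)"
  unfolding inv_g_def by (simp add: power_mult_distrib)
next
 fix x assume "unit x"
 from cong_pow[OF FI1[OF this], of "p-2"] show "inv_g (w x) * inv_g x \<doteq> d ^ (p-2)"
  unfolding inv_g_def by (simp add: power_mult_distrib)
next
 fix x assume "unit x"
 from cong_pow[OF FI0[OF this], of "p-2"] show "inv_g (w x) * inv_g (- x) \<doteq> 1"
  unfolding inv_g_def by (simp add: power_mult_distrib)
qed

lemma g_neg: assumes x: "unit x" shows "g (- x) \<doteq> d * g x"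
proof -
 have *: "d * g (- y) \<doteq> g y" if y: "unit y" for y
 proof -
  have "d * g (- y) \<doteq> g (w y) * g y * g (- y)"
   by (intro cong_mult cong_sym[OF FI1] cong_refl y)
  also have "g (w y) * g y * g (- y) = g y * (g (w y) * g (- y))" by simp
  also have "g y * (g (w y) * g (- y)) \<doteq> g y * 1" by (intro cong_mult FI0 y cong_refl)
  finally show ?thesis by simp
 qed
 show ?thesis using cong_sym[OF *[of "-x"]] x by simp
qed

lemma w_surj:
 assumes "unit y" obtains x where "unit x" "w x \<doteq> y"
proof -
 let ?U = "{1..<int p}"
 have U: "x \<in> ?U \<Longrightarrow> unit x" for x using zdvd_imp_le[of "int p" x] by auto
 have mU: "unit x \<Longrightarrow> x mod int p \<in> ?U" for x
  using odd pos_mod_bound[of "int p" x] pos_mod_sign[of "int p" x]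
  by (simp add: dvd_eq_mod_eq_0 int_one_le_iff_zero_less order_less_le)
 have inj: "inj_on (\<lambda>x. w x mod int p) ?U"
 proof (rule inj_onI)
  fix x y assume *: "x \<in> ?U" "y \<in> ?U" "w x mod int p = w y mod int p"
  then show "x = y" using w_inj[of x y] U cong_def by fastforce
 qed
 have "(\<lambda>x. w x mod int p) ` ?U \<subseteq> ?U" using mU w_unit U by blast
 then obtain x where "x \<in> ?U" "y mod int p = w x mod int p" using inj mU[OF assms] endo_inj_surj by blast
 then show thesis using that[of x] U by (auto simp: cong_def)
qed

text \<open>Models the Weyl element acting on binary forms of degree \<open>n\<close>: if
  \<open>g\<close> is a multiple of \<open>y^n\<close> and \<open>w y = c / y\<close>, then
  \<open>R\<close> is \<open>F\<close> with its coefficients reversed and rescaled. The last clause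
  fixes the value of \<open>R\<close> at 0, an argument that is never of the form \<open>w y\<close>
  with \<open>y\<close> a unit.\<close>

definition good :: "nat \<Rightarrow> int \<Rightarrow> int poly \<Rightarrow> bool" where
 "good n c F \<longleftrightarrow> (\<exists>R. degree R \<le> n \<and> (\<forall>y. unit y \<longrightarrow> poly R (w y) \<doteq> g (w y) * poly F y) \<and>
   poly R 0 * c \<doteq> d * Polynomial.coeff F n)"

lemma good_add: "good n c F \<Longrightarrow> good n c F' \<Longrightarrow> good n c (F + F')"
proof -
 assume "good n c F" and "good n c F'"
 obtain R where R: "degree R \<le> n" "\<And>y. unit y \<Longrightarrow> poly R (w y) \<doteq> g (w y) * poly F y"
   "poly R 0 * c \<doteq> d * Polynomial.coeff F n" using \<open>good n c F\<close> unfolding good_def by blast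
 obtain R' where R': "degree R' \<le> n" "\<And>y. unit y \<Longrightarrow> poly R' (w y) \<doteq> g (w y) * poly F' y"
   "poly R' 0 * c \<doteq> d * Polynomial.coeff F' n" using \<open>good n c F'\<close> unfolding good_def by blast
 show ?thesis unfolding good_def
 proof (intro exI[of _ "R + R'"] conjI allI impI)
  show "degree (R + R') \<le> n" using R(1) R'(1) by (rule degree_add_le)
  show "poly (R + R') (w y) \<doteq> g (w y) * poly (F + F') y" if "unit y" for y
   using cong_add[OF R(2)[OF that] R'(2)[OF that]] by (simp add: distrib_left)
  show "poly (R + R') 0 * c \<doteq> d * Polynomial.coeff (F + F') n"
   using cong_add[OF R(3) R'(3)] by (simp add: distrib_left distrib_right)
 qed
qed

lemma good_smult: "good n c F \<Longrightarrow> good n c (Polynomial.smult a F)"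
proof -
 assume "good n c F"
 then obtain R where R: "degree R \<le> n" "\<And>y. unit y \<Longrightarrow> poly R (w y) \<doteq> g (w y) * poly F y"
   "poly R 0 * c \<doteq> d * Polynomial.coeff F n" unfolding good_def by blast
 show ?thesis unfolding good_def
 proof (intro exI[of _ "Polynomial.smult a R"] conjI allI impI)
  show "degree (Polynomial.smult a R) \<le> n" using R(1) degree_smult_le order.trans by blast
  show "poly (Polynomial.smult a R) (w y) \<doteq> g (w y) * poly (Polynomial.smult a F) y" if "unit y" for y
   using cong_scalar_left[OF R(2)[OF that], of a] by (simp add: mult.left_commute)
  show "poly (Polynomial.smult a R) 0 * c \<doteq> d * Polynomial.coeff (Polynomial.smult a F) n"
   using cong_scalar_left[OF R(3), of a] by (simp add: mult.left_commute mult.assoc)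
 qed
qed

lemma good_diff: "good n c F \<Longrightarrow> good n c F' \<Longrightarrow> good n c (F - F')"
 using good_add[of n c F "Polynomial.smult (-1) F'"] good_smult[of n c F' "-1"] by simp

lemma good_dvd: assumes "[:int p:] dvd F" shows "good n c F"
proof -
 obtain F' where F: "F = [:int p:] * F'" using assms by blast
 show ?thesis using F by (simp add: exI[of _ 0] cong_iff_dvd_diff good_def)
qed

text \<open>\<open>FI\<close> says precisely that the translate of \<open>G\<close> by
  \<open>a\<close> is carried to a multiple of the translate by \<open>w a\<close>. For
  \<open>a\<close> divisible by \<open>p\<close>, where \<open>w\<close> carries no information,
  \<open>FI1\<close> makes the image the constant \<open>d\<close>.\<close>

lemma good_translate:
 assumes G: "\<And>y. poly G y \<doteq> g y" "degree G = n"
 shows "good n (lead_coeff G) (pcompose G [:-a, 1:])"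
proof -
 have co: "Polynomial.coeff (pcompose G [:-a, 1:]) n = lead_coeff G"
  using coeff_shift_top[of G n "-a"] G by simp
 show ?thesis
 proof (cases "int p dvd a")
  case False
  have ia: "g (w a) * inv_g (w a) \<doteq> 1" by (rule inv_g[OF w_unit[OF False]])
  let ?R = "Polynomial.smult (inv_g (w a)) (pcompose G [:- w a, 1:])"
  have "poly ?R (w y) \<doteq> g (w y) * poly (pcompose G [:-a, 1:]) y" if y: "unit y" for y
  proof -
   have "poly ?R (w y) \<doteq> inv_g (w a) * (g (w y) * g (y - a) * g (w a))"
    by (simp add: poly_pcompose cong_mult cong_refl cong_trans[OF G(1)] cong_sym[OF FI] y False)
   also have "inv_g (w a) * (g (w y) * g (y - a) * g (w a)) = (g (w a) * inv_g (w a)) * (g (w y) * g (y - a))" by simp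
   also have "\<dots> \<doteq> 1 * (g (w y) * g (y - a))" by (intro cong_mult ia cong_refl)
   also have "1 * (g (w y) * g (y - a)) \<doteq> g (w y) * poly (pcompose G [:-a, 1:]) y"
    using G(1)[of "y - a"] by (auto simp: poly_pcompose intro!: cong_mult cong_refl intro: cong_sym)
   finally show ?thesis .
  qed
  moreover have "poly ?R 0 \<doteq> d"
  proof -
   have "poly ?R 0 \<doteq> inv_g (w a) * (d * g (w a))"
    by (simp add: poly_pcompose cong_mult cong_refl cong_trans[OF G(1)] g_neg w_unit False)
   also have "inv_g (w a) * (d * g (w a)) = d * (g (w a) * inv_g (w a))" by simp
   also have "\<dots> \<doteq> d * 1" by (intro cong_mult ia cong_refl)
   finally show ?thesis by simp
  qed
  ultimately show ?thesis using G(2) by (simp add: degree_pcompose exI[of _ ?R] cong_mult good_def co)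
 next
  case True
  have "poly [:d:] (w y) \<doteq> g (w y) * poly (pcompose G [:-a, 1:]) y" if y: "unit y" for y
  proof -
   have "poly (pcompose G [:-a, 1:]) y \<doteq> g (y - a)" by (simp add: poly_pcompose G)
   also have "g (y - a) \<doteq> g y" by (rule g_cong) (use True in \<open>simp add: cong_iff_dvd_diff\<close>)
   finally have "g (w y) * poly (pcompose G [:-a, 1:]) y \<doteq> g (w y) * g y" by (intro cong_mult cong_refl)
   also have "g (w y) * g y \<doteq> d" by (rule FI1[OF y])
   finally show ?thesis by (simp add: cong_sym_eq)
  qed
  then show ?thesis unfolding good_def co by (intro exI[of _ "[:d:]"]) auto
 qed
qed

text \<open>The difference of two neighbouring translates has degree one less, and
  \<open>n < p\<close> keeps its leading coefficient a unit. Goodness of all translates is carried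
  along so that the step can be repeated.\<close>

lemma good_degree_step:
 assumes G: "\<And>y. poly G y \<doteq> g y" "degree G = n" "unit (lead_coeff G)" "n < p" and "j \<le> n"
 shows "\<exists>F. degree F \<le> n - j \<and> unit (Polynomial.coeff F (n - j)) \<and> (\<forall>a. good n (lead_coeff G) (pcompose F [:-a, 1:]))"
 using \<open>j \<le> n\<close>
proof (induction j)
 case 0
 show ?case using good_translate[OF G(1,2)] G by (intro exI[of _ G]) auto
next
 case (Suc j)
 then obtain F where F: "degree F \<le> n - j" "unit (Polynomial.coeff F (n - j))"
  "\<And>a. good n (lead_coeff G) (pcompose F [:-a, 1:])" by auto
 let ?m = "n - Suc j"
 let ?D = "pcompose F [:1, 1:] - F"
 have nj: "n - j = Suc ?m" and D: "degree ?D \<le> ?m" "Polynomial.coeff ?D ?m = int (Suc ?m) * Polynomial.coeff F (Suc ?m)"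
  using Suc degree_difference[of F ?m] F(1) by auto
 have "unit (Polynomial.coeff ?D ?m)"
  using nj G(4) F(2) prime_dvd_mult_iff[OF p_prime_int] unfolding D(2) by (auto dest!: dvd_imp_le simp del: of_nat_Suc)
 moreover have "good n (lead_coeff G) (pcompose ?D [:-a, 1:])" for a
 proof -
  show ?thesis
   using good_diff[OF F(3)[of "a - 1"] F(3)[of a]] by (simp add: pcompose_assoc[symmetric] pcompose_pCons pcompose_diff)
 qed
 ultimately show ?case using D(1) by blast
qed

text \<open>\<open>good_degree_step\<close> provides a good polynomial with unit leading coefficient
  in every degree up to \<open>n\<close>, so these span modulo \<open>p\<close>. The integer
  \<open>c\<close> is what remains of the top coefficient after the reduction; it is divisible by
  \<open>p\<close> and hence harmless.\<close>

lemma good_all: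
 assumes G: "\<And>y. poly G y \<doteq> g y" "degree G = n" "unit (lead_coeff G)" "n < p"
 shows "i \<le> n \<Longrightarrow> degree F \<le> i \<Longrightarrow> good n (lead_coeff G) F"
proof (induction i arbitrary: F rule: less_induct)
 case (less i)
 obtain B where B: "degree B \<le> i" "unit (Polynomial.coeff B i)" "\<And>a. good n (lead_coeff G) (pcompose B [:-a, 1:])"
  using good_degree_step[OF G, of "n - i"] less(2) by auto
 have gB: "good n (lead_coeff G) B" using B(3)[of 0] by simp
 obtain b where b: "Polynomial.coeff B i * b \<doteq> 1"
  using unit_inverse[OF B(2)] by blast
 define k where "k = Polynomial.coeff F i * b"
 define c where "c = Polynomial.coeff F i - k * Polynomial.coeff B i"
 have "c = - (Polynomial.coeff F i * (Polynomial.coeff B i * b - 1))" by (simp add: c_def k_def algebra_simps)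
 then have pc: "int p dvd c" using b by (simp add: cong_iff_dvd_diff)
 define H where "H = F - Polynomial.smult k B - Polynomial.monom c i"
 have Hi: "Polynomial.coeff H i = 0" and dH: "degree H \<le> i"
  using less(3) B(1) unfolding H_def by (auto simp: H_def c_def degree_diff_le order.trans[OF degree_smult_le] degree_monom_le)
 have "good n (lead_coeff G) H"
 proof (cases "i = 0")
  case True
  then show ?thesis using Hi dH leading_coeff_0_iff[of H] good_dvd by fastforce
 next
  case False
  have "degree H \<noteq> i \<or> H = 0" using Hi by auto
  then show ?thesis using dH less(1)[of "i-1" H] less(2) False by auto
 qed
 moreover have "good n (lead_coeff G) (Polynomial.monom c i)"
  using pc by (intro good_dvd) (auto simp: const_poly_dvd_iff)
 ultimately show ?case using good_add[OF good_add[OF _ good_smult[OF gB, of k]]] H_def by fastforce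
qed

text \<open>Let \<open>R j\<close> be the image of \<open>y^j\<close>. The quotient of
  \<open>R 1\<close> and \<open>R 0\<close> at \<open>w x\<close> is \<open>x\<close>, so it
  suffices to find the shape of these two polynomials; their orders of vanishing at 0 determine
  it.\<close>

lemma moebius_core:
 assumes G: "\<And>y. poly G y \<doteq> g y" "unit (lead_coeff G)" "2 * degree G \<le> p - 1"
 shows "\<exists>c. unit c \<and> (\<forall>x. unit x \<longrightarrow> w x * x \<doteq> c)"
proof -
 define n where "n = degree G"
 let ?l = "lead_coeff G"
 have np: "n < p" using G(3) odd n_def by auto
 have n1: "n \<ge> 1"
 proof (rule ccontr)
  assume "\<not> n \<ge> 1"
  then have "degree G = 0" by (simp add: n_def)
  then obtain c where "G = [:c:]" by (rule degree_eq_zeroE)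
  then have "c \<doteq> g 0" "c \<doteq> g 1" using G(1)[of 0] G(1)[of 1] by simp_all
  then show False using cong_dvd_iff g_unit unit_one by blast
 qed
 have d: "unit d"
 proof
  assume "int p dvd d"
  note one = unit_one
  show False
   using cong_dvd_iff[OF FI1[OF one]] \<open>int p dvd d\<close> g_unit w_unit[OF one] prime_dvd_mult_iff[OF p_prime_int] by simp
 qed
 have "\<forall>j\<in>{..n}. \<exists>R. degree R \<le> n \<and> (\<forall>y. unit y \<longrightarrow> poly R (w y) \<doteq> g (w y) * y ^ j) \<and>
   poly R 0 * ?l \<doteq> d * (if j = n then 1 else 0)"
 proof
  fix j assume "j \<in> {..n}"
  then show "\<exists>R. degree R \<le> n \<and> (\<forall>y. unit y \<longrightarrow> poly R (w y) \<doteq> g (w y) * y ^ j) \<and>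
   poly R 0 * ?l \<doteq> d * (if j = n then 1 else 0)"
   using good_all[OF G(1) n_def[symmetric] G(2) np, of j "Polynomial.monom 1 j"] by (simp add: degree_monom_eq poly_monom good_def)
 qed
 then obtain R where R: "\<And>j. j \<le> n \<Longrightarrow> degree (R j) \<le> n"
  "\<And>j y. j \<le> n \<Longrightarrow> unit y \<Longrightarrow> poly (R j) (w y) \<doteq> g (w y) * y ^ j"
  "\<And>j. j \<le> n \<Longrightarrow> poly (R j) 0 * ?l \<doteq> d * (if j = n then 1 else 0)"
 proof -
  assume a: "\<And>R. (\<And>j. j \<le> n \<Longrightarrow> degree (R j) \<le> n) \<Longrightarrow>
   (\<And>j y. j \<le> n \<Longrightarrow> unit y \<Longrightarrow> poly (R j) (w y) \<doteq> g (w y) * y ^ j) \<Longrightarrow>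
   (\<And>j. j \<le> n \<Longrightarrow> poly (R j) 0 * ?l \<doteq> d * (if j = n then 1 else 0)) \<Longrightarrow> thesis"
  assume "\<forall>j\<in>{..n}. \<exists>R. degree R \<le> n \<and> (\<forall>y. unit y \<longrightarrow> poly R (w y) \<doteq> g (w y) * y ^ j) \<and>
   poly R 0 * ?l \<doteq> d * (if j = n then 1 else 0)"
  from bchoice[OF this] show thesis using a by auto
 qed
 have R0: "int p dvd poly (R j) 0" if "j < n" for j
  using R(3)[of j] that G(2) prime_dvd_mult_iff[OF p_prime_int] cong_0_iff by auto
 have Rn: "unit (poly (R n) 0)" using cong_dvd_iff[OF R(3)[of n]] d by auto
 have nz: "\<exists>i. unit (Polynomial.coeff (R j) i)" if "j \<le> n" for j
 proof (rule ccontr)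
  assume "\<not> ?thesis"
  then obtain Q where Q: "R j = [:int p:] * Q" using const_poly_dvd_iff by blast
  note one = unit_one
  show False using cong_dvd_iff[OF R(2)[OF that one]] g_unit w_unit[OF one] by (simp add: Q)
 qed
 \<comment> \<open>The order of vanishing at 0 modulo \<open>p\<close>; additive on products because
   \<open>p\<close> is prime.\<close>
 define o' where "o' F = (LEAST i. unit (Polynomial.coeff F i))" for F :: "int poly"
 have o_not: "unit (Polynomial.coeff F (o' F))" if "\<exists>i. unit (Polynomial.coeff F i)" for F
  unfolding o'_def using that by (rule LeastI_ex)
 have o_less: "int p dvd Polynomial.coeff F i" if "i < o' F" for F i
  using not_less_Least[of i "\<lambda>i. unit (Polynomial.coeff F i)"] that unfolding o'_def by blast
 have o_eqI: "o' F = i" if "unit (Polynomial.coeff F i)" "\<And>j. j < i \<Longrightarrow> int p dvd Polynomial.coeff F j" for F i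
  unfolding o'_def using that by (intro Least_equality) (auto simp: not_less[symmetric])
 have o_mult: "o' (A * B) = o' A + o' B" if A: "\<exists>i. unit (Polynomial.coeff A i)" and B: "\<exists>i. unit (Polynomial.coeff B i)" for A B
 proof (rule o_eqI)
  fix j assume j: "j < o' A + o' B"
  show "int p dvd Polynomial.coeff (A * B) j" unfolding coeff_mult
  proof (intro dvd_sum)
   fix i assume "i \<in> {..j}"
   then have "i < o' A \<or> j - i < o' B" using j by auto
   then show "int p dvd Polynomial.coeff A i * Polynomial.coeff B (j - i)" using o_less by (auto intro: dvd_mult dvd_mult2)
  qed
 next
  let ?j = "o' A + o' B"
  have "Polynomial.coeff (A * B) ?j = Polynomial.coeff A (o' A) * Polynomial.coeff B (o' B) + (\<Sum>i\<in>{..?j} - {o' A}. Polynomial.coeff A i * Polynomial.coeff B (?j - i))"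
   unfolding coeff_mult by (subst sum.remove[of _ "o' A"]) auto
  moreover have "int p dvd (\<Sum>i\<in>{..?j} - {o' A}. Polynomial.coeff A i * Polynomial.coeff B (?j - i))"
  proof (intro dvd_sum)
   fix i assume "i \<in> {..?j} - {o' A}"
   then have "i < o' A \<or> ?j - i < o' B" by auto
   then show "int p dvd Polynomial.coeff A i * Polynomial.coeff B (?j - i)" using o_less by (auto intro: dvd_mult dvd_mult2)
  qed
  moreover have "unit (Polynomial.coeff A (o' A) * Polynomial.coeff B (o' B))"
   using o_not[OF A] o_not[OF B] p_prime_int prime_dvd_multD by blast
  ultimately show "unit (Polynomial.coeff (A * B) ?j)" by (simp add: dvd_add_left_iff)
 qed
 \<comment> \<open>The difference of the products vanishes at every \<open>w x\<close>, hence at all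
   units, and at 0 because \<open>R 0\<close> and \<open>R j\<close> do. Its degree is at most
   \<open>2 * n < p\<close>, so it is zero modulo \<open>p\<close> as a polynomial.\<close>
 have rel: "o' (R (Suc j)) + o' (R 0) = o' (R j) + o' (R 1)" if j: "j < n" for j
 proof -
  let ?F = "R (Suc j) * R 0 - R j * R 1"
  have "degree ?F \<le> n + n"
   using R(1)[of "Suc j"] R(1)[of 0] R(1)[of j] R(1)[of 1] j by (intro degree_diff_le order.trans[OF degree_mult_le]) (auto intro: add_mono)
  then have "degree ?F < p" using G(3) odd n_def by simp
  moreover have "int p dvd poly ?F y" for y
  proof (cases "int p dvd y")
   case True
   have "poly ?F y \<doteq> poly ?F 0" by (rule poly_cong) (use True in \<open>simp add: cong_0_iff\<close>)
   then show ?thesis using R0[of 0] R0[of j] j cong_dvd_iff by fastforce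
  next
   case False
   then obtain x where x: "unit x" "w x \<doteq> y" using w_surj by blast
   have "poly ?F (w x) \<doteq> (g (w x) * x ^ Suc j) * (g (w x) * x ^ 0) - (g (w x) * x ^ j) * (g (w x) * x ^ 1)"
    unfolding poly_diff poly_mult using j x by (intro cong_diff cong_mult R(2)) auto
   then show ?thesis using cong_dvd_iff[OF poly_cong[OF x(2), of ?F]] cong_0_iff by fastforce
  qed
  ultimately have "[:int p:] dvd ?F" using poly_dvd_of_values[OF prime] by blast
  then have "int p dvd Polynomial.coeff (R (Suc j) * R 0) i \<longleftrightarrow> int p dvd Polynomial.coeff (R j * R 1) i" for i
   using dvd_coeff[of "int p" ?F i] by (intro cong_dvd_iff) (simp add: cong_iff_dvd_diff)
  then have "o' (R (Suc j) * R 0) = o' (R j * R 1)" unfolding o'_def by simp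
  then show ?thesis using o_mult nz j by simp
 qed
 have ap: "o' (R j) + j * o' (R 0) = o' (R 0) + j * o' (R 1)" if "j \<le> n" for j
  using that
 proof (induction j)
  case (Suc j)
  then show ?case using rel[of j] by simp
 qed simp
 have on: "o' (R n) = 0" by (rule o_eqI) (use Rn in \<open>auto simp: poly_0_coeff_0\<close>)
 have o0: "o' (R 0) \<ge> 1"
 proof (rule ccontr)
  assume "\<not> ?thesis"
  then have "o' (R 0) = 0" by simp
  then show False using o_not[OF nz[of 0]] R0[of 0] n1 by (simp add: poly_0_coeff_0)
 qed
 have o0n: "o' (R 0) \<le> n"
 proof (rule ccontr)
  assume "\<not> ?thesis"
  then show False using R(1)[of 0] o_not[OF nz[of 0]] by (simp add: coeff_eq_0)
 qed
 \<comment> \<open>The orders form an arithmetic progression that ends with 0 at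
   \<open>j = n\<close>. Hence \<open>n\<close> divides \<open>o' (R 0)\<close>, which lies between
   1 and \<open>n\<close>, and the progression descends in steps of 1.\<close>
 have nn: "n * o' (R 0) = o' (R 0) + n * o' (R 1)" using ap[of n] on by simp
 then have "n dvd o' (R 0) + n * o' (R 1)" by (metis dvd_triv_left)
 then have o0eq: "o' (R 0) = n" using dvd_add_left_iff[of n "n * o' (R 1)"] o0 o0n by auto
 then have o1eq: "o' (R 1) = n - 1"
 proof -
  have "n * n = n * (1 + o' (R 1))" using nn o0eq by simp
  then show ?thesis using n1 by (simp only: mult_cancel1) simp
 qed
 define r a b where "r = Polynomial.coeff (R 0) n" and "a = Polynomial.coeff (R 1) (n - 1)" and "b = Polynomial.coeff (R 1) n"
 have a: "unit a" using o_not[OF nz[of 1]] o1eq n1 a_def by simp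
 have v0: "poly (R 0) y \<doteq> r * y ^ n" for y
 proof -
  have "poly (R 0) y = (\<Sum>i<n. Polynomial.coeff (R 0) i * y ^ i) + r * y ^ n"
   using R(1)[of 0] poly_altdef_le lessThan_Suc_atMost[symmetric] r_def by fastforce
  also have "\<dots> \<doteq> 0 + r * y ^ n"
   by (intro cong_add cong_refl) (use o_less[of _ "R 0"] o0eq in \<open>auto simp: cong_0_iff intro!: dvd_sum\<close>)
  finally show ?thesis by simp
 qed
 have v1: "poly (R 1) y \<doteq> a * y ^ (n - 1) + b * y ^ n" for y
 proof -
  have "poly (R 1) y = (\<Sum>i\<le>n. Polynomial.coeff (R 1) i * y ^ i)" using R(1)[of 1] n1 by (intro poly_altdef_le) simp
  also have "\<dots> = (\<Sum>i<n-1. Polynomial.coeff (R 1) i * y ^ i) + (a * y ^ (n - 1) + b * y ^ n)"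
   using n1 by (cases n) (simp_all add: a_def b_def lessThan_Suc_atMost[symmetric])
  also have "\<dots> \<doteq> 0 + (a * y ^ (n - 1) + b * y ^ n)"
   by (intro cong_add cong_refl) (use o_less[of _ "R 1"] o1eq in \<open>auto simp: cong_0_iff intro!: dvd_sum\<close>)
  finally show ?thesis by simp
 qed
 have key: "r * w x * x \<doteq> a + b * w x" if x: "unit x" for x
 proof -
  have nn: "w x ^ n = w x ^ (n - 1) * w x" using n1 by (cases n) auto
  have "r * w x ^ n * x \<doteq> poly (R 0) (w x) * x" by (intro cong_mult cong_refl cong_sym[OF v0])
  also have "poly (R 0) (w x) * x \<doteq> g (w x) * x ^ 0 * x" by (intro cong_mult cong_refl R(2) x) simp
  also have "g (w x) * x ^ 0 * x = g (w x) * x ^ 1" by simp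
  also have "\<dots> \<doteq> poly (R 1) (w x)" by (intro cong_sym[OF R(2)] x n1)
  also have "poly (R 1) (w x) \<doteq> a * w x ^ (n - 1) + b * w x ^ n" by (rule v1)
  finally have "w x ^ (n - 1) * (r * w x * x) \<doteq> w x ^ (n - 1) * (a + b * w x)"
   unfolding nn by (simp add: algebra_simps)
  then show ?thesis by (metis cancel w_unit[OF x] prime_dvd_power[OF p_prime_int])
 qed
 obtain s where s: "r * s \<doteq> 1"
  using unit_inverse o_not[OF nz[of 0]] o0eq r_def by blast
 have su: "unit s" using cong_dvd_iff[OF s] unit_one by auto
 \<comment> \<open>Otherwise \<open>key\<close> at \<open>x = b / r\<close> would leave
   \<open>a\<close> congruent to 0.\<close>
 have b: "int p dvd b"
 proof (rule ccontr)
  assume b: "unit b"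
  let ?x = "b * s"
  have x: "unit ?x" using b su p_prime_int prime_dvd_multD by blast
  have "r * w ?x * ?x = (r * s) * (b * w ?x)" by simp
  also have "\<dots> \<doteq> 1 * (b * w ?x)" by (intro cong_mult s cong_refl)
  finally have "0 + b * w ?x \<doteq> a + b * w ?x" using cong_trans[OF cong_sym key[OF x]] by simp
  then show False using cong_add_rcancel a cong_dvd_iff[of 0 a] by blast
 qed
 have "w x * x \<doteq> a * s" if x: "unit x" for x
 proof -
  have "r * (w x * x) \<doteq> a + b * w x" using key[OF x] by (simp add: mult.assoc)
  also have "a + b * w x \<doteq> a + 0" using b by (intro cong_add cong_refl) (simp add: cong_0_iff)
  finally have "s * (r * (w x * x)) \<doteq> s * a" by (intro cong_mult cong_refl) simp
  then have "(r * s) * (w x * x) \<doteq> a * s" by (simp add: algebra_simps)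
  moreover have "(r * s) * (w x * x) \<doteq> 1 * (w x * x)" by (intro cong_mult s cong_refl)
  ultimately show ?thesis using cong_trans[OF cong_sym] by fastforce
 qed
 then show ?thesis by (metis a su p_prime_int prime_dvd_multD)
qed

end

section \<open>Correlation sums of functions modulo a prime\<close>

lemma correlation_degree:
 fixes A B :: "int poly" and p :: nat
 assumes p: "prime p" and A: "degree A \<le> p - 1" "\<not> int p dvd lead_coeff A"
  and B: "degree B \<le> p - 1" "\<not> int p dvd lead_coeff B"
 defines "L \<equiv> degree A + degree B - (p - 1)"
 shows "\<exists>R. (\<forall>s. [(\<Sum>y\<in>{0..<int p}. poly A y * poly B (y + s)) = poly R s] (mod int p)) \<and>
  (if degree A + degree B < p - 1 then R = 0 else degree R \<le> L \<and> \<not> int p dvd Polynomial.coeff R L)"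
proof -
 define n m where "n = degree A" and "m = degree B"
 define M where "M k = (\<Sum>y\<in>{0..<int p}. poly A y * y ^ k)" for k
 define c where "c l = (\<Sum>i\<le>m. Polynomial.coeff B i * int (i choose l) * M (i - l))" for l
 have pi: "prime (int p)" using p by simp
 \<comment> \<open>Moments are sums over all residues, so each reads off one coefficient of
   \<open>A\<close>: they vanish below \<open>p - 1 - degree A\<close>, and the first nonzero one is
   minus the leading coefficient.\<close>
 have M: "[M k = - Polynomial.coeff A (p - 1 - k)] (mod int p)" if "k \<le> p - 1 - n" for k
 proof -
  have "degree (Polynomial.monom 1 k * A) \<le> n + k" unfolding n_def
   by (rule order.trans[OF degree_mult_le]) (simp add: degree_monom_le)
  then have "degree (Polynomial.monom 1 k * A) \<le> p - 1" using that A(1) n_def by simp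
  note poly_sum_cong[OF p this]
  moreover have "Polynomial.coeff (Polynomial.monom 1 k * A) (p - 1) = Polynomial.coeff A (p - 1 - k)"
   using that by (simp add: coeff_monom_mult)
  moreover have "poly (Polynomial.monom 1 k * A) y = poly A y * y ^ k" for y by (simp only: poly_mult poly_monom) simp
  ultimately show ?thesis unfolding M_def by (simp only:)
 qed
 have M0: "int p dvd M k" if "k < p - 1 - n" for k
  using cong_dvd_iff[OF M[of k]] that n_def by (simp add: coeff_eq_0)
 have eq: "(\<Sum>y\<in>{0..<int p}. poly A y * poly B (y + s)) = (\<Sum>l\<le>m. s ^ l * c l)" for s
 proof -
  have pw: "(y + s) ^ i = (\<Sum>l\<le>m. int (i choose l) * s ^ l * y ^ (i - l))" if "i \<le> m" for i y
   by (simp add: binomial_ring that sum.mono_neutral_left add.commute)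
  have "(\<Sum>y\<in>{0..<int p}. poly A y * poly B (y + s)) =
    (\<Sum>y\<in>{0..<int p}. \<Sum>l\<le>m. \<Sum>i\<le>m. s ^ l * (Polynomial.coeff B i * int (i choose l) * (poly A y * y ^ (i - l))))"
   using pw unfolding poly_altdef m_def[symmetric] by (subst sum.swap) (simp add: sum_distrib_left algebra_simps)
  also have "\<dots> = (\<Sum>l\<le>m. \<Sum>y\<in>{0..<int p}. \<Sum>i\<le>m. s ^ l * (Polynomial.coeff B i * int (i choose l) * (poly A y * y ^ (i - l))))"
   by (rule sum.swap)
  also have "\<dots> = (\<Sum>l\<le>m. \<Sum>i\<le>m. \<Sum>y\<in>{0..<int p}. s ^ l * (Polynomial.coeff B i * int (i choose l) * (poly A y * y ^ (i - l))))"
   by (intro sum.cong refl sum.swap)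
  also have "\<dots> = (\<Sum>l\<le>m. s ^ l * c l)"
   unfolding c_def M_def by (simp add: sum_distrib_left)
  finally show ?thesis .
 qed
 define K where "K = p - 1 - n"
 have c0: "int p dvd c l" if "m < l + K" for l
  unfolding c_def
 proof (intro dvd_sum)
  fix i assume "i \<in> {..m}"
  then have "i < l \<or> i - l < K" using that by auto
  then show "int p dvd Polynomial.coeff B i * int (i choose l) * M (i - l)"
   using M0[of "i - l"] by (auto simp: K_def binomial_eq_0)
 qed
 show ?thesis
 proof (cases "n + m < p - 1")
  case True
  show ?thesis using True eq n_def m_def by (simp add: dvd_sum c0 K_def cong_0_iff)
 next
  case False
  have L: "L = m - K" "K \<le> m" "L \<le> m" using False A(1) by (auto simp: L_def K_def n_def m_def)
  define R where "R = (\<Sum>l\<le>L. Polynomial.monom (c l) l)"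
  have coR: "Polynomial.coeff R l = (if l \<le> L then c l else 0)" for l unfolding R_def coeff_sum by (simp cong: if_cong)
  have "poly R s = (\<Sum>l\<le>L. s ^ l * c l)" for s unfolding R_def by (simp add: poly_sum poly_monom mult.commute)
  moreover have "[(\<Sum>l\<le>m. s ^ l * c l) = (\<Sum>l\<le>L. s ^ l * c l)] (mod int p)" for s
  proof -
   have "{..m} = {..L} \<union> {L<..m}" using L by auto
   then have "(\<Sum>l\<le>m. s ^ l * c l) = (\<Sum>l\<le>L. s ^ l * c l) + (\<Sum>l\<in>{L<..m}. s ^ l * c l)"
    by (simp only:) (subst sum.union_disjoint, auto)
   moreover have "int p dvd (\<Sum>l\<in>{L<..m}. s ^ l * c l)"
    by (intro dvd_sum dvd_mult c0) (use L in auto)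
   ultimately show ?thesis by (simp add: cong_iff_dvd_diff)
  qed
  moreover have "degree R \<le> L" by (rule degree_le) (simp add: coR)
  \<comment> \<open>Up to sign this is the product of both leading coefficients and
    \<open>m choose L\<close>, a unit because \<open>m < p\<close>.\<close>
  moreover have "\<not> int p dvd c L"
  proof -
   have "c L = (\<Sum>i<m. Polynomial.coeff B i * int (i choose L) * M (i - L)) + Polynomial.coeff B m * int (m choose L) * M K"
    unfolding c_def using L by (simp add: lessThan_Suc_atMost[symmetric])
   moreover have "int p dvd (\<Sum>i<m. Polynomial.coeff B i * int (i choose L) * M (i - L))"
   proof (intro dvd_sum)
    fix i assume "i \<in> {..<m}"
    then have "i < L \<or> i - L < K" using L by auto
    then show "int p dvd Polynomial.coeff B i * int (i choose L) * M (i - L)"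
     using M0[of "i - L"] by (auto simp: K_def binomial_eq_0)
   qed
   moreover have "\<not> int p dvd Polynomial.coeff B m * int (m choose L) * M K"
   proof -
    have "\<not> int p dvd M K"
     using A(1) prime_gt_0_nat[OF p] cong_dvd_iff[OF M[of K]] A(2) n_def K_def by fastforce
    moreover have "\<not> p dvd (m choose L)"
    proof
     assume "p dvd (m choose L)"
     then have "p \<le> m" by (metis binomial_fact_lemma[OF L(3)] p dvd_mult prime_dvd_fact_iff)
     then show False using B(1) m_def prime_gt_0_nat[OF p] by simp
    qed
    ultimately show ?thesis using B(2) m_def by (simp add: prime_dvd_mult_iff[OF pi])
   qed
   ultimately show ?thesis by (simp add: dvd_add_right_iff)
  qed
  ultimately show ?thesis using False eq coR[of L] n_def m_def by (intro exI[of _ R]) auto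
 qed
qed

lemma sum_reindex_mod:
 fixes p :: nat and f h :: "int \<Rightarrow> int"
 assumes p: "0 < p" and f: "\<And>x y. [x = y] (mod int p) \<Longrightarrow> [f x = f y] (mod int p)"
  and h: "\<And>x y. [h x = h y] (mod int p) \<Longrightarrow> [x = y] (mod int p)"
 shows "[(\<Sum>y\<in>{0..<int p}. f (h y)) = (\<Sum>y\<in>{0..<int p}. f y)] (mod int p)"
proof -
 let ?I = "{0..<int p}" and ?h = "\<lambda>y. h y mod int p"
 have "inj_on ?h ?I"
 proof (rule inj_onI)
  fix x y assume *: "x \<in> ?I" "y \<in> ?I" "?h x = ?h y"
  then have "[x = y] (mod int p)" by (metis cong_def h)
  then show "x = y" using * by (simp add: cong_def)
 qed
 moreover have "?h ` ?I \<subseteq> ?I" by auto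
 ultimately have "bij_betw ?h ?I ?I" by (simp add: bij_betw_def endo_inj_surj)
 then have "(\<Sum>y\<in>?I. f (?h y)) = (\<Sum>y\<in>?I. f y)" by (rule sum.reindex_bij_betw)
 moreover have "[(\<Sum>y\<in>?I. f (h y)) = (\<Sum>y\<in>?I. f (?h y))] (mod int p)" by (intro cong_sum f) simp
 ultimately show ?thesis by simp
qed

context moebius_data
begin

definition sigma where "sigma = (\<Sum>y\<in>{0..<int p}. g y)"

lemma inv_g_cong: "x \<doteq> y \<Longrightarrow> inv_g x \<doteq> inv_g y"
 unfolding inv_g_def by (intro cong_pow g_cong)

text \<open>After reflecting the summation variable and multiplying by \<open>g (w s)\<close>, the
  relations \<open>FI0\<close> and \<open>FI\<close> turn the term at \<open>a\<close> into
  \<open>g (w s - w a)\<close>. Over all residues these add up to \<open>sigma\<close>, except for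
  the missing term at \<open>a = 0\<close>; the factor \<open>g (- s)\<close> then cancels
  \<open>g (w s)\<close>.\<close>

lemma correlation: "(\<Sum>y\<in>{0..<int p}. inv_g y * g (y + s)) \<doteq> sigma * g (- s) - 1"
proof (cases "int p dvd s")
 case True
 have "(\<Sum>y\<in>{0..<int p}. inv_g y * g (y + s)) \<doteq> (\<Sum>y\<in>{0..<int p}. if y = 0 then 0 else 1)"
 proof (intro cong_sum)
  fix y assume y: "y \<in> {0..<int p}"
  have *: "inv_g y * g (y + s) \<doteq> inv_g y * g y"
   using True by (intro cong_mult g_cong cong_refl) (simp add: cong_iff_dvd_diff)
  show "inv_g y * g (y + s) \<doteq> (if y = 0 then 0 else 1)"
  proof (cases "y = 0")
   case True
   then have "int p dvd g y" using g_unit by simp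
   then show ?thesis using True cong_trans[OF *] cong_0_iff by fastforce
  next
   case False
   then show ?thesis
    using y zdvd_imp_le[of "int p" y] cong_trans[OF *, of 1] inv_g[of y] by (auto simp: mult.commute)
  qed
 qed
 also have "(\<Sum>y\<in>{0..<int p}. if y = 0 then 0 else 1) = int p - (1::int)"
 proof -
  have "{0..<int p} = insert 0 {1..<int p}" using odd by auto
  then show ?thesis using odd by simp
 qed
 also have "int p - 1 \<doteq> sigma * g (- s) - 1" by (simp add: True g_unit cong_iff_dvd_diff)
 finally show ?thesis .
next
 case s: False
 let ?I = "{0..<int p}"
 \<comment> \<open>Extends \<open>w\<close> from the units to a permutation of all residues.\<close>
 let ?h = "\<lambda>a. if int p dvd a then 0 else w a"
 have h_inj: "x \<doteq> y" if "?h x \<doteq> ?h y" for x y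
 proof (cases "int p dvd x"; cases "int p dvd y")
  assume "int p dvd x" "int p dvd y" then show ?thesis by (simp add: cong_iff_dvd_diff)
 next
  assume *: "int p dvd x" "unit y"
  then show ?thesis using that w_unit[OF *(2)] cong_dvd_iff[of 0 "w y"] by simp
 next
  assume *: "unit x" "int p dvd y"
  then show ?thesis using that w_unit[OF *(1)] cong_dvd_iff[of "w x" 0] by simp
 next
  assume "unit x" "unit y"
  then show ?thesis using that w_inj by simp
 qed
 have "(\<Sum>y\<in>?I. inv_g (- y) * g (- y + s)) \<doteq> (\<Sum>y\<in>?I. inv_g y * g (y + s))"
 proof (rule sum_reindex_mod[where f = "\<lambda>y. inv_g y * g (y + s)" and h = uminus])
  show "0 < p" using odd by simp
  show "inv_g x * g (x + s) \<doteq> inv_g y * g (y + s)" if "x \<doteq> y" for x y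
   using that by (intro cong_mult inv_g_cong g_cong cong_add cong_refl)
  show "x \<doteq> y" if "- x \<doteq> - y" for x y using that by (simp add: cong_minus_minus_iff)
 qed
 then have "g (w s) * (\<Sum>y\<in>?I. inv_g y * g (y + s)) \<doteq> g (w s) * (\<Sum>y\<in>?I. inv_g (- y) * g (- y + s))"
  by (intro cong_mult cong_refl) (rule cong_sym)
 also have "g (w s) * (\<Sum>y\<in>?I. inv_g (- y) * g (- y + s)) = (\<Sum>y\<in>?I. g (w s) * (inv_g (- y) * g (- y + s)))"
  by (simp add: sum_distrib_left)
 also have "\<dots> \<doteq> (\<Sum>y\<in>?I. g (w s - ?h y) - (if y = 0 then g (w s) else 0))"
 proof (intro cong_sum)
  fix a assume a: "a \<in> ?I"
  show "g (w s) * (inv_g (- a) * g (- a + s)) \<doteq> g (w s - ?h a) - (if a = 0 then g (w s) else 0)"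
  proof (cases "a = 0")
   case True
   show ?thesis using g_unit[of 0] odd True by (simp add: prime_dvd_power_iff[OF p_prime_int] cong_0_iff inv_g_def)
  next
   case False
   then have au: "unit a" using a zdvd_imp_le[of "int p" a] by auto
   have i: "inv_g (- a) \<doteq> g (w a)"
   proof -
    have "g (- a) * inv_g (- a) \<doteq> g (- a) * g (w a)"
     using cong_trans[OF inv_g[of "-a"] cong_sym[OF FI0[OF au]]] au by (simp add: mult.commute)
    then show ?thesis using cancel[of "g (- a)"] g_unit au by simp
   qed
   have "g (w s) * (inv_g (- a) * g (- a + s)) \<doteq> g (w s) * (g (w a) * g (- a + s))"
    by (intro cong_mult cong_refl i)
   also have "g (w s) * (g (w a) * g (- a + s)) = g (w s) * g (s - a) * g (w a)" by simp
   also have "\<dots> \<doteq> g (w s - w a)" by (rule FI[OF s au])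
   finally show ?thesis using False au by simp
  qed
 qed
 also have "(\<Sum>y\<in>?I. g (w s - ?h y) - (if y = 0 then g (w s) else 0)) =
   (\<Sum>y\<in>?I. g (w s - ?h y)) - g (w s)"
  using odd by (simp add: sum_subtractf)
 also have "\<dots> \<doteq> sigma - g (w s)"
  unfolding sigma_def
 proof (intro cong_diff cong_refl sum_reindex_mod[where h = "\<lambda>y. w s - ?h y"] g_cong)
  fix x y assume "w s - ?h x \<doteq> w s - ?h y"
  then have "?h x \<doteq> ?h y" using cong_diff[OF cong_refl[of "w s"]] by fastforce
  then show "x \<doteq> y" by (rule h_inj)
 qed (use odd in auto)
 finally have "g (- s) * (g (w s) * (\<Sum>y\<in>?I. inv_g y * g (y + s))) \<doteq> g (- s) * (sigma - g (w s))"
  by (intro cong_mult cong_refl)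
 then have 1: "(g (w s) * g (- s)) * (\<Sum>y\<in>?I. inv_g y * g (y + s)) \<doteq> sigma * g (- s) - g (w s) * g (- s)"
  by (simp add: algebra_simps)
 have 2: "(g (w s) * g (- s)) * (\<Sum>y\<in>?I. inv_g y * g (y + s)) \<doteq> 1 * (\<Sum>y\<in>?I. inv_g y * g (y + s))"
  by (intro cong_mult FI0[OF s] cong_refl)
 have 3: "sigma * g (- s) - g (w s) * g (- s) \<doteq> sigma * g (- s) - 1"
  by (intro cong_diff FI0[OF s] cong_refl)
 from cong_trans[OF cong_trans[OF cong_sym[OF 2] 1] 3] show ?thesis by simp
qed

text \<open>If \<open>sigma\<close> vanishes, the correlation of \<open>1 / g\<close> with
  \<open>g\<close> is the constant \<open>- 1\<close>. Were the two degrees to add up to more than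
  \<open>p - 1\<close>, that correlation would be a polynomial of positive degree. So one degree is
  at most half of \<open>p - 1\<close>, and \<open>moebius_core\<close> applies to \<open>g\<close>
  or to its reciprocal.\<close>

lemma moebius_of_sigma:
 assumes "int p dvd sigma"
 shows "\<exists>c. unit c \<and> (\<forall>x. unit x \<longrightarrow> w x * x \<doteq> c)"
proof -
 have u: "unit (g 1)" "unit (inv_g 1)" using g_unit moebius_data.g_unit[OF dual] unit_one by auto
 obtain G where G: "degree G \<le> p - 1" "\<And>y. poly G y \<doteq> g y" "unit (lead_coeff G)"
  using mod_degree_exists[of p g 1, OF prime g_cong u(1)] by (auto simp only:)
 obtain H where H: "degree H \<le> p - 1" "\<And>y. poly H y \<doteq> inv_g y" "unit (lead_coeff H)"
  using mod_degree_exists[of p inv_g 1, OF prime inv_g_cong u(2)] by (auto simp only:)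
 have "degree H + degree G \<le> p - 1"
 proof (rule ccontr)
  assume gt: "\<not> ?thesis"
  define L where "L = degree H + degree G - (p - 1)"
  obtain R where R: "\<And>s. (\<Sum>y\<in>{0..<int p}. poly H y * poly G (y + s)) \<doteq> poly R s"
   "degree R \<le> L" "unit (Polynomial.coeff R L)"
   using correlation_degree[OF prime H(1,3) G(1,3)] gt unfolding L_def by (auto split: if_splits)
  let ?F = "R + [:1:]"
  have "int p dvd poly ?F s" for s
  proof -
   have "poly R s \<doteq> (\<Sum>y\<in>{0..<int p}. poly H y * poly G (y + s))" by (rule cong_sym[OF R(1)])
   also have "(\<Sum>y\<in>{0..<int p}. poly H y * poly G (y + s)) \<doteq> (\<Sum>y\<in>{0..<int p}. inv_g y * g (y + s))"
    by (intro cong_sum cong_mult G(2) H(2))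
   also have "(\<Sum>y\<in>{0..<int p}. inv_g y * g (y + s)) \<doteq> sigma * g (- s) - 1" by (rule correlation)
   also have "sigma * g (- s) - 1 \<doteq> 0 * g (- s) - 1" using assms by (intro cong_diff cong_mult cong_refl) (simp add: cong_0_iff)
   finally show ?thesis by (simp add: cong_iff_dvd_diff)
  qed
  moreover have "L < p" "0 < L" using gt G(1) H(1) unfolding L_def by linarith+
  moreover have "degree ?F \<le> L" by (intro degree_add_le R) simp
  ultimately have "[:int p:] dvd ?F" using poly_dvd_of_values[OF prime, of ?F] by simp
  then have "int p dvd Polynomial.coeff ?F L" by (rule dvd_coeff)
  then show False using R(3) \<open>0 < L\<close> by (simp add: coeff_eq_0)
 qed
 then consider "2 * degree G \<le> p - 1" | "2 * degree H \<le> p - 1" by linarith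
 then show ?thesis by cases (rule moebius_core[OF G(2,3)] moebius_data.moebius_core[OF dual H(2,3)]; assumption)+
qed

text \<open>Summing the hypothesis over all residues gives
  \<open>l^2 * sigma = sigma\<close>.\<close>

lemma moebius_scaling:
 assumes l: "\<And>y. unit y \<Longrightarrow> g (l * y) * l ^ 2 \<doteq> g y"
  and lu: "unit l" and ln: "\<not> l ^ 2 \<doteq> 1"
 shows "\<exists>c. unit c \<and> (\<forall>x. unit x \<longrightarrow> w x * x \<doteq> c)"
proof (rule moebius_of_sigma)
 have "(\<Sum>y\<in>{0..<int p}. g (l * y)) \<doteq> sigma"
  unfolding sigma_def
  by (rule sum_reindex_mod[where h = "\<lambda>y. l * y"]) (use odd g_cong cancel[OF lu] in auto)
 then have "l ^ 2 * (\<Sum>y\<in>{0..<int p}. g (l * y)) \<doteq> l ^ 2 * sigma" by (intro cong_mult cong_refl)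
 moreover have "l ^ 2 * (\<Sum>y\<in>{0..<int p}. g (l * y)) \<doteq> sigma"
  unfolding sigma_def sum_distrib_left
 proof (intro cong_sum)
  fix y show "l ^ 2 * g (l * y) \<doteq> g y"
  proof (cases "int p dvd y")
   case True
   then show ?thesis by (simp add: g_unit cong_iff_dvd_diff)
  next
   case False then show ?thesis using l[of y] by (simp add: mult.commute)
  qed
 qed
 ultimately have "l ^ 2 * sigma \<doteq> sigma" by (rule cong_trans[OF cong_sym])
 then have "int p dvd (l ^ 2 - 1) * sigma" by (simp add: cong_iff_dvd_diff algebra_simps)
 then show "int p dvd sigma"
  using ln prime_dvd_mult_iff[OF p_prime_int] by (simp add: cong_iff_dvd_diff)
qed

text \<open>Here \<open>g\<close> is its own reciprocal, so the correlation is an autocorrelation.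
  If \<open>sigma\<close> were a unit, the modified function \<open>E\<close> would have an
  autocorrelation of the form constant minus \<open>sigma * E\<close>. But a polynomial of degree
  strictly between 0 and \<open>p - 1\<close> has an autocorrelation of smaller degree.\<close>

lemma moebius_involutory:
 assumes sq: "\<And>y. unit y \<Longrightarrow> g y ^ 2 \<doteq> 1"
  and nc: "unit a" "unit b" "\<not> g a \<doteq> g b"
 shows "\<exists>c. unit c \<and> (\<forall>x. unit x \<longrightarrow> w x * x \<doteq> c)"
proof (rule moebius_of_sigma, rule ccontr)
 assume sg: "unit sigma"
 let ?I = "{0..<int p}"
 define \<delta> where "\<delta> y = (if int p dvd y then 1 else 0 :: int)" for y
 \<comment> \<open>The constant and the point mass at 0 are chosen such that \<open>E 0 = 0\<close>,
   the sum of \<open>E\<close> vanishes modulo \<open>p\<close>, and the terms in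
   \<open>g (- s)\<close> of the autocorrelation cancel.\<close>
 define E where "E y = g y + sigma - sigma * \<delta> y" for y
 have dc: "\<delta> x = \<delta> y" if "x \<doteq> y" for x y using cong_dvd_iff[OF that] by (simp add: \<delta>_def)
 have Ec: "E x \<doteq> E y" if "x \<doteq> y" for x y
  unfolding E_def dc[OF that] by (intro cong_add cong_diff cong_refl g_cong that)
 have ig: "inv_g y \<doteq> g y" for y
 proof (cases "int p dvd y")
  case True
  then show ?thesis by (simp add: g_unit odd inv_g_def prime_dvd_power_iff[OF p_prime_int] cong_iff_dvd_diff)
 next
  case False
  show ?thesis
   by (metis cong_trans[OF inv_g[OF False] cong_sym[OF sq[OF False]]] cancel[of "g y"] g_unit False power2_eq_square)
 qed
 have shift: "(\<Sum>y\<in>?I. f (y + s)) \<doteq> (\<Sum>y\<in>?I. f y)" if "\<And>x y. x \<doteq> y \<Longrightarrow> f x \<doteq> f y" for f s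
  by (rule sum_reindex_mod[where h = "\<lambda>y. y + s"]) (use odd that in \<open>auto simp: cong_add_rcancel\<close>)
 have pick: "(\<Sum>y\<in>?I. \<delta> y * f y) = f 0" for f
 proof -
  have "(\<Sum>y\<in>?I. \<delta> y * f y) = (\<Sum>y\<in>?I. if y = 0 then f 0 else 0)"
  proof (intro sum.cong refl)
   fix y assume "y \<in> ?I"
   then show "\<delta> y * f y = (if y = 0 then f 0 else 0)"
    using inj_mod_interval[of y "int p" 0] odd by (simp add: \<delta>_def)
  qed
  then show ?thesis using odd by simp
 qed
 have pick': "(\<Sum>y\<in>?I. \<delta> (y + s) * f y) \<doteq> f (- s)" if f: "\<And>x y. x \<doteq> y \<Longrightarrow> f x \<doteq> f y" for f s
 proof -
  have "(\<Sum>y\<in>?I. \<delta> (y + s) * f (y + s - s)) \<doteq> (\<Sum>y\<in>?I. \<delta> y * f (y - s))"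
  proof (rule shift[of "\<lambda>y. \<delta> y * f (y - s)"])
   fix x y assume "x \<doteq> y"
   then show "\<delta> x * f (x - s) \<doteq> \<delta> y * f (y - s)"
    using dc by (intro cong_mult f cong_diff cong_refl) auto
  qed
  then show ?thesis using pick[of "\<lambda>y. f (y - s)"] by simp
 qed
 have EE: "(\<Sum>y\<in>?I. E y * E (y + s)) \<doteq> sigma ^ 2 - 1 - sigma * E s" for s
 proof -
  have A: "(\<Sum>y\<in>?I. E y * E (y + s)) =
    (\<Sum>y\<in>?I. g y * g (y + s)) + sigma * (\<Sum>y\<in>?I. g y) - sigma * (\<Sum>y\<in>?I. \<delta> (y + s) * g y)
    + sigma * (\<Sum>y\<in>?I. g (y + s)) + sigma ^ 2 * int p - sigma ^ 2 * (\<Sum>y\<in>?I. \<delta> (y + s) * 1)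
    - sigma * (\<Sum>y\<in>?I. \<delta> y * g (y + s)) - sigma ^ 2 * (\<Sum>y\<in>?I. \<delta> y * 1) + sigma ^ 2 * (\<Sum>y\<in>?I. \<delta> y * \<delta> (y + s))" (is "_ = ?big")
   unfolding E_def by (simp add: algebra_simps power2_eq_square sum.distrib sum_subtractf sum_distrib_left)
  have B: "?big \<doteq> (sigma * g (- s) - 1) + sigma * sigma - sigma * g (- s)
    + sigma * sigma + sigma ^ 2 * 0 - sigma ^ 2 * 1 - sigma * g s - sigma ^ 2 * 1 + sigma ^ 2 * \<delta> s"
  proof (intro cong_add cong_diff cong_mult cong_refl)
   show "(\<Sum>y\<in>?I. g y * g (y + s)) \<doteq> sigma * g (- s) - 1"
    by (rule cong_trans[OF _ correlation]) (intro cong_sum cong_mult cong_sym[OF ig] cong_refl)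
   show "(\<Sum>y\<in>?I. g y) \<doteq> sigma" by (simp add: sigma_def)
   show "(\<Sum>y\<in>?I. \<delta> (y + s) * g y) \<doteq> g (- s)" by (rule pick'[OF g_cong])
   show "(\<Sum>y\<in>?I. g (y + s)) \<doteq> sigma" unfolding sigma_def by (rule shift[OF g_cong])
   show "int p \<doteq> 0" by (simp add: cong_0_iff)
   show "(\<Sum>y\<in>?I. \<delta> (y + s) * 1) \<doteq> 1" by (rule pick'[of "\<lambda>_. 1"]) simp
   show "(\<Sum>y\<in>?I. \<delta> y * g (y + s)) \<doteq> g s" using pick[of "\<lambda>y. g (y + s)"] by simp
   show "(\<Sum>y\<in>?I. \<delta> y * 1) \<doteq> 1" using pick[of "\<lambda>_. 1"] by simp
   show "(\<Sum>y\<in>?I. \<delta> y * \<delta> (y + s)) \<doteq> \<delta> s" using pick[of "\<lambda>y. \<delta> (y + s)"] by simp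
  qed
  have C: "(sigma * g (- s) - 1) + sigma * sigma - sigma * g (- s)
    + sigma * sigma + sigma ^ 2 * 0 - sigma ^ 2 * 1 - sigma * g s - sigma ^ 2 * 1 + sigma ^ 2 * \<delta> s
    = sigma ^ 2 - 1 - sigma * E s"
   unfolding E_def by (simp add: algebra_simps power2_eq_square)
  show ?thesis using B unfolding A C .
 qed
 have E0: "E 0 \<doteq> 0" using g_unit by (simp add: cong_0_iff E_def \<delta>_def)
 have "unit (E a) \<or> unit (E b)"
 proof (rule ccontr)
  assume "\<not> ?thesis"
  then have "g a + sigma \<doteq> 0" "g b + sigma \<doteq> 0" using nc by (auto simp: E_def \<delta>_def cong_0_iff)
  then show False by (metis nc cong_add_rcancel cong_trans[OF _ cong_sym])
 qed
 then obtain y0 where y0: "unit (E y0)" by blast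
 obtain F where F: "degree F \<le> p - 1" "\<And>y. poly F y \<doteq> E y" "unit (lead_coeff F)"
  using mod_degree_exists[of p E y0, OF prime Ec y0] by (auto simp only:)
 have "- Polynomial.coeff F (p - 1) \<doteq> (\<Sum>y\<in>?I. poly F y)" by (rule cong_sym[OF poly_sum_cong[OF prime F(1)]])
 also have "(\<Sum>y\<in>?I. poly F y) \<doteq> (\<Sum>y\<in>?I. E y)" by (intro cong_sum F(2))
 also have "(\<Sum>y\<in>?I. E y) = sigma + sigma * int p - sigma * (\<Sum>y\<in>?I. \<delta> y * 1)"
 proof -
  have "(\<Sum>y\<in>?I. E y) = (\<Sum>y\<in>?I. g y) + (\<Sum>y\<in>?I. sigma) - (\<Sum>y\<in>?I. sigma * \<delta> y)"
   unfolding E_def by (simp only: sum.distrib sum_subtractf)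
  moreover have "(\<Sum>y\<in>?I. sigma) = sigma * int p" by simp
  ultimately show ?thesis by (simp add: sum_distrib_left sigma_def)
 qed
 also have "\<dots> = sigma * int p" using pick[of "\<lambda>_. 1"] by simp
 finally have "- Polynomial.coeff F (p - 1) \<doteq> sigma * int p" .
 from cong_dvd_iff[OF this] have "degree F \<noteq> p - 1" using F(3) by auto
 then have e1: "degree F < p - 1" using F(1) by simp
 have e0: "degree F \<noteq> 0"
 proof
  assume "degree F = 0"
  then obtain c where c: "F = [:c:]" by (rule degree_eq_zeroE)
  then have "E 0 \<doteq> E y0" using F(2)[of 0] F(2)[of y0] cong_trans[OF cong_sym] by fastforce
  then show False by (metis y0 cong_trans[OF cong_sym E0] cong_0_iff)
 qed
 define L where "L = degree F + degree F - (p - 1)"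
 obtain R where R: "\<And>s. (\<Sum>y\<in>?I. poly F y * poly F (y + s)) \<doteq> poly R s" "degree R \<le> L"
 proof -
  assume a: "\<And>R. (\<And>s. (\<Sum>y\<in>?I. poly F y * poly F (y + s)) \<doteq> poly R s) \<Longrightarrow> degree R \<le> L \<Longrightarrow> thesis"
  obtain R where R: "\<forall>s. (\<Sum>y\<in>?I. poly F y * poly F (y + s)) \<doteq> poly R s"
   "if degree F + degree F < p - 1 then R = 0 else degree R \<le> L \<and> unit (Polynomial.coeff R L)"
   using correlation_degree[OF prime F(1,3) F(1,3)] unfolding L_def by blast
  have "degree R \<le> L" using R(2) by (auto split: if_splits)
  then show thesis using a R(1) by blast
 qed
 have L: "L < degree F" unfolding L_def using e1 e0 by simp
 let ?H = "R - ([:sigma ^ 2 - 1:] - Polynomial.smult sigma F)"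
 have "int p dvd poly ?H s" for s
 proof -
  have "poly R s \<doteq> (\<Sum>y\<in>?I. poly F y * poly F (y + s))" by (rule cong_sym[OF R(1)])
  also have "(\<Sum>y\<in>?I. poly F y * poly F (y + s)) \<doteq> (\<Sum>y\<in>?I. E y * E (y + s))" by (intro cong_sum cong_mult F(2))
  also have "(\<Sum>y\<in>?I. E y * E (y + s)) \<doteq> sigma ^ 2 - 1 - sigma * E s" by (rule EE)
  also have "sigma ^ 2 - 1 - sigma * E s \<doteq> sigma ^ 2 - 1 - sigma * poly F s" by (intro cong_diff cong_mult cong_refl cong_sym[OF F(2)])
  finally show ?thesis by (simp add: cong_iff_dvd_diff)
 qed
 moreover have "degree ?H \<le> degree F"
  using R(2) L by (intro degree_diff_le order.trans[OF degree_smult_le]) auto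
 then have "degree ?H < p" using e1 by simp
 ultimately have "[:int p:] dvd ?H" using poly_dvd_of_values[OF prime, of ?H] by blast
 then have "int p dvd Polynomial.coeff ?H (degree F)" by (rule dvd_coeff)
 then show False using R(2) L sg F(3) prime_dvd_mult_iff[OF p_prime_int] by (simp add: coeff_eq_0)
qed

end

section \<open>Elements of prime power order\<close>

lemma (in group) pow_cong:
 assumes "x \<in> carrier G" "x [^] (n::nat) = \<one>" "[a = b] (mod n)"
 shows "x [^] (a::nat) = x [^] (b::nat)"
proof -
 have *: "x [^] (c + k * n) = x [^] c" for c k :: nat
 proof -
  have "x [^] (n * k) = \<one>" using assms by (simp add: nat_pow_pow[symmetric])
  then show ?thesis using assms(1) by (simp add: nat_pow_mult[symmetric] mult.commute)
 qed
 have "x [^] c = x [^] (c mod n)" for c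
  using *[of "c mod n" "c div n"] by simp
 then show ?thesis using assms(3) unfolding cong_def by metis
qed

definition (in group) cj :: "'a \<Rightarrow> 'a \<Rightarrow> 'a" where "cj g x = g \<otimes> x \<otimes> inv g"

context group begin

lemma cj_closed [simp, intro]: "g \<in> \<G> \<Longrightarrow> x \<in> \<G> \<Longrightarrow> cj g x \<in> \<G>"
 by (simp add: cj_def)

lemma cj_one [simp]: "g \<in> \<G> \<Longrightarrow> cj g \<one> = \<one>"
 by (simp add: cj_def)

lemma cj_by_one [simp]: "x \<in> \<G> \<Longrightarrow> cj \<one> x = x"
 by (simp add: cj_def)

lemma cj_mult: "g \<in> \<G> \<Longrightarrow> x \<in> \<G> \<Longrightarrow> y \<in> \<G> \<Longrightarrow> cj g (x \<otimes> y) = cj g x \<otimes> cj g y"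
 by (simp add: cj_def m_assoc inv_solve_left)

lemma cj_cj: "g \<in> \<G> \<Longrightarrow> h \<in> \<G> \<Longrightarrow> x \<in> \<G> \<Longrightarrow> cj g (cj h x) = cj (g \<otimes> h) x"
 by (simp add: cj_def m_assoc inv_mult_group)

lemma cj_inv_cj [simp]: "g \<in> \<G> \<Longrightarrow> x \<in> \<G> \<Longrightarrow> cj (inv g) (cj g x) = x"
 by (simp add: cj_cj)

lemma cj_cj_inv [simp]: "g \<in> \<G> \<Longrightarrow> x \<in> \<G> \<Longrightarrow> cj g (cj (inv g) x) = x"
 by (simp add: cj_cj)

lemma cj_inv: "g \<in> \<G> \<Longrightarrow> x \<in> \<G> \<Longrightarrow> cj g (inv x) = inv (cj g x)"
 by (rule inv_equality[symmetric]) (simp_all add: cj_mult[symmetric])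

lemma cj_pow: "g \<in> \<G> \<Longrightarrow> x \<in> \<G> \<Longrightarrow> cj g (x [^] (n::nat)) = cj g x [^] n"
 by (induction n) (simp_all add: cj_mult)

lemma cj_eq_iff: "g \<in> \<G> \<Longrightarrow> x \<in> \<G> \<Longrightarrow> y \<in> \<G> \<Longrightarrow> cj g x = cj g y \<longleftrightarrow> x = y"
 by (metis cj_inv_cj)

lemma cj_inj_on: "g \<in> \<G> \<Longrightarrow> X \<subseteq> \<G> \<Longrightarrow> inj_on (cj g) X"
 by (intro inj_onI) (metis cj_eq_iff subsetD)

lemma cj_self: "x \<in> \<G> \<Longrightarrow> y \<in> \<G> \<Longrightarrow> cj x y = y \<longleftrightarrow> x \<otimes> y = y \<otimes> x"
 by (metis cj_def inv_solve_right m_closed)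

lemma cj_comm: "g \<in> \<G> \<Longrightarrow> x \<in> \<G> \<Longrightarrow> y \<in> \<G> \<Longrightarrow>
  cj g x \<otimes> cj g y = cj g y \<otimes> cj g x \<longleftrightarrow> x \<otimes> y = y \<otimes> x"
 by (simp add: cj_mult[symmetric] cj_eq_iff)

lemma cj_image_cj: "g \<in> \<G> \<Longrightarrow> h \<in> \<G> \<Longrightarrow> X \<subseteq> \<G> \<Longrightarrow> cj g ` (cj h ` X) = cj (g \<otimes> h) ` X"
 unfolding image_image by (intro image_cong refl) (auto simp: cj_cj)

lemma cj_image_one [simp]: "X \<subseteq> \<G> \<Longrightarrow> cj \<one> ` X = X"
 by force

lemma cj_image_subgroup:
 assumes "g \<in> \<G>" "subgroup S G" shows "subgroup (cj g ` S) G"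
proof -
 have S: "S \<subseteq> \<G>" using assms subgroup.subset by blast
 show ?thesis
 proof (rule subgroupI)
  show "cj g ` S \<subseteq> \<G>" using S assms by auto
  show "cj g ` S \<noteq> {}" using subgroup.one_closed[OF assms(2)] by auto
  fix a b assume "a \<in> cj g ` S" "b \<in> cj g ` S"
  then obtain s t where st: "s \<in> S" "t \<in> S" "a = cj g s" "b = cj g t" by auto
  have "inv a = cj g (inv s)" "a \<otimes> b = cj g (s \<otimes> t)"
   using st S assms by (auto simp: cj_inv cj_mult subsetD)
  then show "inv a \<in> cj g ` S" "a \<otimes> b \<in> cj g ` S"
   using st subgroup.m_inv_closed[OF assms(2)] subgroup.m_closed[OF assms(2)] by auto
 qed
qed

lemma comm_inv: "x \<in> \<G> \<Longrightarrow> y \<in> \<G> \<Longrightarrow> x \<otimes> y = y \<otimes> x \<Longrightarrow> x \<otimes> inv y = inv y \<otimes> x"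
 by (metis inv_closed inv_solve_left inv_solve_right m_assoc m_closed)

lemma comm_mult: "x \<in> \<G> \<Longrightarrow> y \<in> \<G> \<Longrightarrow> z \<in> \<G> \<Longrightarrow>
  x \<otimes> y = y \<otimes> x \<Longrightarrow> x \<otimes> z = z \<otimes> x \<Longrightarrow> x \<otimes> (y \<otimes> z) = (y \<otimes> z) \<otimes> x"
 by (metis m_assoc)

lemma comm_pow: "x \<in> \<G> \<Longrightarrow> y \<in> \<G> \<Longrightarrow> x \<otimes> y = y \<otimes> x \<Longrightarrow> x \<otimes> (y [^] (n::nat)) = (y [^] n) \<otimes> x"
 by (induction n) (auto intro: comm_mult)

lemma centralizer_subgroup:
 assumes "subgroup H G" "x \<in> \<G>"
 shows "subgroup {y \<in> H. x \<otimes> y = y \<otimes> x} G"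
proof (rule subgroupI)
 have S: "H \<subseteq> \<G>" using assms subgroup.subset by blast
 show "{y \<in> H. x \<otimes> y = y \<otimes> x} \<subseteq> \<G>" using S by auto
 show "{y \<in> H. x \<otimes> y = y \<otimes> x} \<noteq> {}" using subgroup.one_closed[OF assms(1)] assms by auto
 fix a b assume ab: "a \<in> {y \<in> H. x \<otimes> y = y \<otimes> x}" "b \<in> {y \<in> H. x \<otimes> y = y \<otimes> x}"
 then show "inv a \<in> {y \<in> H. x \<otimes> y = y \<otimes> x}"
  using S assms comm_inv[of x a] by (auto simp: subgroup.m_inv_closed)
 show "a \<otimes> b \<in> {y \<in> H. x \<otimes> y = y \<otimes> x}"
  using ab S assms comm_mult[of x a b] by (auto simp: subgroup.m_closed)
qed

end

locale fin_group_prime = group G + prime_nat p for G (structure) and p +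
 assumes fin: "finite \<G>"
begin

abbreviation P where "P \<equiv> p_elements G p"

lemma P_iff: "x \<in> P \<longleftrightarrow> x \<in> \<G> \<and> (\<exists>m. x [^] (p ^ m) = \<one>)"
 using pow_eq_id divides_primepow_nat[OF prime] unfolding p_elements_def by blast

lemma P_carrier: "x \<in> P \<Longrightarrow> x \<in> \<G>" and P_subset: "P \<subseteq> \<G>"
 using P_iff by auto

lemma P_fin: "finite P" using P_subset fin finite_subset by blast

lemma p_ge_2: "p \<ge> 2" using prime prime_ge_2_nat by blast
lemma p_gt_0: "p > 0" using p_ge_2 by simp

lemma P_one [simp]: "\<one> \<in> P" by (auto simp: P_iff)

lemma P_pow: "x \<in> P \<Longrightarrow> x [^] (n::nat) \<in> P"
 by (auto simp: P_iff) (metis mult.commute nat_pow_one nat_pow_pow)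

lemma P_of_pow: assumes "x \<in> \<G>" "x [^] (p ^ k) \<in> P" shows "x \<in> P"
 by (metis assms P_iff nat_pow_pow power_add)

lemma P_inv: "x \<in> P \<Longrightarrow> inv x \<in> P"
 by (auto simp: P_iff nat_pow_inv)

lemma P_cj: "g \<in> \<G> \<Longrightarrow> x \<in> P \<Longrightarrow> cj g x \<in> P"
 unfolding P_iff by (metis cj_closed cj_one cj_pow)

lemma P_mult: assumes "x \<in> P" "y \<in> P" "x \<otimes> y = y \<otimes> x" shows "x \<otimes> y \<in> P"
proof -
 obtain k m where km: "x [^] (p ^ k) = \<one>" "y [^] (p ^ m) = \<one>" using assms P_iff by blast
 have c: "x \<in> \<G>" "y \<in> \<G>" using assms P_iff by auto
 have "(x \<otimes> y) [^] (p ^ (k + m)) = \<one>"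
  using km c pow_mult_distrib[OF assms(3) c] by (simp_all add: power_add nat_pow_pow[symmetric]) (metis mult.commute nat_pow_one nat_pow_pow)
 then show ?thesis using c P_iff by blast
qed

text \<open>\<open>d\<close> is invertible modulo the order of \<open>x\<close>. So \<open>x\<close>
  and \<open>x [^] d\<close> generate the same subgroup; differences of exponents below
  \<open>p\<close> can therefore be removed wherever two powers are compared.\<close>

lemma P_root: assumes "x \<in> P" "\<not> p dvd d" shows "\<exists>e. (x [^] (d::nat)) [^] (e::nat) = x"
proof -
 obtain m where m: "x [^] (p ^ m) = \<one>" "x \<in> \<G>" using assms P_iff by blast
 have "coprime d (p ^ m)" using assms prime by (metis coprime_commute coprime_power_right_iff prime_imp_coprime)
 then obtain e where "[d * e = 1] (mod p ^ m)" using cong_solve_coprime_nat[of d "p ^ m"] by auto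
 then have "x [^] (d * e) = x [^] (1::nat)" using pow_cong m by blast
 then show ?thesis using m by (auto simp: nat_pow_pow)
qed

lemma comm_of_pow:
 assumes "x \<in> P" "w \<in> \<G>" "\<not> p dvd d" "w \<otimes> (x [^] (d::nat)) = (x [^] d) \<otimes> w"
 shows "w \<otimes> x = x \<otimes> w"
proof -
 obtain e where "(x [^] d) [^] (e::nat) = x" using P_root assms by blast
 then show ?thesis using comm_pow[OF assms(2) _ assms(4), of e] assms(1) P_carrier by auto
qed

lemma P_eq_one: assumes "x \<in> P" "x [^] (d::nat) = \<one>" "\<not> p dvd d" shows "x = \<one>"
 using P_root[OF assms(1,3)] assms(2) by auto

text \<open>Right multiplication by powers of \<open>x\<close> splits \<open>S\<close> into orbits, each of which meets the
 centralizer of \<open>w\<close> in at most a \<open>p\<close>-th part.\<close>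

lemma centralizing_part_bound:
 assumes x: "x \<in> P" and w: "w \<in> \<G>" and nc: "w \<otimes> x \<noteq> x \<otimes> w"
  and S: "S \<subseteq> \<G>" and cl: "\<And>y. y \<in> S \<Longrightarrow> y \<otimes> x \<in> S"
 shows "p * card {y \<in> S. w \<otimes> y = y \<otimes> w} \<le> card S"
proof -
 let ?C = "{y \<in> S. w \<otimes> y = y \<otimes> w}"
 let ?f = "\<lambda>(y, i). y \<otimes> x [^] (i::nat)"
 have xc: "x \<in> \<G>" using x P_carrier by simp
 have cl': "y \<otimes> x [^] i \<in> S" if "y \<in> S" for y and i :: nat
 proof (induction i)
  case 0 then show ?case using that S by auto
 next
  case (Suc i)
  show ?case using that S xc cl[OF Suc] m_assoc by fastforce
 qed
 have *: False if "y \<in> ?C" "y' \<in> ?C" "i < j" "j < p" "y \<otimes> x [^] i = y' \<otimes> x [^] j" for y y' and i j :: nat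
 proof -
  have yc: "y \<in> \<G>" "y' \<in> \<G>" using that S by auto
  have "y \<otimes> x [^] i = (y' \<otimes> x [^] (j - i)) \<otimes> x [^] i"
   using that xc yc nat_pow_mult m_assoc by fastforce
  then have "x [^] (j - i) = inv y' \<otimes> y" using yc xc by (simp add: inv_solve_left)
  moreover have "w \<otimes> (inv y' \<otimes> y) = (inv y' \<otimes> y) \<otimes> w"
   using that yc w by (intro comm_mult comm_inv) auto
  moreover have "\<not> p dvd j - i" using that by (auto dest: dvd_imp_le)
  ultimately show False using comm_of_pow[OF x w, of "j - i"] nc by simp
 qed
 have "inj_on ?f (?C \<times> {..<p})"
 proof (rule inj_onI, clarify)
  fix y y' i j assume a: "y \<in> S" "w \<otimes> y = y \<otimes> w" "y' \<in> S" "w \<otimes> y' = y' \<otimes> w" "i < p" "j < p"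
   "y \<otimes> x [^] i = y' \<otimes> x [^] j"
  have "i = j" using *[of y y' i j] *[of y' y j i] a by (metis (mono_tags, lifting) linorder_neqE_nat mem_Collect_eq)
  moreover from this have "y = y'" using a S xc by (simp add: subset_eq)
  ultimately show "y = y' \<and> i = j" by simp
 qed
 moreover have "?f ` (?C \<times> {..<p}) \<subseteq> S" using cl' by auto
 ultimately have "card (?C \<times> {..<p}) \<le> card S" using S fin finite_subset by (meson card_inj_on_le)
 then show ?thesis by (simp add: card_cartesian_product mult.commute)
qed

lemma subgroup_card_dvd:
 assumes "subgroup K G" "subgroup H G" "K \<subseteq> H" shows "card K dvd card H"
proof -
 interpret H: group "G\<lparr>carrier := H\<rparr>" using assms subgroup_imp_group by blast
 have "subgroup K (G\<lparr>carrier := H\<rparr>)" using assms subgroup_incl by blast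
 from H.lagrange[OF this] show ?thesis by (simp add: order_def) (metis dvd_triv_right)
qed

lemma subgroup_finite: "subgroup H G \<Longrightarrow> finite H"
 using subgroup.subset fin finite_subset by metis

lemma subgroup_card_pos: "subgroup H G \<Longrightarrow> card H > 0"
 using subgroup_finite subgroup.one_closed by (metis card_gt_0_iff empty_iff)

lemma subgroup_pow_card: assumes "subgroup K G" "x \<in> K" shows "x [^] card K = \<one>"
proof -
 interpret K: group "G\<lparr>carrier := K\<rparr>" using assms subgroup_imp_group by blast
 show ?thesis using K.pow_order_eq_1[of x] assms nat_pow_consistent[of x "card K" K] by (simp add: order_def)
qed

text \<open>A prime \<open>q\<close> other than \<open>p\<close> dividing the order would give a
  subgroup of order \<open>q\<close>, whose elements are killed both by \<open>q\<close> and by a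
  power of \<open>p\<close>.\<close>

lemma p_subgroup_card: assumes K: "subgroup K G" "K \<subseteq> P" shows "\<exists>a. card K = p ^ a"
proof (rule ccontr)
 assume n: "\<not> ?thesis"
 obtain q where q: "prime q" "q dvd card K" "q \<noteq> p"
  by (metis subgroup_card_pos[OF K(1)] dvd_mult_div_cancel multiplicity_dvd multiplicity_decompose less_not_refl2 not_prime_unit n mult.right_neutral prime_factor_nat dvd_mult)
 interpret K: group "G\<lparr>carrier := K\<rparr>" using K subgroup_imp_group by blast
 obtain m where m: "card K = q ^ 1 * m" using q by auto
 have "\<exists>L. subgroup L (G\<lparr>carrier := K\<rparr>) \<and> card L = q ^ 1"
  by (rule sylow_thm[OF q(1) K.is_group]) (use m subgroup_finite[OF K(1)] in \<open>auto simp: order_def\<close>)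
 then obtain L where L: "subgroup L (G\<lparr>carrier := K\<rparr>)" "card L = q" by auto
 have LG: "subgroup L G" using L(1) K(1) incl_subgroup by blast
 have LK: "L \<subseteq> K" using L(1) subgroup.subset by fastforce
 have "L = {\<one>}"
 proof -
  have "x = \<one>" if "x \<in> L" for x
   by (rule P_eq_one) (use that LK K subgroup_pow_card[OF LG that] L q prime primes_dvd_imp_eq in auto)
  then show ?thesis using subgroup.one_closed[OF LG] by blast
 qed
 then show False using L(2) q(1) by (simp add: prime_nat_iff)
qed

lemma p_subgroup_proper:
 assumes "subgroup K G" "K \<subseteq> P" "subgroup C G" "C \<subseteq> K" "C \<noteq> K"
 shows "p * card C \<le> card K"
proof -
 obtain a where a: "card K = p ^ a" using p_subgroup_card assms by blast
 obtain b where b: "card C = p ^ b" using p_subgroup_card assms by (metis order.trans)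
 have "card C < card K" using assms subgroup_finite by (metis psubset_card_mono psubsetI)
 then have "p ^ Suc b \<le> p ^ a" using a b p_ge_2 by (intro power_increasing) auto
 then show ?thesis using a b by simp
qed

lemma p_power_less: "p ^ b < p ^ a \<Longrightarrow> p * p ^ b \<le> p ^ a"
 using p_ge_2 power_increasing[of "Suc b" a p] by simp

end

section \<open>Fixed points of maps of prime power period\<close>

lemma funpow_fixed_mult: "(f ^^ n) x = x \<Longrightarrow> (f ^^ (k * n)) x = x"
 by (induction k) (simp_all add: funpow_add)

lemma funpow_closed: "f ` X \<subseteq> X \<Longrightarrow> x \<in> X \<Longrightarrow> (f ^^ n) x \<in> X"
 by (induction n) auto

text \<open>Orbits of non-fixed points have exactly \<open>p\<close> elements and are removed one at
  a time. The formulation with iterates of one map covers both cosets under a single element and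
  other permutations without setting up an action.\<close>

lemma card_fixed_points_prime:
 fixes p :: nat
 assumes p: "prime p" and "finite X" "f ` X \<subseteq> X" "\<And>x. x \<in> X \<Longrightarrow> (f ^^ p) x = x"
 shows "[card X = card {x \<in> X. f x = x}] (mod p)"
 using assms(2-)
proof (induction "card X" arbitrary: X rule: less_induct)
 case (less X)
 show ?case
 proof (cases "\<exists>x\<in>X. f x \<noteq> x")
  case False
  then have "{x \<in> X. f x = x} = X" by auto
  then show ?thesis by simp
 next
  case True
  then obtain x where x: "x \<in> X" "f x \<noteq> x" by blast
  define O' where "O' = (\<lambda>i. (f ^^ i) x) ` {..<p}"
  have px: "(f ^^ p) x = x" and p0: "p > 0" using less x p prime_gt_0_nat by auto
  \<comment> \<open>A period \<open>d\<close> prime to \<open>p\<close> combines with the period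
    \<open>p\<close> to the period 1, since some multiple of \<open>d\<close> is 1 modulo
    \<open>p\<close>.\<close>
  have ne: "(f ^^ d) x \<noteq> x" if "0 < d" "d < p" for d
  proof
   assume d: "(f ^^ d) x = x"
   have "coprime d p" using that p by (metis coprime_commute dvd_imp_le not_le prime_imp_coprime)
   then obtain e where "[d * e = 1] (mod p)" using cong_solve_coprime_nat[of d p] by auto
   then have de: "e * d = 1 + (d * e div p) * p"
    using prime_ge_2_nat[OF p] mod_mult_div_eq[of "d * e" p] by (simp add: cong_def mult.commute)
   have "x = (f ^^ (e * d)) x" using funpow_fixed_mult[OF d] by simp
   also have "\<dots> = f x" using funpow_fixed_mult[OF px] by (simp add: de)
   finally show False using x by simp
  qed
  have inv: "f y = f z \<Longrightarrow> y = z" if "y \<in> X" "z \<in> X" for y z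
  proof -
   assume "f y = f z"
   then have "(f ^^ Suc (p - 1)) y = (f ^^ Suc (p - 1)) z" by (metis funpow_Suc_right comp_apply)
   then show "y = z" using p0 less(4) that by simp
  qed
  have inj: "inj_on (\<lambda>i. (f ^^ i) x) {..<p}"
  proof -
   have "i = j" if "i \<le> j" "j < p" "(f ^^ i) x = (f ^^ j) x" for i j
   proof (rule ccontr)
    assume "i \<noteq> j"
    have "(f ^^ p) x = (f ^^ (p - i + j)) x"
     using that funpow_add[of "p - i" i f] funpow_add[of "p - i" j f] by simp
    also have "p - i + j = (j - i) + p" using that by simp
    also have "(f ^^ (j - i + p)) x = (f ^^ (j - i)) x" using px by (simp add: funpow_add)
    finally have "(f ^^ (j - i)) x = x" using px by simp
    then show False using that \<open>i \<noteq> j\<close> ne by simp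
   qed
   note le = this
   show ?thesis
   proof (rule inj_onI)
    fix i j assume "i \<in> {..<p}" "j \<in> {..<p}" "(f ^^ i) x = (f ^^ j) x"
    then show "i = j" using le[of i j] le[of j i] by (cases "i \<le> j") auto
   qed
  qed
  then have cO: "card O' = p" unfolding O'_def by (simp add: card_image)
  have OX: "O' \<subseteq> X" unfolding O'_def using funpow_closed[OF less(3) x(1)] by auto
  have fO: "f y \<in> O'" if y: "y \<in> O'" for y
  proof -
   obtain i where i: "i < p" "y = (f ^^ i) x" using y O'_def by auto
   show ?thesis
   proof (cases "Suc i < p")
    case True
    then show ?thesis unfolding O'_def i by (intro image_eqI[of _ _ "Suc i"]) auto
   next
    case False
    then have "Suc i = p" using i by simp
    then show ?thesis using px i by (auto simp: image_eqI[of _ _ 0] O'_def)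
   qed
  qed
  have fO': "f y \<in> X - O'" if y: "y \<in> X - O'" for y
  proof -
   have "f y \<notin> O'"
   proof
    assume "f y \<in> O'"
    have "(f ^^ n) (f y) \<in> O'" for n by (induction n) (use \<open>f y \<in> O'\<close> fO in auto)
    from this[of "p - 1"] have "(f ^^ Suc (p - 1)) y \<in> O'" by (simp only: funpow_Suc_right comp_apply)
    then show False using p0 less(4) y by auto
   qed
   then show ?thesis using less(3) y by auto
  qed
  have nofix: "f y \<noteq> y" if y: "y \<in> O'" for y
  proof
   assume fy: "f y = y"
   obtain i where i: "i < p" "y = (f ^^ i) x" using y O'_def by auto
   have "(f ^^ n) y = y" for n by (induction n) (use fy in auto)
   then show False using i px funpow_add[of "p - i" i f] fy x by simp
  qed
  have "[card (X - O') = card {y \<in> X - O'. f y = y}] (mod p)"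
  proof (rule less(1))
   show "card (X - O') < card X" using p0 less(2) x(1) unfolding O'_def by (intro psubset_card_mono) auto
  qed (use less fO' in auto)
  moreover have "{y \<in> X - O'. f y = y} = {y \<in> X. f y = y}" using nofix by auto
  moreover have "card X = card (X - O') + p"
   using cO card_Diff_subset[of O' X] card_mono[OF less(2) OX] OX less(2) finite_subset by fastforce
  ultimately show ?thesis by (simp add: cong_def)
 qed
qed

lemma card_fixed_points_prime_power:
 fixes p :: nat
 assumes p: "prime p" and "finite X" "f ` X \<subseteq> X" "\<And>x. x \<in> X \<Longrightarrow> (f ^^ (p ^ n)) x = x"
 shows "[card X = card {x \<in> X. f x = x}] (mod p)"
 using assms(2-)
proof (induction n arbitrary: X)
 case 0
 then have "{x \<in> X. f x = x} = X" by auto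
 then show ?case by simp
next
 case (Suc n)
 let ?h = "f ^^ (p ^ n)"
 let ?F = "{x \<in> X. ?h x = x}"
 have "[card X = card ?F] (mod p)"
 proof (rule card_fixed_points_prime[OF p Suc(2)])
  show "?h ` X \<subseteq> X" using funpow_closed[OF Suc(3)] by auto
  show "(?h ^^ p) x = x" if "x \<in> X" for x using Suc(4)[OF that] by (simp add: funpow_mult mult.commute)
 qed
 also have "[card ?F = card {x \<in> ?F. f x = x}] (mod p)"
 proof (rule Suc(1))
  show "f ` ?F \<subseteq> ?F"
  proof (clarify)
   fix x assume x: "x \<in> X" "?h x = x"
   have "?h (f x) = f (?h x)" by (metis funpow_swap1)
   then show "f x \<in> X \<and> ?h (f x) = f x" using x Suc(3) by auto
  qed
 qed (use Suc in auto)
 also have "{x \<in> ?F. f x = x} = {x \<in> X. f x = x}"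
 proof -
  have "?h x = x" if "f x = x" for x
  proof -
   have "(f ^^ k) x = x" for k by (induction k) (use that in auto)
   then show ?thesis by simp
  qed
  then show ?thesis by auto
 qed
 finally show ?case .
qed

section \<open>Counting commuting pairs\<close>

lemma double_count_commuting:
 assumes "finite E" and sym: "\<And>x y. c x y \<longleftrightarrow> c y x"
 shows "(\<Sum>x\<in>E. (\<Sum>w\<in>E. card {y\<in>E. c x y \<and> c w y})) = (\<Sum>y\<in>E. (card {x\<in>E. c y x})\<^sup>2)"
proof -
 have card_if: "card {y\<in>E. Q y} = (\<Sum>y\<in>E. if Q y then 1 else 0)" for Q
  using \<open>finite E\<close> by (simp only: card_eq_sum sum.inter_filter)
 have "(\<Sum>x\<in>E. \<Sum>w\<in>E. card {y\<in>E. c x y \<and> c w y}) = (\<Sum>x\<in>E. \<Sum>w\<in>E. \<Sum>y\<in>E. (if c x y \<and> c w y then 1 else 0))"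
  by (simp only: card_if)
 also have "\<dots> = (\<Sum>x\<in>E. \<Sum>y\<in>E. \<Sum>w\<in>E. (if c x y \<and> c w y then 1 else 0))"
  by (intro sum.cong refl sum.swap)
 also have "\<dots> = (\<Sum>y\<in>E. \<Sum>x\<in>E. \<Sum>w\<in>E. (if c x y \<and> c w y then 1 else 0))"
  by (rule sum.swap)
 also have "\<dots> = (\<Sum>y\<in>E. (card {x\<in>E. c y x})\<^sup>2)"
 proof (intro sum.cong refl)
  fix y assume "y \<in> E"
  have cw: "c w y = c y w" for w by (rule sym)
  have inner: "(\<Sum>w\<in>E. (if c x y \<and> c w y then 1 else 0)) = (if c x y then card {w\<in>E. c y w} else 0)" for x
   by (cases "c x y") (simp_all add: card_if cw)
  then show "(\<Sum>x\<in>E. \<Sum>w\<in>E. (if c x y \<and> c w y then 1 else 0)) = (card {x\<in>E. c y x})\<^sup>2"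
  proof -
   have "(\<Sum>x\<in>E. \<Sum>w\<in>E. (if c x y \<and> c w y then 1 else 0)) = (\<Sum>x\<in>E. if c y x then card {w\<in>E. c y w} else 0)"
    unfolding inner by (intro sum.cong refl) (simp add: cw)
   also have "\<dots> = (\<Sum>x\<in>{x\<in>E. c y x}. card {w\<in>E. c y w})" by (simp only: sum.inter_filter[OF \<open>finite E\<close>])
   finally show ?thesis by (simp add: power2_eq_square)
  qed
 qed
 finally show ?thesis .
qed

text \<open>The first quadratic increases up to \<open>A = n\<close>, so
  \<open>A = n / (2 * p - 1)\<close> is the worst case; the remaining inequality is
  \<open>(p - 1)^2 * (3 * p - 1) >= 0\<close>. The second is definiteness of a quadratic form in
  \<open>A\<close> and \<open>n\<close>: after completing the square it becomes
  \<open>b * f > 1\<close>, that is \<open>(p - 1)^2 * (p^2 - 1) > 0\<close>.\<close>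

lemma centralizer_poly_bounds:
 fixes p n A :: real
 assumes p: "p \<ge> 2" and n: "n > 0"
 defines "f \<equiv> (p\<^sup>2 + p - 1) / p ^ 3"
 shows "0 \<le> A \<Longrightarrow> (2 * p - 1) * A \<le> n \<Longrightarrow> 2 * n * A - A\<^sup>2 \<le> f * n\<^sup>2"
  and "2 * n * A - (1 + p - p * f) * A\<^sup>2 < f * n\<^sup>2"
proof -
 assume A: "0 \<le> A" "(2 * p - 1) * A \<le> n"
 define t where "t = 1 / (2 * p - 1)"
 have t: "0 < t" "t < 1" and At: "A \<le> t * n" using p A by (auto simp: t_def field_simps)
 have "2 * n * A - A\<^sup>2 = n\<^sup>2 - (n - A)\<^sup>2" by (simp add: power2_eq_square algebra_simps)
 also have "(n - t * n)\<^sup>2 \<le> (n - A)\<^sup>2" using At t n by (intro power_mono) simp_all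
 then have "n\<^sup>2 - (n - A)\<^sup>2 \<le> n\<^sup>2 - (n - t * n)\<^sup>2" by simp
 also have "n\<^sup>2 - (n - t * n)\<^sup>2 = (2 * t - t\<^sup>2) * n\<^sup>2" by (simp add: power2_eq_square algebra_simps)
 also have "2 * t - t\<^sup>2 \<le> f"
 proof -
  define d where "d = 2 * p - 1"
  have "d > 0" using p by (simp add: d_def)
  then have "2 * (1 / d) - (1 / d)\<^sup>2 = (2 * d - 1) / d\<^sup>2" by (simp add: field_simps power2_eq_square)
  then have "2 * t - t\<^sup>2 = (4 * p - 3) / (2 * p - 1)\<^sup>2" by (simp add: d_def t_def)
  also have "\<dots> \<le> f"
  proof -
   have "0 \<le> (p - 1)\<^sup>2 * (3 * p - 1)" using p by simp
   then have "(4 * p - 3) * p ^ 3 \<le> (p\<^sup>2 + p - 1) * (2 * p - 1)\<^sup>2"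
    by (simp add: power2_eq_square power3_eq_cube algebra_simps)
   then show ?thesis unfolding f_def using p by (simp add: divide_simps)
  qed
  finally show ?thesis .
 qed
 finally show "2 * n * A - A\<^sup>2 \<le> f * n\<^sup>2" by (simp add: mult_right_mono)
next
 define b where "b = 1 + p - p * f"
 have "p\<^sup>2 + p - 1 > 0" using zero_le_power2[of p] p by linarith
 then have f0: "f > 0" unfolding f_def using p by (intro divide_pos_pos) auto
 have "b = (p ^ 3 - p + 1) / p\<^sup>2" unfolding b_def f_def using p
  by (simp add: field_simps power2_eq_square power3_eq_cube)
 then have "b * f = (p ^ 3 - p + 1) * (p\<^sup>2 + p - 1) / p ^ 5" unfolding f_def by simp
 also have "\<dots> > 1"
 proof -
  have "0 < (p - 1)\<^sup>2 * (p\<^sup>2 - 1)" using p by (intro mult_pos_pos) (auto intro: less_1_mult)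
  then show ?thesis using p by (simp add: algebra_simps eval_nat_numeral)
 qed
 finally have bf: "b * f > 1" .
 have "f * (f * n\<^sup>2 - 2 * n * A + b * A\<^sup>2) = (f * n - A)\<^sup>2 + (b * f - 1) * A\<^sup>2"
  by (simp add: power2_eq_square algebra_simps)
 also have "\<dots> > 0"
 proof (cases "A = 0")
  case True then show ?thesis using f0 n by simp
 next
  case False
  then show ?thesis using bf by (intro add_nonneg_pos mult_pos_pos) auto
 qed
 finally have "f * n\<^sup>2 - 2 * n * A + b * A\<^sup>2 > 0" using f0 by (simp add: zero_less_mult_iff)
 then show "2 * n * A - (1 + p - p * f) * A\<^sup>2 < f * n\<^sup>2" unfolding b_def by simp
qed

text \<open>The counting argument behind the upper bound, for an abstract commuting relation \<open>c\<close>: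
 \<open>Z\<close> are the central elements, \<open>X\<close> those with small centralizer, and on \<open>Y\<close> the bound is known
 for the centralizers. The sum of the squares of the centralizer orders counts the triples
 \<open>(x, y, w)\<close> with \<open>x, w\<close> both commuting with \<open>y\<close>; the weights are chosen such that each
 non-central \<open>x\<close> contributes less than the average that is claimed.\<close>

lemma commuting_pairs_less:
 fixes c :: "'a \<Rightarrow> 'a \<Rightarrow> bool" and p :: nat
 assumes fin: "finite E" and sym: "\<And>x y. c x y \<longleftrightarrow> c y x"
  and p: "p \<ge> 2"
 defines "a \<equiv> \<lambda>x. card {y \<in> E. c x y}" and "n \<equiv> card E"
 defines "M \<equiv> \<lambda>x. \<Sum>w\<in>{w\<in>E. c x w}. card {y\<in>E. c x y \<and> c w y}"
 defines "f \<equiv> ((real p)\<^sup>2 + real p - 1) / real p ^ 3"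
 assumes bound: "\<And>x w. x \<in> E \<Longrightarrow> w \<in> E \<Longrightarrow> \<not> c x w \<Longrightarrow> p * card {y\<in>E. c x y \<and> c w y} \<le> a x"
  and E: "E = Z \<union> X \<union> Y" "Z \<inter> X = {}" "Z \<inter> Y = {}" "X \<inter> Y = {}" and Y: "Y \<noteq> {}"
  and Zc: "\<And>x. x \<in> Z \<Longrightarrow> a x = n"
  and Xb: "\<And>x. x \<in> X \<Longrightarrow> (2 * p - 1) * a x \<le> n"
  and Yb: "\<And>x. x \<in> Y \<Longrightarrow> real (M x) \<le> f * (real (a x))\<^sup>2"
 shows "real (\<Sum>x\<in>E. a x) < f * (real n)\<^sup>2"
proof -
 define A where "A x = real (a x)" for x
 define N where "N = real (\<Sum>x\<in>E. a x)"
 define q where "q = real p"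
 define m where "m = real n"
 have q2: "q \<ge> 2" using p by (simp add: q_def)
 have finZ: "finite Z" "finite X" "finite Y" and m0: "m > 0" using fin E Y unfolding m_def n_def by auto
 have an: "a x \<le> n" for x unfolding a_def n_def by (rule card_mono[OF fin]) auto
 have Mle: "M x \<le> a x * a x" for x
 proof -
  have "M x \<le> (\<Sum>w\<in>{w\<in>E. c x w}. a x)" unfolding M_def a_def
   by (intro sum_mono card_mono) (use fin in auto)
  then show ?thesis unfolding a_def by simp
 qed
 \<comment> \<open>The triples are counted from \<open>x\<close>: each \<open>w\<close> not
   commuting with \<open>x\<close> contributes at most \<open>a x / p\<close> by
   \<open>bound\<close>, and those commuting with \<open>x\<close> contribute \<open>M x\<close>
   together.\<close>
 have S: "(\<Sum>x\<in>E. q * (A x)\<^sup>2) \<le> (\<Sum>x\<in>E. (m - A x) * A x + q * real (M x))"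
 proof -
  have "real (\<Sum>w\<in>E. card {y\<in>E. c x y \<and> c w y}) * q \<le> (m - A x) * A x + q * real (M x)" if x: "x \<in> E" for x
  proof -
   have "(\<Sum>w\<in>E. card {y\<in>E. c x y \<and> c w y}) = M x + (\<Sum>w\<in>{w\<in>E. \<not> c x w}. card {y\<in>E. c x y \<and> c w y})"
   proof -
    have "E - {w\<in>E. c x w} = {w\<in>E. \<not> c x w}" by auto
    then show ?thesis unfolding M_def
     using sum.subset_diff[of "{w\<in>E. c x w}" E "\<lambda>w. card {y\<in>E. c x y \<and> c w y}"] fin by simp
   qed
   moreover have "p * (\<Sum>w\<in>{w\<in>E. \<not> c x w}. card {y\<in>E. c x y \<and> c w y}) \<le> (\<Sum>w\<in>{w\<in>E. \<not> c x w}. a x)"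
    unfolding sum_distrib_left by (intro sum_mono bound x) auto
   moreover have "card {w\<in>E. \<not> c x w} = n - a x"
   proof -
    have "{w\<in>E. \<not> c x w} = E - {w\<in>E. c x w}" by auto
    then show ?thesis unfolding n_def a_def using fin by (simp add: card_Diff_subset)
   qed
   ultimately have "p * (\<Sum>w\<in>E. card {y\<in>E. c x y \<and> c w y}) \<le> (n - a x) * a x + p * M x"
    by (simp add: algebra_simps)
   then have "real (p * (\<Sum>w\<in>E. card {y\<in>E. c x y \<and> c w y})) \<le> real ((n - a x) * a x + p * M x)"
    by (rule of_nat_mono)
   then show ?thesis unfolding q_def m_def A_def using an[of x] by (simp add: mult.commute)
  qed
  then have "(\<Sum>x\<in>E. real (\<Sum>w\<in>E. card {y\<in>E. c x y \<and> c w y}) * q) \<le> (\<Sum>x\<in>E. (m - A x) * A x + q * real (M x))"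
   by (intro sum_mono) auto
  moreover have "(\<Sum>x\<in>E. real (\<Sum>w\<in>E. card {y\<in>E. c x y \<and> c w y}) * q) = (\<Sum>x\<in>E. q * (A x)\<^sup>2)"
  proof -
   have "(\<Sum>x\<in>E. real (\<Sum>w\<in>E. card {y\<in>E. c x y \<and> c w y}) * q) =
     real (\<Sum>x\<in>E. (\<Sum>w\<in>E. card {y\<in>E. c x y \<and> c w y})) * q"
    by (simp add: sum_distrib_right)
   also have "\<dots> = real (\<Sum>y\<in>E. (a y)\<^sup>2) * q" unfolding a_def by (subst double_count_commuting[OF fin sym]) simp
   finally show ?thesis unfolding A_def by (simp add: sum_distrib_left[symmetric])
  qed
  ultimately show ?thesis by simp
 qed
 \<comment> \<open>Adding \<open>m * A x\<close> turns \<open>S\<close> into \<open>m * N\<close>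
   being at most the sum of \<open>\<psi>\<close>. Central elements give at most \<open>N\<close>
   and the others at most \<open>f * m^2\<close>, strictly on \<open>Y\<close>; collecting terms
   compares \<open>N\<close> with \<open>f * m^2\<close> after multiplication by the number of
   noncentral elements.\<close>
 define \<psi> where "\<psi> x = m * A x + ((m - A x) * A x + q * real (M x)) - q * (A x)\<^sup>2" for x
 have "m * N \<le> (\<Sum>x\<in>E. \<psi> x)"
  using S by (simp add: sum_distrib_left N_def A_def \<psi>_def sum.distrib sum_subtractf)
 also have "\<dots> = (\<Sum>x\<in>Z. \<psi> x) + (\<Sum>x\<in>X. \<psi> x) + (\<Sum>x\<in>Y. \<psi> x)"
  unfolding E(1) using E finZ by (subst sum.union_disjoint; (subst sum.union_disjoint)?) auto
 also have "\<dots> < (\<Sum>x\<in>Z. N) + (\<Sum>x\<in>X. f * m\<^sup>2) + (\<Sum>x\<in>Y. f * m\<^sup>2)"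
 proof -
  have "\<psi> x \<le> N" if x: "x \<in> Z" for x
  proof -
   have Ax: "A x = m" using Zc[OF x] by (simp add: A_def m_def)
   have "{w\<in>E. c x w} = E" using Zc[OF x] unfolding a_def n_def by (intro card_subset_eq fin) auto
   then have "M x = (\<Sum>w\<in>E. a w)" unfolding M_def a_def by (intro sum.cong arg_cong[where f = card]) auto
   then have MN: "real (M x) = N" by (simp add: N_def)
   have "N \<le> m * m"
   proof -
    have "(\<Sum>w\<in>E. a w) \<le> (\<Sum>w\<in>E. n)" by (intro sum_mono an)
    then show ?thesis using n_def of_nat_mono of_nat_mult unfolding N_def m_def by fastforce
   qed
   then have "0 \<le> (q - 1) * (m * m - N)" using q2 by simp
   then show ?thesis unfolding \<psi>_def Ax MN by (simp add: power2_eq_square algebra_simps)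
  qed
  then have "(\<Sum>x\<in>Z. \<psi> x) \<le> (\<Sum>x\<in>Z. N)" by (rule sum_mono)
  moreover have "\<psi> x \<le> f * m\<^sup>2" if x: "x \<in> X" for x
  proof -
   have "real (M x) \<le> A x * A x" unfolding A_def using Mle[of x] by (metis of_nat_mono of_nat_mult)
   then have "\<psi> x \<le> 2 * m * A x - (A x)\<^sup>2"
    using q2 by (simp add: power2_eq_square algebra_simps \<psi>_def)
   also have "\<dots> \<le> f * m\<^sup>2" unfolding f_def q_def[symmetric]
   proof (rule centralizer_poly_bounds(1)[OF q2 m0])
    have "real ((2 * p - 1) * a x) \<le> real n" using Xb[OF x] by (rule of_nat_mono)
    then show "(2 * q - 1) * A x \<le> m" unfolding q_def A_def m_def using p by simp
   qed (simp add: A_def)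
   finally show ?thesis .
  qed
  then have "(\<Sum>x\<in>X. \<psi> x) \<le> (\<Sum>x\<in>X. f * m\<^sup>2)" by (rule sum_mono)
  moreover have "\<psi> x < f * m\<^sup>2" if x: "x \<in> Y" for x
  proof -
   have "\<psi> x \<le> 2 * m * A x - (1 + q - q * f) * (A x)\<^sup>2"
    using Yb[OF x] q2 by (simp add: power2_eq_square algebra_simps A_def \<psi>_def)
   also have "\<dots> < f * m\<^sup>2" unfolding f_def q_def[symmetric] by (rule centralizer_poly_bounds(2)[OF q2 m0])
   finally show ?thesis .
  qed
  then have "(\<Sum>x\<in>Y. \<psi> x) < (\<Sum>x\<in>Y. f * m\<^sup>2)" by (intro sum_strict_mono finZ Y)
  ultimately show ?thesis by linarith
 qed
 also have "\<dots> = real (card Z) * N + (m - real (card Z)) * (f * m\<^sup>2)"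
 proof -
  have "n = card Z + card X + card Y" unfolding n_def E(1) using E finZ
   by (subst card_Un_disjoint; (subst card_Un_disjoint)?) auto
  then show ?thesis by (simp add: algebra_simps m_def)
 qed
 finally have "(m - real (card Z)) * N < (m - real (card Z)) * (f * m\<^sup>2)" by (simp add: algebra_simps)
 moreover have "m - real (card Z) \<ge> 0" using card_mono[OF fin] E(1) by (auto simp: n_def m_def)
 ultimately have "N < f * m\<^sup>2" by (meson mult_left_mono not_less)
 then show ?thesis unfolding N_def m_def .
qed

section \<open>The p-elements of a subgroup and their centralizers\<close>

context fin_group_prime begin

definition pe where "pe H = H \<inter> P"
definition ce where "ce H x = {y \<in> pe H. x \<otimes> y = y \<otimes> x}"
text \<open>Centrality is tested against \<open>p\<close>-elements only, because the count sees no
  others. It becomes centrality in the group once the group is generated by its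
  \<open>p\<close>-elements.\<close>

definition Zp where "Zp H = {z \<in> pe H. \<forall>y \<in> pe H. z \<otimes> y = y \<otimes> z}"
definition cc where "cc H x = {y \<in> H. x \<otimes> y = y \<otimes> x}"
definition commute_on where "commute_on X \<longleftrightarrow> (\<forall>x\<in>X. \<forall>y\<in>X. x \<otimes> y = y \<otimes> x)"
text \<open>Phrased by an index prime to \<open>p\<close>, so that the property is inherited by
  every subgroup between \<open>S\<close> and \<open>H\<close>; this is used for centralizers in
  \<open>syl_cc\<close>.\<close>

definition syl where "syl H S \<longleftrightarrow> subgroup S G \<and> S \<subseteq> pe H \<and> (\<exists>m. card H = card S * m \<and> \<not> p dvd m)"

lemma pe_cc: "pe (cc H x) = ce H x" by (auto simp: pe_def cc_def ce_def)

lemma cc_subgroup: "subgroup H G \<Longrightarrow> x \<in> \<G> \<Longrightarrow> subgroup (cc H x) G"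
 unfolding cc_def by (rule centralizer_subgroup)

lemma cc_subset: "cc H x \<subseteq> H" by (auto simp: cc_def)

lemma pe_P: "pe H \<subseteq> P" and pe_sub: "pe H \<subseteq> H" and pe_carrier: "pe H \<subseteq> \<G>"
 and pe_finite: "finite (pe H)" and ce_pe: "ce H x \<subseteq> pe H" and ce_finite: "finite (ce H x)"
 and Zp_pe: "Zp H \<subseteq> pe H"
 using P_subset P_fin by (auto simp: pe_def ce_def Zp_def)

lemma pe_cj: "subgroup H G \<Longrightarrow> h \<in> H \<Longrightarrow> x \<in> pe H \<Longrightarrow> cj h x \<in> pe H"
 using P_cj subgroup.mem_carrier[of H G h] subgroup.m_closed[of H G] subgroup.m_inv_closed[of H G]
 by (auto simp: pe_def cj_def)

lemma ce_iff: "y \<in> ce H x \<longleftrightarrow> y \<in> pe H \<and> x \<otimes> y = y \<otimes> x"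
 by (simp add: ce_def)

lemma commute_onD: "commute_on X \<Longrightarrow> a \<in> X \<Longrightarrow> b \<in> X \<Longrightarrow> a \<otimes> b = b \<otimes> a"
 by (simp add: commute_on_def)

lemma pe_mult: "subgroup H G \<Longrightarrow> x \<in> pe H \<Longrightarrow> y \<in> pe H \<Longrightarrow> x \<otimes> y = y \<otimes> x \<Longrightarrow> x \<otimes> y \<in> pe H"
 unfolding pe_def by (blast intro: P_mult subgroup.m_closed)

lemma pe_inv: "subgroup H G \<Longrightarrow> x \<in> pe H \<Longrightarrow> inv x \<in> pe H"
 unfolding pe_def by (blast intro: P_inv subgroup.m_inv_closed)

lemma ce_cj: assumes "subgroup H G" "h \<in> H" "x \<in> pe H" shows "ce H (cj h x) = cj h ` ce H x"
proof -
 have hc: "h \<in> \<G>" "x \<in> \<G>" using subgroup.mem_carrier[OF assms(1,2)] assms(3) pe_carrier by auto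
 have hi: "inv h \<in> H" by (rule subgroup.m_inv_closed[OF assms(1,2)])
 show ?thesis
 proof (intro equalityI subsetI)
  fix y assume y: "y \<in> ce H (cj h x)"
  then have yc: "y \<in> \<G>" using ce_pe pe_carrier by blast
  let ?z = "cj (inv h) y"
  have "?z \<in> ce H x" using pe_cj[OF assms(1) hi] y hc yc cj_comm[OF hc(1) hc(2), of ?z] ce_def by simp
  moreover have "y = cj h ?z" using hc yc by simp
  ultimately show "y \<in> cj h ` ce H x" by blast
 next
  fix y assume "y \<in> cj h ` ce H x"
  then obtain z where z: "z \<in> ce H x" "y = cj h z" by blast
  then have zc: "z \<in> \<G>" using ce_pe pe_carrier by blast
  show "y \<in> ce H (cj h x)"
   using z pe_cj[OF assms(1,2), of z] cj_comm[OF hc zc] unfolding ce_def by auto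
 qed
qed

lemma ce_eq_of_X1:
 assumes "x \<in> pe H" "y \<in> ce H x" "commute_on (ce H x)" "commute_on (ce H y)"
 shows "ce H x = ce H y"
proof -
 have xy: "x \<in> ce H y" "y \<in> ce H x" using assms(1,2) by (simp_all add: ce_iff)
 show ?thesis using commute_onD[OF assms(3,2)] ce_iff commute_onD[OF assms(4) xy(1)] by auto
qed

lemma commuting_set_subgroup:
 assumes H: "subgroup H G" and x: "x \<in> pe H" and c: "commute_on (ce H x)"
 shows "subgroup (ce H x) G"
proof (rule subgroupI)
 show "ce H x \<subseteq> \<G>" using ce_pe pe_carrier by blast
 show "ce H x \<noteq> {}" using x by (auto simp: ce_def)
 have xc: "x \<in> \<G>" using x pe_carrier by auto
 fix a b assume ab: "a \<in> ce H x" "b \<in> ce H x"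
 then have abc: "a \<in> \<G>" "b \<in> \<G>" "a \<in> pe H" "b \<in> pe H"
  using ce_pe pe_carrier by blast+
 have m: "a \<otimes> b = b \<otimes> a" by (rule commute_onD[OF c ab])
 have xa: "x \<otimes> a = a \<otimes> x" "x \<otimes> b = b \<otimes> x" using ab unfolding ce_iff by blast+
 show "inv a \<in> ce H x"
  unfolding ce_iff using pe_inv[OF H abc(3)] comm_inv[OF xc abc(1) xa(1)] by blast
 show "a \<otimes> b \<in> ce H x"
  unfolding ce_iff using pe_mult[OF H abc(3,4) m] comm_mult[OF xc abc(1,2) xa] by blast
qed

lemma Zp_subgroup: assumes H: "subgroup H G" shows "subgroup (Zp H) G"
proof (rule subgroupI)
 show "Zp H \<subseteq> \<G>" using Zp_pe pe_carrier by blast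
 have "\<one> \<in> Zp H" using subgroup.one_closed[OF H] P_carrier by (auto simp: Zp_def pe_def)
 then show "Zp H \<noteq> {}" by auto
 fix a b assume ab: "a \<in> Zp H" "b \<in> Zp H"
 then have abc: "a \<in> \<G>" "b \<in> \<G>" "a \<in> pe H" "b \<in> pe H"
  using Zp_pe pe_carrier by blast+
 have za: "y \<otimes> a = a \<otimes> y" "y \<otimes> b = b \<otimes> y" if "y \<in> pe H" for y
  using ab that unfolding Zp_def by fastforce+
 have m: "a \<otimes> b = b \<otimes> a" by (rule za(2)[OF abc(3)])
 have "inv a \<otimes> y = y \<otimes> inv a" if "y \<in> pe H" for y
  by (rule comm_inv[OF subsetD[OF pe_carrier that] abc(1) za(1)[OF that], symmetric])
 then show "inv a \<in> Zp H" unfolding Zp_def using pe_inv[OF H abc(3)] by blast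
 have "(a \<otimes> b) \<otimes> y = y \<otimes> (a \<otimes> b)" if "y \<in> pe H" for y
  by (rule comm_mult[OF subsetD[OF pe_carrier that] abc(1,2) za[OF that], symmetric])
 then show "a \<otimes> b \<in> Zp H" unfolding Zp_def using pe_mult[OF H abc(3,4) m] by blast
qed

lemma subgroup_pow: "subgroup B G \<Longrightarrow> b \<in> B \<Longrightarrow> b [^] (k::nat) \<in> B"
 by (induction k) (auto simp: subgroup.one_closed subgroup.m_closed)

lemma product_p_subgroup:
 assumes R: "subgroup R G" "R \<subseteq> P" and B: "subgroup B G" "B \<subseteq> P"
  and n: "\<And>b r. b \<in> B \<Longrightarrow> r \<in> R \<Longrightarrow> cj b r \<in> R"
 shows "subgroup (R <#> B) G" "R <#> B \<subseteq> P" "R \<subseteq> R <#> B" "B \<subseteq> R <#> B"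
proof -
 have c: "R \<subseteq> \<G>" "B \<subseteq> \<G>" using R B P_subset by auto
 have one: "\<one> \<in> R" "\<one> \<in> B" using R B subgroup.one_closed by auto
 have mem: "x \<in> R <#> B \<longleftrightarrow> (\<exists>r\<in>R. \<exists>b\<in>B. x = r \<otimes> b)" for x by (auto simp: set_mult_def)
 have prod: "(r \<otimes> b) \<otimes> (r' \<otimes> b') = (r \<otimes> cj b r') \<otimes> (b \<otimes> b')" if "r \<in> R" "b \<in> B" "r' \<in> R" "b' \<in> B" for r b r' b'
  using that c by (auto simp: cj_def m_assoc subset_eq inv_solve_left)
 show sub: "subgroup (R <#> B) G"
 proof (rule subgroupI)
  show "R <#> B \<subseteq> \<G>" using c by (rule set_mult_closed)
  show "R <#> B \<noteq> {}" using one by (auto simp: set_mult_def)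
  fix x assume "x \<in> R <#> B"
  then obtain r b where x: "r \<in> R" "b \<in> B" "x = r \<otimes> b" using mem by blast
  have i: "inv b \<in> B" "inv r \<in> R" using subgroup.m_inv_closed[OF B(1)] subgroup.m_inv_closed[OF R(1)] x by auto
  have "inv x = cj (inv b) (inv r) \<otimes> inv b"
   using x c by (auto simp: cj_def m_assoc subset_eq inv_mult_group)
  then show "inv x \<in> R <#> B" using n[OF i] i mem by blast
 next
  fix x y assume "x \<in> R <#> B" "y \<in> R <#> B"
  then obtain r b r' b' where x: "r \<in> R" "b \<in> B" "x = r \<otimes> b" "r' \<in> R" "b' \<in> B" "y = r' \<otimes> b'" unfolding mem by blast
  then show "x \<otimes> y \<in> R <#> B"
   unfolding mem by (metis prod n[of b r'] subgroup.m_closed[OF R(1)] subgroup.m_closed[OF B(1)])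
 qed
 show "R <#> B \<subseteq> P"
 proof
  fix x assume "x \<in> R <#> B"
  then obtain r b where x: "r \<in> R" "b \<in> B" "x = r \<otimes> b" using mem by blast
  obtain m where m: "b [^] (p ^ m) = \<one>" using x B P_iff by blast
  \<comment> \<open>Powers of \<open>r \<otimes> b\<close> stay in the coset of the same power of
    \<open>b\<close>. When that power is \<open>\<one>\<close>, an element of \<open>R\<close>
    remains, and \<open>P_of_pow\<close> applies.\<close>
  have "\<exists>r'\<in>R. x [^] k = r' \<otimes> b [^] k" for k :: nat
  proof (induction k)
   case 0 show ?case using one by (intro bexI[of _ \<one>]) simp_all
  next
   case (Suc k)
   then obtain r' where r': "r' \<in> R" "x [^] k = r' \<otimes> b [^] k" by blast
   have bk: "b [^] k \<in> B" using x by (intro subgroup_pow[OF B(1)])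
   show ?case using r' x n[OF bk x(1)] subgroup.m_closed[OF R(1)] prod[OF r'(1) bk x(1,2)] by fastforce
  qed
  then obtain r' where "r' \<in> R" "x [^] (p ^ m) = r' \<otimes> b [^] (p ^ m)" by blast
  moreover from this have "r' \<in> \<G>" using c by blast
  ultimately have "x [^] (p ^ m) \<in> P" using m R(2) by auto
  then show "x \<in> P" using P_of_pow x c by blast
 qed
 show "R \<subseteq> R <#> B"
 proof
  fix r assume "r \<in> R"
  then show "r \<in> R <#> B" using mem[of r] one c by (metis r_one subsetD)
 qed
 show "B \<subseteq> R <#> B"
 proof
  fix b assume "b \<in> B"
  then show "b \<in> R <#> B" using mem[of b] one c by (metis l_one subsetD)
 qed
qed

end

section \<open>Sylow subgroups and their conjugates\<close>

context fin_group_prime begin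

lemma powers_subgroup: assumes "y \<in> \<G>" shows "subgroup (range (\<lambda>k::nat. y [^] k)) G"
proof (rule subgroupI)
 show "range (\<lambda>k::nat. y [^] k) \<subseteq> \<G>" "range (\<lambda>k::nat. y [^] k) \<noteq> {}" using assms by auto
 fix a b assume "a \<in> range (\<lambda>k::nat. y [^] k)" "b \<in> range (\<lambda>k::nat. y [^] k)"
 then obtain i j :: nat where ij: "a = y [^] i" "b = y [^] j" by auto
 then show "a \<otimes> b \<in> range (\<lambda>k::nat. y [^] k)" using assms by (auto simp: nat_pow_mult)
 have "inv a = y [^] (order G * i - i)"
  using assms fin ij nat_pow_mult nat_pow_pow[symmetric] pow_order_eq_1 inv_equality order_gt_0_iff_finite by fastforce
 then show "inv a \<in> range (\<lambda>k::nat. y [^] k)" by simp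
qed

text \<open>\<open>R\<close> and the powers of \<open>y\<close> form a \<open>p\<close>-subgroup
  together, which by maximality is no larger than \<open>R\<close>. This is the source of the later
  rule that a \<open>p\<close>-element fixing a block belongs to it.\<close>

lemma normalized_imp_mem:
 assumes R: "subgroup R G" "R \<subseteq> pe H" and H: "subgroup H G"
  and max: "\<And>K. subgroup K G \<Longrightarrow> K \<subseteq> pe H \<Longrightarrow> card K \<le> card R"
  and y: "y \<in> pe H" and n: "cj y ` R = R"
 shows "y \<in> R"
proof -
 have yc: "y \<in> \<G>" using y pe_carrier by auto
 let ?B = "range (\<lambda>k::nat. y [^] k)"
 have B: "subgroup ?B G" by (rule powers_subgroup[OF yc])
 have BP: "?B \<subseteq> P" and RP: "R \<subseteq> P" using y pe_P P_pow R by blast+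
 have Rc: "R \<subseteq> \<G>" using RP P_subset by auto
 have "cj (y [^] k) r \<in> R" if "r \<in> R" for r and k :: nat
  using that
 proof (induction k arbitrary: r)
  case 0 then show ?case using Rc by auto
 next
  case (Suc k)
  have "cj (y [^] Suc k) r = cj (y [^] k) (cj y r)" using Suc(2) Rc yc by (auto simp: cj_cj)
  then show ?case using Suc(2) n Suc(1) by auto
 qed
 then have n': "\<And>b r. b \<in> ?B \<Longrightarrow> r \<in> R \<Longrightarrow> cj b r \<in> R" by auto
 note pr = product_p_subgroup[OF R(1) RP B BP n']
 have "R <#> ?B \<subseteq> pe H"
  using y subgroup_pow[OF H] R subgroup.m_closed[OF H] pr(2) by (simp add: set_mult_def subset_eq pe_def)
 then have "R = R <#> ?B" by (metis max pr(1) pr(3) subgroup_finite[OF pr(1)] card_seteq)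
 moreover have "y [^] (1::nat) \<in> ?B" by blast
 ultimately show ?thesis using pr(4) yc by auto
qed

lemma syl_exists: assumes H: "subgroup H G" shows "\<exists>S. syl H S"
proof -
 interpret H: group "G\<lparr>carrier := H\<rparr>" using H subgroup_imp_group by blast
 have c0: "card H > 0" by (rule subgroup_card_pos[OF H])
 define a where "a = multiplicity p (card H)"
 obtain m where m: "card H = p ^ a * m" unfolding a_def by (metis multiplicity_dvd dvdE)
 have nd: "\<not> p dvd m"
 proof
  assume "p dvd m"
  then have "p ^ Suc a dvd card H" using m by auto
  then have "Suc a \<le> a" unfolding a_def
   by (intro multiplicity_geI) (use c0 prime in auto)
  then show False by simp
 qed
 have "\<exists>L. subgroup L (G\<lparr>carrier := H\<rparr>) \<and> card L = p ^ a"
  by (rule sylow_thm[OF prime H.is_group]) (use m subgroup_finite[OF H] in \<open>auto simp: order_def\<close>)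
 then obtain S where S: "subgroup S (G\<lparr>carrier := H\<rparr>)" "card S = p ^ a" by auto
 have SG: "subgroup S G" using S(1) H incl_subgroup by blast
 have "S \<subseteq> P" using subgroup_pow_card[OF SG] S(2) subgroup.mem_carrier[OF SG] P_iff by auto
 then show ?thesis using m S(2) nd SG S(1) subgroup.subset by (fastforce simp: pe_def syl_def)
qed

lemma syl_max: assumes "syl H S" "subgroup H G" "subgroup K G" "K \<subseteq> pe H" shows "card K \<le> card S"
proof -
 obtain m where m: "card H = card S * m" "\<not> p dvd m" using assms by (auto simp: syl_def)
 obtain a where a: "card S = p ^ a" using assms p_subgroup_card pe_P by (metis syl_def order.trans)
 obtain b where b: "card K = p ^ b" using assms p_subgroup_card pe_P by (metis order.trans)
 show ?thesis
  using subgroup_card_dvd[OF assms(3,2)] assms(4) pe_sub a b m m(2) prime p_gt_0 by (simp add: order.trans prime_imp_coprime coprime_dvd_mult_left_iff dvd_imp_le)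
qed

lemma syl_of_card: assumes "syl H S" "subgroup K G" "K \<subseteq> pe H" "card K = card S" shows "syl H K"
 using assms by (simp add: syl_def)

text \<open>The number of right cosets of \<open>S\<close> is prime to \<open>p\<close>, so right
  multiplication by the \<open>p\<close>-element \<open>y\<close> fixes one of them,
  \<open>S #> h\<close>; then \<open>h\<close> conjugates \<open>y\<close> into
  \<open>S\<close>.\<close>

lemma syl_conj: assumes S: "syl H S" and H: "subgroup H G" and y: "y \<in> pe H"
 shows "\<exists>h\<in>H. cj h y \<in> S"
proof -
 interpret H: group "G\<lparr>carrier := H\<rparr>" using H subgroup_imp_group by blast
 have SG: "subgroup S G" and SH: "S \<subseteq> H" using S pe_sub by (auto simp: syl_def)
 have Hc: "H \<subseteq> \<G>" and yc: "y \<in> \<G>" "y \<in> H"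
  using H subgroup.subset y pe_carrier pe_sub by blast+
 obtain m where m: "card H = card S * m" "\<not> p dvd m" using S by (auto simp: syl_def)
 have S': "subgroup S (G\<lparr>carrier := H\<rparr>)" using subgroup_incl SG H SH by blast
 define X where "X = (\<lambda>h. S #> h) ` H"
 have X': "X = rcosets\<^bsub>G\<lparr>carrier := H\<rparr>\<^esub> S" unfolding X_def RCOSETS_def r_coset_def by auto
 have cX: "card X = m" using H.lagrange[OF S'] m subgroup_card_pos[OF SG] by (simp add: order_def X')
 obtain k where k: "y [^] (p ^ k) = \<one>" using y pe_P P_iff by blast
 let ?f = "\<lambda>M. M #> y"
 have sc: "S \<subseteq> \<G>" using SH Hc by auto
 have f1: "?f (S #> h) = S #> (h \<otimes> y)" if "h \<in> H" for h
  using that Hc yc sc by (intro coset_mult_assoc) auto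
 have fn: "(?f ^^ n) (S #> h) = S #> (h \<otimes> y [^] n)" if "h \<in> H" for h and n :: nat
 proof (induction n)
  case 0 then show ?case using that Hc by auto
 next
  case (Suc n)
  have "h \<otimes> y [^] n \<in> H" using that yc subgroup_pow[OF H] subgroup.m_closed[OF H] by blast
  from f1[OF this] show ?case using Suc that Hc yc by (auto simp: m_assoc)
 qed
 have "[card X = card {M \<in> X. ?f M = M}] (mod p)"
 proof (rule card_fixed_points_prime_power[OF prime])
  show "finite X" unfolding X_def using subgroup_finite[OF H] by simp
  show "?f ` X \<subseteq> X" unfolding X_def using f1 yc subgroup.m_closed[OF H] by auto
  show "(?f ^^ (p ^ k)) M = M" if "M \<in> X" for M
  proof -
   have "\<exists>h\<in>H. M = S #> h" using that unfolding X_def by blast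
   then obtain h where h: "h \<in> H" "M = S #> h" by blast
   then show ?thesis using fn[OF h(1), of "p ^ k"] k Hc by auto
  qed
 qed
 then have "{M \<in> X. ?f M = M} \<noteq> {}" by (metis m cX cong_dvd_iff card.empty dvd_0_right)
 then obtain M h where "M \<in> X" "?f M = M" and h: "h \<in> H" "?f (S #> h) = S #> h" by (auto simp: X_def)
 have hc: "h \<in> \<G>" using h Hc by auto
 have "h \<otimes> y \<in> S #> h" using hc yc SG h f1 rcos_self by fastforce
 then obtain s where "s \<in> S" "h \<otimes> y = s \<otimes> h" by (auto simp: r_coset_def)
 then have "cj h y = s" using hc sc by (auto simp: cj_def m_assoc)
 then show ?thesis using h \<open>s \<in> S\<close> by blast
qed

lemma syl_cj: assumes S: "syl H S" and H: "subgroup H G" and h: "h \<in> H" shows "syl H (cj h ` S)"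
proof -
 have hc: "h \<in> \<G>" using subgroup.mem_carrier[OF H h] .
 have SG: "subgroup S G" "S \<subseteq> pe H" using S by (auto simp: syl_def)
 have Sc: "S \<subseteq> \<G>" using SG subgroup.subset by blast
 show ?thesis
  using pe_cj[OF H h] SG syl_of_card[OF S cj_image_subgroup[OF hc SG(1)]] card_image[OF cj_inj_on[OF hc Sc]] by blast
qed

lemma syl_containing: assumes S: "syl H S" and H: "subgroup H G" and y: "y \<in> pe H"
 shows "\<exists>h\<in>H. y \<in> cj h ` S"
proof -
 obtain h where h: "h \<in> H" "cj h y \<in> S" using syl_conj assms by blast
 have "y = cj (inv h) (cj h y)" using y pe_carrier subgroup.mem_carrier[OF H h(1)] by fastforce
 then show ?thesis using subgroup.m_inv_closed[OF H h(1)] h(2) by auto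
qed

lemma commute_on_cj: assumes "h \<in> \<G>" "S \<subseteq> \<G>" "commute_on S" shows "commute_on (cj h ` S)"
 unfolding commute_on_def
proof (clarify)
 fix x y assume xy: "x \<in> S" "y \<in> S"
 then show "cj h x \<otimes> cj h y = cj h y \<otimes> cj h x"
  using commute_onD[OF assms(3) xy] cj_comm[OF assms(1)] assms(2) by blast
qed

lemma not_syl_eq_pe:
 assumes S: "syl H S" and H: "subgroup H G" and nS: "S \<noteq> pe H"
 shows "\<exists>y\<in>pe H. y \<notin> S \<and> cj y ` S \<noteq> S"
proof -
 have SG: "subgroup S G" "S \<subseteq> pe H" using S by (auto simp: syl_def)
 obtain y where y: "y \<in> pe H" "y \<notin> S" using nS SG by auto
 show ?thesis by (metis y normalized_imp_mem[OF SG H _ y(1)] syl_max[OF S H])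
qed

lemma inter_proper:
 assumes "subgroup S G" "subgroup T G" "S \<subseteq> P" "card T = card S" "S \<noteq> T"
 shows "p * card (S \<inter> T) \<le> card S"
proof (rule p_subgroup_proper)
 show "subgroup (S \<inter> T) G" using assms subgroups_Inter_pair by blast
 show "S \<inter> T \<noteq> S"
 proof
  assume "S \<inter> T = S"
  then have "S \<subseteq> T" by auto
  then show False by (metis subgroup_finite[OF assms(2)] assms card_subset_eq)
 qed
qed (use assms in auto)

text \<open>\<open>S\<close> has a conjugate different from itself, and the two share at most a
  \<open>p\<close>-th part. Their union has at least \<open>2 * card S - card S / p\<close>
  elements.\<close>

lemma many_p_elements:
 assumes S: "syl H S" and H: "subgroup H G" and nS: "S \<noteq> pe H"
 shows "(2 * p - 1) * card S \<le> p * card (pe H)"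
proof -
 have SG: "subgroup S G" "S \<subseteq> pe H" using S by (auto simp: syl_def)
 obtain y where y: "y \<in> pe H" "cj y ` S \<noteq> S" using not_syl_eq_pe[OF assms] by blast
 have yH: "y \<in> H" using y pe_sub by auto
 have T: "syl H (cj y ` S)" by (rule syl_cj[OF S H yH])
 then have TG: "subgroup (cj y ` S) G" "cj y ` S \<subseteq> pe H" by (auto simp: syl_def)
 have Sc: "S \<subseteq> \<G>" using SG subgroup.subset by blast
 have cT: "card (cj y ` S) = card S" using y pe_carrier by (intro card_image cj_inj_on Sc) auto
 have "p * card (S \<inter> cj y ` S) \<le> card S"
  using inter_proper[OF SG(1) TG(1) _ cT] SG(2) pe_P y(2) by auto
 moreover have "card (S \<union> cj y ` S) \<le> card (pe H)" by (intro card_mono pe_finite) (use SG TG in auto)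
 moreover have "card S + card (cj y ` S) = card (S \<union> cj y ` S) + card (S \<inter> cj y ` S)"
  by (intro card_Un_Int) (use SG subgroup_finite in auto)
 ultimately have "2 * card S \<le> card (pe H) + card (S \<inter> cj y ` S)" using cT by simp
 then have "p * (2 * card S) \<le> p * (card (pe H) + card (S \<inter> cj y ` S))" by (rule mult_le_mono2)
 then show ?thesis using \<open>p * card (S \<inter> cj y ` S) \<le> card S\<close> by (simp add: algebra_simps)
qed

lemma noncentral_ce:
 assumes "x \<in> pe H" "x \<notin> Zp H" shows "ce H x \<noteq> pe H"
 using assms by (auto simp: Zp_def ce_iff)

lemma Zp_subset_ce: "x \<in> pe H \<Longrightarrow> Zp H \<subseteq> ce H x"
 using ce_iff by (auto simp: Zp_def)

lemma mem_ce_self: "x \<in> pe H \<Longrightarrow> x \<in> ce H x"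
 by (simp add: ce_iff)

text \<open>If all centralizers of non-central \<open>p\<close>-elements are commutative, then those centralizers
 partition the \<open>p\<close>-elements modulo the center.\<close>

lemma blocks_inter:
 assumes all: "\<And>x. x \<in> pe H - Zp H \<Longrightarrow> commute_on (ce H x)"
  and x: "x \<in> pe H - Zp H" and y: "y \<in> pe H - Zp H" and ne: "ce H x \<noteq> ce H y"
 shows "ce H x \<inter> ce H y = Zp H"
proof (intro equalityI subsetI)
 fix t assume t: "t \<in> ce H x \<inter> ce H y"
 show "t \<in> Zp H"
 proof (rule ccontr)
  assume "t \<notin> Zp H"
  then have "t \<in> pe H - Zp H" using t ce_pe by blast
  then show False using ce_eq_of_X1 all x y t ne by blast
 qed
next
 fix t assume "t \<in> Zp H"
 then show "t \<in> ce H x \<inter> ce H y" using Zp_subset_ce x y by blast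
qed

text \<open>Conjugation by \<open>x\<close> fixes its own centralizer but no other conjugate of it.
  The images of another conjugate under the \<open>p\<close> powers of \<open>x\<close>, together
  with \<open>ce H x\<close>, are therefore \<open>p + 1\<close> sets of equal size that meet
  pairwise in \<open>Zp H\<close>.\<close>

lemma many_blocks:
 assumes H: "subgroup H G" and all: "\<And>x. x \<in> pe H - Zp H \<Longrightarrow> commute_on (ce H x)"
  and x: "x \<in> pe H - Zp H" and S: "syl H (ce H x)"
 shows "(p + 1) * card (ce H x) \<le> card (pe H) + p * card (Zp H)"
  and "p * card (Zp H) \<le> card (ce H x)"
proof -
 let ?A = "ce H x" and ?Z = "Zp H"
 have xc: "x \<in> \<G>" "x \<in> H" "x \<in> pe H" and ZA: "?Z \<subseteq> ?A"
  using x pe_carrier pe_sub Zp_subset_ce by auto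
 show pZ: "p * card ?Z \<le> card ?A"
  using mem_ce_self x p_subgroup_proper Zp_subgroup[OF H] ZA S pe_P syl_def by blast
 obtain y where y: "y \<in> pe H" "cj y ` ?A \<noteq> ?A"
  using not_syl_eq_pe[OF S H noncentral_ce] x by blast
 have yH: "y \<in> H" "y \<in> \<G>" using subsetD[OF pe_sub y(1)] subsetD[OF pe_carrier y(1)] .
 define x' where "x' = cj y x"
 have x'pe: "x' \<in> pe H" and Tx': "ce H x' = cj y ` ?A"
  unfolding x'_def by (auto simp: pe_cj[OF H yH(1) xc(3)] ce_cj[OF H yH(1) xc(3)])
 have cZ: "cj h ` ?Z = ?Z" if "h \<in> H" for h
 proof (rule card_subset_eq)
  have hc: "h \<in> \<G>" using subgroup.mem_carrier[OF H that] .
  have Zc: "?Z \<subseteq> \<G>" using Zp_pe pe_carrier by blast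
  show "finite ?Z" using Zp_pe pe_finite finite_subset by blast
  show "card (cj h ` ?Z) = card ?Z" by (intro card_image cj_inj_on hc Zc)
  show "cj h ` ?Z \<subseteq> ?Z"
  proof (clarify)
   fix z assume z: "z \<in> ?Z"
   then have zp: "z \<in> pe H" using Zp_pe by blast
   have "cj h z \<otimes> u = u \<otimes> cj h z" if u: "u \<in> pe H" for u
   proof -
    have i: "inv h \<in> H" by (rule subgroup.m_inv_closed[OF H \<open>h \<in> H\<close>])
    show ?thesis
     using z cj_comm[OF hc, of z "cj (inv h) u"] hc pe_cj[OF H i u] Zp_def u zp pe_carrier by fastforce
   qed
   then show "cj h z \<in> ?Z" using pe_cj[OF H that zp] unfolding Zp_def by blast
  qed
 qed
 have noncent: "cj h u \<in> pe H - ?Z" if "h \<in> H" "u \<in> pe H - ?Z" for h u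
 proof -
  have hc: "h \<in> \<G>" using subgroup.mem_carrier[OF H that(1)] .
  have uc: "u \<in> \<G>" using that pe_carrier by auto
  have "cj h u \<notin> ?Z"
  proof
   assume "cj h u \<in> ?Z"
   then have "cj h u \<in> cj h ` ?Z" by (simp only: cZ[OF that(1)])
   then obtain z where "z \<in> ?Z" "cj h u = cj h z" by blast
   then show False using cj_eq_iff[OF hc uc, of z] Zp_pe pe_carrier that by auto
  qed
  then show ?thesis using pe_cj[OF H that(1)] that(2) by blast
 qed
 have x'nc: "x' \<in> pe H - ?Z" unfolding x'_def by (rule noncent[OF yH(1) x])
 define X where "X i = cj (x [^] (i::nat)) x'" for i
 have xi: "x [^] (i::nat) \<in> H" "x [^] i \<in> \<G>" for i using subgroup_pow[OF H xc(2)] xc by auto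
 have ceX: "ce H (X i) = cj (x [^] i) ` ce H x'" for i unfolding X_def by (rule ce_cj[OF H xi(1) x'pe])
 have ceXc: "ce H z \<subseteq> \<G>" for z using ce_pe pe_carrier by blast
 have cX: "card (ce H (X i)) = card ?A" for i
  unfolding ceX Tx' using card_image[OF cj_inj_on[OF xi(2) ceXc[of x', unfolded Tx']]]
   card_image[OF cj_inj_on[OF yH(2) ceXc]] by simp
 have xA: "cj (x [^] i) ` ?A = ?A" for i :: nat
 proof -
  have "cj (x [^] i) a = a" if "a \<in> ?A" for a
  proof -
   have ac: "a \<in> \<G>" using that ceXc by auto
   show ?thesis by (metis that ce_iff comm_pow[OF ac xc(1)] cj_self[OF xi(2) ac])
  qed
  then show ?thesis by simp
 qed
 have neA: "ce H (X i) \<noteq> ?A" for i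
  by (metis ceX xA inj_on_image_eq_iff[OF cj_inj_on[OF xi(2) subset_refl] ceXc ceXc] y Tx')
 have max: "card K \<le> card (ce H x')" if "subgroup K G" "K \<subseteq> pe H" for K
  using syl_max[OF S H that] cX[of 0] subsetD[OF pe_carrier x'pe] unfolding X_def by simp
 have sx': "subgroup (ce H x') G" by (rule commuting_set_subgroup[OF H x'pe all[OF x'nc]])
 \<comment> \<open>If two images coincide, a power of \<open>x\<close> with exponent prime to
   \<open>p\<close> normalizes the Sylow subgroup \<open>ce H x'\<close> and lies in it. Then
   \<open>x\<close> itself commutes with \<open>x'\<close>, and the two centralizers would be
   equal.\<close>
 have neX: "ce H (X i) \<noteq> ce H (X j)" if "i < j" "j < p" for i j
 proof
  assume eq: "ce H (X i) = ce H (X j)"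
  have "cj (x [^] i) ` ce H x' = cj (x [^] i) ` (cj (x [^] (j - i)) ` ce H x')"
   using that xc eq ceX cj_image_cj[OF xi(2) xi(2) ceXc] by (simp add: nat_pow_mult)
  moreover have "cj (x [^] (j - i)) ` ce H x' \<subseteq> \<G>"
   using subsetD[OF ceXc[of x']] xi(2)[of "j - i"] by auto
  ultimately have "ce H x' = cj (x [^] (j - i)) ` ce H x'"
   using inj_on_image_eq_iff[OF cj_inj_on[OF xi(2) subset_refl] ceXc] by blast
  then have "x [^] (j - i) \<in> ce H x'"
   using xc P_pow xi by (intro normalized_imp_mem[OF sx' ce_pe H max]) (auto simp: pe_def)
  moreover have "\<not> p dvd j - i" using that by (auto dest: dvd_imp_le)
  ultimately have "x' \<otimes> x = x \<otimes> x'"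
   using comm_of_pow[of x x' "j - i"] xc x'pe pe_P pe_carrier by (auto simp: ce_iff)
  then show False by (metis y Tx' x'pe ce_eq_of_X1[OF xc(3) _ all[OF x] all[OF x'nc]] ce_iff)
 qed
 let ?\<B> = "insert ?A ((\<lambda>i. ce H (X i)) ` {..<p})"
 have inj: "inj_on (\<lambda>i. ce H (X i)) {..<p}"
  using neX by (intro inj_onI) (metis lessThan_iff linorder_neqE_nat)
 have cB: "card ?\<B> = p + 1" and finB: "finite ?\<B>"
  using neA by (subst card_insert_disjoint) (auto simp: card_image[OF inj])
 have block: "\<exists>u\<in>pe H - ?Z. B = ce H u" if "B \<in> ?\<B>" for B
  using that x noncent[OF xi(1) x'nc] unfolding X_def by blast
 have cardB: "card B = card ?A" if "B \<in> ?\<B>" for B using that cX by auto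
 have "card (\<Union>B\<in>?\<B>. B - ?Z) = (\<Sum>B\<in>?\<B>. card (B - ?Z))"
 proof (rule card_UN_disjoint[OF finB])
  show "\<forall>B\<in>?\<B>. finite (B - ?Z)" using ce_finite by auto
  show "\<forall>B\<in>?\<B>. \<forall>B'\<in>?\<B>. B \<noteq> B' \<longrightarrow> (B - ?Z) \<inter> (B' - ?Z) = {}"
  proof (intro ballI impI)
   fix B B' assume B: "B \<in> ?\<B>" "B' \<in> ?\<B>" "B \<noteq> B'"
   obtain u v where "u \<in> pe H - ?Z" "B = ce H u" "v \<in> pe H - ?Z" "B' = ce H v" using block B by meson
   then show "(B - ?Z) \<inter> (B' - ?Z) = {}" using blocks_inter[OF all] B(3) by auto
  qed
 qed
 also have "\<dots> = (\<Sum>B\<in>?\<B>. card ?A - card ?Z)"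
 proof (rule sum.cong[OF refl])
  fix B assume B: "B \<in> ?\<B>"
  obtain u where "u \<in> pe H - ?Z" "B = ce H u" using block B by meson
  then show "card (B - ?Z) = card ?A - card ?Z"
   using Zp_subset_ce cardB[OF B] by (simp add: card_Diff_subset finite_subset[OF Zp_pe pe_finite])
 qed
 also have "\<dots> = (p + 1) * (card ?A - card ?Z)" using cB by simp
 finally have c1: "card (\<Union>B\<in>?\<B>. B - ?Z) = (p + 1) * (card ?A - card ?Z)" .
 have "?Z \<union> (\<Union>B\<in>?\<B>. B - ?Z) \<subseteq> pe H"
  using subsetD[OF ce_pe] subsetD[OF Zp_pe] by auto
 then have "card (?Z \<union> (\<Union>B\<in>?\<B>. B - ?Z)) \<le> card (pe H)" by (rule card_mono[OF pe_finite])
 moreover have "card (?Z \<union> (\<Union>B\<in>?\<B>. B - ?Z)) = card ?Z + card (\<Union>B\<in>?\<B>. B - ?Z)"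
  by (rule card_Un_disjoint) (use finite_subset[OF Zp_pe pe_finite] ce_finite in auto)
 ultimately have "card ?Z + (p + 1) * (card ?A - card ?Z) \<le> card (pe H)" using c1 by simp
 then show "(p + 1) * card ?A \<le> card (pe H) + p * card ?Z" by (simp add: algebra_simps)
qed

end

section \<open>Centralizer bounds and the induction over subgroups\<close>

context fin_group_prime begin

lemma cc_card_less:
 assumes H: "subgroup H G" and x: "x \<in> pe H - Zp H"
 shows "card (cc H x) < card H"
proof (rule psubset_card_mono[OF subgroup_finite[OF H]])
 show "cc H x \<subset> H" using x pe_sub cc_def unfolding Zp_def by blast
qed

lemma syl_cc:
 assumes T: "syl H T" and c: "commute_on T" and H: "subgroup H G" and y: "y \<in> T"
 shows "syl (cc H y) T"
proof -
 have TG: "subgroup T G" "T \<subseteq> pe H" using T by (auto simp: syl_def)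
 have yc: "y \<in> \<G>" using subgroup.mem_carrier[OF TG(1) y] .
 have sc: "subgroup (cc H y) G" by (rule cc_subgroup[OF H yc])
 have Tce: "T \<subseteq> ce H y" using commute_onD[OF c y] TG(2) by (auto simp: ce_iff)
 then have Tcc: "T \<subseteq> cc H y" using pe_sub[of "cc H y"] unfolding pe_cc by blast
 obtain m where m: "card H = card T * m" "\<not> p dvd m" using T by (auto simp: syl_def)
 obtain m' where m': "card (cc H y) = card T * m'" using subgroup_card_dvd[OF TG(1) sc Tcc] by blast
 show ?thesis using subgroup_card_dvd[OF sc H cc_subset] m m' TG(1) Tce pe_cc unfolding syl_def by fastforce
qed

text \<open>If some centralizer of a noncentral \<open>y\<close> is noncommutative, induction
  applies inside it: a conjugate of \<open>S\<close> through \<open>y\<close> is commutative and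
  remains Sylow there. Otherwise \<open>ce H x\<close> is itself such a conjugate and
  \<open>many_blocks\<close> applies.\<close>

lemma abelian_syl_bound:
 assumes "subgroup H G" "syl H S" "commute_on S" "\<not> commute_on (pe H)"
 shows "p * card S \<le> card (pe H)"
 using assms
proof (induction "card H" arbitrary: H S rule: less_induct)
 case (less H S)
 note H = less(2) and S = less(3) and cS = less(4)
 have Sc: "S \<subseteq> \<G>" by (metis subgroup.subset S syl_def)
 have cont: "\<exists>T. syl H T \<and> commute_on T \<and> y \<in> T \<and> card T = card S" if y: "y \<in> pe H" for y
 proof -
  obtain h where h: "h \<in> H" "y \<in> cj h ` S" using syl_containing[OF S H y] by blast
  have hc: "h \<in> \<G>" using subgroup.mem_carrier[OF H h(1)] .
  show ?thesis using syl_cj[OF S H h(1)] commute_on_cj[OF hc Sc cS] h(2) card_image[OF cj_inj_on[OF hc Sc]] by blast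
 qed
 show ?case
 proof (cases "\<exists>y\<in>pe H - Zp H. \<not> commute_on (ce H y)")
  case True
  then obtain y T where y: "y \<in> pe H - Zp H" "\<not> commute_on (ce H y)" and T: "syl H T" "commute_on T" "y \<in> T" "card T = card S"
   using cont by blast
  have yc: "y \<in> \<G>" using y pe_carrier by auto
  have "p * card T \<le> card (pe (cc H y))"
   using y(2) by (intro less(1)[OF cc_card_less[OF H y(1)] cc_subgroup[OF H yc] syl_cc[OF T(1,2) H T(3)] T(2)])
    (simp add: pe_cc)
  also have "\<dots> \<le> card (pe H)" unfolding pe_cc by (rule card_mono[OF pe_finite ce_pe])
  finally show ?thesis using T by simp
 next
  case False
  then have all: "\<And>x. x \<in> pe H - Zp H \<Longrightarrow> commute_on (ce H x)" by blast
  obtain x T where x: "x \<in> pe H - Zp H" and T: "syl H T" "commute_on T" "x \<in> T" "card T = card S"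
   using less(5) cont unfolding commute_on_def Zp_def by blast
  have "T \<subseteq> ce H x" using commute_onD[OF T(2,3)] T(1) by (auto simp: ce_iff syl_def)
  then have "T = ce H x"
   using commuting_set_subgroup[OF H _ all[OF x]] x ce_pe ce_finite by (simp add: syl_max[OF T(1) H] card_seteq)
  then have "syl H (ce H x)" using T by simp
  from many_blocks[OF H all x this] show ?thesis using \<open>T = ce H x\<close> T(4) by simp
 qed
qed

text \<open>If all conjugates of \<open>y\<close> commuted with \<open>y\<close>, then
  \<open>y\<close> would lie in a normal \<open>p\<close>-subgroup, hence in every Sylow subgroup.
  These are commutative and cover all \<open>p\<close>-elements, so \<open>y\<close> would be in
  \<open>Zp H\<close>.\<close>

lemma noncommuting_conjugate:
 assumes H: "subgroup H G" and A: "syl H A" "commute_on A" and y: "y \<in> pe H - Zp H"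
 shows "\<exists>h\<in>H. y \<otimes> cj h y \<noteq> cj h y \<otimes> y"
proof (rule ccontr)
 assume "\<not> ?thesis"
 then have cy: "y \<otimes> cj h y = cj h y \<otimes> y" if "h \<in> H" for h using that by blast
 have Hc: "h \<in> \<G>" if "h \<in> H" for h using subgroup.mem_carrier[OF H that] .
 have yc: "y \<in> \<G>" "y \<in> pe H" "y \<in> H" using y pe_carrier pe_sub by auto
 have cyy: "cj h y \<otimes> cj k y = cj k y \<otimes> cj h y" if "h \<in> H" "k \<in> H" for h k
 proof -
  have "inv h \<otimes> k \<in> H" by (metis subgroup.m_closed[OF H _ that(2)] subgroup.m_inv_closed[OF H that(1)])
  from cy[OF this] show ?thesis
   using cj_comm[OF Hc[OF that(1)] yc(1), of "cj (inv h \<otimes> k) y"] Hc that yc cj_cj m_assoc[symmetric] by fastforce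
 qed
 define cen where "cen c \<longleftrightarrow> (\<forall>h\<in>H. c \<otimes> cj h y = cj h y \<otimes> c)" for c
 \<comment> \<open>A double centralizer of the conjugates of \<open>y\<close>, cut down to
   \<open>p\<close>-elements. It is invariant and commutative by construction, so no generated
   subgroup has to be analysed.\<close>
 define R where "R = {x \<in> pe H. \<forall>c\<in>H. cen c \<longrightarrow> c \<otimes> x = x \<otimes> c}"
 have Rc: "x \<in> \<G>" "x \<in> H" "x \<in> pe H" if "x \<in> R" for x
  using that pe_carrier pe_sub unfolding R_def by auto
 have RD: "c \<otimes> x = x \<otimes> c" if "x \<in> R" "c \<in> H" "cen c" for x c using that unfolding R_def by blast
 have cenR: "cen x" if "x \<in> R" for x
  unfolding cen_def
 proof
  fix h assume h: "h \<in> H"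
  show "x \<otimes> cj h y = cj h y \<otimes> x"
   using pe_cj[OF H h yc(2)] pe_sub cyy[OF h] RD[OF that] by (fastforce simp: cen_def)
 qed
 have Rcomm: "x \<otimes> x' = x' \<otimes> x" if "x \<in> R" "x' \<in> R" for x x'
  using RD[OF that(2) Rc(2)[OF that(1)] cenR[OF that(1)]] .
 have yR: "y \<in> R" using subgroup.one_closed[OF H] yc by (auto simp: cen_def R_def)
 have RG: "subgroup R G"
 proof (rule subgroupI)
  show "R \<subseteq> \<G>" using Rc by blast
  show "R \<noteq> {}" using yR by blast
  fix a b assume ab: "a \<in> R" "b \<in> R"
  show "inv a \<in> R" using pe_inv[OF H Rc(3)[OF ab(1)]] comm_inv Hc Rc[OF ab(1)] RD[OF ab(1)] by (simp add: R_def)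
  show "a \<otimes> b \<in> R"
   using pe_mult[OF H Rc(3)[OF ab(1)] Rc(3)[OF ab(2)] Rcomm[OF ab]] comm_mult Hc Rc[OF ab(1)] Rc[OF ab(2)] RD[OF ab(1)] RD[OF ab(2)] by (simp add: R_def)
 qed
 have Rn: "cj h x \<in> R" if h: "h \<in> H" and x: "x \<in> R" for h x
  unfolding R_def
 proof (intro CollectI conjI ballI impI)
  show "cj h x \<in> pe H" by (rule pe_cj[OF H h Rc(3)[OF x]])
  fix c assume c: "c \<in> H" "cen c"
  have hc: "h \<in> \<G>" "c \<in> \<G>" "x \<in> \<G>" using Hc h c Rc x by auto
  let ?c = "cj (inv h) c"
  have "?c \<in> H" using h c subgroup.m_closed[OF H] subgroup.m_inv_closed[OF H] unfolding cj_def by simp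
  moreover have "cen ?c" unfolding cen_def
  proof
   fix k assume k: "k \<in> H"
   show "?c \<otimes> cj k y = cj k y \<otimes> ?c"
    using subgroup.m_closed[OF H h k] c(2) Hc k yc hc cj_comm[OF hc(1), of ?c "cj k y"] cj_cj cen_def by fastforce
  qed
  ultimately have "?c \<otimes> x = x \<otimes> ?c" using RD[OF x] by blast
  then show "c \<otimes> cj h x = cj h x \<otimes> c" using cj_comm[OF hc(1), of ?c x] hc by simp
 qed
 have RB: "R \<subseteq> B" if B: "syl H B" for B
 proof -
  have BG: "subgroup B G" "B \<subseteq> pe H" using B by (auto simp: syl_def)
  have RP: "R \<subseteq> P" "B \<subseteq> P" using Rc(3) BG pe_P by blast+
  have "\<And>b r. b \<in> B \<Longrightarrow> r \<in> R \<Longrightarrow> cj b r \<in> R" using Rn BG pe_sub by blast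
  note pr = product_p_subgroup[OF RG RP(1) BG(1) RP(2) this]
  have "R <#> B \<subseteq> pe H"
   using Rc(2) BG subgroup.m_closed[OF H] pr(2) by (simp add: set_mult_def subset_eq pe_def)
  then show ?thesis by (metis pr(3) syl_max[OF B H pr(1)] pr(4) subgroup_finite[OF pr(1)] card_seteq)
 qed
 have Ac: "A \<subseteq> \<G>" using A(1) pe_carrier by (auto simp: syl_def)
 have "y \<otimes> u = u \<otimes> y" if u: "u \<in> pe H" for u
 proof -
  obtain h where h: "h \<in> H" "u \<in> cj h ` A" using syl_containing[OF A(1) H u] by blast
  show ?thesis
   using RB[OF syl_cj[OF A(1) H h(1)]] yR commute_onD[OF commute_on_cj[OF Hc[OF h(1)] Ac A(2)]] h(2) by auto
 qed
 then show False using y by (simp add: Zp_def)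
qed

lemma Zp_less:
 assumes H: "subgroup H G" and x: "x \<in> pe H - Zp H" and s: "subgroup (ce H x) G"
 shows "p * card (Zp H) \<le> card (ce H x)"
proof (rule p_subgroup_proper[OF s _ Zp_subgroup[OF H]])
 show "ce H x \<subseteq> P" using ce_pe pe_P by blast
 show "Zp H \<subseteq> ce H x" using Zp_subset_ce x by blast
 show "Zp H \<noteq> ce H x" using mem_ce_self x by blast
qed

text \<open>The factor \<open>2 * p - 1\<close> comes from the union of two conjugate sets that
  overlap in at most a \<open>p\<close>-th part. If \<open>ce H x\<close> is smaller than a Sylow
  subgroup, these are two Sylow subgroups. If it is a Sylow subgroup, they are the centralizers of
  \<open>y\<close> and of a conjugate not commuting with \<open>y\<close>, and
  \<open>abelian_syl_bound\<close> shows that \<open>ce H y\<close> is at least \<open>p\<close>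
  times as large as \<open>ce H x\<close>.\<close>

lemma commutative_centralizer_small:
 assumes H: "subgroup H G" and ns: "\<not> subgroup (pe H) G"
  and x: "x \<in> pe H - Zp H" "commute_on (ce H x)"
  and y: "y \<in> pe H - Zp H" "\<not> commute_on (ce H y)"
 shows "(2 * p - 1) * card (ce H x) \<le> card (pe H)"
proof -
 obtain S where S: "syl H S" using syl_exists[OF H] by blast
 have SG: "subgroup S G" "S \<subseteq> pe H" using S by (auto simp: syl_def)
 have mp: "(2 * p - 1) * card S \<le> p * card (pe H)" using ns SG by (intro many_p_elements[OF S H]) auto
 have AG: "subgroup (ce H x) G" and AP: "ce H x \<subseteq> P" "S \<subseteq> P"
  using commuting_set_subgroup[OF H _ x(2)] x(1) ce_pe pe_P SG by blast+
 have "p * ((2 * p - 1) * card (ce H x)) \<le> p * card (pe H)"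
 proof (cases "card (ce H x) < card S")
  case True
  then have "(2 * p - 1) * (p * card (ce H x)) \<le> (2 * p - 1) * card S"
   using p_power_less p_subgroup_card[OF AG AP(1)] p_subgroup_card[OF SG(1) AP(2)] by auto
  also note mp
  finally show ?thesis by (simp only: mult.left_commute)
 next
  case False
  then have A: "syl H (ce H x)" using syl_max[OF S H AG ce_pe] syl_of_card[OF S AG ce_pe] by simp
  have Ac: "ce H x \<subseteq> \<G>" using ce_pe pe_carrier by blast
  obtain h where h: "h \<in> H" "y \<otimes> cj h y \<noteq> cj h y \<otimes> y" using noncommuting_conjugate[OF H A x(2) y(1)] by blast
  obtain g where g: "g \<in> H" "y \<in> cj g ` ce H x" using syl_containing[OF A H] y(1) by blast
  have gc: "g \<in> \<G>" "h \<in> \<G>" using subgroup.mem_carrier[OF H] g h by auto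
  let ?T = "cj g ` ce H x"
  have T: "syl (cc H y) ?T" "commute_on ?T"
   using syl_cc[OF syl_cj[OF A H g(1)] commute_on_cj[OF gc(1) Ac x(2)] H g(2)] commute_on_cj[OF gc(1) Ac x(2)] .
  have ype: "y \<in> pe H" and yc: "y \<in> \<G>" "y \<in> P" using y pe_carrier pe_P by auto
  let ?y = "cj h y"
  have y'c: "?y \<in> \<G>" and cy: "ce H y \<subseteq> \<G>"
   using pe_carrier pe_cj[OF H h(1) ype] ce_pe by blast+
  have "p * card {z \<in> ce H y. ?y \<otimes> z = z \<otimes> ?y} \<le> card (ce H y)"
  proof (rule centralizing_part_bound[OF yc(2) y'c _ cy])
   show "?y \<otimes> y \<noteq> y \<otimes> ?y" using h(2) by metis
   fix z assume z: "z \<in> ce H y"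
   then have zc: "z \<in> pe H" "z \<in> \<G>" "y \<otimes> z = z \<otimes> y" using cy by (auto simp: ce_iff)
   show "z \<otimes> y \<in> ce H y" unfolding ce_iff
    using pe_mult[OF H zc(1) ype] zc(3) comm_mult[OF yc(1) zc(2) yc(1) zc(3) refl] by simp
  qed
  moreover have "{z \<in> ce H y. ?y \<otimes> z = z \<otimes> ?y} = ce H y \<inter> ce H ?y" by (auto simp: ce_iff)
  ultimately have b2: "p * card (ce H y \<inter> ce H ?y) \<le> card (ce H y)" by simp
  have "card (ce H ?y) = card (ce H y)"
   unfolding ce_cj[OF H h(1) ype] by (rule card_image[OF cj_inj_on[OF gc(2) cy]])
  moreover have "card (ce H y) + card (ce H ?y) = card (ce H y \<union> ce H ?y) + card (ce H y \<inter> ce H ?y)" "card (ce H y \<union> ce H ?y) \<le> card (pe H)"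
   using ce_pe by (auto simp: card_Un_Int[OF ce_finite ce_finite] card_mono pe_finite)
  ultimately have "2 * card (ce H y) \<le> card (pe H) + card (ce H y \<inter> ce H ?y)" by simp
  then have "p * (2 * card (ce H y)) \<le> p * (card (pe H) + card (ce H y \<inter> ce H ?y))" by (rule mult_le_mono2)
  then have "(2 * p - 1) * card (ce H y) \<le> p * card (pe H)" using b2 by (simp add: algebra_simps)
  note b3 = this
  have "(2 * p - 1) * (p * card (ce H x)) \<le> (2 * p - 1) * card (ce H y)"
   by (metis y(2) pe_cc card_image[OF cj_inj_on[OF gc(1) Ac]] abelian_syl_bound[OF cc_subgroup[OF H yc(1)] T] mult_le_mono2)
  also note b3
  finally show ?thesis by (simp only: mult.left_commute)
 qed
 then show ?thesis using p_gt_0 by simp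
qed

text \<open>In both cases \<open>Zp H\<close>, \<open>ce H x\<close> and \<open>pe H\<close> grow by
  a factor \<open>p\<close> at least. The second factor comes from the order of subgroups, from a
  strictly larger Sylow subgroup, or from \<open>many_blocks\<close> when \<open>ce H x\<close> is
  Sylow.\<close>

lemma small_centralizers:
 assumes H: "subgroup H G" and x: "x \<in> pe H - Zp H"
  and cases: "subgroup (pe H) G \<or> (\<forall>u\<in>pe H - Zp H. commute_on (ce H u))"
 shows "p * card (ce H x) \<le> card (pe H)" "p\<^sup>2 * card (Zp H) \<le> card (pe H)"
proof -
 have "p * card (ce H x) \<le> card (pe H) \<and> p * card (Zp H) \<le> card (ce H x)"
 proof (cases "subgroup (pe H) G")
  case True
  have xc: "x \<in> \<G>" using x pe_carrier by auto
  have "ce H x = cc H x \<inter> pe H" using subsetD[OF pe_sub[of H]] by (auto simp: ce_iff cc_def)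
  then have s: "subgroup (ce H x) G" using subgroups_Inter_pair[OF cc_subgroup[OF H xc] True] by simp
  show ?thesis using noncentral_ce x Zp_less[OF H x s] p_subgroup_proper[OF True pe_P s ce_pe] by blast
 next
  case False
  then have all: "\<And>x. x \<in> pe H - Zp H \<Longrightarrow> commute_on (ce H x)" using cases by blast
  have AG: "subgroup (ce H x) G" using commuting_set_subgroup[OF H _ all[OF x]] x by blast
  obtain S where S: "syl H S" using syl_exists[OF H] by blast
  have SG: "subgroup S G" "S \<subseteq> pe H" using S by (auto simp: syl_def)
  have AP: "ce H x \<subseteq> P" "S \<subseteq> P" using ce_pe pe_P SG by blast+
  have "p * card (ce H x) \<le> card (pe H)"
  proof (cases "card (ce H x) < card S")
   case True
   then show ?thesis
    using p_power_less p_subgroup_card[OF AG AP(1)] p_subgroup_card[OF SG(1) AP(2)] card_mono[OF pe_finite SG(2)] by fastforce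
  next
   case nl: False
   then have A: "syl H (ce H x)" using syl_max[OF S H AG ce_pe] syl_of_card[OF S AG ce_pe] by simp
   from many_blocks[OF H all x A] show ?thesis by simp
  qed
  then show ?thesis using Zp_less[OF H x AG] by blast
 qed
 then have a: "p * card (ce H x) \<le> card (pe H)" "p * card (Zp H) \<le> card (ce H x)" by auto
 then show "p * card (ce H x) \<le> card (pe H)" by blast
 have "p * (p * card (Zp H)) \<le> p * card (ce H x)" using a(2) by (rule mult_le_mono2)
 from order.trans[OF this a(1)] show "p\<^sup>2 * card (Zp H) \<le> card (pe H)" by (simp add: power2_eq_square)
qed

definition bd where "bd = ((real p)\<^sup>2 + real p - 1) / real p ^ 3"

text \<open>Elements of \<open>Zp H\<close> commute with everything and are at most a
  \<open>p^2\<close>-th part; the others commute with at most a \<open>p\<close>-th part. This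
  yields the proportion \<open>1/p^2 + (1 - 1/p^2)/p\<close>, and equality forces equality in both
  estimates.\<close>

lemma comm_count_small:
 assumes H: "subgroup H G" and nc: "\<not> commute_on (pe H)"
  and cases: "subgroup (pe H) G \<or> (\<forall>u\<in>pe H - Zp H. commute_on (ce H u))"
 shows "real (\<Sum>x\<in>pe H. card (ce H x)) \<le> bd * (real (card (pe H)))\<^sup>2"
  and "real (\<Sum>x\<in>pe H. card (ce H x)) = bd * (real (card (pe H)))\<^sup>2 \<Longrightarrow>
   p\<^sup>2 * card (Zp H) = card (pe H) \<and> (\<forall>x\<in>pe H - Zp H. p * card (ce H x) = card (pe H))"
proof -
 define n where "n = real (card (pe H))"
 define z where "z = real (card (Zp H))"
 define q where "q = real p"
 define a where "a x = real (card (ce H x))" for x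
 have q2: "q \<ge> 2" using p_ge_2 by (simp add: q_def)
 obtain x0 where x0: "x0 \<in> pe H - Zp H" using nc unfolding commute_on_def Zp_def by blast
 have n0: "n > 0" unfolding n_def using x0 pe_finite by (auto simp: card_gt_0_iff)
 have ab: "q * a x \<le> n" if "x \<in> pe H - Zp H" for x
  using of_nat_mono[OF small_centralizers(1)[OF H that cases]] by (simp add: q_def a_def n_def)
 have fz: "finite (Zp H)" using Zp_pe pe_finite finite_subset by blast
 have az: "ce H x = pe H" if "x \<in> Zp H" for x
  using that unfolding ce_def Zp_def by blast
 have N: "real (\<Sum>x\<in>pe H. card (ce H x)) = z * n + (\<Sum>x\<in>pe H - Zp H. a x)" and cD: "real (card (pe H - Zp H)) = n - z"
  using card_Diff_subset[OF fz Zp_pe] card_mono[OF pe_finite Zp_pe] unfolding a_def z_def n_def by (auto simp: sum.subset_diff[OF Zp_pe pe_finite] az)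
 have S: "q * (\<Sum>x\<in>pe H - Zp H. a x) \<le> (n - z) * n"
 proof -
  have "(\<Sum>x\<in>pe H - Zp H. q * a x) \<le> (\<Sum>x\<in>pe H - Zp H. n)" by (intro sum_mono ab)
  then show ?thesis using cD by (simp add: sum_distrib_left)
 qed
 have bd: "q ^ 3 * bd = q\<^sup>2 + q - 1" unfolding bd_def q_def using p_gt_0 by simp
 let ?N = "real (\<Sum>x\<in>pe H. card (ce H x))"
 have up: "q * ?N \<le> n\<^sup>2 + (q - 1) * (z * n)"
  unfolding N using S by (simp add: algebra_simps power2_eq_square)
 have zn: "(q - 1) * n * (q\<^sup>2 * z) \<le> (q - 1) * n * n"
  using q2 n0 of_nat_mono[OF small_centralizers(2)[OF H x0 cases]] by (simp add: q_def z_def n_def)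
 have up3: "q ^ 3 * ?N \<le> q\<^sup>2 * n\<^sup>2 + (q - 1) * n * (q\<^sup>2 * z)"
 proof -
  have "q\<^sup>2 * (q * ?N) \<le> q\<^sup>2 * (n\<^sup>2 + (q - 1) * (z * n))" using up by (intro mult_left_mono) auto
  then show ?thesis by (simp add: algebra_simps power2_eq_square power3_eq_cube)
 qed
 have rhs: "q ^ 3 * (bd * n\<^sup>2) = q\<^sup>2 * n\<^sup>2 + (q - 1) * n * n"
 proof -
  have "q ^ 3 * (bd * n\<^sup>2) = (q ^ 3 * bd) * n\<^sup>2" by simp
  then show ?thesis unfolding bd by (simp add: algebra_simps power2_eq_square)
 qed
 have "q ^ 3 * ?N \<le> q ^ 3 * (bd * n\<^sup>2)" unfolding rhs using up3 zn by linarith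
 then show "?N \<le> bd * (real (card (pe H)))\<^sup>2" using q2 by (simp add: n_def)
 assume eq: "?N = bd * (real (card (pe H)))\<^sup>2"
 then have e3: "q ^ 3 * ?N = q\<^sup>2 * n\<^sup>2 + (q - 1) * n * n" using rhs n_def by simp
 then have ze: "q\<^sup>2 * z = n" using up3 zn q2 n0 by simp
 have "q * ?N = n\<^sup>2 + (q - 1) * (z * n)"
 proof -
  have "q\<^sup>2 * (q * ?N) = q\<^sup>2 * (n\<^sup>2 + (q - 1) * (z * n))"
   using e3 by (simp add: ze[symmetric] algebra_simps power2_eq_square power3_eq_cube)
  then show ?thesis using q2 by simp
 qed
 then have S2: "q * (\<Sum>x\<in>pe H - Zp H. a x) = (n - z) * n"
  unfolding N by (simp add: algebra_simps power2_eq_square)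
 have "(\<Sum>x\<in>pe H - Zp H. n - q * a x) = 0"
  using S2 cD by (simp add: sum_subtractf sum_distrib_left[symmetric])
 then have "\<forall>x\<in>pe H - Zp H. n - q * a x = 0"
  using ab by (subst (asm) sum_nonneg_eq_0_iff) (auto simp: pe_finite)
 then show "p\<^sup>2 * card (Zp H) = card (pe H) \<and> (\<forall>x\<in>pe H - Zp H. p * card (ce H x) = card (pe H))"
  using ze of_nat_mult of_nat_eq_iff of_nat_power unfolding n_def q_def a_def z_def by fastforce
qed

text \<open>The induction is needed only for mixed groups: there the bound for the smaller group
  \<open>cc H x\<close>, whose \<open>p\<close>-elements are \<open>ce H x\<close>, is the
  hypothesis \<open>Yb\<close> of \<open>commuting_pairs_less\<close>, and the resulting inequality
  is strict.\<close>

lemma comm_count_bound: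
 assumes "subgroup H G" "\<not> commute_on (pe H)"
 shows "real (\<Sum>x\<in>pe H. card (ce H x)) \<le> bd * (real (card (pe H)))\<^sup>2 \<and>
  (subgroup (pe H) G \<or> (\<forall>u\<in>pe H - Zp H. commute_on (ce H u)) \<or>
   real (\<Sum>x\<in>pe H. card (ce H x)) < bd * (real (card (pe H)))\<^sup>2)"
 using assms
proof (induction "card H" arbitrary: H rule: less_induct)
 case (less H)
 note H = less(2)
 show ?case
 proof (cases "subgroup (pe H) G \<or> (\<forall>u\<in>pe H - Zp H. commute_on (ce H u))")
  case True
  then show ?thesis using comm_count_small(1)[OF H less(3)] by blast
 next
  case False
  let ?E = "pe H" and ?c = "\<lambda>x y. x \<otimes> y = y \<otimes> x"
  let ?X = "{x \<in> pe H - Zp H. commute_on (ce H x)}" and ?Y = "{x \<in> pe H - Zp H. \<not> commute_on (ce H x)}"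
  have ce': "{y \<in> ?E. ?c x y} = ce H x" for x by (simp add: ce_def)
  obtain y where y: "y \<in> pe H - Zp H" "\<not> commute_on (ce H y)" using False by blast
  have "real (\<Sum>x\<in>?E. card {y \<in> ?E. ?c x y}) < ((real p)\<^sup>2 + real p - 1) / real p ^ 3 * (real (card ?E))\<^sup>2"
  proof (rule commuting_pairs_less[where Z = "Zp H" and X = ?X and Y = ?Y, OF pe_finite _ p_ge_2])
   show "?c x y \<longleftrightarrow> ?c y x" for x y by metis
   show "p * card {y \<in> ?E. ?c x y \<and> ?c w y} \<le> card {y \<in> ?E. ?c x y}"
    if x: "x \<in> ?E" and w: "w \<in> ?E" and n: "\<not> ?c x w" for x w
   proof -
    have xc: "x \<in> \<G>" "w \<in> \<G>" "x \<in> P" and cx: "ce H x \<subseteq> \<G>"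
     using x w pe_carrier pe_P ce_pe by blast+
    have "p * card {y \<in> ce H x. ?c w y} \<le> card (ce H x)"
    proof (rule centralizing_part_bound[OF xc(3,2) _ cx])
     show "w \<otimes> x \<noteq> x \<otimes> w" using n by metis
     fix z assume z: "z \<in> ce H x"
     then have zc: "z \<in> pe H" "z \<in> \<G>" "x \<otimes> z = z \<otimes> x"
      using cx by (auto simp: ce_iff)
     show "z \<otimes> x \<in> ce H x" unfolding ce_iff
      using pe_mult[OF H zc(1) x] zc(3) comm_mult[OF xc(1) zc(2) xc(1) zc(3) refl] by simp
    qed
    then show ?thesis by (auto simp: ce_def)
   qed
   show "?E = Zp H \<union> ?X \<union> ?Y" using Zp_pe by blast
   show "Zp H \<inter> ?X = {}" "Zp H \<inter> ?Y = {}" "?X \<inter> ?Y = {}" by blast+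
   show "?Y \<noteq> {}" using y by blast
   show "card {y \<in> ?E. ?c x y} = card ?E" if "x \<in> Zp H" for x
    using that unfolding Zp_def by (intro arg_cong[where f = card]) blast
   show "(2 * p - 1) * card {y \<in> ?E. ?c x y} \<le> card ?E" if "x \<in> ?X" for x
    unfolding ce' using commutative_centralizer_small[OF H _ _ _ y, of x] False that by blast
   show "real (\<Sum>w | w \<in> ?E \<and> ?c x w. card {y \<in> ?E. ?c x y \<and> ?c w y})
     \<le> ((real p)\<^sup>2 + real p - 1) / real p ^ 3 * (real (card {y \<in> ?E. ?c x y}))\<^sup>2" if x: "x \<in> ?Y" for x
   proof -
    have xc: "x \<in> \<G>" using x pe_carrier by auto
    show ?thesis using less(1)[OF cc_card_less[OF H] cc_subgroup[OF H xc]] x by (simp add: ce_def pe_cc bd_def)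
   qed
  qed
  then show ?thesis by (simp add: ce' bd_def)
 qed
qed

end

section \<open>The blocks of an extremal group\<close>

context fin_group_prime begin

lemma pe_carrier_G: "pe \<G> = P"
 using P_subset by (auto simp: pe_def)

lemma bd_less_one: "bd < 1"
proof -
 have p2: "real p \<ge> 2" using p_ge_2 by simp
 have "real p * real p \<ge> 2 * 2" using p2 by (intro mult_mono) auto
 then have "(real p - 1) * (real p * real p - 1) > 0" using p2 by (intro mult_pos_pos) auto
 then show ?thesis using p_gt_0 by (simp add: power2_eq_square power3_eq_cube algebra_simps bd_def)
qed

lemma Pr_count: "Pr G p = real (\<Sum>x\<in>P. card (ce \<G> x)) / (real (card P))\<^sup>2"
proof -
 have "{(x, y) \<in> P \<times> P. x \<otimes> y = y \<otimes> x} = (SIGMA x:P. ce \<G> x)"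
  by (auto simp: ce_def pe_carrier_G)
 then show ?thesis unfolding Pr_def using P_fin ce_finite by simp
qed

lemma card_P_pos: "card P > 0"
 using P_fin P_one by (metis card_gt_0_iff empty_iff)

lemma Pr_commute: assumes "commute_on P" shows "Pr G p = 1"
proof -
 have "ce \<G> x = P" if "x \<in> P" for x
  using assms that unfolding ce_def pe_carrier_G commute_on_def by blast
 then show ?thesis unfolding Pr_count using card_P_pos by (simp add: power2_eq_square)
qed

lemma equality_cases:
 assumes "Pr G p = bd"
 shows "subgroup P G \<or> (\<forall>u\<in>P - Zp \<G>. commute_on (ce \<G> u))"
  and "p\<^sup>2 * card (Zp \<G>) = card P"
  and "\<And>x. x \<in> P - Zp \<G> \<Longrightarrow> p * card (ce \<G> x) = card P"
proof -
 let ?H = "\<G>"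
 have nc: "\<not> commute_on (pe ?H)" and eq: "real (\<Sum>x\<in>pe ?H. card (ce ?H x)) = bd * (real (card (pe ?H)))\<^sup>2"
  using Pr_commute assms bd_less_one card_P_pos unfolding pe_carrier_G Pr_count by (auto simp: field_simps)
 have 1: "subgroup (pe ?H) G \<or> (\<forall>u\<in>pe ?H - Zp ?H. commute_on (ce ?H u))"
  using comm_count_bound[OF subgroup_self nc] eq by linarith
 show "subgroup P G \<or> (\<forall>u\<in>P - Zp ?H. commute_on (ce ?H u))" using 1 unfolding pe_carrier_G .
 from comm_count_small(2)[OF subgroup_self nc 1 eq]
 show "p\<^sup>2 * card (Zp ?H) = card P" "\<And>x. x \<in> P - Zp ?H \<Longrightarrow> p * card (ce ?H x) = card P"
  unfolding pe_carrier_G by blast+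
qed

lemma commutes_generate:
 assumes "x \<in> \<G>" "K \<subseteq> \<G>" "\<And>k. k \<in> K \<Longrightarrow> x \<otimes> k = k \<otimes> x" "g \<in> generate G K"
 shows "x \<otimes> g = g \<otimes> x"
 using assms(4)
proof (induction rule: generate.induct)
 case (eng a b)
 then show ?case using assms(1,2) generate_in_carrier[OF assms(2)] by (intro comm_mult) auto
qed (use assms comm_inv in auto)

end

text \<open>All that is kept of the count when \<open>P\<close> is not a subgroup.
  \<open>Z_iff\<close> asks for centrality in the whole group, which is where generation by
  \<open>p\<close>-elements enters. \<open>BL_norm\<close> and \<open>BL_max\<close> record that the
  blocks are the Sylow subgroups.\<close>

locale block_group = fin_group_prime +
 fixes Z :: "'a set" and BL :: "'a set set"
 assumes gen: "carrier G = generate G P"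
  and Z_subgroup: "subgroup Z G" and Z_P: "Z \<subseteq> P"
  and Z_iff: "z \<in> Z \<longleftrightarrow> z \<in> P \<and> (\<forall>g\<in>carrier G. z \<otimes> g = g \<otimes> z)"
  and BL_subgroup: "B \<in> BL \<Longrightarrow> subgroup B G"
  and Z_BL: "B \<in> BL \<Longrightarrow> Z \<subseteq> B" and BL_P: "B \<in> BL \<Longrightarrow> B \<subseteq> P"
  and BL_comm: "B \<in> BL \<Longrightarrow> commute_on B"
  and BL_card: "card BL = p + 1"
  and BL_ne_Z: "B \<in> BL \<Longrightarrow> B \<noteq> Z"
  and BL_cover: "x \<in> P \<Longrightarrow> \<exists>B\<in>BL. x \<in> B"
  and BL_inter: "B \<in> BL \<Longrightarrow> B' \<in> BL \<Longrightarrow> B \<noteq> B' \<Longrightarrow> B \<inter> B' = Z"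
  and BL_cj: "B \<in> BL \<Longrightarrow> g \<in> carrier G \<Longrightarrow> cj g ` B \<in> BL"
  and BL_norm: "B \<in> BL \<Longrightarrow> x \<in> P \<Longrightarrow> cj x ` B = B \<Longrightarrow> x \<in> B"
  and BL_max: "B \<in> BL \<Longrightarrow> subgroup K G \<Longrightarrow> K \<subseteq> P \<Longrightarrow> card K \<le> card B"

context fin_group_prime begin

lemma block_structure:
 assumes gen: "\<G> = generate G P" and eq: "Pr G p = bd" and ns: "\<not> subgroup P G"
 shows "block_group G p (Zp \<G>) (ce \<G> ` (P - Zp \<G>))"
proof -
 let ?H = "\<G>" and ?Z = "Zp \<G>"
 let ?BL = "ce ?H ` (P - ?Z)"
 have all: "\<And>u. u \<in> pe ?H - ?Z \<Longrightarrow> commute_on (ce ?H u)"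
  using equality_cases(1)[OF eq] ns unfolding pe_carrier_G by blast
 have H: "subgroup ?H G" by (rule subgroup_self)
 have Zsub: "subgroup ?Z G" by (rule Zp_subgroup[OF H])
 have sub: "subgroup (ce ?H x) G" if "x \<in> P - ?Z" for x
  using commuting_set_subgroup[OF H _ all] that pe_carrier_G by blast
 obtain S where S: "syl ?H S" using syl_exists[OF H] by blast
 have SG: "subgroup S G" "S \<subseteq> P" using S unfolding syl_def pe_carrier_G by auto
 have cS: "card S < card P" by (metis SG ns P_fin psubset_card_mono psubsetI)
 have ceP: "ce ?H x \<subseteq> P" for x using ce_pe[of ?H x] unfolding pe_carrier_G .
 \<comment> \<open>A block smaller than \<open>S\<close> would satisfy
   \<open>p * card (ce ?H x) <= card S < card P\<close>, whereas the left-hand side equals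
   \<open>card P\<close>.\<close>
 have max: "card K \<le> card (ce ?H x)" if x: "x \<in> P - ?Z" and K: "subgroup K G" "K \<subseteq> pe ?H" for K x
 proof -
  have "\<not> card (ce ?H x) < card S"
   using p_power_less p_subgroup_card[OF sub[OF x] ceP] p_subgroup_card[OF SG] equality_cases(3)[OF eq x] cS by fastforce
  then show ?thesis using syl_max[OF S H K] by simp
 qed
 have cB: "card (ce ?H x) = p * card ?Z" if "x \<in> P - ?Z" for x
 proof -
  have "p * card (ce ?H x) = p * (p * card ?Z)"
   using equality_cases(2)[OF eq] equality_cases(3)[OF eq that] by (simp add: power2_eq_square)
  then show ?thesis using p_gt_0 by (metis mult_left_cancel not_gr_zero)
 qed
 have Zce: "?Z \<subseteq> ce ?H x" if "x \<in> P" for x using Zp_subset_ce that pe_carrier_G by blast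
 have selfce: "x \<in> ce ?H x" if "x \<in> P" for x using mem_ce_self that pe_carrier_G by blast
 have int: "ce ?H x \<inter> ce ?H y = ?Z" if "x \<in> P - ?Z" "y \<in> P - ?Z" "ce ?H x \<noteq> ce ?H y" for x y
  using blocks_inter[OF all _ _ that(3)] that pe_carrier_G by blast
 have finBL: "finite ?BL" using P_fin by blast
 have "card (\<Union>B\<in>?BL. B - ?Z) = (\<Sum>B\<in>?BL. card (B - ?Z))"
 proof (rule card_UN_disjoint[OF finBL])
  show "\<forall>B\<in>?BL. finite (B - ?Z)" using ce_finite by blast
  show "\<forall>B\<in>?BL. \<forall>B'\<in>?BL. B \<noteq> B' \<longrightarrow> (B - ?Z) \<inter> (B' - ?Z) = {}" using int by blast
 qed
 also have "(\<Union>B\<in>?BL. B - ?Z) = P - ?Z" using ceP selfce by blast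
 also have "(\<Sum>B\<in>?BL. card (B - ?Z)) = (\<Sum>B\<in>?BL. p * card ?Z - card ?Z)"
 proof (rule sum.cong[OF refl])
  fix B assume "B \<in> ?BL"
  then obtain x where x: "x \<in> P - ?Z" "B = ce ?H x" by blast
  then show "card (B - ?Z) = p * card ?Z - card ?Z"
   using cB[OF x(1)] Zce subgroup_finite[OF Zsub] by (simp add: card_Diff_subset)
 qed
 \<comment> \<open>The total is \<open>(p^2 - 1) * card ?Z\<close> and each block contributes
   \<open>(p - 1) * card ?Z\<close>; hence there are \<open>p + 1\<close> blocks.\<close>
 finally have "card (P - ?Z) = card ?BL * (p * card ?Z - card ?Z)" by simp
 then have "card ?BL * (p * card ?Z - card ?Z) = (p + 1) * (p * card ?Z - card ?Z)"
  using equality_cases(2)[OF eq] Zp_pe[of ?H] subgroup_finite[OF Zsub] by (simp add: card_Diff_subset power2_eq_square diff_mult_distrib2 pe_carrier_G)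
 moreover have "p * card ?Z - card ?Z > 0"
  using subgroup_card_pos[OF Zsub] p_ge_2 by simp
 ultimately have card: "card ?BL = p + 1" by (metis mult_right_cancel not_gr_zero)
 have Ziff: "z \<in> ?Z \<longleftrightarrow> z \<in> P \<and> (\<forall>g\<in>\<G>. z \<otimes> g = g \<otimes> z)" for z
 proof
  assume z: "z \<in> ?Z"
  then have zP: "z \<in> P" using Zp_pe[of ?H] unfolding pe_carrier_G by blast
  have "z \<otimes> g = g \<otimes> z" if "g \<in> \<G>" for g
   using that unfolding gen
   by (rule commutes_generate[OF P_carrier[OF zP] P_subset, rotated]) (use z in \<open>auto simp: Zp_def pe_carrier_G\<close>)
  then show "z \<in> P \<and> (\<forall>g\<in>\<G>. z \<otimes> g = g \<otimes> z)" using zP by blast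
 next
  assume "z \<in> P \<and> (\<forall>g\<in>\<G>. z \<otimes> g = g \<otimes> z)"
  then show "z \<in> ?Z" unfolding Zp_def pe_carrier_G using P_carrier by blast
 qed
 show ?thesis
 proof (rule block_group.intro[OF fin_group_prime_axioms], rule block_group_axioms.intro)
  show "\<G> = generate G P" by (rule gen)
  show "subgroup ?Z G" by (rule Zsub)
  show "?Z \<subseteq> P" using Zp_pe[of ?H] unfolding pe_carrier_G .
  show "z \<in> ?Z \<longleftrightarrow> z \<in> P \<and> (\<forall>g\<in>\<G>. z \<otimes> g = g \<otimes> z)" for z by (rule Ziff)
  show "card ?BL = p + 1" by (rule card)
 next
  fix x assume "x \<in> P"
  show "\<exists>B\<in>?BL. x \<in> B"
  proof (cases "x \<in> ?Z")
   case False then show ?thesis using selfce \<open>x \<in> P\<close> by blast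
  next
   case True
   have "?BL \<noteq> {}" using card by (metis add_eq_0_iff_both_eq_0 card.empty one_neq_zero)
   then show ?thesis using True Zce by blast
  qed
 next
  fix B assume B: "B \<in> ?BL"
  then obtain x where x: "x \<in> P - ?Z" "B = ce ?H x" by blast
  show "subgroup B G" "?Z \<subseteq> B" "B \<subseteq> P" "B \<noteq> ?Z"
   unfolding x(2) using sub[OF x(1)] Zce ceP selfce x(1) by auto
  show "commute_on B" unfolding x(2) using all x(1) pe_carrier_G by blast
  show "B' \<in> ?BL \<Longrightarrow> B \<noteq> B' \<Longrightarrow> B \<inter> B' = ?Z" for B' using int B by blast
  show "cj g ` B \<in> ?BL" if g: "g \<in> \<G>" for g
  proof -
   have xp: "x \<in> pe ?H" using x pe_carrier_G by blast
   have "cj g x \<in> P" using P_cj g x by blast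
   moreover have "cj g x \<notin> ?Z"
   proof
    assume a: "cj g x \<in> ?Z"
    have xc: "x \<in> \<G>" using x P_carrier by blast
    have "x = cj g x" using a Ziff g xc cj_def m_assoc by fastforce
    then show False using a x by simp
   qed
   ultimately show ?thesis by (simp add: ce_cj[OF H g xp, symmetric] x(2))
  qed
  show "subgroup K G \<Longrightarrow> K \<subseteq> P \<Longrightarrow> card K \<le> card B" for K
   unfolding x(2) using max[OF x(1)] pe_carrier_G by blast
  show "y \<in> B" if y: "y \<in> P" "cj y ` B = B" for y
   unfolding x(2)
  proof (rule normalized_imp_mem[OF sub[OF x(1)] ce_pe H max[OF x(1)]])
   show "y \<in> pe ?H" using y pe_carrier_G by blast
   show "cj y ` ce ?H x = ce ?H x" using y(2) x(2) by simp
  qed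
 qed
qed

end

section \<open>The doubly transitive action on the blocks\<close>

context block_group begin

lemma Z_carrier: "Z \<subseteq> \<G>" using Z_P P_subset by blast
lemma BL_carrier: "B \<in> BL \<Longrightarrow> B \<subseteq> \<G>" using BL_P P_subset by blast
lemma Z_comm: "z \<in> Z \<Longrightarrow> g \<in> \<G> \<Longrightarrow> z \<otimes> g = g \<otimes> z" using Z_iff by blast
lemma BL_finite: "finite BL" using BL_card by (metis add_eq_0_iff_both_eq_0 card.infinite one_neq_zero)

lemma cj_Z: "z \<in> Z \<Longrightarrow> g \<in> \<G> \<Longrightarrow> cj g z = z"
 using Z_comm Z_carrier by (subst cj_self) auto

lemma cj_by_Z: "z \<in> Z \<Longrightarrow> x \<in> \<G> \<Longrightarrow> cj z x = x"
 using Z_comm Z_carrier by (subst cj_self) auto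

lemma Z_center: "Z \<subseteq> center G"
 using Z_iff P_carrier by (auto simp: center_def)

lemma BL_self: "B \<in> BL \<Longrightarrow> x \<in> B \<Longrightarrow> cj x ` B = B"
proof -
 assume B: "B \<in> BL" "x \<in> B"
 have "cj x b = b" if "b \<in> B" for b
  using commute_onD[OF BL_comm[OF B(1)] B(2) that] BL_carrier[OF B(1)] B(2) that by (subst cj_self) auto
 then show ?thesis by simp
qed

lemma root_Z: assumes "x \<in> P" "x [^] (d::nat) \<in> Z" "\<not> p dvd d" shows "x \<in> Z"
 by (metis P_root assms subgroup_pow[OF Z_subgroup assms(2)])

lemma act_inj: "g \<in> \<G> \<Longrightarrow> A \<subseteq> \<G> \<Longrightarrow> B \<subseteq> \<G> \<Longrightarrow> cj g ` A = cj g ` B \<Longrightarrow> A = B"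
 using inj_on_image_eq_iff[OF cj_inj_on[OF _ subset_refl]] by blast

lemma act_inv: "g \<in> \<G> \<Longrightarrow> A \<subseteq> \<G> \<Longrightarrow> cj g ` A = B \<Longrightarrow> cj (inv g) ` B = A"
 by (metis cj_image_cj cj_image_one inv_closed l_inv)

text \<open>Otherwise \<open>x [^] (j - i)\<close> fixes \<open>T\<close> and so lies in
  \<open>T\<close>, hence in the intersection \<open>Z\<close> of \<open>T\<close> and
  \<open>B\<close>. As \<open>j - i\<close> is prime to \<open>p\<close>, then \<open>x\<close>
  would lie in \<open>Z\<close> as well.\<close>

lemma moves_distinct:
 assumes B: "B \<in> BL" and T: "T \<in> BL" "T \<noteq> B" and x: "x \<in> B - Z"
  and e: "cj (x [^] i) ` T = cj (x [^] (j::nat)) ` T" and "i < j" "j < i + p"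
 shows False
proof -
 have xP: "x \<in> P" "x \<in> \<G>" using x BL_P[OF B] P_subset by auto
 have Tc: "T \<subseteq> \<G>" by (rule BL_carrier[OF T(1)])
 have "x [^] j = x [^] i \<otimes> x [^] (j - i)" using assms(6) xP by (simp add: nat_pow_mult)
 then have "T = cj (x [^] (j - i)) ` T"
  by (simp add: e xP act_inj[of "x [^] i" T] BL_carrier[OF BL_cj[OF T(1)]] Tc cj_image_cj[OF _ _ Tc])
 then have "x [^] (j - i) \<in> Z"
  using BL_norm[OF T(1) P_pow[OF xP(1)]] subgroup_pow[OF BL_subgroup[OF B]] x BL_inter[OF B T(1)] T(2) by auto
 moreover have "\<not> p dvd j - i" using assms(6,7) by (auto dest: dvd_imp_le)
 ultimately show False using root_Z xP x by blast
qed

lemma moves_all: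
 assumes B: "B \<in> BL" and T: "T \<in> BL" "T \<noteq> B" and x: "x \<in> B - Z"
 shows "(\<lambda>i::nat. cj (x [^] i) ` T) ` {..<p} = BL - {B}"
proof (rule card_subset_eq)
 show "finite (BL - {B})" using BL_finite by simp
 have inj: "inj_on (\<lambda>i::nat. cj (x [^] i) ` T) {..<p}"
 proof (rule inj_onI)
  fix i j :: nat assume ij: "i \<in> {..<p}" "j \<in> {..<p}" "cj (x [^] i) ` T = cj (x [^] j) ` T"
  show "i = j" using moves_distinct[OF B T x ij(3)] moves_distinct[OF B T x ij(3)[symmetric]] ij by fastforce
 qed
 show "card ((\<lambda>i::nat. cj (x [^] i) ` T) ` {..<p}) = card (BL - {B})"
  using BL_card B by (simp add: card_image[OF inj])
 show "(\<lambda>i::nat. cj (x [^] i) ` T) ` {..<p} \<subseteq> BL - {B}"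
 proof (rule image_subsetI)
  fix i :: nat
  have xi: "x [^] i \<in> \<G>" "x [^] i \<in> B"
   using subgroup_pow[OF BL_subgroup[OF B]] x BL_carrier[OF B] by auto
  show "cj (x [^] i) ` T \<in> BL - {B}"
   using BL_cj[OF T(1) xi(1)] BL_self[OF B xi(2)] act_inj[OF xi(1) BL_carrier[OF T(1)] BL_carrier[OF B]] T by blast
 qed
qed

text \<open>The powers of \<open>x\<close> below \<open>p\<close> already carry \<open>T\<close> to
  all blocks other than \<open>B\<close>, so \<open>x [^] p\<close> acts on \<open>T\<close> like
  one of them. By \<open>moves_distinct\<close> that one is the power 0, whence
  \<open>x [^] p\<close> fixes \<open>T\<close>.\<close>

lemma pow_p_in_Z: assumes B: "B \<in> BL" and x: "x \<in> B" shows "x [^] p \<in> Z"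
proof (cases "x \<in> Z")
 case True then show ?thesis using subgroup_pow[OF Z_subgroup] by blast
next
 case False
 have "BL \<noteq> {B}" using BL_card p_gt_0 by auto
 then obtain T where T: "T \<in> BL" "T \<noteq> B" using B by blast
 have xB: "x \<in> B - Z" and xp: "x [^] p \<in> \<G>" "x [^] p \<in> B" "x [^] p \<in> P"
  using x False subgroup_pow[OF BL_subgroup[OF B] x] BL_carrier[OF B] BL_P[OF B] by auto
 have "cj (x [^] p) ` T \<in> (\<lambda>i::nat. cj (x [^] i) ` T) ` {..<p}"
  using act_inj[OF xp(1) BL_carrier[OF T(1)] BL_carrier[OF B]] BL_self[OF B xp(2)] T(2) BL_cj[OF T(1) xp(1)] by (auto simp: moves_all[OF B T xB])
 then obtain i where i: "i < p" "cj (x [^] i) ` T = cj (x [^] p) ` T" by auto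
 then have "i = 0" using moves_distinct[OF B T xB i(2)] by auto
 then show ?thesis using i BL_carrier[OF T(1)] BL_norm[OF T(1) xp(3)] BL_inter[OF B T(1)] T(2) xp by auto
qed

lemma third_block: "\<exists>R\<in>BL. R \<noteq> A \<and> R \<noteq> C"
proof -
 have "card {A, C} \<le> 2" by (simp add: card_insert_if)
 then show ?thesis using BL_card p_ge_2 card_mono[of "{A, C}" BL] by auto
qed

lemma noncentral_in_block: assumes "B \<in> BL" obtains x where "x \<in> B - Z" "x \<in> \<G>" "x \<in> P"
 using BL_ne_Z[OF assms] Z_BL[OF assms] BL_carrier[OF assms] BL_P[OF assms] by blast

lemma moves_to:
 assumes B: "B \<in> BL" and T: "T \<in> BL" "T \<noteq> B" and x: "x \<in> B - Z" and C: "C \<in> BL" "C \<noteq> B"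
 shows "\<exists>i. i < p \<and> cj (x [^] (i::nat)) ` T = C"
proof -
 have "C \<in> (\<lambda>i::nat. cj (x [^] i) ` T) ` {..<p}" unfolding moves_all[OF B T x] using C by blast
 then show ?thesis by auto
qed

lemma transitive: assumes "A \<in> BL" "C \<in> BL" shows "\<exists>g\<in>\<G>. cj g ` A = C"
proof -
 obtain R where R: "R \<in> BL" "R \<noteq> A" "R \<noteq> C" using third_block by blast
 obtain x where x: "x \<in> R - Z" "x \<in> \<G>" using noncentral_in_block[OF R(1)] by blast
 show ?thesis using moves_to[OF R(1) assms(1) _ x(1) assms(2)] R x by auto
qed

lemma two_transitive:
 assumes "A \<in> BL" "B \<in> BL" "A \<noteq> B" "C \<in> BL" "D \<in> BL" "C \<noteq> D"
 shows "\<exists>g\<in>\<G>. cj g ` A = C \<and> cj g ` B = D"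
proof -
 obtain g where g: "g \<in> \<G>" "cj g ` A = C" using transitive assms by blast
 have B': "cj g ` B \<in> BL" "cj g ` B \<noteq> C"
  using BL_cj[OF assms(2) g(1)] act_inj[OF g(1) BL_carrier BL_carrier, of A B] assms g by auto
 obtain y where y: "y \<in> C - Z" "y \<in> \<G>" using noncentral_in_block[OF assms(4)] by blast
 obtain i where i: "cj (y [^] (i::nat)) ` (cj g ` B) = D"
  using moves_to[OF assms(4) B' y(1) assms(5)] assms(6) by blast
 have yi: "y [^] i \<in> \<G>" "y [^] i \<in> C" using y subgroup_pow[OF BL_subgroup[OF assms(4)]] by auto
 have "cj (y [^] i \<otimes> g) ` A = C" "cj (y [^] i \<otimes> g) ` B = D"
  using i g yi BL_self[OF assms(4) yi(2)] cj_image_cj[OF yi(1) g(1) BL_carrier] assms by auto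
 then show ?thesis using g yi by blast
qed

lemma center_subgroup: "subgroup (center G) G" using center_normal normal_imp_subgroup by blast

lemma center_comm: "c \<in> center G \<Longrightarrow> g \<in> \<G> \<Longrightarrow> c \<otimes> g = g \<otimes> c" by (simp add: center_def)
lemma center_carrier: "c \<in> center G \<Longrightarrow> c \<in> \<G>" by (simp add: center_def)

lemma center_iff_P: "g \<in> \<G> \<Longrightarrow> (\<And>x. x \<in> P \<Longrightarrow> g \<otimes> x = x \<otimes> g) \<Longrightarrow> g \<in> center G"
 unfolding center_def using commutes_generate[OF _ P_subset] gen by blast

lemma P_center: "x \<in> P \<Longrightarrow> x \<in> center G \<Longrightarrow> x \<in> Z"
 using Z_iff by (auto simp: center_def)

lemma cj_center: "c \<in> center G \<Longrightarrow> x \<in> \<G> \<Longrightarrow> cj c x = x"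
 using cj_self center_comm center_carrier by metis

text \<open>For a \<open>p\<close>-element \<open>x\<close> in a block \<open>B\<close> the elements
  \<open>x\<close> and \<open>cj g x\<close> permute the blocks alike, so their quotient lies in
  \<open>B\<close> and in a second block \<open>T\<close>, hence in \<open>Z\<close>. Conjugation by
  \<open>g\<close> thus moves every \<open>p\<close>-element only by a factor in
  \<open>Z\<close>.\<close>

lemma fixes_all_imp_center:
 assumes g: "g \<in> \<G>" and f: "\<And>B. B \<in> BL \<Longrightarrow> cj g ` B = B"
 shows "g \<in> center G"
proof -
 have ez: "\<exists>z\<in>Z. cj g x = x \<otimes> z" if x: "x \<in> P" for x
 proof (cases "x \<in> Z")
  case True
  then show ?thesis using cj_Z[OF True g] subgroup.one_closed[OF Z_subgroup] P_carrier[OF x] by (intro bexI[of _ \<one>]) simp_all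
 next
  case False
  obtain B where B: "B \<in> BL" "x \<in> B" using BL_cover[OF x] by blast
  obtain T where T: "T \<in> BL" "T \<noteq> B" using third_block by blast
  have xc: "x \<in> \<G>" by (rule P_carrier[OF x])
  let ?y = "cj g x"
  have yB: "?y \<in> B" and yc: "?y \<in> \<G>" using f[OF B(1)] B(2) g xc by auto
  have Tc: "T \<subseteq> \<G>" by (rule BL_carrier[OF T(1)])
  have "?y \<otimes> g = g \<otimes> x" using g xc by (simp add: cj_def m_assoc)
  then have "cj ?y ` (cj g ` T) = cj g ` (cj x ` T)" using g xc by (simp add: cj_image_cj[OF _ _ Tc])
  then have "cj (inv x) ` (cj ?y ` T) = T" by (metis f T(1) BL_cj[OF T(1) xc] act_inv[OF xc Tc])
  then have "inv x \<otimes> ?y \<in> Z"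
   using cj_image_cj[OF _ yc Tc] xc BL_norm[OF T(1)] BL_P[OF B(1)] BL_inter[OF B(1) T(1)] T(2) subgroup.m_closed[OF BL_subgroup[OF B(1)] subgroup.m_inv_closed[OF BL_subgroup[OF B(1)] B(2)] yB] by auto
  moreover have "?y = x \<otimes> (inv x \<otimes> ?y)" using xc yc by (simp add: m_assoc[symmetric])
  ultimately show ?thesis by blast
 qed
 obtain a m where am: "order G = p ^ a * m" "\<not> p dvd m"
 proof -
  obtain S m where "syl \<G> S" and m: "subgroup S G" "S \<subseteq> pe \<G>" "card \<G> = card S * m" "\<not> p dvd m"
   by (metis syl_exists[OF subgroup_self] syl_def)
  then show thesis using that p_subgroup_card[OF m(1)] pe_P unfolding order_def by force
 qed
 have o: "g [^] (p ^ a * m) = \<one>" using pow_order_eq_1[OF g] am by simp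
 \<comment> \<open>\<open>h\<close> and \<open>k\<close> are essentially the parts of
   \<open>g\<close> of order prime to \<open>p\<close> and of \<open>p\<close>-power order. For
   \<open>h\<close> the accumulated factor in \<open>Z\<close> is a \<open>p\<close>-element killed
   by \<open>m\<close>, hence trivial. \<open>k\<close> is a \<open>p\<close>-element fixing all
   blocks, so it lies in all of them and thus in \<open>Z\<close>. A Bezout relation recovers
   \<open>g\<close>.\<close>
 define h where "h = g [^] (p ^ a)"
 define k where "k = g [^] m"
 have hk: "h \<in> \<G>" "k \<in> \<G>" using g by (auto simp: h_def k_def)
 have "h \<otimes> x = x \<otimes> h" if x: "x \<in> P" for x
 proof -
  have xc: "x \<in> \<G>" by (rule P_carrier[OF x])
  obtain z where z: "z \<in> Z" "cj g x = x \<otimes> z" using ez[OF x] by blast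
  have zc: "z \<in> \<G>" using z Z_carrier by blast
  have pw: "cj (g [^] n) x = x \<otimes> z [^] n" for n :: nat
  proof (induction n)
   case 0 then show ?case using xc by simp
  next
   case (Suc n)
   have "cj (g [^] Suc n) x = cj (g [^] n) (cj g x)" using g xc by (simp add: cj_cj)
   also have "\<dots> = cj (g [^] n) x \<otimes> cj (g [^] n) z" using z g xc zc by (simp add: cj_mult)
   also have "cj (g [^] n) z = z" using cj_Z[OF z(1)] g by simp
   finally show ?case using Suc xc zc by (simp add: m_assoc)
  qed
  have "cj (g [^] (p ^ a * m)) x = x" using o xc by simp
  then have "z [^] (p ^ a) = \<one>" using pw xc zc P_eq_one[OF P_pow _ am(2)] z Z_P nat_pow_pow by auto
  then show ?thesis using pw xc cj_self hk by (fastforce simp: h_def)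
 qed
 then have hC: "h \<in> center G" by (rule center_iff_P[OF hk(1)])
 have kP: "k \<in> P" unfolding P_iff k_def using g o by (auto simp: nat_pow_pow mult.commute)
 have fk: "cj (g [^] n) ` B = B" if "B \<in> BL" for B and n :: nat
 proof (induction n)
  case 0 then show ?case using BL_carrier[OF that] by simp
 next
  case (Suc n)
  have "cj (g [^] Suc n) ` B = cj (g [^] n) ` (cj g ` B)" using g by (simp add: cj_image_cj[OF _ _ BL_carrier[OF that]])
  then show ?case using Suc f[OF that] by simp
 qed
 have "k \<in> B" if "B \<in> BL" for B using BL_norm[OF that kP] fk[OF that] unfolding k_def by blast
 moreover obtain B T where "B \<in> BL" "T \<in> BL" "B \<noteq> T" using third_block by metis
 ultimately have "k \<in> Z" using BL_inter by blast
 then have kC: "k \<in> center G" using Z_center by blast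
 obtain e where "[p ^ a * e = 1] (mod m)"
  using am(2) prime cong_solve_coprime_nat[of "p ^ a" m] by (auto simp: prime_imp_coprime)
 then obtain q where q: "p ^ a * e + m * q = 1 \<or> p ^ a * e = 1 + m * q"
  by (metis cong_sym add.commute mult.commute nat_le_linear cong_le_nat)
 have pc: "h [^] e \<in> center G" "k [^] q \<in> center G" using subgroup_pow[OF center_subgroup] hC kC by auto
 have he: "h [^] e = g [^] (p ^ a * e)" "k [^] q = g [^] (m * q)" using g by (auto simp: h_def k_def nat_pow_pow)
 from q show ?thesis
 proof
  assume "p ^ a * e + m * q = 1"
  then show ?thesis by (metis g he pc subgroup.m_closed[OF center_subgroup] nat_pow_mult nat_pow_eone)
 next
  assume "p ^ a * e = 1 + m * q"
  then have "h [^] e = g \<otimes> k [^] q" using g he by (metis nat_pow_mult nat_pow_eone)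
  then have "g = h [^] e \<otimes> inv (k [^] q)" using g hk by (simp add: m_assoc)
  then show ?thesis using pc subgroup.m_closed[OF center_subgroup] subgroup.m_inv_closed[OF center_subgroup] by metis
 qed
qed

lemma block_elements:
 assumes B: "B \<in> BL" and x: "x \<in> B - Z" and s: "s \<in> B"
 shows "\<exists>i<p. \<exists>z\<in>Z. s = x [^] (i::nat) \<otimes> z"
proof -
 obtain T where T: "T \<in> BL" "T \<noteq> B" using third_block by blast
 have c: "s \<in> \<G>" "x \<in> \<G>" "s \<in> P" using s x BL_carrier[OF B] BL_P[OF B] by auto
 have Tc: "T \<subseteq> \<G>" by (rule BL_carrier[OF T(1)])
 obtain i where i: "i < p" "cj (x [^] i) ` T = cj s ` T"
  by (metis act_inj[OF c(1) Tc BL_carrier[OF B]] BL_self[OF B s] T(2) moves_to[OF B T x BL_cj[OF T(1) c(1)]])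
 have xi: "x [^] i \<in> \<G>" "x [^] i \<in> B" using c subgroup_pow[OF BL_subgroup[OF B]] x by auto
 have "inv (x [^] i) \<otimes> s \<in> Z"
  using act_inv[OF xi(1) Tc i(2)] cj_image_cj[OF _ c(1) Tc] xi BL_norm[OF T(1)] BL_P[OF B] BL_inter[OF B T(1)] T(2) subgroup.m_closed[OF BL_subgroup[OF B] subgroup.m_inv_closed[OF BL_subgroup[OF B] xi(2)] s] by auto
 moreover have "s = x [^] i \<otimes> (inv (x [^] i) \<otimes> s)" using c by (simp add: m_assoc[symmetric])
 ultimately show ?thesis using i(1) by blast
qed

text \<open>The powers of \<open>x\<close> carry \<open>T\<close> to every block other than
  \<open>S\<close>, and \<open>k\<close> commutes with them up to factors in \<open>Z\<close>, which
  fix all blocks. So fixing \<open>T\<close> spreads to all blocks.\<close>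

lemma fixes_two_imp_center:
 assumes k: "k \<in> \<G>" and S: "S \<in> BL" "cj k ` S = S" and T: "T \<in> BL" "cj k ` T = T" "T \<noteq> S"
  and x: "x \<in> S - Z" and z: "z \<in> Z" "cj k x = x \<otimes> z"
 shows "k \<in> center G"
proof (rule fixes_all_imp_center[OF k])
 fix B assume B: "B \<in> BL"
 show "cj k ` B = B"
 proof (cases "B = S")
  case False
  have xc: "x \<in> \<G>" "z \<in> \<G>" using x z BL_carrier[OF S(1)] Z_carrier by auto
  have Tc: "T \<subseteq> \<G>" by (rule BL_carrier[OF T(1)])
  obtain i where i: "cj (x [^] (i::nat)) ` T = B" using moves_to[OF S(1) T(1,3) x B False] by blast
  have "cj k (x [^] i) = (x \<otimes> z) [^] i" using z(2) k xc by (simp add: cj_pow)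
  also have "\<dots> = x [^] i \<otimes> z [^] i" using Z_comm[OF z(1) xc(1)] xc by (intro pow_mult_distrib) auto
  finally have e: "k \<otimes> x [^] i = x [^] i \<otimes> z [^] i \<otimes> k"
   using k xc by (simp add: cj_def) (metis inv_solve_right m_closed nat_pow_closed)
  have "cj k ` B = cj (x [^] i) ` (cj (z [^] i) ` (cj k ` T))"
   using cj_image_cj[OF k _ Tc] xc cj_image_cj[OF _ _ Tc] cj_image_cj[OF _ _ BL_carrier[OF BL_cj[OF T(1)]]] k by (simp add: i[symmetric] e)
  also have "\<dots> = cj (x [^] i) ` T"
   using T(2) BL_self[OF T(1), of "z [^] i"] Z_BL[OF T(1)] subgroup_pow[OF Z_subgroup z(1)] by auto
  finally show ?thesis using i by simp
 qed (use S in simp)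
qed

text \<open>The product of a normal \<open>p\<close>-subgroup with a block is a
  \<open>p\<close>-subgroup, so by maximality the normal subgroup lies in the block. Two blocks meet
  in \<open>Z\<close>.\<close>

lemma Z_O_lower: "Z = O_lower_p G p"
proof
 have "Z \<lhd> G"
 proof (rule normal_invI[OF Z_subgroup])
  fix x h assume "x \<in> \<G>" "h \<in> Z"
  then show "x \<otimes> h \<otimes> inv x \<in> Z" using cj_Z unfolding cj_def by simp
 qed
 then show "Z \<subseteq> O_lower_p G p"
  by (metis p_subgroup_card[OF Z_subgroup Z_P] normal_p_subgroup_def O_lower_p_greatest(2)[OF fin prime])
 let ?Q = "O_lower_p G p"
 have Q: "?Q \<lhd> G" "\<exists>m. card ?Q = p ^ m"
  using O_lower_p_greatest(1)[OF fin prime] by (auto simp: normal_p_subgroup_def)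
 have QG: "subgroup ?Q G" using Q normal_imp_subgroup by blast
 have QP: "?Q \<subseteq> P" using Q(2) subgroup_pow_card[OF QG] subgroup.mem_carrier[OF QG] P_iff by fastforce
 have QR: "?Q \<subseteq> R" if R: "R \<in> BL" for R
 proof -
  have n: "\<And>b r. b \<in> R \<Longrightarrow> r \<in> ?Q \<Longrightarrow> cj b r \<in> ?Q"
   using normal.inv_op_closed2[OF Q(1)] BL_carrier[OF R] by (auto simp: cj_def)
  note pr = product_p_subgroup[OF QG QP BL_subgroup[OF R] BL_P[OF R] n]
  show ?thesis using pr(3) card_seteq[OF subgroup_finite[OF pr(1)] pr(4) BL_max[OF R pr(1,2)]] by blast
 qed
 obtain B C where "B \<in> BL" "C \<in> BL" "B \<noteq> C" using third_block by metis
 then show "?Q \<subseteq> Z" using QR[of B] QR[of C] BL_inter[of B C] by blast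
qed

end

section \<open>Noncentral elements fixing two blocks\<close>

lemma (in group) cj_int_pow: "g \<in> carrier G \<Longrightarrow> x \<in> carrier G \<Longrightarrow> cj g (x [^] (i::int)) = cj g x [^] i"
proof -
 assume g: "g \<in> carrier G" "x \<in> carrier G"
 have "cj g \<in> hom G G" using g by (auto simp: hom_def cj_mult)
 from hom_int_pow[OF this g(2) is_group is_group] show ?thesis .
qed

context block_group begin

lemma cj_in_Z_iff: "g \<in> \<G> \<Longrightarrow> x \<in> \<G> \<Longrightarrow> cj g x \<in> Z \<longleftrightarrow> x \<in> Z"
 using cj_Z by (metis cj_inv_cj inv_closed)

lemma BL_fixed_mem: "B \<in> BL \<Longrightarrow> cj g ` B = B \<Longrightarrow> x \<in> B \<Longrightarrow> cj g x \<in> B" by blast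

lemma cj_stable_inv: "g \<in> \<G> \<Longrightarrow> B \<in> BL \<Longrightarrow> cj g ` B = B \<Longrightarrow> cj (inv g) ` B = B"
 using act_inv BL_carrier by blast

lemma cj_stable_mult: "g \<in> \<G> \<Longrightarrow> h \<in> \<G> \<Longrightarrow> B \<in> BL \<Longrightarrow> cj g ` B = B \<Longrightarrow> cj h ` B = B \<Longrightarrow>
  cj (g \<otimes> h) ` B = B"
 using cj_image_cj[OF _ _ BL_carrier] by metis

text \<open>The torus, the stabilizer of two blocks, acts on \<open>S\<close> modulo \<open>Z\<close> by scalars; so commutators
 inside it are central, and it acts by scalars on every commutator \<open>[g, x]\<close> as well.\<close>

lemma stabilizer_scales_commutator:
 assumes g: "g \<in> \<G>" "cj g ` S = S" "cj g ` T = T" and ST: "S \<in> BL" "T \<in> BL" "T \<noteq> S"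
  and x: "x \<in> S - Z" and h: "h \<in> \<G>" "cj h ` S = S"
 shows "\<exists>i::nat. cj h (cj g x \<otimes> inv x) = (cj g x \<otimes> inv x) [^] i"
proof -
 have Sc: "S \<subseteq> \<G>" and Tc: "T \<subseteq> \<G>" using BL_carrier ST by auto
 have SG: "subgroup S G" by (rule BL_subgroup[OF ST(1)])
 have xc: "x \<in> \<G>" "x \<in> S" using x Sc by auto
 have comm: "s \<otimes> t = t \<otimes> s" if "s \<in> S" "t \<in> S" for s t
  using commute_onD[OF BL_comm[OF ST(1)] that] .
 have cs: "cj s t = t" if "s \<in> S" "t \<in> S" for s t
  using comm[OF that] that Sc by (subst cj_self) auto
 have hT: "cj h ` T \<in> BL" by (rule BL_cj[OF ST(2) h(1)])
 have hTS: "cj h ` T \<noteq> S" using act_inj[OF h(1) Tc Sc] h(2) ST(3) by blast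
 obtain i where i: "cj (x [^] (i::nat)) ` T = cj h ` T" using moves_to[OF ST x hT hTS] by blast
 define s where "s = x [^] i"
 have s: "s \<in> S" "s \<in> \<G>" "cj s ` S = S" "cj s ` T = cj h ` T" unfolding s_def
  using subgroup_pow[OF SG xc(2)] xc i BL_self[OF ST(1)] by auto
 \<comment> \<open>Corrects \<open>h\<close> by an element of the commutative group
   \<open>S\<close>, which acts trivially on \<open>S\<close> itself, so that \<open>T\<close> is
   fixed too.\<close>
 define h' where "h' = inv s \<otimes> h"
 have h': "h' \<in> \<G>" "h = s \<otimes> h'" unfolding h'_def using s h by (auto simp: m_assoc[symmetric])
 have h'S: "cj h' ` S = S" and h'T: "cj h' ` T = T"
  using cj_stable_mult cj_stable_inv s h ST act_inv[OF s(2) Tc s(4)] cj_image_cj[OF _ h(1) Tc] unfolding h'_def by auto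
 obtain b z' where b: "z' \<in> Z" "cj g x = x [^] (b::nat) \<otimes> z'"
  using block_elements[OF ST(1) x BL_fixed_mem[OF ST(1) g(2) xc(2)]] by blast
 obtain a z where a: "z \<in> Z" "cj h' x = x [^] (a::nat) \<otimes> z"
  using block_elements[OF ST(1) x BL_fixed_mem[OF ST(1) h'S xc(2)]] by blast
 have zc: "z \<in> \<G>" "z' \<in> \<G>" using a b Z_carrier by auto
 have pd: "(y \<otimes> q) [^] (n::nat) = y [^] n \<otimes> q [^] n" if "q \<in> Z" "y \<in> \<G>" for y q n
  using pow_mult_distrib[of y q n] Z_comm[OF that] that Z_carrier by auto
 define A where "A = g \<otimes> h'"
 define B where "B = h' \<otimes> g"
 have AB: "A \<in> \<G>" "B \<in> \<G>" using g h' by (auto simp: A_def B_def)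
 have cA: "cj A x = x [^] (a * b) \<otimes> (z' [^] a \<otimes> z)"
 proof -
  have "cj A x = cj g (cj h' x)" unfolding A_def using g h' xc by (simp add: cj_cj)
  also have "\<dots> = x [^] (a * b) \<otimes> (z' [^] a \<otimes> z)"
   using g xc zc cj_Z[OF a(1)] pd[OF b(1)] by (simp add: cj_mult cj_pow nat_pow_pow m_assoc mult.commute a(2) b(2))
  finally show ?thesis .
 qed
 have cB: "cj B x = x [^] (a * b) \<otimes> (z [^] b \<otimes> z')"
 proof -
  have "cj B x = cj h' (cj g x)" unfolding B_def using g h' xc by (simp add: cj_cj)
  also have "\<dots> = x [^] (a * b) \<otimes> (z [^] b \<otimes> z')"
   using h' xc zc cj_Z[OF b(1)] pd[OF a(1)] by (simp add: cj_mult cj_pow nat_pow_pow m_assoc b(2) a(2))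
  finally show ?thesis .
 qed
 define q where "q = inv (z' [^] a \<otimes> z) \<otimes> (z [^] b \<otimes> z')"
 have zz: "z' [^] a \<otimes> z \<in> Z" "z [^] b \<otimes> z' \<in> Z" "q \<in> Z" "cj B x = cj A x \<otimes> q"
  using subgroup.m_closed[OF Z_subgroup] subgroup.m_inv_closed[OF Z_subgroup] subgroup_pow[OF Z_subgroup] a b xc zc unfolding q_def cA cB by (simp_all add: m_assoc) (simp_all add: m_assoc[symmetric])
 \<comment> \<open>The two orders of composition act alike on \<open>x\<close> up to
   \<open>Z\<close>. Their quotient \<open>k\<close> fixes \<open>S\<close> and \<open>T\<close> and
   moves \<open>x\<close> only by \<open>Z\<close>, hence is central.\<close>
 define k where "k = inv A \<otimes> B"
 have k: "k \<in> \<G>" "B = A \<otimes> k" unfolding k_def using AB by (auto simp: m_assoc[symmetric])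
 have "cj k x = cj (inv A) (cj B x)" unfolding k_def using AB xc by (simp add: cj_cj)
 also have "\<dots> = x \<otimes> q"
  using AB xc cj_Z[OF zz(3)] zz Z_carrier by (auto simp: cj_mult \<open>cj B x = cj A x \<otimes> q\<close>)
 finally have kx: "cj k x = x \<otimes> q" .
 have kC: "k \<in> center G"
  using cj_stable_inv ST cj_stable_mult g h' h'S h'T fixes_two_imp_center[OF k(1) ST(1) _ ST(2) _ ST(3) x zz(3) kx] by (simp add: A_def B_def k_def)
 have hg: "cj h' (cj g x) = cj g x [^] a \<otimes> z"
  using g h' xc cj_center[OF kC xc(1)] k zc cj_Z[OF a(1)] by (simp add: cj_cj cj_cj[symmetric] cj_mult cj_pow B_def A_def a(2))
 let ?u = "cj g x \<otimes> inv x"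
 have gxS: "cj g x \<in> S" "inv x \<in> S" and gxc: "cj g x \<in> \<G>"
  using BL_fixed_mem[OF ST(1) g(2) xc(2)] subgroup.m_inv_closed[OF SG xc(2)] g xc by auto
 have hu: "cj h' ?u = ?u [^] a"
  using h' xc zc gxc pow_mult_distrib[OF comm[OF gxS]] by (simp add: cj_mult cj_inv inv_mult_group m_assoc nat_pow_inv m_assoc[symmetric] hg a(2))
 have uS: "?u \<in> S" using subgroup.m_closed[OF SG gxS] .
 have "cj h ?u = cj s (cj h' ?u)" unfolding h'(2) using h' s uS Sc by (subst cj_cj) auto
 also have "\<dots> = ?u [^] a" unfolding hu using cs[OF s(1) subgroup_pow[OF SG uS]] .
 finally show ?thesis by blast
qed

lemma int_pow_in_Z:
 assumes B: "B \<in> BL" and x: "x \<in> B - Z"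
 shows "x [^] (i::int) \<in> Z \<longleftrightarrow> int p dvd i"
proof
 have xc: "x \<in> \<G>" using x BL_carrier[OF B] by blast
 have xp: "x [^] (int p * q) \<in> Z" for q
  using subgroup_int_pow_closed[OF Z_subgroup pow_p_in_Z[OF B], of x q] x xc
  by (simp add: int_pow_int[symmetric] int_pow_pow del: int_pow_int)
 show "x [^] i \<in> Z" if "int p dvd i" using that xp by (auto simp: dvd_def)
 assume a: "x [^] i \<in> Z"
 show "int p dvd i"
 proof (rule ccontr)
  assume "unit i"
  then obtain e q where q: "i * e = 1 + int p * q" using unit_inverse_lin by blast
  have "x \<otimes> x [^] (int p * q) \<otimes> inv (x [^] (int p * q)) \<in> Z"
   using q subgroup_int_pow_closed[OF Z_subgroup a, of e] xc subgroup.m_closed[OF Z_subgroup]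
    subgroup.m_inv_closed[OF Z_subgroup xp] by (simp add: int_pow_pow int_pow_mult)
  then show False using x xc by (simp add: m_assoc)
 qed
qed

end

locale torus_group = block_group +
 fixes S T :: "'a set" and u w :: 'a
 assumes ST: "S \<in> BL" "T \<in> BL" "T \<noteq> S"
  and u: "u \<in> S - Z" "u [^] p = \<one>"
  and w: "w \<in> carrier G" "cj w ` S = T" "cj w ` T = S"
  and u_scaled: "h \<in> carrier G \<Longrightarrow> cj h ` S = S \<Longrightarrow> \<exists>i::int. cj h u = u [^] i"
  and noncentral: "\<exists>h\<in>carrier G. cj h ` S = S \<and> cj h ` T = T \<and> h \<notin> center G"

context block_group begin

text \<open>\<open>u\<close> is the commutator of \<open>g\<close> and \<open>x\<close>. Since
  \<open>x [^] p\<close> lies in \<open>Z\<close> and is fixed by \<open>g\<close>, the commutator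
  has \<open>u [^] p = \<one>\<close> even if \<open>x\<close> has larger order. It is outside
  \<open>Z\<close>, as otherwise \<open>fixes_two_imp_center\<close> would make \<open>g\<close>
  central.\<close>

lemma torus_exists:
 assumes g: "g \<in> \<G>" "cj g ` S = S" "cj g ` T = T" and ST: "S \<in> BL" "T \<in> BL" "T \<noteq> S"
  and gC: "g \<notin> center G"
 shows "\<exists>u w. torus_group G p Z BL S T u w"
proof -
 have SG: "subgroup S G" by (rule BL_subgroup[OF ST(1)])
 obtain x where x: "x \<in> S - Z" "x \<in> \<G>" using noncentral_in_block[OF ST(1)] by blast
 let ?u = "cj g x \<otimes> inv x"
 have gx: "cj g x \<in> S" "cj g x \<in> \<G>" and ix: "inv x \<in> S"
  using x g subgroup.m_inv_closed[OF SG] by auto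
 have uS: "?u \<in> S" using subgroup.m_closed[OF SG gx(1) ix] .
 have comm: "cj g x \<otimes> inv x = inv x \<otimes> cj g x" using commute_onD[OF BL_comm[OF ST(1)] gx(1) ix] .
 have uZ: "?u \<notin> Z"
 proof
  assume uZ: "?u \<in> Z"
  show False
   using gx x Z_comm[OF uZ x(2)] fixes_two_imp_center[OF g(1) ST(1) g(2) ST(2) g(3) ST(3) x(1) uZ] gC m_assoc by fastforce
 qed
 have up: "?u [^] p = \<one>"
  using pow_mult_distrib[OF comm gx(2)] x cj_Z[OF pow_p_in_Z[OF ST(1), of x] g(1)] g cj_pow[symmetric] nat_pow_inv by fastforce
 obtain w where w: "w \<in> \<G>" "cj w ` S = T" "cj w ` T = S"
  using two_transitive[OF ST(1,2) ST(3)[symmetric] ST(2,1,3)] by blast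
 have "torus_group G p Z BL S T ?u w"
 proof (rule torus_group.intro[OF block_group_axioms], rule torus_group_axioms.intro)
  show "\<exists>i::int. cj h ?u = ?u [^] i" if "h \<in> \<G>" "cj h ` S = S" for h
   using stabilizer_scales_commutator[OF g ST x(1) that] by (metis int_pow_int)
  show "\<exists>h\<in>\<G>. cj h ` S = S \<and> cj h ` T = T \<and> h \<notin> center G" using g gC by blast
 qed (use ST uS uZ up w in auto)
 then show ?thesis by blast
qed

end

section \<open>Labels of the blocks and the transfer\<close>

context torus_group begin

definition v where "v = cj w u"
text \<open>A label \<open>x\<close> modulo \<open>p\<close> is a finite point of the projective
  line, with \<open>S\<close> as the point at infinity and \<open>T\<close> as 0.
  \<open>pt x\<close> generates the distinguished subgroup of order \<open>p\<close> in the block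
  \<open>blk x\<close>, and conjugation by \<open>u\<close> is the translation of labels by
  1.\<close>

definition pt :: "int \<Rightarrow> 'a" where "pt x = cj (u [^] x) v"
definition blk :: "int \<Rightarrow> 'a set" where "blk x = cj (u [^] x) ` T"

lemma SG: "subgroup S G" and TG: "subgroup T G" and Sc: "S \<subseteq> \<G>" and Tc: "T \<subseteq> \<G>"
 using BL_subgroup BL_carrier ST by auto

lemma u_carrier [simp]: "u \<in> \<G>" and u_mem: "u \<in> S" and u_not_Z: "u \<notin> Z"
 using u Sc by auto

lemma u_pow_S: "u [^] (i::int) \<in> S" using subgroup_int_pow_closed[OF SG u_mem] .

lemma w_carrier [simp]: "w \<in> \<G>" by (rule w(1))

lemma v_carrier [simp]: "v \<in> \<G>" by (simp add: v_def)
lemma pt_carrier [simp]: "pt x \<in> \<G>" by (simp add: pt_def)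

lemma u_ord: "ord u = p"
 using u(2) pow_eq_id u_not_Z subgroup.one_closed[OF Z_subgroup] ord_eq_1[of u] prime prime_nat_iff by auto

lemma u_pow_eq: "u [^] (i::int) = u [^] (j::int) \<longleftrightarrow> i \<doteq> j"
 using int_pow_eq[OF u_carrier, of i j] u_ord by (metis cong_iff_dvd_diff cong_sym_eq)

lemma u_pow_Z: "u [^] (i::int) \<in> Z \<longleftrightarrow> int p dvd i"
 by (rule int_pow_in_Z[OF ST(1) u(1)])

lemma v_pow: "v [^] (i::int) = cj w (u [^] i)" by (simp add: v_def cj_int_pow)

lemma pt_pow: "pt x [^] (i::int) = cj (u [^] x \<otimes> w) (u [^] i)"
 by (simp add: pt_def v_def cj_int_pow cj_cj)

lemma pt_pow_mem: "pt x [^] (i::int) \<in> blk x"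
 unfolding pt_pow blk_def using u_pow_S w(2) by (auto simp: cj_cj[symmetric])

lemma pt_pow_Z: "pt x [^] (i::int) \<in> Z \<longleftrightarrow> int p dvd i"
 unfolding pt_pow by (simp add: cj_in_Z_iff u_pow_Z)

lemma pt_pow_eq: "pt x [^] (i::int) = pt x [^] (j::int) \<longleftrightarrow> i \<doteq> j"
 unfolding pt_pow by (simp add: cj_eq_iff u_pow_eq)

lemma pt_cong: "x \<doteq> y \<Longrightarrow> pt x = pt y"
 unfolding pt_def using u_pow_eq by metis

lemma blk_BL: "blk x \<in> BL" unfolding blk_def by (rule BL_cj[OF ST(2)]) simp

lemma u_pow_fixes_S: "cj (u [^] (x::int)) ` S = S" by (rule BL_self[OF ST(1) u_pow_S])

lemma blk_ne_S: "blk x \<noteq> S"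
 unfolding blk_def using act_inj[OF _ Tc Sc, of "u [^] x"] u_pow_fixes_S[of x] ST(3) by auto

lemma cj_blk: "cj (u [^] (x::int)) ` blk y = blk (x + y)"
 unfolding blk_def by (subst cj_image_cj) (auto simp: Tc int_pow_mult)

lemma blk_0: "blk 0 = T" unfolding blk_def using Tc by simp
lemma pt_0: "pt 0 = v" unfolding pt_def by simp

lemma cj_pt: "cj (u [^] (x::int)) (pt y) = pt (x + y)"
 unfolding pt_def by (subst cj_cj) (auto simp: int_pow_mult)

lemma blk_eq: "blk x = blk y \<longleftrightarrow> x \<doteq> y"
proof
 assume "blk x = blk y"
 then have "cj (u [^] (- x)) ` blk x = cj (u [^] (- x)) ` blk y" by simp
 then have e: "cj (u [^] (y - x)) ` T = T" unfolding cj_blk using Tc by (simp add: blk_def)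
 have "int p dvd y - x" using u_pow_S BL_P[OF ST(1)] BL_norm[OF ST(2) _ e] BL_inter[OF ST(1,2)] ST(3) u_pow_Z by auto
 then show "x \<doteq> y" by (simp add: cong_iff_dvd_diff dvd_diff_commute)
next
 assume "x \<doteq> y"
 then show "blk x = blk y" unfolding blk_def using u_pow_eq by metis
qed

lemma blk_exists: "B \<in> BL \<Longrightarrow> B \<noteq> S \<Longrightarrow> \<exists>x. B = blk x"
 using moves_to[OF ST u(1)] unfolding blk_def by (metis int_pow_int)

lemma pt_eqD:
 assumes "pt x [^] (i::int) = pt y [^] (j::int)" "unit i"
 shows "x \<doteq> y" "i \<doteq> j"
proof -
 have "blk x = blk y" by (metis pt_pow_mem assms(1) BL_inter[OF blk_BL blk_BL] pt_pow_Z assms(2) IntI)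
 then show xy: "x \<doteq> y" using blk_eq by blast
 show "i \<doteq> j" using assms(1) pt_cong[OF xy] pt_pow_eq by metis
qed

lemma pt_ne_u: assumes "pt x [^] (i::int) = u [^] (j::int)" shows "int p dvd i"
 by (metis pt_pow_mem assms u_pow_S IntI BL_inter[OF blk_BL ST(1) blk_ne_S] pt_pow_Z)

lemma to_S: assumes "g \<in> \<G>" "cj g ` S = S" shows "\<exists>i::int. cj g u = u [^] i \<and> unit i"
proof -
 obtain i :: int where i: "cj g u = u [^] i" using u_scaled assms by blast
 have "cj g u \<notin> Z" using cj_in_Z_iff assms u_not_Z by simp
 then show ?thesis using i u_pow_Z by auto
qed

lemma to_blk: assumes g: "g \<in> \<G>" "cj g ` S = blk y"
 shows "\<exists>i::int. cj g u = pt y [^] i \<and> unit i"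
proof -
 define m where "m = u [^] y \<otimes> w"
 define k where "k = inv m \<otimes> g"
 have m: "m \<in> \<G>" by (simp add: m_def)
 have k: "k \<in> \<G>" "g = m \<otimes> k" "cj k ` S = S"
  using g m Sc w(2) act_inv[OF m Sc] unfolding k_def by (auto simp: m_assoc[symmetric] cj_image_cj[symmetric] k_def m_def blk_def)
 then obtain i :: int where i: "cj k u = u [^] i" "unit i" using to_S k by blast
 have "cj g u = cj m (cj k u)" unfolding k(2) using k m by (simp add: cj_cj)
 then show ?thesis unfolding i(1) m_def pt_pow using i(2) by blast
qed

text \<open>The transfer into the stabilizer of \<open>S\<close>, acting on \<open>u\<close>, is a homomorphism to the units
 modulo \<open>p\<close>; it is trivial because \<open>G\<close> is generated by \<open>p\<close>-elements.\<close>

definition tv where "tv B = (if B = S then u else pt (SOME x. B = blk x))"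
definition J where "J g B = (SOME i::int. cj g (tv B) = tv (cj g ` B) [^] i)"

lemma tv_carrier: "tv B \<in> \<G>" by (simp add: tv_def)

lemma tv_pow_eq: "tv B [^] (i::int) = tv B [^] (j::int) \<longleftrightarrow> i \<doteq> j"
 by (simp add: tv_def u_pow_eq pt_pow_eq)

lemma tv_blk: "tv (blk x) = pt x"
proof -
 have "blk x = blk (SOME y. blk x = blk y)" by (rule someI) simp
 then show ?thesis unfolding tv_def using blk_ne_S blk_eq pt_cong by metis
qed

lemma tv_S: "tv S = u" by (simp add: tv_def)

lemma tv_conj: assumes "B \<in> BL" shows "\<exists>k\<in>\<G>. cj k ` S = B \<and> cj k u = tv B"
proof (cases "B = S")
 case True
 then show ?thesis using Sc tv_S by (intro bexI[of _ \<one>]) auto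
next
 case False
 then obtain x where x: "B = blk x" using blk_exists assms by blast
 show ?thesis
 proof (intro bexI conjI)
  show "cj (u [^] x \<otimes> w) ` S = B" unfolding x blk_def using cj_image_cj[of "u [^] x" w S] Sc w(2) by simp
  show "cj (u [^] x \<otimes> w) u = tv B" unfolding x tv_blk using pt_pow[of x 1] by simp
 qed simp
qed

lemma J: assumes g: "g \<in> \<G>" and B: "B \<in> BL"
 shows "cj g (tv B) = tv (cj g ` B) [^] J g B" "unit (J g B)"
proof -
 obtain k where k: "k \<in> \<G>" "cj k ` S = B" "cj k u = tv B" using tv_conj[OF B] by blast
 have gk: "g \<otimes> k \<in> \<G>" "cj (g \<otimes> k) ` S = cj g ` B" and gu: "cj g (tv B) = cj (g \<otimes> k) u"
  using g k Sc by (auto simp: cj_image_cj[symmetric] cj_cj[symmetric])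
 have "\<exists>i::int. cj g (tv B) = tv (cj g ` B) [^] i \<and> unit i"
 proof (cases "cj g ` B = S")
  case True
  then show ?thesis unfolding gu using to_S[OF gk(1)] gk(2) tv_S by simp
 next
  case False
  then obtain y where y: "cj g ` B = blk y" using blk_exists BL_cj[OF B g] by blast
  then show ?thesis unfolding gu using to_blk[OF gk(1), of y] gk(2) tv_blk by simp
 qed
 then obtain i :: int where i: "cj g (tv B) = tv (cj g ` B) [^] i" "unit i" by blast
 then show J: "cj g (tv B) = tv (cj g ` B) [^] J g B" unfolding J_def by (rule_tac someI)
 then show "unit (J g B)" by (metis i(1) tv_pow_eq i(2) cong_dvd_iff)
qed

lemma J_unique: "g \<in> \<G> \<Longrightarrow> B \<in> BL \<Longrightarrow> cj g (tv B) = tv (cj g ` B) [^] (i::int) \<Longrightarrow> J g B \<doteq> i"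
 using J(1) tv_pow_eq by metis

lemma J_mult: assumes g: "g \<in> \<G>" and h: "h \<in> \<G>" and B: "B \<in> BL"
 shows "J (g \<otimes> h) B \<doteq> J g (cj h ` B) * J h B"
proof (rule J_unique[OF _ B])
 have hB: "cj h ` B \<in> BL" by (rule BL_cj[OF B h])
 have "cj (g \<otimes> h) (tv B) = cj g (cj h (tv B))" using g h tv_carrier by (simp add: cj_cj)
 also have "\<dots> = (cj g (tv (cj h ` B))) [^] J h B" unfolding J(1)[OF h B] using g tv_carrier by (simp add: cj_int_pow)
 also have "\<dots> = tv (cj g ` (cj h ` B)) [^] (J g (cj h ` B) * J h B)"
  unfolding J(1)[OF g hB] using tv_carrier by (simp add: int_pow_pow)
 also have "cj g ` (cj h ` B) = cj (g \<otimes> h) ` B" using g h BL_carrier[OF B] by (rule cj_image_cj)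
 finally show "cj (g \<otimes> h) (tv B) = tv (cj (g \<otimes> h) ` B) [^] (J g (cj h ` B) * J h B)" .
qed (use g h in simp)

definition Tr where "Tr g = (\<Prod>B\<in>BL. J g B)"

lemma Tr_unit: assumes "g \<in> \<G>" shows "unit (Tr g)"
 unfolding Tr_def using prime_dvd_prod_iff[OF BL_finite, of "int p"] J(2)[OF assms] prime by auto

lemma Tr_mult: assumes g: "g \<in> \<G>" and h: "h \<in> \<G>"
 shows "Tr (g \<otimes> h) \<doteq> Tr g * Tr h"
proof -
 have inj: "inj_on (image (cj h)) BL"
  using act_inj[OF h] BL_carrier by (intro inj_onI) blast
 have im: "image (cj h) ` BL = BL"
  by (rule card_subset_eq) (use BL_finite BL_cj h card_image[OF inj] in auto)
 have "(\<Prod>B\<in>BL. J g (cj h ` B)) = (\<Prod>B\<in>image (cj h) ` BL. J g B)"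
  by (simp add: prod.reindex[OF inj])
 then have e: "(\<Prod>B\<in>BL. J g (cj h ` B) * J h B) = Tr g * Tr h"
  unfolding Tr_def prod.distrib im by simp
 have "Tr (g \<otimes> h) \<doteq> (\<Prod>B\<in>BL. J g (cj h ` B) * J h B)"
  unfolding Tr_def by (rule cong_prod) (use J_mult g h in blast)
 then show ?thesis unfolding e .
qed

lemma Tr_one: "Tr \<one> \<doteq> 1"
proof -
 have "Tr \<one> * 1 \<doteq> Tr \<one> * Tr \<one>" using Tr_mult[OF one_closed one_closed] by simp
 then show ?thesis
  by (metis Tr_unit[OF one_closed] cancel cong_sym)
qed

lemma Tr_pow: "g \<in> \<G> \<Longrightarrow> Tr (g [^] (n::nat)) \<doteq> Tr g ^ n"
proof (induction n)
 case 0 then show ?case using Tr_one by simp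
next
 case (Suc n)
 have "Tr (g [^] Suc n) \<doteq> Tr (g [^] n) * Tr g" using Tr_mult[of "g [^] n" g] Suc(2) by simp
 also have "Tr (g [^] n) * Tr g \<doteq> Tr g ^ n * Tr g" using Suc by (intro cong_mult) auto
 finally show ?case by (simp add: mult.commute)
qed

lemma fermat_pow: "a ^ (p ^ m) \<doteq> a"
proof (induction m)
 case (Suc m)
 have f: "b ^ p \<doteq> b" for b
 proof (cases "int p dvd b")
  case True
  then show ?thesis by (metis p_gt_0 dvd_trans dvd_power cong_0_iff cong_sym cong_trans)
 next
  case False
  have "b ^ p = b * b ^ (p - 1)" using p_gt_0 by (metis power_eq_if not_gr_zero)
  moreover have "b * b ^ (p - 1) \<doteq> b * 1" using int_fermat[OF prime False] by (intro cong_mult) auto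
  ultimately show ?thesis by simp
 qed
 show ?case using f[of "a ^ (p ^ m)"] Suc cong_trans by (simp add: power_mult[symmetric] mult.commute)
qed simp

text \<open>A residue \<open>a\<close> satisfies \<open>a ^ (p ^ m) = a\<close> modulo
  \<open>p\<close>, while the transfer of a \<open>p\<close>-element becomes 1 after such a power.
  So it is 1 on all generators.\<close>

lemma Tr_trivial: assumes "g \<in> \<G>" shows "Tr g \<doteq> 1"
proof -
 have P: "Tr x \<doteq> 1" if x: "x \<in> P" for x
 proof -
  obtain m where m: "x [^] (p ^ m) = \<one>" "x \<in> \<G>" using x P_iff by blast
  show ?thesis by (metis Tr_pow[OF m(2), of "p ^ m"] m(1) Tr_one fermat_pow cong_sym cong_trans)
 qed
 have "g \<in> generate G P" using assms gen by simp
 then show ?thesis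
 proof (induction rule: generate.induct)
  case one then show ?case by (rule Tr_one)
 next
  case (incl h) then show ?case by (rule P)
 next
  case (inv h) then show ?case using P P_inv by blast
 next
  case (eng a b)
  have "Tr (a \<otimes> b) \<doteq> Tr a * Tr b" using eng generate_in_carrier[OF P_subset] by (intro Tr_mult) auto
  then show ?case using eng cong_trans cong_mult by fastforce
 qed
qed

text \<open>\<open>h\<close> contributes \<open>l\<close> at \<open>S\<close> and \<open>m\<close>
  at each of the other \<open>p\<close> blocks, so its transfer is \<open>l * m ^ p\<close>, which
  is \<open>l * m\<close> modulo \<open>p\<close>. This replaces the determinant condition on
  diagonal matrices.\<close>

lemma torus_inverse:
 assumes h: "h \<in> \<G>" and l: "cj h u = u [^] (l::int)" and m: "cj h v = v [^] (m::int)"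
  and fx: "cj h ` S = S" "cj h ` T = T"
 shows "l * m \<doteq> 1" "cj h (pt x) = pt (l * x) [^] m"
proof -
 have hpt: "cj h (pt x) = pt (l * x) [^] m" and hblk: "cj h ` blk x = blk (l * x)" for x
 proof -
  have e: "h \<otimes> u [^] x = u [^] (l * x) \<otimes> h"
  proof -
   have "h \<otimes> u [^] x \<otimes> inv h \<otimes> h = u [^] (l * x) \<otimes> h"
    using h l cj_int_pow int_pow_pow unfolding cj_def by fastforce
   then show ?thesis using h by (simp add: m_assoc)
  qed
  have "cj h (pt x) = cj (u [^] (l * x) \<otimes> h) v" unfolding pt_def e[symmetric] using h by (simp add: cj_cj)
  also have "\<dots> = cj (u [^] (l * x)) (cj h v)" using h by (simp add: cj_cj)
  finally show "cj h (pt x) = pt (l * x) [^] m" unfolding m pt_def by (simp add: cj_int_pow)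
  have "cj h ` blk x = cj (u [^] (l * x) \<otimes> h) ` T" unfolding blk_def e[symmetric] using h Tc by (simp add: cj_image_cj)
  then show "cj h ` blk x = blk (l * x)" unfolding blk_def using h Tc fx by (simp add: cj_image_cj[symmetric])
 qed
 show "cj h (pt x) = pt (l * x) [^] m" by (rule hpt)
 have JS: "J h S \<doteq> l" using J_unique[OF h ST(1)] fx(1) l tv_S by simp
 have JB: "J h B \<doteq> m" if "B \<in> BL - {S}" for B
 proof -
  have B: "B \<in> BL" "B \<noteq> S" using that by auto
  obtain x where x: "B = blk x" using blk_exists[OF B] by blast
  show ?thesis using J_unique[OF h, of B m] that unfolding x hblk tv_blk hpt by blast
 qed
 have "(\<Prod>B\<in>BL - {S}. J h B) \<doteq> (\<Prod>B\<in>BL - {S}. m)" by (rule cong_prod) (rule JB)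
 then have "(\<Prod>B\<in>BL - {S}. J h B) \<doteq> m ^ (p ^ 1)" using BL_card ST by simp
 then have mm: "(\<Prod>B\<in>BL - {S}. J h B) \<doteq> m" using fermat_pow[of m 1] by (rule cong_trans)
 show "l * m \<doteq> 1"
  using Tr_trivial[OF h] cong_sym cong_trans unfolding Tr_def by (metis cong_mult[OF JS mm] prod.remove[OF BL_finite ST(1)])
qed

end

section \<open>The exchange of two blocks as a pair of functions modulo p\<close>

context torus_group begin

definition W where "W x = (SOME y. cj w ` blk x = blk y)"
text \<open>Indexed by the image label \<open>y = W x\<close>, not by \<open>x\<close>, so that all
  relations involve one and the same function. The value 0 at multiples of \<open>p\<close> extends
  it to all residues, as the sums over residues require.\<close>

definition gf where "gf y = (if int p dvd y then 0 else SOME i::int. \<exists>x. cj w (pt x) = pt y [^] i \<and> unit i)"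

lemma w_inv_S: "cj (inv w) ` S = T" and w_inv_T: "cj (inv w) ` T = S"
 using act_inv[OF w_carrier] w(2,3) Sc Tc by auto

lemma blk_T_iff: "blk x = T \<longleftrightarrow> int p dvd x"
 using blk_eq[of x 0] unfolding blk_0 by (simp add: cong_0_iff)

lemma w_step:
 assumes x: "unit x"
 shows "cj w ` blk x = blk (W x)" "unit (W x)"
  "\<exists>i. cj w (pt x) = pt (W x) [^] (i::int) \<and> unit i"
proof -
 have bc: "blk x \<subseteq> \<G>" by (rule BL_carrier[OF blk_BL])
 show B: "cj w ` blk x = blk (W x)"
  using act_inj[OF w_carrier bc Tc] w(3) x blk_T_iff blk_exists[OF BL_cj[OF blk_BL w_carrier]] someI_ex unfolding W_def by meson
 show "unit (W x)" using act_inj[OF w_carrier bc Sc] w(2) blk_ne_S blk_T_iff by (auto simp: B)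
 have m: "w \<otimes> (u [^] x \<otimes> w) \<in> \<G>" by simp
 have "cj (w \<otimes> (u [^] x \<otimes> w)) ` S = blk (W x)"
  using cj_image_cj[of "u [^] x" w S] Sc w(2) cj_image_cj[of w "u [^] x \<otimes> w" S] B by (simp add: blk_def)
 from to_blk[OF m this] show "\<exists>i. cj w (pt x) = pt (W x) [^] (i::int) \<and> unit i"
  using pt_pow[of x 1] by (simp add: cj_cj)
qed

lemma w_surj: assumes y: "unit y" shows "\<exists>x. unit x \<and> W x \<doteq> y"
proof -
 have bc: "blk y \<subseteq> \<G>" by (rule BL_carrier[OF blk_BL])
 obtain x where x: "cj (inv w) ` blk y = blk x"
  by (metis act_inj[OF inv_closed[OF w_carrier] bc Tc] w_inv_T y blk_T_iff blk_exists[OF BL_cj[OF blk_BL inv_closed[OF w_carrier]]])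
 have xu: "unit x" by (metis x w_inv_S blk_T_iff act_inj[OF inv_closed[OF w_carrier] bc Sc] blk_ne_S)
 have "blk (W x) = blk y" using bc w_step(1)[OF xu] by (simp add: cj_image_cj x[symmetric])
 then show ?thesis using xu blk_eq by blast
qed

lemma W_cong: "x \<doteq> y \<Longrightarrow> W x = W y"
 unfolding W_def using blk_eq by metis

lemma gf_cong: assumes "x \<doteq> y" shows "gf x = gf y"
 unfolding gf_def using pt_cong[OF assms] cong_dvd_iff[OF assms] by simp

lemma gf: assumes x: "unit x"
 shows "cj w (pt x) = pt (W x) [^] gf (W x)" "unit (gf (W x))"
proof -
 have ex: "\<exists>i::int. \<exists>x'. cj w (pt x') = pt (W x) [^] i \<and> unit i" using w_step(3)[OF x] by blast
 obtain x' where x': "cj w (pt x') = pt (W x) [^] gf (W x)" "unit (gf (W x))"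
  using someI_ex[OF ex] w_step(2)[OF x] gf_def by fastforce
 show "unit (gf (W x))" by fact
 obtain i :: int where i: "cj w (pt x) = pt (W x) [^] i" "unit i" using w_step(3)[OF x] by blast
 have "cj w (pt x [^] gf (W x)) = cj w (pt x' [^] i)"
  using i x' by (simp add: cj_int_pow int_pow_pow mult.commute)
 then have "x \<doteq> x'" by (simp add: pt_eqD(1) x'(2) cj_eq_iff)
 then show "cj w (pt x) = pt (W x) [^] gf (W x)" using x'(1) pt_cong by simp
qed

lemma w_pt_pow: "unit x \<Longrightarrow> cj w (pt x [^] (e::int)) = pt (W x) [^] (gf (W x) * e)"
 using gf by (simp add: cj_int_pow int_pow_pow)

lemma w_pt_pow_eq: assumes "unit x" "W x \<doteq> y"
 shows "cj w (pt x [^] (e::int)) = pt y [^] (gf y * e)"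
 using w_pt_pow[OF assms(1)] pt_cong[OF assms(2)] gf_cong[OF assms(2)] by simp

lemma torus_elem:
 assumes h: "h \<in> \<G>" "cj h ` S = S" "cj h ` T = T"
 shows "\<exists>l m::int. cj h u = u [^] l \<and> cj h v = v [^] m \<and> l * m \<doteq> 1 \<and>
  unit l \<and> (\<forall>x. cj h (pt x) = pt (l * x) [^] m)"
proof -
 obtain l :: int where l: "cj h u = u [^] l" "unit l" using to_S h by blast
 have "cj (h \<otimes> w) ` S = blk 0" unfolding blk_0 using h w Sc by (simp add: cj_image_cj[symmetric])
 from to_blk[OF _ this] obtain m :: int where "cj (h \<otimes> w) u = pt 0 [^] m" using h by auto
 then have m: "cj h v = v [^] m" unfolding pt_0 v_def using h by (simp add: cj_cj)
 show ?thesis using l m torus_inverse[OF h(1) l(1) m h(2,3)] by blast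
qed

lemma w_square: "\<exists>c m::int. cj w v = u [^] c \<and> c * m \<doteq> 1 \<and> unit c \<and>
  (\<forall>x. cj (w \<otimes> w) (pt x) = pt (c * x) [^] m)"
 using w Sc Tc cj_image_cj[symmetric] cj_cj torus_elem[of "w \<otimes> w"] by (auto simp: v_def)

text \<open>The element \<open>b = w\<inverse> u\<^sup>-\<^sup>W\<^sup>a w u\<^sup>a w\<close> fixes \<open>S\<close>, which yields the functional equation
 of \<open>gf\<close> from the relation \<open>u\<^sup>-\<^sup>W\<^sup>a w u\<^sup>a w = w b\<close>.\<close>

lemma functional_relation:
 assumes a: "unit a"
 obtains c m h where "gf (W a) * m \<doteq> 1"
  "\<And>x. cj (u [^] (- W a)) (cj w (cj (u [^] a) (cj w (pt x)))) = cj w (pt (c + gf (W a) * x)) [^] (m::int)"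
  "h \<in> \<G>" "cj h ` S = S" "cj h ` T = T" "cj h u = u [^] gf (W a)"
proof -
 define k where "k = u [^] (- W a) \<otimes> (w \<otimes> u [^] a)"
 define b where "b = inv w \<otimes> (k \<otimes> w)"
 have k: "k \<in> \<G>" and b: "b \<in> \<G>" by (simp_all add: k_def b_def)
 have cjk: "cj k x = cj (u [^] (- W a)) (cj w (cj (u [^] a) x))" if "x \<in> \<G>" for x
  using that unfolding k_def by (simp add: cj_cj)
 have kv: "cj k v = v [^] gf (W a)"
  using cj_pt[of a 0] gf(1)[OF a] cj_pt[of "- W a" "W a"] by (simp add: cjk pt_0 cj_int_pow)
 have kT: "cj k ` T = T"
 proof -
  have "cj k ` T = cj (u [^] (- W a)) ` (cj w ` (cj (u [^] a) ` blk 0))"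
   unfolding blk_0 k_def by (simp add: cj_image_cj Tc)
  also have "\<dots> = T" using cj_blk[of a 0] w_step(1)[OF a] cj_blk[of "- W a" "W a"] by (simp add: blk_0)
  finally show ?thesis .
 qed
 have bS: "cj b ` S = S"
  unfolding b_def using k Sc w(2) kT w_inv_T by (simp add: cj_image_cj[symmetric])
 have bu: "cj b u = u [^] gf (W a)"
 proof -
  have "cj b u = cj (inv w) (cj k v)" unfolding b_def v_def using k by (simp add: cj_cj)
  also have "\<dots> = cj (inv w) v [^] gf (W a)" unfolding kv by (simp add: cj_int_pow)
  finally show ?thesis by (simp add: v_def)
 qed
 obtain c where c: "cj b ` T = blk c" by (metis act_inj[OF b Tc Sc] bS ST(3) blk_exists[OF BL_cj[OF ST(2) b]])
 \<comment> \<open>Removes the translation part of \<open>b\<close>; what remains fixes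
   \<open>S\<close> and \<open>T\<close> and scales \<open>u\<close> by
   \<open>gf (W a)\<close>.\<close>
 define h where "h = u [^] (- c) \<otimes> b"
 have h: "h \<in> \<G>" "cj h ` S = S" and hT: "cj h ` T = T" and hu: "cj h u = u [^] gf (W a)"
  using b bS u_pow_fixes_S[of "- c"] Sc Tc c cj_blk[of "- c" c] bu unfolding h_def by (auto simp: cj_image_cj[symmetric] blk_0 cj_self int_pow_mult[symmetric] cj_cj[symmetric] h_def)
 obtain l m where lm: "cj h u = u [^] (l::int)" "l * m \<doteq> 1" "\<And>x. cj h (pt x) = pt (l * x) [^] (m::int)"
  using torus_elem[OF h hT] by blast
 have l: "l \<doteq> gf (W a)" using lm(1) hu u_pow_eq by metis
 have bh: "b = u [^] c \<otimes> h" unfolding h_def using b by (simp add: m_assoc[symmetric] int_pow_mult[symmetric])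
 show thesis
 proof (rule that[of m c h])
  show "gf (W a) * m \<doteq> 1" using lm(2) l by (metis cong_scalar_right cong_sym cong_trans)
  show "cj (u [^] (- W a)) (cj w (cj (u [^] a) (cj w (pt x)))) = cj w (pt (c + gf (W a) * x)) [^] m" for x
  proof -
   have "cj b (pt x) = cj (u [^] c) (cj h (pt x))" unfolding bh using h by (simp add: cj_cj)
   also have "\<dots> = pt (c + l * x) [^] m" unfolding lm(3) by (simp add: cj_int_pow cj_pt)
   also have "pt (c + l * x) = pt (c + gf (W a) * x)"
    by (rule pt_cong) (intro cong_add cong_mult cong_refl l)
   finally have e: "cj b (pt x) = pt (c + gf (W a) * x) [^] m" .
   have "cj k (cj w (pt x)) = cj w (cj b (pt x))" using k b by (simp add: m_assoc[symmetric] cj_cj b_def)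
   then show ?thesis unfolding e by (simp add: cjk cj_int_pow)
  qed
 qed (use h hT hu in auto)
qed

lemma gf_unit: "int p dvd gf x \<longleftrightarrow> int p dvd x"
proof (cases "int p dvd x")
 case False
 then obtain y where y: "unit y" "W y \<doteq> x" using w_surj by blast
 then show ?thesis using gf(2)[OF y(1)] gf_cong[OF y(2)] False by simp
qed (simp add: gf_def)

text \<open>Take \<open>x\<close> with \<open>W x = - a\<close>. The inner steps then lead to the
  block \<open>T\<close>, which \<open>w\<close> sends to \<open>S\<close>, so both sides of
  \<open>functional_relation\<close> are powers of \<open>u\<close> and the exponents can be
  compared.\<close>

lemma gf_FI0: assumes a: "unit a" shows "gf (W a) * gf (- a) \<doteq> 1"
proof (rule functional_relation[OF a])
 fix c m h
 assume m: "gf (W a) * m \<doteq> 1"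
  and rel: "\<And>x. cj (u [^] (- W a)) (cj w (cj (u [^] a) (cj w (pt x)))) = cj w (pt (c + gf (W a) * x)) [^] (m::int)"
 have "unit (- a)" using a by simp
 then obtain x where x: "unit x" "W x \<doteq> - a" using w_surj by blast
 obtain e n where e: "cj w v = u [^] (e::int)" "e * n \<doteq> 1" "unit e"
  using w_square by blast
 let ?z = "c + gf (W a) * x"
 have "cj w (cj (u [^] a) (cj w (pt x))) = u [^] (e * gf (- a))"
  using w_pt_pow_eq[OF x, of 1] cj_pt[of a "- a"] e cj_int_pow pt_0 int_pow_pow by fastforce
 then have L: "cj (u [^] (- W a)) (cj w (cj (u [^] a) (cj w (pt x)))) = u [^] (e * gf (- a))"
  by (simp add: cj_self int_pow_mult[symmetric])
 have mu: "unit m" by (rule unit_of_inverse(2)[OF m])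
 have "int p dvd ?z"
 proof (rule ccontr)
  assume z: "unit ?z"
  then show False using gf(1)[OF z] L rel pt_ne_u int_pow_pow unit_mult[OF gf(2)[OF z] mu] by simp
 qed
 then have "u [^] (e * gf (- a)) = u [^] (e * m)"
  using pt_cong[of ?z 0] cong_0_iff pt_0 L rel[of x] e int_pow_pow by fastforce
 then show ?thesis
  using u_pow_eq e(3) prime cong_mult_lcancel coprime_commute prime_imp_coprime prime_nat_int_transfer m cong_scalar_left cong_trans by meson
qed

text \<open>Take \<open>y\<close> with \<open>W y = x - a\<close>. Then the left side of
  \<open>functional_relation\<close> is a power of \<open>pt (W x - W a)\<close>, and the right side
  must be a power of the same generator; comparing exponents gives the identity after multiplication
  by \<open>gf (W a)\<close>.\<close>

lemma gf_FI: assumes x: "unit x" and a: "unit a"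
 shows "gf (W x) * gf (x - a) * gf (W a) \<doteq> gf (W x - W a)"
proof (cases "int p dvd x - a")
 case True
 then show ?thesis by (simp add: W_cong cong_iff_dvd_diff gf_def)
next
 case False
 show ?thesis
 proof (rule functional_relation[OF a])
  fix c m h
  assume m: "gf (W a) * m \<doteq> 1"
   and rel: "\<And>x. cj (u [^] (- W a)) (cj w (cj (u [^] a) (cj w (pt x)))) = cj w (pt (c + gf (W a) * x)) [^] (m::int)"
  obtain y where y: "unit y" "W y \<doteq> x - a" using w_surj[OF False] by blast
  let ?z = "c + gf (W a) * y" and ?e = "gf (W x) * gf (x - a)"
  have L: "cj (u [^] (- W a)) (cj w (cj (u [^] a) (cj w (pt y)))) = pt (W x - W a) [^] ?e" and eu: "unit ?e"
   using w_pt_pow_eq[OF y, of 1] cj_pt[of a "x - a"] cj_int_pow w_pt_pow[OF x] cj_pt[of "- W a" "W x"] unit_mult[OF gf(2)[OF x]] gf_unit False by auto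
  have z: "unit ?z"
  proof
   assume "int p dvd ?z"
   then have "pt ?z = v" using pt_cong[of ?z 0] cong_0_iff pt_0 by metis
   moreover obtain e n where "cj w v = u [^] (e::int)" "e * n \<doteq> 1" using w_square by blast
   ultimately have "pt (W x - W a) [^] ?e = u [^] (e * m)" using L rel[of y] by (simp add: int_pow_pow)
   then show False using pt_ne_u eu by blast
  qed
  have "pt (W x - W a) [^] ?e = pt (W ?z) [^] (gf (W ?z) * m)"
   using L rel[of y] gf(1)[OF z] int_pow_pow by fastforce
  note d = pt_eqD[OF this eu]
  have "?e * gf (W a) \<doteq> gf (W x - W a) * m * gf (W a)"
   by (metis d(2) gf_cong[OF d(1)] cong_scalar_right)
  also have "gf (W x - W a) * m * gf (W a) = gf (W x - W a) * (gf (W a) * m)" by simp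
  also have "gf (W x - W a) * (gf (W a) * m) \<doteq> gf (W x - W a) * 1" using m by (rule cong_scalar_left)
  finally show ?thesis by simp
 qed
qed

text \<open>The square of \<open>w\<close> fixes \<open>S\<close> and \<open>T\<close>, hence scales
  the generators of all blocks other than \<open>S\<close> by one common exponent
  \<open>m\<close>.\<close>

lemma gf_FI1: "\<exists>c m. cj w v = u [^] (c::int) \<and> c * m \<doteq> 1 \<and>
  (\<forall>y. unit y \<longrightarrow> gf (W y) * gf y \<doteq> m)"
proof -
 obtain c m where c: "cj w v = u [^] (c::int)" "c * m \<doteq> 1" "unit c"
  and rel: "\<And>x. cj (w \<otimes> w) (pt x) = pt (c * x) [^] (m::int)"
  using w_square by blast
 have "gf (W y) * gf y \<doteq> m" if y: "unit y" for y
 proof -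
  obtain x where x: "unit x" "W x \<doteq> y" using w_surj[OF y] by blast
  have "cj (w \<otimes> w) (pt x) = cj w (cj w (pt x))" by (simp add: cj_cj)
  also have "cj w (pt x) = pt y [^] gf y" using w_pt_pow_eq[OF x, of 1] by simp
  also have "cj w (pt y [^] gf y) = pt (W y) [^] (gf (W y) * gf y)" by (rule w_pt_pow[OF y])
  finally have "pt (c * x) [^] m = pt (W y) [^] (gf (W y) * gf y)" using rel by simp
  then show ?thesis using pt_eqD(2)[OF _ unit_of_inverse(2)[OF c(2)]] cong_sym by blast
 qed
 then show ?thesis using c by blast
qed

text \<open>Conjugating \<open>h\<close> by \<open>w\<close> gives an element of the same kind with
  inverse scaling factor, since \<open>w\<close> exchanges the two groups of order \<open>p\<close>.
  Evaluating \<open>w \<otimes> h\<close> on \<open>pt x\<close> in both ways yields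
  \<open>W (l * x) = y\<close> when \<open>W x = l * y\<close>, and the exponents differ by
  \<open>l ^ 2\<close>.\<close>

lemma gf_scaling:
 assumes h: "h \<in> \<G>" "cj h ` S = S" "cj h ` T = T" and l: "cj h u = u [^] (l::int)"
  and y: "unit y"
 shows "gf (l * y) * l ^ 2 \<doteq> gf y"
proof -
 obtain l0 m where m0: "cj h u = u [^] (l0::int)" "l0 * m \<doteq> 1" "unit l0"
  and hp0: "\<And>x. cj h (pt x) = pt (l0 * x) [^] (m::int)"
  using torus_elem[OF h] by blast
 have ll: "l0 \<doteq> l" using m0(1) l u_pow_eq by metis
 have lu: "unit l" and m: "l * m \<doteq> 1"
  using m0(3) cong_dvd_iff[OF ll] m0(2) ll by (metis cong_scalar_right cong_sym cong_trans)+
 have mu: "unit m" by (rule unit_of_inverse(2)[OF m])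
 define h' where "h' = w \<otimes> (h \<otimes> inv w)"
 have h': "h' \<in> \<G>" "cj h' ` S = S" "cj h' ` T = T" and wh: "w \<otimes> h = h' \<otimes> w"
  using h w Sc Tc w_inv_S w_inv_T unfolding h'_def by (auto simp: cj_image_cj[symmetric] m_assoc)
 obtain l' m' where lm': "cj h' v = v [^] (m'::int)" "l' * m' \<doteq> 1"
  and hp': "\<And>x. cj h' (pt x) = pt (l' * x) [^] (m'::int)"
  using torus_elem[OF h'] by blast
 have "cj h' v = cj (w \<otimes> h) u" unfolding wh v_def using h' by (simp add: cj_cj)
 also have "\<dots> = v [^] l" using h l by (simp add: cj_cj[symmetric] cj_int_pow v_def)
 finally have m'l: "m' \<doteq> l" using lm'(1) pt_pow_eq[of 0] unfolding pt_0 by simp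
 have l'm: "l' \<doteq> m"
 proof -
  have "l' * l * m \<doteq> 1 * m"
   by (metis lm'(2) m'l cong_scalar_left cong_sym cong_trans cong_scalar_right)
  then show ?thesis
   by (metis m cong_scalar_left cong_sym cong_trans mult.assoc mult.left_neutral mult.right_neutral)
 qed
 obtain x where x: "unit x" "W x \<doteq> l * y" by (metis w_surj unit_mult[OF lu y])
 have lx: "unit (l * x)" by (rule unit_mult[OF lu x(1)])
 have A: "cj (w \<otimes> h) (pt x) = pt (W (l * x)) [^] (gf (W (l * x)) * m)"
  by (simp add: hp0[of x] pt_cong[OF cong_scalar_right[OF ll]] h cj_cj[symmetric] w_pt_pow[OF lx])
 have "cj (h' \<otimes> w) (pt x) = cj h' (cj w (pt x))" using h' by (simp add: cj_cj)
 also have "cj w (pt x) = pt (l * y) [^] gf (l * y)" using w_pt_pow_eq[OF x, of 1] by simp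
 also have "cj h' (pt (l * y) [^] gf (l * y)) = pt (l' * (l * y)) [^] (m' * gf (l * y))"
  using hp' h' by (simp add: cj_int_pow int_pow_pow)
 finally have B: "pt (W (l * x)) [^] (gf (W (l * x)) * m) = pt (l' * (l * y)) [^] (m' * gf (l * y))"
  using A wh by simp
 note d = pt_eqD[OF B unit_mult[OF gf(2)[OF lx] mu]]
 have "l' * (l * y) \<doteq> m * (l * y)" using l'm by (rule cong_scalar_right)
 also have "m * (l * y) = l * m * y" by simp
 also have "l * m * y \<doteq> 1 * y" using m by (rule cong_scalar_right)
 finally have "W (l * x) \<doteq> y" using d(1) cong_trans by fastforce
 then have "gf y * m \<doteq> m' * gf (l * y)" by (metis d(2) gf_cong)
 also have "m' * gf (l * y) \<doteq> l * gf (l * y)" using m'l by (rule cong_scalar_right)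
 finally have "gf y * m * l \<doteq> l * gf (l * y) * l" by (rule cong_scalar_right)
 moreover have "gf y * (l * m) \<doteq> gf y * 1" using m by (rule cong_scalar_left)
 ultimately have "gf y \<doteq> l * gf (l * y) * l"
  by (metis cong_sym cong_trans mult.assoc mult.commute mult.right_neutral)
 then show ?thesis by (simp add: power2_eq_square ac_simps cong_sym_eq)
qed

lemma noncentral_scales: obtains h l where "h \<in> \<G>" "cj h ` S = S" "cj h ` T = T"
  "cj h u = u [^] (l::int)" "unit l" "\<not> l \<doteq> 1"
proof -
 obtain h where h: "h \<in> \<G>" "cj h ` S = S" "cj h ` T = T" "h \<notin> center G" using noncentral by blast
 obtain l :: int where l: "cj h u = u [^] l" "unit l" using to_S h by blast
 show thesis
  using l u_pow_eq[of l 1] fixes_two_imp_center[OF h(1) ST(1) h(2) ST(2) h(3) ST(3) u(1) subgroup.one_closed[OF Z_subgroup]] that h by auto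
qed

lemma p_odd: "2 < p"
proof (rule noncentral_scales)
 fix h and l :: int assume l: "unit l" "\<not> l \<doteq> 1"
 show "2 < p"
 proof (rule ccontr)
  assume "\<not> 2 < p"
  then show False using p_ge_2 l cong_def by fastforce
 qed
qed

text \<open>\<open>S\<close> consists of powers of \<open>u\<close> times \<open>Z\<close>, its
  image under \<open>w'\<close> is \<open>T\<close>, and the powers of \<open>u\<close> carry
  \<open>T\<close> to all remaining blocks.\<close>

lemma block_cover_u_w:
 assumes K: "subgroup K G" and Z: "Z \<subseteq> K" and uK: "u \<in> K"
  and w': "cj w' ` S = T" and c: "\<And>x. x \<in> K \<Longrightarrow> cj w' x \<in> K"
 shows "P \<subseteq> K"
proof
 fix x assume x: "x \<in> P"
 have SK: "S \<subseteq> K"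
  using block_elements[OF ST(1) u(1)] subgroup.m_closed[OF K subgroup_pow[OF K uK]] Z by auto
 then have TK: "T \<subseteq> K" using w' c by blast
 have uc: "cj (u [^] (i::int)) y \<in> K" if "y \<in> K" for i y
  unfolding cj_def using subgroup_int_pow_closed[OF K uK] that subgroup.m_closed[OF K] subgroup.m_inv_closed[OF K] by simp
 obtain B where B: "B \<in> BL" "x \<in> B" using BL_cover[OF x] by blast
 show "x \<in> K"
 proof (cases "B = S")
  case False
  then show ?thesis using blk_exists B uc TK unfolding blk_def by blast
 qed (use SK B in blast)
qed

text \<open>If \<open>gf\<close> were constant, one could choose a generator in each block so that
  all \<open>p\<close>-elements permute the chosen generators exactly. The whole group would then do
  so, contradicting an element that scales \<open>u\<close> by a factor other than 1.\<close>

lemma gf_not_constant: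
 assumes sq: "\<And>y. unit y \<Longrightarrow> gf y ^ 2 \<doteq> 1"
 shows "\<exists>a b. unit a \<and> unit b \<and> \<not> gf a \<doteq> gf b"
proof (rule ccontr)
 assume "\<not> ?thesis"
 then have const: "gf a \<doteq> gf b" if "unit a" "unit b" for a b using that by blast
 have one: "unit 1" using p_ge_2 by auto
 define e where "e = gf 1"
 have e2: "e * e \<doteq> 1" using sq[OF one] by (simp add: e_def power2_eq_square)
 have ge: "gf y \<doteq> e" if "unit y" for y unfolding e_def using const[OF that one] .
 obtain c m where c: "cj w v = u [^] (c::int)" "c * m \<doteq> 1"
  and m: "\<And>y. unit y \<Longrightarrow> gf (W y) * gf y \<doteq> m" using gf_FI1 by blast
 have "gf (W 1) * gf 1 \<doteq> e * e" by (intro cong_mult ge w_step(2) one)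
 then have "c \<doteq> 1" by (metis m[OF one] e2 cong_sym cong_trans c(2) cong_scalar_left mult.right_neutral)
 then have wv: "cj w v = u" using c(1) u_pow_eq[of c 1] by simp
 define t where "t B = (if B = S then u [^] e else tv B)" for B
 have tc: "t B \<in> \<G>" for B unfolding t_def using tv_carrier by simp
 have tee: "t B [^] (e * e) = t B" for B
 proof -
  have "t B [^] (1::int) = t B" using tc by simp
  moreover have "t B [^] (e * e) = t B [^] (1::int)"
   using e2 cong_scalar_left u_pow_eq int_pow_pow tv_pow_eq by (fastforce simp: t_def)
  ultimately show ?thesis by simp
 qed
 have tb: "t (blk x) = pt x" for x unfolding t_def using blk_ne_S tv_blk by simp
 have wt: "cj w (t B) = t (cj w ` B) [^] e" if B: "B \<in> BL" for B
 proof (cases "B = S")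
  case True
  then show ?thesis using tb[of 0] w(2) by (simp add: t_def cj_int_pow v_def[symmetric] pt_0 blk_0)
 next
  case False
  then obtain x where x: "B = blk x" using blk_exists B by blast
  show ?thesis
  proof (cases "int p dvd x")
   case True
   then have "B = T" using x blk_T_iff by simp
   show ?thesis
    using u_pow_eq[of "e * e" 1] e2 tb[of 0] wv w(3) \<open>B = T\<close> t_def int_pow_pow pt_0 blk_0 by fastforce
  next
   case False
   show ?thesis unfolding x w_step(1)[OF False] tb by (metis pt_pow_eq ge[OF w_step(2)[OF False]] gf(1)[OF False])
  qed
 qed
 define K where "K = {g \<in> \<G>. \<forall>B\<in>BL. cj g (t B) = t (cj g ` B)}"
 have pre: "\<exists>B'\<in>BL. B = cj g ` B'" if g: "g \<in> \<G>" and B: "B \<in> BL" for g B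
  using BL_cj[OF B inv_closed[OF g]] BL_carrier[OF B] g by (intro bexI[of _ "cj (inv g) ` B"]) (auto simp: cj_image_cj)
 have K: "subgroup K G"
 proof (rule subgroupI)
  show "K \<subseteq> \<G>" by (auto simp: K_def)
  show "K \<noteq> {}" using tc BL_carrier by (auto simp: K_def)
  fix a assume a: "a \<in> K"
  then have ac: "a \<in> \<G>" by (simp add: K_def)
  have "cj (inv a) (t B) = t (cj (inv a) ` B)" if "B \<in> BL" for B
  proof -
   obtain B' where B': "B' \<in> BL" "B = cj a ` B'" using pre[OF ac \<open>B \<in> BL\<close>] by blast
   have "t B = cj a (t B')" using a B' unfolding K_def by simp
   then show ?thesis using ac tc act_inv[OF ac BL_carrier[OF B'(1)] B'(2)[symmetric]] by simp
  qed
  then show "inv a \<in> K" using ac by (simp add: K_def)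
  fix b assume b: "b \<in> K"
  then have bc: "b \<in> \<G>" by (simp add: K_def)
  have "cj (a \<otimes> b) (t B) = t (cj (a \<otimes> b) ` B)" if B: "B \<in> BL" for B
  proof -
   have "cj (a \<otimes> b) (t B) = cj a (cj b (t B))" using ac bc tc by (simp add: cj_cj)
   also have "\<dots> = t (cj a ` (cj b ` B))" using a b B BL_cj[OF B bc] unfolding K_def by simp
   finally show ?thesis using ac bc BL_carrier[OF B] by (simp add: cj_image_cj)
  qed
  then show "a \<otimes> b \<in> K" using ac bc by (simp add: K_def)
 qed
 have ZK: "Z \<subseteq> K"
 proof
  fix z assume z: "z \<in> Z"
  have "cj z (t B) = t (cj z ` B)" if "B \<in> BL" for B
   using cj_by_Z[OF z tc] BL_self[OF that subsetD[OF Z_BL[OF that] z]] by simp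
  then show "z \<in> K" using z Z_carrier by (auto simp: K_def)
 qed
 have uK: "u \<in> K"
 proof -
  have "cj u (t B) = t (cj u ` B)" if "B \<in> BL" for B
  proof (cases "B = S")
   case True
   show ?thesis using cj_int_pow[of u u e] cj_self[of u u] True BL_self[OF ST(1) u_mem] t_def by fastforce
  next
   case False
   then obtain x where x: "B = blk x" using blk_exists \<open>B \<in> BL\<close> by blast
   show ?thesis unfolding x using cj_blk[of 1 x] cj_pt[of 1 x] tb by simp
  qed
  then show ?thesis by (simp add: K_def)
 qed
 have wK: "cj w g \<in> K" if g: "g \<in> K" for g
 proof -
  have gc: "g \<in> \<G>" using g by (simp add: K_def)
  have "cj (cj w g) (t B) = t (cj (cj w g) ` B)" if B: "B \<in> BL" for B
  proof -
   obtain B' where B': "B' \<in> BL" "B = cj w ` B'" using pre[OF w_carrier B] by blast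
   have wg: "cj w g \<otimes> w = w \<otimes> g" using gc by (simp add: cj_def m_assoc)
   have "t B = (t B [^] e) [^] e" using tee tc by (simp add: int_pow_pow)
   also have "t B [^] e = cj w (t B')" using wt B' by simp
   finally have "cj (cj w g) (t B) = (cj (cj w g) (cj w (t B'))) [^] e"
    using gc tc by (simp add: cj_int_pow)
   also have "cj (cj w g) (cj w (t B')) = cj w (cj g (t B'))"
    using wg gc tc by (simp add: cj_cj)
   also have "\<dots> = t (cj w ` (cj g ` B')) [^] e" using g B' wt[OF BL_cj[OF B'(1) gc]] unfolding K_def by simp
   also have "cj w ` (cj g ` B') = cj (cj w g) ` B"
    using wg gc by (simp add: BL_carrier[OF B'(1)] cj_image_cj B'(2))
   finally show ?thesis using tee tc by (simp add: int_pow_pow)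
  qed
  then show ?thesis using gc by (simp add: K_def)
 qed
 have "\<G> \<subseteq> K" by (simp add: block_cover_u_w[OF K ZK uK w(2) wK] generate_subgroup_incl[OF _ K] gen)
 moreover obtain h l where h: "h \<in> \<G>" "cj h ` S = S" "cj h u = u [^] (l::int)" "\<not> l \<doteq> 1"
  by (rule noncentral_scales)
 ultimately have "cj h (t S) = t (cj h ` S)" using ST(1) unfolding K_def by blast
 then have "l * e * e \<doteq> e * e" by (simp add: h u_pow_eq t_def cj_int_pow int_pow_pow cong_scalar_right)
 then show False by (metis h(4) e2 cong_scalar_left cong_sym cong_trans mult.assoc mult.right_neutral)
qed

text \<open>By \<open>functional_relation\<close> every value of \<open>gf\<close> at a unit is the
  scaling factor of some element fixing \<open>S\<close> and \<open>T\<close>. So either some such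
  factor has a square other than 1, or \<open>gf\<close> takes only values of square 1 and is not
  constant there.\<close>

lemma w_moebius: "\<exists>c. unit c \<and> (\<forall>x. unit x \<longrightarrow> W x * x \<doteq> c)"
proof -
 obtain d where d: "\<And>y. unit y \<Longrightarrow> gf (W y) * gf y \<doteq> d" using gf_FI1 by blast
 interpret M: moebius_data p W gf d
 proof
  show "W x \<doteq> W y" "gf x \<doteq> gf y" if "x \<doteq> y" for x y
   using W_cong[OF that] gf_cong[OF that] by simp_all
  show "x \<doteq> y" if "unit x" "unit y" "W x \<doteq> W y" for x y
   by (metis w_step(1) that blk_eq act_inj[OF w_carrier BL_carrier[OF blk_BL] BL_carrier[OF blk_BL]])
 qed (use prime p_odd w_step(2) gf_unit gf_FI gf_FI0 d in auto)
 show ?thesis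
 proof (cases "\<exists>h\<in>\<G>. cj h ` S = S \<and> cj h ` T = T \<and> (\<exists>l::int. cj h u = u [^] l \<and> \<not> l ^ 2 \<doteq> 1)")
  case True
  then obtain h l where h: "h \<in> \<G>" "cj h ` S = S" "cj h ` T = T" "cj h u = u [^] (l::int)"
   and l: "\<not> l ^ 2 \<doteq> 1" by blast
  have "unit l" by (metis cj_in_Z_iff[OF h(1) u_carrier] u_not_Z h(4) u_pow_Z)
  from M.moebius_scaling[OF gf_scaling[OF h] this l] show ?thesis by blast
 next
  case False
  have "gf y ^ 2 \<doteq> 1" if y: "unit y" for y
  proof -
   obtain x where x: "unit x" "W x \<doteq> y" using w_surj[OF y] by blast
   show ?thesis by (metis gf_cong[OF x(2)] functional_relation[OF x(1)] False)
  qed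
  moreover from this obtain a b where "unit a" "unit b" "\<not> gf a \<doteq> gf b"
   using gf_not_constant by blast
  ultimately show ?thesis by (rule M.moebius_involutory)
 qed
qed

end

section \<open>The Steinberg relations of \<open>SL\<^sub>2(p)\<close>\<close>

lemma primitive_root_int:
 fixes p :: nat
 assumes p: "prime p" "2 < p"
 shows "\<exists>r::int. (\<forall>a. \<not> int p dvd a \<longrightarrow> (\<exists>k. [a = r ^ k] (mod int p))) \<and>
  \<not> int p dvd r \<and> \<not> (\<exists>b. [r = b ^ 2] (mod int p))"
proof -
 have odd: "odd p" using p prime_odd_nat by blast
 obtain g where "\<forall>k>0. residue_primroot (p ^ k) g" using residue_primroot_odd_prime_power_exists[OF p(1) odd] .
 then have g: "residue_primroot p g" by (metis power_one_right zero_less_one)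
 have og: "ord p g = p - 1" "coprime p g" using g p by (auto simp: residue_primroot_def totient_prime)
 have bij: "bij_betw (\<lambda>i. g ^ i mod p) {..<totient p} (totatives p)"
  using residue_primroot_is_generator g p prime_gt_1_nat by blast
 let ?r = "int g"
 have rp: "\<not> int p dvd ?r" using og(2) p by (metis coprime_absorb_left int_dvd_int_iff not_prime_unit)
 have ex: "\<exists>k. [a = ?r ^ k] (mod int p)" if a: "\<not> int p dvd a" for a
 proof -
  define n where "n = nat (a mod int p)"
  have n: "int n = a mod int p" unfolding n_def using p by simp
  have "n > 0" using a n by (metis dvd_eq_mod_eq_0 gr0I of_nat_0)
  moreover have "n < p" using n p by (metis of_nat_0_less_iff of_nat_less_iff pos_mod_bound prime_gt_0_nat)
  ultimately have "n \<in> totatives p" using p(1) by (simp add: totatives_prime)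
  then obtain i where i: "n = g ^ i mod p" using bij by (auto simp: bij_betw_def)
  have "a mod int p = int (g ^ i) mod int p" using n i by (simp add: zmod_int)
  then show ?thesis by (auto simp: cong_def)
 qed
 have ns: False if b: "[?r = b ^ 2] (mod int p)" for b
 proof -
  have bp: "\<not> int p dvd b"
  proof
   assume "int p dvd b"
   then show False using rp cong_dvd_iff[OF b] by (simp add: power2_eq_square)
  qed
  obtain m where m: "p = 2 * m + 1" using odd by (rule oddE)
  have "[?r ^ m = (b ^ 2) ^ m] (mod int p)" using b by (rule cong_pow)
  also have "(b ^ 2) ^ m = b ^ (p - 1)" using m by (simp add: power_mult)
  also have "[b ^ (p - 1) = 1] (mod int p)" by (rule int_fermat[OF p(1) bp])
  finally have "[g ^ m = 1] (mod p)" by (metis cong_int_iff of_nat_1 of_nat_power)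
  then show False using ord_divides og m by simp
 qed
 show ?thesis using ex rp ns by blast
qed

text \<open>The model is \<open>X t\<close> for the upper and \<open>Y t\<close> for the lower
  unitriangular matrix with entry \<open>t\<close>. Then
  \<open>X a \<otimes> (Y (- b) \<otimes> X a)\<close> with \<open>b = 1 / a\<close> is the monomial
  matrix with rows \<open>(0, a)\<close> and \<open>(- b, 0)\<close>, and \<open>wX\<close>,
  \<open>wY\<close> are its conjugation rules.\<close>

locale steinberg = group G + prime_nat p for G (structure) and p +
 fixes X Y :: "int \<Rightarrow> 'a"
 assumes odd: "2 < p"
  and X_closed [simp]: "X t \<in> \<G>" and Y_closed [simp]: "Y t \<in> \<G>"
  and X_add: "X (s + t) = X s \<otimes> X t" and Y_add: "Y (s + t) = Y s \<otimes> Y t"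
  and X_cong: "s \<doteq> t \<Longrightarrow> X s = X t" and Y_cong: "s \<doteq> t \<Longrightarrow> Y s = Y t"
  and wX: "a * b \<doteq> 1 \<Longrightarrow> cj (X a \<otimes> (Y (- b) \<otimes> X a)) (X t) = Y (- (b ^ 2) * t)"
  and wY: "a * b \<doteq> 1 \<Longrightarrow> cj (X a \<otimes> (Y (- b) \<otimes> X a)) (Y t) = X (- (a ^ 2) * t)"
begin

definition iv :: "int \<Rightarrow> int" where "iv a = a ^ (p - 2)"
text \<open>In the model \<open>ww a\<close> has rows \<open>(0, a)\<close> and
  \<open>(- 1 / a, 0)\<close>, and \<open>hh a\<close> is diagonal with entries \<open>a\<close> and
  \<open>1 / a\<close>.\<close>

definition ww where "ww a = X a \<otimes> (Y (- iv a) \<otimes> X a)"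
definition hh where "hh a = ww a \<otimes> inv (ww 1)"

lemma iv: "unit a \<Longrightarrow> a * iv a \<doteq> 1"
proof -
 assume a: "unit a"
 have "p - 1 = Suc (p - 2)" using odd by simp
 then show ?thesis using int_fermat[OF prime a] unfolding iv_def by simp
qed

lemma unit_cong: "a \<doteq> b \<Longrightarrow> unit a \<longleftrightarrow> unit b" using cong_dvd_iff by blast

lemma unit_iv: "unit a \<Longrightarrow> unit (iv a)" using unit_of_inverse(2)[OF iv] .

lemma iv_unique: assumes "a * b \<doteq> 1" shows "iv a \<doteq> b"
proof (rule cancel)
 show a: "unit a" by (rule unit_of_inverse(1)[OF assms])
 show "a * iv a \<doteq> a * b" using iv[OF a] assms cong_trans cong_sym by metis
qed

lemma X_0: "X 0 = \<one>" using X_add[of 0 0] by simp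
lemma Y_0: "Y 0 = \<one>" using Y_add[of 0 0] by simp
lemma X_inv: "inv (X a) = X (- a)" using X_add[of "- a" a] X_0 by (intro inv_equality) auto
lemma Y_inv: "inv (Y a) = Y (- a)" using Y_add[of "- a" a] Y_0 by (intro inv_equality) auto

lemma ww_closed [simp]: "ww a \<in> \<G>" by (simp add: ww_def)
lemma hh_closed [simp]: "hh a \<in> \<G>" by (simp add: hh_def)

lemma ww_eq: "a * b \<doteq> 1 \<Longrightarrow> ww a = X a \<otimes> (Y (- b) \<otimes> X a)"
 unfolding ww_def using Y_cong[of "- iv a" "- b"] iv_unique by (simp add: cong_minus_minus_iff)

lemma ww_cong: assumes "a \<doteq> b" shows "ww a = ww b"
 using assms cong_pow X_cong[OF assms] Y_cong[of "- iv a" "- iv b"] cong_minus_minus_iff by (fastforce simp: iv_def ww_def)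

lemma hh_cong: "a \<doteq> b \<Longrightarrow> hh a = hh b" unfolding hh_def using ww_cong by metis

lemma ww_X: "a * b \<doteq> 1 \<Longrightarrow> cj (ww a) (X t) = Y (- (b ^ 2) * t)" using wX ww_eq by simp
lemma ww_Y: "a * b \<doteq> 1 \<Longrightarrow> cj (ww a) (Y t) = X (- (a ^ 2) * t)" using wY ww_eq by simp

lemma ww_inv: assumes a: "unit a" shows "inv (ww a) = ww (- a)"
proof -
 have "(- a) * (- iv a) \<doteq> 1" using iv[OF a] by simp
 from ww_eq[OF this] show ?thesis unfolding ww_def by (simp add: inv_mult_group X_inv Y_inv m_assoc)
qed

lemma ww_alt: assumes ab: "a * b \<doteq> 1" shows "ww a = Y (- b) \<otimes> (X a \<otimes> Y (- b))"
proof -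
 have "ww a = cj (ww a) (X a) \<otimes> (cj (ww a) (Y (- b)) \<otimes> cj (ww a) (X a))"
  using cj_self[of "ww a" "ww a"] ww_eq[OF ab] cj_mult by fastforce
 also have "cj (ww a) (X a) = Y (- (b ^ 2) * a)" by (rule ww_X[OF ab])
 also have "Y (- (b ^ 2) * a) = Y (- b)"
 proof (rule Y_cong)
  have "- b * (a * b) \<doteq> - b * 1" using ab by (rule cong_scalar_left)
  then show "- (b ^ 2) * a \<doteq> - b" by (simp add: power2_eq_square ac_simps)
 qed
 also have "cj (ww a) (Y (- b)) = X (- (a ^ 2) * (- b))" by (rule ww_Y[OF ab])
 also have "\<dots> = X a"
 proof (rule X_cong)
  have "a * (a * b) \<doteq> a * 1" using ab by (rule cong_scalar_left)
  then show "- (a ^ 2) * (- b) \<doteq> a" by (simp add: power2_eq_square ac_simps)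
 qed
 finally show ?thesis .
qed

lemma cjD: "g \<in> \<G> \<Longrightarrow> x \<in> \<G> \<Longrightarrow> cj g x = y \<Longrightarrow> g \<otimes> x = y \<otimes> g"
 by (auto simp: cj_def m_assoc)

lemma hh_X: assumes ab: "a * b \<doteq> 1" shows "cj (hh a) (X t) = X (a ^ 2 * t)"
proof -
 have "(- 1) * (- 1) \<doteq> (1::int)" by simp
 note w1 = ww_X[OF this] ww_Y[OF this]
 have "cj (hh a) (X t) = cj (ww a) (cj (ww (- 1)) (X t))" unfolding hh_def by (simp add: cj_cj ww_inv[OF unit_one])
 also have "cj (ww (- 1)) (X t) = Y (- t)" using w1(1)[of t] by simp
 also have "cj (ww a) (Y (- t)) = X (a ^ 2 * t)" using ww_Y[OF ab, of "- t"] by simp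
 finally show ?thesis .
qed

lemma hh_Y: assumes ab: "a * b \<doteq> 1" shows "cj (hh a) (Y t) = Y (b ^ 2 * t)"
proof -
 have "(- 1) * (- 1) \<doteq> (1::int)" by simp
 note w1 = ww_X[OF this] ww_Y[OF this]
 have "cj (hh a) (Y t) = cj (ww a) (cj (ww (- 1)) (Y t))" unfolding hh_def by (simp add: cj_cj ww_inv[OF unit_one])
 also have "cj (ww (- 1)) (Y t) = X (- t)" using w1(2)[of t] by simp
 also have "cj (ww a) (X (- t)) = Y (b ^ 2 * t)" using ww_X[OF ab, of "- t"] by simp
 finally show ?thesis .
qed

lemma hh_1: "hh 1 = \<one>" by (simp add: hh_def)

text \<open>By \<open>ww_alt\<close> the factor \<open>X (- s)\<close> is \<open>inv (ww s)\<close>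
  between two factors \<open>Y (- s')\<close>. These are pushed outwards through \<open>ww a\<close>
  and \<open>ww b\<close>, where they become values of \<open>X\<close>.\<close>

lemma ww_X_ww:
 assumes a: "unit a" and b: "unit b" and s: "s * s' \<doteq> 1"
 shows "ww a \<otimes> (X (- s) \<otimes> ww b) = X (a ^ 2 * s') \<otimes> (ww a \<otimes> (inv (ww s) \<otimes> (ww b \<otimes> X (b ^ 2 * s'))))"
proof -
 have ms: "(- s) * (- s') \<doteq> 1" using s by simp
 have su: "unit s" by (rule unit_of_inverse(1)[OF s])
 have "Y s' \<otimes> (X (- s) \<otimes> Y s') = ww (- s)" using ww_alt[OF ms] by simp
 then have e: "X (- s) = Y (- s') \<otimes> (inv (ww s) \<otimes> Y (- s'))"
  unfolding ww_inv[OF su]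
  by (simp add: m_assoc Y_inv[symmetric] flip: \<open>Y s' \<otimes> (X (- s) \<otimes> Y s') = ww (- s)\<close>)
   (simp add: m_assoc[symmetric])
 have A: "ww a \<otimes> Y (- s') = X (a ^ 2 * s') \<otimes> ww a"
  using cjD[OF ww_closed Y_closed ww_Y[OF iv[OF a], of "- s'"]] by simp
 have mb: "(- b) * (- iv b) \<doteq> 1" using iv[OF b] by simp
 have "cj (inv (ww b)) (Y (- s')) = X (b ^ 2 * s')" using ww_Y[OF mb, of "- s'"] by (simp add: ww_inv[OF b])
 then have B: "ww b \<otimes> X (b ^ 2 * s') = Y (- s') \<otimes> ww b"
  by (metis cj_cj_inv ww_closed Y_closed cjD[OF ww_closed X_closed])
 have "ww a \<otimes> (X (- s) \<otimes> ww b) = (ww a \<otimes> Y (- s')) \<otimes> (inv (ww s) \<otimes> (Y (- s') \<otimes> ww b))"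
  unfolding e by (simp add: m_assoc)
 also have "\<dots> = X (a ^ 2 * s') \<otimes> (ww a \<otimes> (inv (ww s) \<otimes> (ww b \<otimes> X (b ^ 2 * s'))))"
  unfolding A B[symmetric] by (simp add: m_assoc)
 finally show ?thesis .
qed

text \<open>This is additivity of \<open>Y\<close> at \<open>- 1 / a\<close> and
  \<open>- 1 / b\<close>, read through
  \<open>Y (- 1 / c) = X (- c) \<otimes> (ww c \<otimes> X (- c))\<close>: the argument on the right
  is the reciprocal of \<open>1 / a + 1 / b\<close>.\<close>

lemma ww_sum:
 assumes a: "unit a" and b: "unit b" and s: "unit (a + b)"
 shows "ww a \<otimes> (inv (ww (a + b)) \<otimes> ww b) = ww (a * b * iv (a + b))"
proof -
 let ?s = "a + b" and ?i = "iv (a + b)"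
 let ?r = "a * b * ?i"
 have i: "?s * ?i \<doteq> 1" by (rule iv[OF s])
 have ir: "?r * (iv a + iv b) \<doteq> 1"
 proof -
  have "?r * (iv a + iv b) = ?i * (b * (a * iv a) + a * (b * iv b))" by (simp add: algebra_simps)
  also have "?i * (b * (a * iv a) + a * (b * iv b)) \<doteq> ?i * (b * 1 + a * 1)"
   by (rule cong_scalar_left) (rule cong_add; rule cong_scalar_left, rule iv, fact)
  also have "?i * (b * 1 + a * 1) = ?s * ?i" by simp
  also note i
  finally show ?thesis .
 qed
 have wc: "X (- c) \<otimes> (ww c \<otimes> X (- c)) = Y (- d)" if "c * d \<doteq> 1" for c d
  unfolding ww_eq[OF that] by (simp add: X_inv[symmetric] m_assoc) (simp add: m_assoc[symmetric])
 have "X (- ?r) \<otimes> (ww ?r \<otimes> X (- ?r)) = (X (- a) \<otimes> (ww a \<otimes> X (- a))) \<otimes> (X (- b) \<otimes> (ww b \<otimes> X (- b)))"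
  using Y_add[of "- iv a" "- iv b"] wc[OF ir] wc[OF iv[OF a]] wc[OF iv[OF b]] by fastforce
 also have "\<dots> = X (- a) \<otimes> ((ww a \<otimes> ((X (- a) \<otimes> X (- b)) \<otimes> ww b)) \<otimes> X (- b))" by (simp add: m_assoc)
 also have "X (- a) \<otimes> X (- b) = X (- ?s)" using X_add[of "- a" "- b"] by simp
 also have "ww a \<otimes> (X (- ?s) \<otimes> ww b) = X (a ^ 2 * ?i) \<otimes> (ww a \<otimes> (inv (ww ?s) \<otimes> (ww b \<otimes> X (b ^ 2 * ?i))))"
  by (rule ww_X_ww[OF a b i])
 also have "X (- a) \<otimes> (X (a ^ 2 * ?i) \<otimes> (ww a \<otimes> (inv (ww ?s) \<otimes> (ww b \<otimes> X (b ^ 2 * ?i)))) \<otimes> X (- b)) =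
   (X (- a) \<otimes> X (a ^ 2 * ?i)) \<otimes> ((ww a \<otimes> (inv (ww ?s) \<otimes> ww b)) \<otimes> (X (b ^ 2 * ?i) \<otimes> X (- b)))"
  by (simp add: m_assoc)
 also have "X (- a) \<otimes> X (a ^ 2 * ?i) = X (- ?r)"
  unfolding X_add[symmetric]
 proof (rule X_cong)
  have "- a + a ^ 2 * ?i + ?r = a * (?s * ?i - 1)" by (simp add: power2_eq_square algebra_simps)
  then show "- a + a ^ 2 * ?i \<doteq> - ?r" using i by (simp add: cong_iff_dvd_diff)
 qed
 also have "X (b ^ 2 * ?i) \<otimes> X (- b) = X (- ?r)"
  unfolding X_add[symmetric]
 proof (rule X_cong)
  have "b ^ 2 * ?i + - b + ?r = b * (?s * ?i - 1)" by (simp add: power2_eq_square algebra_simps)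
  then show "b ^ 2 * ?i + - b \<doteq> - ?r" using i by (simp add: cong_iff_dvd_diff)
 qed
 finally have "X (- ?r) \<otimes> (ww ?r \<otimes> X (- ?r)) =
  X (- ?r) \<otimes> ((ww a \<otimes> (inv (ww ?s) \<otimes> ww b)) \<otimes> X (- ?r))" .
 then show ?thesis by simp
qed

lemma comm_ww: assumes g: "g \<in> \<G>" and X: "\<And>t. g \<otimes> X t = X t \<otimes> g" and Y: "\<And>t. g \<otimes> Y t = Y t \<otimes> g"
 shows "g \<otimes> ww a = ww a \<otimes> g" "g \<otimes> hh a = hh a \<otimes> g"
 unfolding ww_def hh_def by (auto simp: comm_mult g X Y comm_inv)

lemma hh_pow_X: assumes ab: "a * b \<doteq> 1"
 shows "cj (hh a [^] (k::nat)) (X t) = X ((a ^ k) ^ 2 * t)" "cj (hh a [^] (k::nat)) (Y t) = Y ((b ^ k) ^ 2 * t)"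
proof (induction k arbitrary: t)
 case (Suc k)
 { case 1
  have "cj (hh a [^] Suc k) (X t) = cj (hh a [^] k) (cj (hh a) (X t))" by (simp add: cj_cj)
  also have "\<dots> = X ((a ^ k) ^ 2 * (a ^ 2 * t))" unfolding hh_X[OF ab] by (rule Suc)
  finally show ?case by (simp add: power_mult_distrib ac_simps) }
 { case 2
  have "cj (hh a [^] Suc k) (Y t) = cj (hh a [^] k) (cj (hh a) (Y t))" by (simp add: cj_cj)
  also have "\<dots> = Y ((b ^ k) ^ 2 * (b ^ 2 * t))" unfolding hh_Y[OF ab] by (rule Suc)
  finally show ?case by (simp add: power_mult_distrib ac_simps) }
qed simp_all

text \<open>With a primitive root \<open>r\<close> and \<open>a = r ^ k\<close>, the elements
  \<open>hh a\<close> and \<open>hh r [^] k\<close> act alike on all \<open>X t\<close> and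
  \<open>Y t\<close>. They differ by an element commuting with these and hence with every
  \<open>hh b\<close>.\<close>

lemma hh_comm: assumes a: "unit a" and b: "unit b" shows "hh a \<otimes> hh b = hh b \<otimes> hh a"
proof -
 obtain r where r: "\<And>a. unit a \<Longrightarrow> \<exists>k. a \<doteq> r ^ k" "unit r"
  using primitive_root_int[OF prime odd] by blast
 have split: "\<exists>k D. D \<in> \<G> \<and> hh a = hh r [^] (k::nat) \<otimes> D \<and> (\<forall>b. D \<otimes> hh b = hh b \<otimes> D)"
  if a: "unit a" for a
 proof -
  obtain k where k: "a \<doteq> r ^ k" using r(1)[OF a] by blast
  have ik: "iv a \<doteq> iv r ^ k"
  proof (rule iv_unique)
   have "a * iv r ^ k \<doteq> r ^ k * iv r ^ k" using k by (rule cong_scalar_right)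
   also have "r ^ k * iv r ^ k = (r * iv r) ^ k" by (rule power_mult_distrib[symmetric])
   also have "(r * iv r) ^ k \<doteq> 1 ^ k" by (rule cong_pow[OF iv[OF r(2)]])
   finally show "a * iv r ^ k \<doteq> 1" by simp
  qed
  define R where "R = hh r [^] k"
  define D where "D = inv R \<otimes> hh a"
  have Rc: "R \<in> \<G>" by (simp add: R_def)
  have D: "D \<in> \<G>" "hh a = R \<otimes> D" unfolding D_def using Rc by (simp_all add: m_assoc[symmetric])
  have "cj (hh a) (X t) = cj R (X t)" "cj (hh a) (Y t) = cj R (Y t)" for t
   unfolding R_def hh_pow_X[OF iv[OF r(2)]] hh_X[OF iv[OF a]] hh_Y[OF iv[OF a]]
   by (rule X_cong Y_cong, rule cong_scalar_right, rule cong_pow, rule k ik)+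
  then have "cj D (X t) = X t" "cj D (Y t) = Y t" for t
   unfolding D_def using Rc by (simp_all add: cj_cj[symmetric])
  then have "D \<otimes> hh b = hh b \<otimes> D" for b using cj_self D(1) comm_ww(2) by simp
  then show ?thesis using D R_def by blast
 qed
 have 1: "hh c \<otimes> hh r = hh r \<otimes> hh c" if c: "unit c" for c
  by (metis split[OF c] comm_mult comm_pow hh_closed nat_pow_closed)
 obtain k D where D: "D \<in> \<G>" "hh b = hh r [^] (k::nat) \<otimes> D" "\<And>b. D \<otimes> hh b = hh b \<otimes> D"
  using split[OF b] by blast
 show ?thesis unfolding D(2)
  by (intro comm_mult comm_pow D(3)[symmetric] hh_closed nat_pow_closed D(1) 1 a)
qed

text \<open>Conjugation by \<open>hh a\<close> multiplies the argument of \<open>ww\<close> by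
  \<open>a ^ 2\<close>, but leaves \<open>hh b\<close> fixed by \<open>hh_comm\<close>. Comparing
  the two gives the claim.\<close>

lemma hh_square: assumes a: "unit a" and b: "unit b" shows "hh (a ^ 2 * b) = hh (a ^ 2) \<otimes> hh b"
proof -
 have w: "cj (hh a) (ww c) = ww (a ^ 2 * c)" if c: "unit c" for c
 proof -
  have e: "(a ^ 2 * c) * (iv a ^ 2 * iv c) \<doteq> 1"
  proof -
   have "(a ^ 2 * c) * (iv a ^ 2 * iv c) = (a * iv a) ^ 2 * (c * iv c)" by (simp add: power2_eq_square)
   then show ?thesis by (metis cong_mult[OF cong_pow[OF iv[OF a]] iv[OF c]] power_one mult_1)
  qed
  have "cj (hh a) (ww c) = cj (hh a) (X c) \<otimes> (cj (hh a) (Y (- iv c)) \<otimes> cj (hh a) (X c))"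
   unfolding ww_def by (simp add: cj_mult)
  then show ?thesis unfolding hh_X[OF iv[OF a]] hh_Y[OF iv[OF a]] ww_eq[OF e] by simp
 qed
 have e: "hh b = ww (a ^ 2 * b) \<otimes> inv (ww (a ^ 2))"
  using iffD2[OF cj_self hh_comm[OF a b]] by (simp add: cj_mult cj_inv hh_def[of b] w[OF b] w[OF unit_one])
 have "ww (a ^ 2 * b) = hh b \<otimes> ww (a ^ 2)" unfolding e by (simp add: m_assoc)
 then have "hh (a ^ 2 * b) = hh b \<otimes> hh (a ^ 2)" unfolding hh_def[of "a ^ 2 * b"] hh_def[of "a ^ 2"] by (simp add: m_assoc)
 then show ?thesis by (metis a unit_mult_iff hh_comm[OF b] power2_eq_square)
qed

definition sqr where "sqr a \<longleftrightarrow> (\<exists>b. a \<doteq> b ^ 2)"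

lemma sqr_unit: assumes "a \<doteq> b ^ 2" "unit a" shows "unit b"
 using unit_cong[OF assms(1)] assms(2) unit_mult_iff by (simp add: power2_eq_square)

lemma nonsquares_ratio:
 assumes a: "unit a" "\<not> sqr a" and b: "unit b" "\<not> sqr b"
 shows "\<exists>c. unit c \<and> a \<doteq> c ^ 2 * b"
proof -
 obtain r where r: "\<And>a. unit a \<Longrightarrow> \<exists>k. a \<doteq> r ^ k" using primitive_root_int[OF prime odd] by blast
 obtain k where k: "a \<doteq> r ^ k" using r a by blast
 obtain j where j: "b \<doteq> r ^ j" using r b by blast
 have "Parity.odd k" "Parity.odd j" using a b k j unfolding sqr_def by (metis evenE power_mult mult.commute)+
 then obtain m where m: "k + j = 2 * m" by (metis evenE odd_even_add)
 have q: "a * b \<doteq> (r ^ m) ^ 2"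
 proof -
  have "a * b \<doteq> r ^ k * r ^ j" using k j by (rule cong_mult)
  also have "r ^ k * r ^ j = r ^ (2 * m)" unfolding m[symmetric] by (rule power_add[symmetric])
  also have "\<dots> = (r ^ m) ^ 2" by (metis mult.commute power_mult)
  finally show ?thesis .
 qed
 let ?c = "r ^ m * iv b"
 have "a \<doteq> ?c ^ 2 * b"
 proof (rule cancel[OF b(1)])
  have "b * (?c ^ 2 * b) = (r ^ m) ^ 2 * (b * iv b) ^ 2" by (simp add: power2_eq_square)
  then show "b * a \<doteq> b * (?c ^ 2 * b)"
   using cong_mult[OF cong_sym[OF q] cong_pow[OF iv[OF b(1)]]] mult.commute[of a] cong_sym by fastforce
 qed
 then show ?thesis by (metis unit_cong[OF q] a b unit_iv[OF b(1)] unit_mult_iff power2_eq_square)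
qed

text \<open>If \<open>k\<close> is the least non-square then \<open>k - 1\<close> is a square, so \<open>1/k\<close> and \<open>(k - 1)/k\<close> are
 non-squares with sum 1.\<close>

lemma nonsquares_sum: "\<exists>a b. unit a \<and> unit b \<and> \<not> sqr a \<and> \<not> sqr b \<and> a + b \<doteq> 1"
proof -
 obtain r where r: "unit r" "\<not> sqr r" unfolding sqr_def using primitive_root_int[OF prime odd] by blast
 let ?Q = "\<lambda>k::nat. unit (int k) \<and> \<not> sqr (int k)"
 have p0: "int p > 0" using odd by simp
 have rr: "int (nat (r mod int p)) = r mod int p" using p0 by simp
 have rc: "int (nat (r mod int p)) \<doteq> r" unfolding rr by simp
 have Qr: "?Q (nat (r mod int p))"
  using r rc unit_cong[OF rc] unfolding sqr_def by (metis cong_sym cong_trans)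
 define k where "k = (LEAST k. ?Q k)"
 have k: "?Q k" unfolding k_def by (rule LeastI[of ?Q, OF Qr])
 have kp: "int k < int p"
  unfolding k_def by (metis p0 Least_le[of ?Q, OF Qr] rr le_less_trans of_nat_le_iff pos_mod_bound)
 have "k \<noteq> 0" using k by (metis dvd_0_right of_nat_0)
 moreover have "k \<noteq> 1" using k unfolding sqr_def by (metis cong_refl of_nat_1 power_one)
 ultimately have k2: "2 \<le> k" by simp
 have "\<not> ?Q (k - 1)" unfolding k_def[symmetric] using not_less_Least[of "k - 1" ?Q] k2 k_def by simp
 moreover have km: "int (k - 1) = int k - 1" and ku: "unit (int k - 1)"
  using k2 zdvd_imp_le[of "int p" "int k - 1"] kp by auto
 ultimately obtain s where s: "int k - 1 \<doteq> s ^ 2" unfolding sqr_def by auto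
 let ?i = "iv (int k)"
 have ki: "int k * ?i \<doteq> 1" using iv k by blast
 have sum: "?i + (int k - 1) * ?i \<doteq> 1" using ki by (simp add: algebra_simps)
 have ni: "\<not> sqr ?i"
 proof
  assume "sqr ?i"
  then obtain b where b: "?i \<doteq> b ^ 2" unfolding sqr_def by blast
  have "int k \<doteq> (int k * b) ^ 2"
  proof -
   have "(int k * b) ^ 2 = int k * (int k * b ^ 2)" by (simp add: power2_eq_square)
   moreover have "int k * (int k * b ^ 2) \<doteq> int k * 1"
    by (metis cong_sym[OF b] cong_scalar_left ki cong_trans)
   ultimately have "(int k * b) ^ 2 \<doteq> int k" by simp
   then show ?thesis by (rule cong_sym)
  qed
  then show False using k unfolding sqr_def by blast
 qed
 have su: "unit s" using sqr_unit[OF s ku] .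
 have "\<not> sqr ((int k - 1) * ?i)"
 proof
  assume "sqr ((int k - 1) * ?i)"
  then obtain b where b: "(int k - 1) * ?i \<doteq> b ^ 2" unfolding sqr_def by blast
  have 1: "iv s ^ 2 * (s ^ 2 * ?i) \<doteq> iv s ^ 2 * b ^ 2"
   by (metis cong_trans[OF cong_scalar_right[OF cong_sym[OF s]] b] cong_scalar_left)
  have 2: "(s * iv s) ^ 2 * ?i \<doteq> 1 ^ 2 * ?i" by (rule cong_scalar_right[OF cong_pow[OF iv[OF su]]])
  have e: "(s * iv s) ^ 2 * ?i = iv s ^ 2 * (s ^ 2 * ?i)" "iv s ^ 2 * b ^ 2 = (iv s * b) ^ 2" "1 ^ 2 * ?i = ?i"
   by (simp_all add: power2_eq_square)
  show False using cong_trans[OF cong_sym[OF 2[unfolded e]] 1[unfolded e(2)]] ni by (simp add: sqr_def)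
 qed
 then show ?thesis by (metis unit_iv k ku unit_mult_iff ni sum)
qed

text \<open>Steinberg's argument that symbols over a finite field are trivial. Square factors are
  covered by \<open>hh_square\<close>; two non-squares agree up to squares with non-squares
  \<open>m\<close>, \<open>n\<close> of sum 1, and for these \<open>ww_sum\<close> says
  \<open>hh m \<otimes> hh n = hh (m * n)\<close>.\<close>

lemma hh_mult: assumes a: "unit a" and b: "unit b" shows "hh (a * b) = hh a \<otimes> hh b"
proof -
 have sq: "hh (a * b) = hh a \<otimes> hh b" if "unit a" "unit b" "sqr a" for a b
 proof -
  obtain c where c: "a \<doteq> c ^ 2" using \<open>sqr a\<close> unfolding sqr_def by blast
  show ?thesis by (metis hh_cong cong_scalar_right c hh_square[OF sqr_unit[OF c that(1)] that(2)])
 qed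
 show ?thesis
 proof (cases "sqr a \<or> sqr b")
  case True
  then show ?thesis using sq[OF a b] sq[OF b a] hh_comm[OF a b] by (auto simp: mult.commute)
 next
  case False
  obtain m n where mn: "unit m" "unit n" "\<not> sqr m" "\<not> sqr n" "m + n \<doteq> 1" using nonsquares_sum by blast
  have s: "unit (m + n)" using unit_cong[OF mn(5)] unit_one by blast
  have h: "hh m \<otimes> hh n = hh (m * n)"
  proof -
   have "iv (m + n) \<doteq> 1" using mn(5) by (intro iv_unique) simp
   then have "ww (m * n * iv (m + n)) = ww (m * n * 1)" by (intro ww_cong cong_scalar_left)
   then have "ww m \<otimes> (inv (ww 1) \<otimes> ww n) \<otimes> inv (ww 1) = hh (m * n)"
    using ww_sum[OF mn(1,2) s] ww_cong[OF mn(5)] hh_def[of "m * n"] by fastforce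
   then show ?thesis unfolding hh_def[of m] hh_def[of n] by (simp add: m_assoc)
  qed
  obtain c where c: "unit c" "a \<doteq> c ^ 2 * m" using nonsquares_ratio a mn False by blast
  obtain d where d: "unit d" "b \<doteq> d ^ 2 * n" using nonsquares_ratio b mn False by blast
  have cc: "unit (c ^ 2)" "unit (d ^ 2)" "unit (m * n)" "unit (d ^ 2 * (m * n))"
   using c d mn unit_mult_iff by (simp_all add: power2_eq_square)
  have "hh a \<otimes> hh b = hh (c ^ 2) \<otimes> ((hh m \<otimes> hh (d ^ 2)) \<otimes> hh n)"
   by (simp add: hh_cong[OF c(2)] hh_cong[OF d(2)] hh_square c d mn m_assoc)
  also have "hh m \<otimes> hh (d ^ 2) = hh (d ^ 2) \<otimes> hh m" by (rule hh_comm[OF mn(1) cc(2)])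
  also have "hh (c ^ 2) \<otimes> (hh (d ^ 2) \<otimes> hh m \<otimes> hh n) = hh (c ^ 2) \<otimes> (hh (d ^ 2) \<otimes> hh (m * n))"
   unfolding h[symmetric] by (simp add: m_assoc)
  also have "\<dots> = hh (c ^ 2 * (d ^ 2 * (m * n)))" using hh_square[OF c(1) cc(4)] hh_square[OF d(1) cc(3)] by simp
  also have "\<dots> = hh (a * b)"
  proof (rule hh_cong)
   have "c ^ 2 * (d ^ 2 * (m * n)) = (c ^ 2 * m) * (d ^ 2 * n)" by simp
   then show "c ^ 2 * (d ^ 2 * (m * n)) \<doteq> a * b" using cong_sym[OF cong_mult[OF c(2) d(2)]] by (simp only:)
  qed
  finally show ?thesis by simp
 qed
qed

lemma ww_1_ww: assumes ab: "a * b \<doteq> 1" shows "ww 1 \<otimes> hh a = ww b"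
proof -
 have ba: "b * a \<doteq> 1" using ab by (simp add: mult.commute)
 have 1: "1 * 1 \<doteq> (1::int)" by simp
 have "cj (ww 1) (ww a) = cj (ww 1) (X a) \<otimes> (cj (ww 1) (Y (- b)) \<otimes> cj (ww 1) (X a))"
  unfolding ww_eq[OF ab] by (simp add: cj_mult)
 also have "\<dots> = ww b" unfolding ww_X[OF 1] ww_Y[OF 1] ww_alt[OF ba] by simp
 finally show ?thesis unfolding hh_def using cj_def by (simp add: m_assoc)
qed

end

section \<open>From the Steinberg relations to a homomorphism on SL_2(p)\<close>

fun mm :: "int \<times> int \<times> int \<times> int \<Rightarrow> int \<times> int \<times> int \<times> int \<Rightarrow> int \<times> int \<times> int \<times> int"
 where "mm (a, b, c, d) (a', b', c', d') = (a * a' + b * c', a * b' + b * d', c * a' + d * c', c * b' + d * d')"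

fun dt :: "int \<times> int \<times> int \<times> int \<Rightarrow> int"
 where "dt (a, b, c, d) = a * d - b * c"

lemma dt_mm: "dt (mm M N) = dt M * dt N"
 by (cases M; cases N) (simp add: algebra_simps)

lemma mm_assoc: "mm (mm L M) N = mm L (mm M N)"
 by (cases L; cases M; cases N) (simp add: algebra_simps)

context steinberg begin

lemma cancel_left: "x \<in> \<G> \<Longrightarrow> y \<in> \<G> \<Longrightarrow> inv x \<otimes> (x \<otimes> y) = y"
  "x \<in> \<G> \<Longrightarrow> y \<in> \<G> \<Longrightarrow> x \<otimes> (inv x \<otimes> y) = y"
 by (simp_all add: m_assoc[symmetric])

text \<open>The Bruhat normal form: with \<open>c = 0\<close> the matrix is upper triangular, and
  otherwise it is an upper unitriangular matrix, a monomial one and another upper unitriangular one.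
  Arguments are unreduced integer matrices, so that identities can be checked over the
  integers.\<close>

fun Phi :: "int \<times> int \<times> int \<times> int \<Rightarrow> 'a"
 where "Phi (a, b, c, d) = (if int p dvd c then X (a * b) \<otimes> hh a
  else X (a * iv c) \<otimes> (ww (- iv c) \<otimes> X (d * iv c)))"

fun meq :: "int \<times> int \<times> int \<times> int \<Rightarrow> int \<times> int \<times> int \<times> int \<Rightarrow> bool"
 where "meq (a, b, c, d) (a', b', c', d') \<longleftrightarrow> a \<doteq> a' \<and> b \<doteq> b' \<and> c \<doteq> c' \<and> d \<doteq> d'"

lemma Phi_closed [simp]: "Phi M \<in> \<G>" by (cases M) simp

lemma iv_cong: "a \<doteq> b \<Longrightarrow> iv a \<doteq> iv b" unfolding iv_def by (rule cong_pow)

lemma iv_minus: "unit a \<Longrightarrow> iv (- a) \<doteq> - iv a" using iv by (intro iv_unique) simp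

lemma Phi_cong: "meq M N \<Longrightarrow> Phi M = Phi N"
proof -
 assume e: "meq M N"
 obtain a b c d a' b' c' d' where MN: "M = (a, b, c, d)" "N = (a', b', c', d')" by (metis prod_cases4)
 have e: "a \<doteq> a'" "b \<doteq> b'" "c \<doteq> c'" "d \<doteq> d'" using e by (auto simp: MN)
 have "X (a * b) = X (a' * b')" "hh a = hh a'" "X (a * iv c) = X (a' * iv c')" "X (d * iv c) = X (d' * iv c')"
  using e by (auto intro!: X_cong hh_cong cong_mult iv_cong)
 then show ?thesis by (simp add: iv_cong[OF e(3)] ww_cong cong_minus_minus_iff cong_dvd_iff[OF e(3)] MN)
qed

lemma meq_mm: "meq M M' \<Longrightarrow> meq (mm M N) (mm M' N)"
 by (cases M; cases M'; cases N) (auto intro!: cong_add cong_mult)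

lemma meq_dt: "meq M N \<Longrightarrow> dt M \<doteq> dt N"
 by (cases M; cases N) (auto intro!: cong_diff cong_mult)

lemma hh_X': "unit a \<Longrightarrow> hh a \<otimes> X t = X (a ^ 2 * t) \<otimes> hh a"
 using cjD[OF hh_closed X_closed hh_X[OF iv]] .

lemma upper_triangular:
 assumes "dt (a, b, c, d) \<doteq> 1" "int p dvd c"
 shows "a * d \<doteq> 1"
proof -
 have "b * c \<doteq> 0" using assms(2) by (simp add: cong_0_iff)
 then have "a * d - b * c \<doteq> a * d - 0" by (rule cong_diff[OF cong_refl])
 then show ?thesis using assms(1) cong_trans[OF cong_sym] by simp
qed

lemma Phi_X_mult:
 assumes dt: "dt (a, b, c, d) \<doteq> 1"
 shows "Phi (a + t * c, b + t * d, c, d) = X t \<otimes> Phi (a, b, c, d)"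
proof (cases "int p dvd c")
 case True
 have ad: "a * d \<doteq> 1" by (rule upper_triangular[OF dt True])
 have "t * c \<doteq> 0" using True by (simp add: cong_0_iff)
 then have a: "a + t * c \<doteq> a" using cong_add[OF cong_refl] by fastforce
 have "(a + t * c) * (b + t * d) \<doteq> a * (b + t * d)" using a by (rule cong_scalar_right)
 also have "a * (b + t * d) = a * b + t * (a * d)" by (simp add: algebra_simps)
 also have "a * b + t * (a * d) \<doteq> a * b + t * 1" by (rule cong_add[OF cong_refl cong_scalar_left[OF ad]])
 finally have "X ((a + t * c) * (b + t * d)) = X (t + a * b)" by (intro X_cong) (simp add: add.commute)
 then show ?thesis using True hh_cong[OF a] by (simp add: X_add m_assoc)
next
 case False
 have "(a + t * c) * iv c = t * (c * iv c) + a * iv c" by (simp add: algebra_simps)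
 also have "t * (c * iv c) + a * iv c \<doteq> t * 1 + a * iv c"
  by (rule cong_add[OF cong_scalar_left[OF iv[OF False]] cong_refl])
 finally have "X ((a + t * c) * iv c) = X (t + a * iv c)" by (intro X_cong) simp
 then show ?thesis using False by (simp add: X_add m_assoc)
qed

lemma inv_hh: "unit c \<Longrightarrow> inv (hh (iv c)) = hh c"
proof (rule inv_equality)
 assume c: "unit c"
 show "hh c \<otimes> hh (iv c) = \<one>" by (metis hh_mult[OF c unit_iv[OF c]] hh_cong[OF iv[OF c]] hh_1)
qed simp_all

text \<open>The three cases are the cells of the matrix before and after multiplication. The
  decisive one has \<open>a\<close> and \<open>c\<close> both units: \<open>ww_X_ww\<close> restores
  the normal form and \<open>hh_mult\<close> identifies its middle factor.\<close>

lemma Phi_W_mult: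
 assumes dt: "dt (a, b, c, d) \<doteq> 1"
 shows "Phi (c, d, - a, - b) = ww 1 \<otimes> Phi (a, b, c, d)"
proof (cases "int p dvd c")
 case True
 have ad: "a * d \<doteq> 1" by (rule upper_triangular[OF dt True])
 have a: "unit a" by (rule unit_of_inverse(1)[OF ad])
 have "X (c * iv (- a)) = X 0" using True by (intro X_cong) (simp add: cong_0_iff)
 moreover have "- iv (- a) \<doteq> - (- iv a)" using iv_minus[OF a] by (simp only: cong_minus_minus_iff)
 then have "ww (- iv (- a)) = ww (iv a)" by (intro ww_cong) simp
 moreover have "X (- b * iv (- a)) = X (b * iv a)"
  using cong_scalar_left[OF iv_minus[OF a], of "- b"] by (intro X_cong) simp
 ultimately have "Phi (c, d, - a, - b) = ww (iv a) \<otimes> X (b * iv a)" using a by (simp add: X_0)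
 also have "\<dots> = ww 1 \<otimes> (hh a \<otimes> X (b * iv a))" unfolding ww_1_ww[OF iv[OF a], symmetric] by (simp add: m_assoc)
 also have "hh a \<otimes> X (b * iv a) = X (a ^ 2 * (b * iv a)) \<otimes> hh a" by (rule hh_X'[OF a])
 also have "X (a ^ 2 * (b * iv a)) = X (a * b)"
 proof (rule X_cong)
  have "a ^ 2 * (b * iv a) = a * b * (a * iv a)" by (simp add: power2_eq_square)
  then show "a ^ 2 * (b * iv a) \<doteq> a * b" by (metis cong_scalar_left[OF iv[OF a]] mult_1_right)
 qed
 finally show ?thesis using True by simp
next
 case c: False
 show ?thesis
 proof (cases "int p dvd a")
  case True
  have "X (a * iv c) = X 0" using True by (intro X_cong) (simp add: cong_0_iff)
  then have "ww 1 \<otimes> Phi (a, b, c, d) = ww 1 \<otimes> ww (- iv c) \<otimes> X (d * iv c)"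
   using c by (simp add: X_0 m_assoc)
  also have "ww (- iv c) = inv (ww (iv c))" using ww_inv[OF unit_iv[OF c]] by simp
  also have "ww 1 \<otimes> inv (ww (iv c)) = inv (hh (iv c))" unfolding hh_def by (simp add: inv_mult_group)
  also have "\<dots> = hh c" by (rule inv_hh[OF c])
  also have "hh c \<otimes> X (d * iv c) = X (c ^ 2 * (d * iv c)) \<otimes> hh c" by (rule hh_X'[OF c])
  also have "X (c ^ 2 * (d * iv c)) = X (c * d)"
  proof (rule X_cong)
   have "c ^ 2 * (d * iv c) = c * d * (c * iv c)" by (simp add: power2_eq_square)
   then show "c ^ 2 * (d * iv c) \<doteq> c * d" by (metis cong_scalar_left[OF iv[OF c]] mult_1_right)
  qed
  finally show ?thesis using True by simp
 next
  case a: False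
  let ?s = "- a * iv c" and ?s' = "- c * iv a" and ?b = "- iv c"
  have ss: "?s * ?s' \<doteq> 1"
  proof -
   have "?s * ?s' = (a * iv a) * (c * iv c)" by simp
   then show ?thesis by (metis cong_mult[OF iv[OF a] iv[OF c]] mult_1)
  qed
  have bu: "unit ?b" using unit_iv[OF c] by simp
  have su: "unit ?s" by (rule unit_of_inverse(1)[OF ss])
  have ia: "unit (iv a)" by (rule unit_iv[OF a])
  have "hh ?s \<otimes> hh (iv a) = hh (?s * iv a)" using hh_mult[OF su ia] by simp
  also have "\<dots> = hh ?b"
  proof (rule hh_cong)
   have "?s * iv a = ?b * (a * iv a)" by simp
   then show "?s * iv a \<doteq> ?b" by (metis cong_scalar_left[OF iv[OF a]] mult_1_right)
  qed
  finally have hb: "hh ?s \<otimes> hh (iv a) = hh ?b" .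
  have mid: "ww 1 \<otimes> (inv (ww ?s) \<otimes> (ww ?b \<otimes> t)) = ww (iv a) \<otimes> t" if t: "t \<in> \<G>" for t
  proof -
   have "ww 1 \<otimes> (inv (ww ?s) \<otimes> (ww ?b \<otimes> t)) = inv (hh ?s) \<otimes> (hh ?b \<otimes> (ww 1 \<otimes> t))"
    unfolding hh_def using t by (simp add: inv_mult_group m_assoc cancel_left)
   also have "\<dots> = hh (iv a) \<otimes> (ww 1 \<otimes> t)" unfolding hb[symmetric] using t by (simp add: m_assoc[symmetric])
   also have "\<dots> = ww (iv a) \<otimes> t" unfolding hh_def using t by (simp add: m_assoc cancel_left)
   finally show ?thesis .
  qed
  have "ww 1 \<otimes> Phi (a, b, c, d) = ww 1 \<otimes> (X (- ?s) \<otimes> ww ?b) \<otimes> X (d * iv c)" using c by (simp add: m_assoc)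
  also have "ww 1 \<otimes> (X (- ?s) \<otimes> ww ?b) = X (1 ^ 2 * ?s') \<otimes> (ww 1 \<otimes> (inv (ww ?s) \<otimes> (ww ?b \<otimes> X (?b ^ 2 * ?s'))))"
   by (rule ww_X_ww[OF unit_one bu ss])
  also have "\<dots> = X ?s' \<otimes> (ww (iv a) \<otimes> X (?b ^ 2 * ?s'))" by (simp only: mid[OF X_closed] power_one mult_1)
  also have "\<dots> \<otimes> X (d * iv c) = X ?s' \<otimes> (ww (iv a) \<otimes> X (?b ^ 2 * ?s' + d * iv c))"
   unfolding X_add by (simp add: m_assoc)
  also have "X (?b ^ 2 * ?s' + d * iv c) = X (b * iv a)"
  proof (rule X_cong, rule cancel[OF c], rule cancel[OF a])
   have 1: "a * (c * (?b ^ 2 * ?s' + d * iv c)) = (c * iv c) * (a * d) - (a * iv a) * (c * iv c) ^ 2"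
    by (simp add: power2_eq_square algebra_simps)
   have "(c * iv c) * (a * d) - (a * iv a) * (c * iv c) ^ 2 \<doteq> 1 * (a * d) - 1 * 1 ^ 2"
    by (rule cong_diff[OF cong_scalar_right[OF iv[OF c]] cong_mult[OF iv[OF a] cong_pow[OF iv[OF c]]]])
   also have "1 * (a * d) - 1 * 1 ^ 2 = (a * d - b * c) + (b * c - 1)" by simp
   also have "(a * d - b * c) + (b * c - 1) \<doteq> 1 + (b * c - 1)"
    by (rule cong_add[OF dt[simplified] cong_refl])
   also have "1 + (b * c - 1) = 1 * (b * c)" by simp
   also have "1 * (b * c) \<doteq> (a * iv a) * (b * c)" by (rule cong_scalar_right[OF cong_sym[OF iv[OF a]]])
   also have "(a * iv a) * (b * c) = a * (c * (b * iv a))" by simp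
   finally show "a * (c * (?b ^ 2 * ?s' + d * iv c)) \<doteq> a * (c * (b * iv a))" unfolding 1 .
  qed
  finally have R: "ww 1 \<otimes> Phi (a, b, c, d) = X ?s' \<otimes> (ww (iv a) \<otimes> X (b * iv a))" .
  have "X (c * iv (- a)) = X ?s'" using cong_scalar_left[OF iv_minus[OF a], of c] by (intro X_cong) simp
  moreover have "- iv (- a) \<doteq> - (- iv a)" using iv_minus[OF a] by (simp only: cong_minus_minus_iff)
  then have "ww (- iv (- a)) = ww (iv a)" by (intro ww_cong) simp
  moreover have "X (- b * iv (- a)) = X (b * iv a)"
   using cong_scalar_left[OF iv_minus[OF a], of "- b"] by (intro X_cong) simp
  ultimately show ?thesis unfolding R using a by simp
 qed
qed

text \<open>Compatibility with left multiplication by \<open>N\<close> alone. This property is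
  closed under products, so it needs to be checked for the matrices \<open>(1, t, 0, 1)\<close> and
  \<open>(0, 1, - 1, 0)\<close> only.\<close>

definition good where "good N \<longleftrightarrow> dt N \<doteq> 1 \<and> (\<forall>M. dt M \<doteq> 1 \<longrightarrow> Phi (mm N M) = Phi N \<otimes> Phi M)"

lemma good_mm: assumes "good M" "good N" shows "good (mm M N)"
 unfolding good_def
proof (intro conjI allI impI)
 have d: "dt M \<doteq> 1" "dt N \<doteq> 1" using assms by (auto simp: good_def)
 show "dt (mm M N) \<doteq> 1" unfolding dt_mm using cong_mult[OF d] by simp
 fix L assume L: "dt L \<doteq> 1"
 have NL: "dt (mm N L) \<doteq> 1" unfolding dt_mm using cong_mult[OF d(2) L] by simp
 have "Phi (mm (mm M N) L) = Phi M \<otimes> Phi (mm N L)" unfolding mm_assoc using assms(1) NL unfolding good_def by blast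
 also have "Phi (mm N L) = Phi N \<otimes> Phi L" using assms(2) L unfolding good_def by blast
 also have "Phi M \<otimes> (Phi N \<otimes> Phi L) = Phi M \<otimes> Phi N \<otimes> Phi L" by (simp only: m_assoc Phi_closed)
 also have "Phi M \<otimes> Phi N = Phi (mm M N)" using assms(1) d(2) unfolding good_def by metis
 finally show "Phi (mm (mm M N) L) = Phi (mm M N) \<otimes> Phi L" .
qed

lemma good_meq: assumes "good M" "meq M N" shows "good N"
 unfolding good_def
proof (intro conjI allI impI)
 show "dt N \<doteq> 1" using assms meq_dt cong_trans[OF cong_sym] unfolding good_def by blast
 fix L assume L: "dt L \<doteq> 1"
 have "Phi (mm N L) = Phi (mm M L)" using Phi_cong[OF meq_mm[OF assms(2)]] by simp
 then show "Phi (mm N L) = Phi N \<otimes> Phi L" using assms(1) L Phi_cong[OF assms(2)] unfolding good_def by simp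
qed

lemma good_X: "good (1, t, 0, 1)"
 using hh_1 Phi_X_mult by (simp add: good_def)

lemma good_W: "good (0, 1, - 1, 0)"
proof -
 have "iv (- 1) \<doteq> - 1" by (rule iv_unique) simp
 then have "- iv (- 1) \<doteq> - (- 1)" by (simp only: cong_minus_minus_iff)
 then show ?thesis using unit_one Phi_W_mult by (simp add: ww_cong X_0 good_def)
qed

lemma good_all: assumes dt: "dt M \<doteq> 1" shows "good M"
proof -
 let ?W = "(0, 1, - 1, 0) :: int \<times> int \<times> int \<times> int"
 have lower: "good (a, b, c, d)" if dt: "dt (a, b, c, d) \<doteq> 1" and c: "unit c" for a b c d
 proof -
  let ?s = "(a - 1) * iv c" and ?t = "(d - 1) * iv c"
  have sc: "?s * c \<doteq> a - 1" "c * ?t \<doteq> d - 1"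
   using cong_scalar_left[OF iv[OF c], of "a - 1"] cong_scalar_left[OF iv[OF c], of "d - 1"] by (simp_all add: ac_simps)
  \<comment> \<open>The lower unitriangular matrix with entry \<open>c\<close>, as a conjugate of an
    upper one: three factors \<open>?W\<close> form the inverse of \<open>?W\<close>. With
    \<open>?s\<close> and \<open>?t\<close> chosen from the diagonal entries, the determinant
    condition forces the remaining entry \<open>b\<close>.\<close>
  let ?Y = "mm ?W (mm (1, - c, 0, 1) (mm ?W (mm ?W ?W)))"
  have g: "good (mm (1, ?s, 0, 1) (mm ?Y (1, ?t, 0, 1)))" by (intro good_mm good_X good_W)
  have e: "mm (1, ?s, 0, 1) (mm ?Y (1, ?t, 0, 1)) = (1 + ?s * c, (1 + ?s * c) * ?t + ?s, c, c * ?t + 1)"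
   by (simp add: algebra_simps)
  have m: "meq (1 + ?s * c, (1 + ?s * c) * ?t + ?s, c, c * ?t + 1) (a, b, c, d)"
  proof -
   have 1: "1 + ?s * c \<doteq> a" using cong_add[OF cong_refl sc(1), of 1] by simp
   have 2: "c * ?t + 1 \<doteq> d" using cong_add[OF sc(2) cong_refl, of 1] by simp
   have "(1 + ?s * c) * ?t + ?s \<doteq> b"
   proof (rule cancel[OF c])
    have "c * ((1 + ?s * c) * ?t + ?s) = (1 + ?s * c) * (c * ?t) + ?s * c" by (simp add: algebra_simps)
    also have "(1 + ?s * c) * (c * ?t) + ?s * c \<doteq> a * (d - 1) + (a - 1)"
     by (rule cong_add[OF cong_mult[OF 1 sc(2)] sc(1)])
    also have "a * (d - 1) + (a - 1) = (a * d - b * c) - 1 + c * b" by (simp add: algebra_simps)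
    also have "(a * d - b * c) - 1 + c * b \<doteq> 1 - 1 + c * b"
     using cong_add[OF cong_diff[OF dt cong_refl[of 1]] cong_refl[of "c * b"]] by (simp only: dt.simps)
    finally show "c * ((1 + ?s * c) * ?t + ?s) \<doteq> c * b" by simp
   qed
   then show ?thesis using 1 2 by simp
  qed
  show ?thesis by (rule good_meq[OF g[unfolded e] m])
 qed
 obtain a b c d where M: "M = (a, b, c, d)" by (metis prod_cases4)
 show ?thesis
 proof (cases "int p dvd c")
  case False then show ?thesis using lower[OF dt[unfolded M]] M by simp
 next
  case True
  \<comment> \<open>Multiplication by \<open>?W\<close> moves the unit \<open>a\<close> into the
    lower left corner; three more factors \<open>?W\<close> undo it, as the fourth power of
    \<open>?W\<close> is the identity.\<close>
  have "good (c, d, - a, - b)"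
   using unit_of_inverse(1)[OF upper_triangular[OF dt[unfolded M] True]] dt lower by (simp add: M algebra_simps)
  then have "good (mm ?W (mm ?W (mm ?W (c, d, - a, - b))))" by (intro good_mm good_W)
  then show ?thesis by (simp add: M)
 qed
qed

lemma Phi_mult: "dt M \<doteq> 1 \<Longrightarrow> dt N \<doteq> 1 \<Longrightarrow> Phi (mm M N) = Phi M \<otimes> Phi N"
 using good_all unfolding good_def by blast

abbreviation R where "R \<equiv> residue_ring (int p)"

lemma SL2_carrier: "(a, b, c, d) \<in> carrier (SL2 R) \<longleftrightarrow>
  a \<in> {0..int p - 1} \<and> b \<in> {0..int p - 1} \<and> c \<in> {0..int p - 1} \<and> d \<in> {0..int p - 1} \<and> dt (a, b, c, d) \<doteq> 1"
proof -
 interpret residues "int p" R by unfold_locales (use odd in auto)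
 show ?thesis
  using odd by (simp add: mod_simps SL2_def res_carrier_eq res_mult_eq res_one_eq cong_def a_minus_def res_neg_eq res_add_eq)
qed

lemma SL2_mult: "meq (M \<otimes>\<^bsub>SL2 R\<^esub> N) (mm M N)"
proof -
 interpret residues "int p" R by unfold_locales (use odd in auto)
 show ?thesis by (cases M; cases N) (simp add: SL2_def res_add_eq res_mult_eq mod_simps)
qed

lemma SL2_dt: "M \<in> carrier (SL2 R) \<Longrightarrow> dt M \<doteq> 1"
 by (cases M) (metis SL2_carrier)

lemma Phi_hom: "Phi \<in> hom (SL2 R) G"
 unfolding hom_def using Phi_mult SL2_dt Phi_cong[OF SL2_mult] by auto

lemma Phi_mod: "Phi (a mod int p, b mod int p, c mod int p, d mod int p) = Phi (a, b, c, d)"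
 by (rule Phi_cong) simp

lemma SL2_mod: "dt (a, b, c, d) \<doteq> 1 \<Longrightarrow> (a mod int p, b mod int p, c mod int p, d mod int p) \<in> carrier (SL2 R)"
proof -
 assume d: "dt (a, b, c, d) \<doteq> 1"
 have "dt (a mod int p, b mod int p, c mod int p, d mod int p) \<doteq> dt (a, b, c, d)" by (rule meq_dt) simp
 then show ?thesis using d cong_trans odd by (simp add: SL2_carrier)
qed

lemma SL2_group: "group (SL2 R)"
proof -
 interpret residues "int p" R by unfold_locales (use odd in auto)
 show ?thesis using cring.group_SL2[OF cring] .
qed

lemma Phi_X: "X t \<in> Phi ` carrier (SL2 R)"
proof -
 have "X t = Phi (1, t, 0, 1)" by (simp add: hh_1)
 then show ?thesis using SL2_mod[of 1 t 0 1] Phi_mod[of 1 t 0 1] by (metis dt.simps image_eqI cong_refl mult_1 mult_zero_right diff_zero)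
qed

lemma Phi_ww: "ww 1 \<in> Phi ` carrier (SL2 R)"
proof -
 have "ww 1 = ww 1 \<otimes> Phi (1, 0, 0, 1)" by (simp add: hh_1 X_0)
 also have "\<dots> = Phi (0, 1, - 1, - 0)" by (rule Phi_W_mult[symmetric]) simp
 finally have "ww 1 = Phi (0 mod int p, 1 mod int p, (- 1) mod int p, 0 mod int p)" using Phi_mod[of 0 1 "- 1" 0] by simp
 moreover have "(0 mod int p, 1 mod int p, (- 1) mod int p, 0 mod int p) \<in> carrier (SL2 R)" by (rule SL2_mod) simp
 ultimately show ?thesis by blast
qed

end

section \<open>Recognition of direct products with a central subgroup\<close>

context group begin

lemma central_product_iso:
 assumes K: "group K" and f: "f \<in> hom K G" and A: "subgroup A G"
  and central: "\<And>a g. a \<in> A \<Longrightarrow> g \<in> \<G> \<Longrightarrow> a \<otimes> g = g \<otimes> a"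
  and triv: "\<And>k. k \<in> carrier K \<Longrightarrow> f k \<in> A \<Longrightarrow> k = \<one>\<^bsub>K\<^esub>"
  and surj: "\<And>g. g \<in> \<G> \<Longrightarrow> \<exists>k\<in>carrier K. \<exists>a\<in>A. g = f k \<otimes> a"
 shows "G \<cong> K \<times>\<times> G\<lparr>carrier := A\<rparr>"
proof -
 let ?D = "K \<times>\<times> G\<lparr>carrier := A\<rparr>" and ?F = "\<lambda>(k, a). f k \<otimes> a"
 interpret K: group K by (rule K)
 interpret A: group "G\<lparr>carrier := A\<rparr>" by (rule subgroup_imp_group[OF A])
 interpret fh: group_hom K G f using f by (simp add: group_hom_def group_hom_axioms_def)
 have D: "group ?D" by (rule DirProd_group[OF K A.is_group])
 have Ac: "A \<subseteq> \<G>" by (rule subgroup.subset[OF A])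
 have hom: "?F \<in> hom ?D G"
 proof (rule homI)
  fix x assume "x \<in> carrier ?D" then show "?F x \<in> \<G>" using Ac by auto
 next
  fix x y assume "x \<in> carrier ?D" "y \<in> carrier ?D"
  then obtain k a l b where xy: "x = (k, a)" "y = (l, b)" "k \<in> carrier K" "l \<in> carrier K" "a \<in> A" "b \<in> A" by auto
  have c: "f k \<in> \<G>" "f l \<in> \<G>" "a \<in> \<G>" "b \<in> \<G>" using xy Ac by auto
  have "f k \<otimes> f l \<otimes> (a \<otimes> b) = f k \<otimes> ((f l \<otimes> a) \<otimes> b)" using c by (simp add: m_assoc)
  also have "f l \<otimes> a = a \<otimes> f l" by (rule central[symmetric, OF xy(5) c(2)])
  finally show "?F (x \<otimes>\<^bsub>?D\<^esub> y) = ?F x \<otimes> ?F y" using xy c by (simp add: m_assoc)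
 qed
 have inj: "inj_on ?F (carrier ?D)"
 proof (rule inj_onI)
  fix x y assume "x \<in> carrier ?D" "y \<in> carrier ?D" and e: "?F x = ?F y"
  then obtain k a l b where xy: "x = (k, a)" "y = (l, b)" "k \<in> carrier K" "l \<in> carrier K" "a \<in> A" "b \<in> A" by auto
  have c: "f k \<in> \<G>" "f l \<in> \<G>" "a \<in> \<G>" "b \<in> \<G>" using xy Ac by auto
  have "f k \<otimes> a = f l \<otimes> b" using e xy by simp
  then have "inv (f l) \<otimes> f k = b \<otimes> inv a" using c by (metis inv_solve_left inv_solve_right m_assoc m_closed inv_closed)
  then have "f (inv\<^bsub>K\<^esub> l \<otimes>\<^bsub>K\<^esub> k) = b \<otimes> inv a" using xy by simp
  moreover have "b \<otimes> inv a \<in> A" using subgroup.m_closed[OF A] subgroup.m_inv_closed[OF A] xy by simp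
  ultimately have "inv\<^bsub>K\<^esub> l \<otimes>\<^bsub>K\<^esub> k = \<one>\<^bsub>K\<^esub>" using triv xy by simp
  then have "k = l" using xy by (metis K.inv_solve_left K.r_one K.one_closed)
  then show "x = y" using \<open>f k \<otimes> a = f l \<otimes> b\<close> c xy by simp
 qed
 have "?F ` carrier ?D = \<G>"
 proof
  show "?F ` carrier ?D \<subseteq> \<G>" using Ac by auto
  show "\<G> \<subseteq> ?F ` carrier ?D" using surj by force
 qed
 then have "?F \<in> iso ?D G" using hom inj by (simp add: iso_def bij_betw_def)
 then have "?D \<cong> G" by (auto simp: is_iso_def)
 then show ?thesis by (rule group.iso_sym[OF D])
qed

lemma central_product_factor_iso:
 assumes K: "group K" and f: "f \<in> hom K G" and A: "subgroup A G"
  and central: "\<And>a g. a \<in> A \<Longrightarrow> g \<in> \<G> \<Longrightarrow> a \<otimes> g = g \<otimes> a"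
  and triv: "\<And>k. k \<in> carrier K \<Longrightarrow> f k \<in> A \<Longrightarrow> f k = \<one>"
  and surj: "\<And>g. g \<in> \<G> \<Longrightarrow> \<exists>k\<in>carrier K. \<exists>a\<in>A. g = f k \<otimes> a"
 shows "G \<cong> (K Mod kernel K G f) \<times>\<times> G\<lparr>carrier := A\<rparr>"
proof -
 interpret fh: group_hom K G f using K f by (simp add: group_hom_def group_hom_axioms_def)
 let ?N = "kernel K G f" and ?f = "\<lambda>X. the_elem (f ` X)"
 interpret N: normal ?N K by (rule fh.normal_kernel)
 have fc: "?f (?N #>\<^bsub>K\<^esub> k) = f k" if k: "k \<in> carrier K" for k
 proof -
  have "f ` (?N #>\<^bsub>K\<^esub> k) = {f k}"
  proof
   show "f ` (?N #>\<^bsub>K\<^esub> k) \<subseteq> {f k}"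
   proof (rule image_subsetI)
    fix x assume "x \<in> ?N #>\<^bsub>K\<^esub> k"
    then obtain m where m: "m \<in> carrier K" "f m = \<one>" "x = m \<otimes>\<^bsub>K\<^esub> k" unfolding r_coset_def kernel_def by blast
    show "f x \<in> {f k}" using m(2) fh.hom_closed[OF k] by (simp add: fh.hom_mult[OF m(1) k] m(3))
   qed
   show "{f k} \<subseteq> f ` (?N #>\<^bsub>K\<^esub> k)" using group.rcos_self[OF K k N.subgroup_axioms] by blast
  qed
  then show ?thesis by simp
 qed
 show ?thesis
 proof (rule central_product_iso[OF N.factorgroup_is_group fh.FactGroup_hom A central])
  fix X assume X: "X \<in> carrier (K Mod ?N)" "?f X \<in> A"
  then obtain k where k: "k \<in> carrier K" "X = ?N #>\<^bsub>K\<^esub> k" by (auto simp: FactGroup_def RCOSETS_def)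
  show "X = \<one>\<^bsub>K Mod ?N\<^esub>"
   using X(2) fc[OF k(1)] triv[OF k(1)] k(1) group.coset_join2[OF K k(1) N.subgroup_axioms] unfolding k(2) kernel_def FactGroup_def by simp
 next
  fix g assume "g \<in> \<G>"
  then obtain k a where ka: "k \<in> carrier K" "a \<in> A" "g = f k \<otimes> a" using surj by blast
  then show "\<exists>X\<in>carrier (K Mod ?N). \<exists>a\<in>A. g = ?f X \<otimes> a"
  proof (intro bexI)
   show "g = ?f (?N #>\<^bsub>K\<^esub> k) \<otimes> a" unfolding fc[OF ka(1)] by (rule ka(3))
   show "?N #>\<^bsub>K\<^esub> k \<in> carrier (K Mod ?N)" using ka(1) by (auto simp: FactGroup_def RCOSETS_def)
  qed (rule ka(2))
 qed
qed

end

section \<open>The Steinberg relations in a group with noncentral torus\<close>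

locale moebius_torus = torus_group +
 fixes c :: int
 assumes c_unit: "unit c" and W_form: "unit x \<Longrightarrow> W x * x \<doteq> c"
begin

definition Xs :: "int \<Rightarrow> 'a" where "Xs a = u [^] a"
text \<open>The factor \<open>c\<close> is the normalization for which \<open>Ys b\<close> acts on
  labels as \<open>z / (1 + b * z)\<close>, sending infinity to \<open>1 / b\<close>, just as a
  lower unitriangular matrix does.\<close>

definition Ys :: "int \<Rightarrow> 'a" where "Ys b = v [^] (c * b)"

lemma Xs_closed [simp]: "Xs a \<in> \<G>" and Ys_closed [simp]: "Ys a \<in> \<G>"
 by (simp_all add: Xs_def Ys_def)

lemma Xs_S: "cj (Xs a) ` S = S" unfolding Xs_def by (rule u_pow_fixes_S)
lemma Xs_blk: "cj (Xs a) ` blk z = blk (a + z)" unfolding Xs_def by (rule cj_blk)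

lemma blk_carrier: "blk x \<subseteq> \<G>" by (rule BL_carrier[OF blk_BL])

lemma blk_eq_T: "int p dvd x \<Longrightarrow> blk x = T" using blk_T_iff by blast

lemma Ys_act: "B \<subseteq> \<G> \<Longrightarrow> cj (Ys b) ` B = cj w ` (cj (u [^] (c * b)) ` (cj (inv w) ` B))"
proof -
 assume B: "B \<subseteq> \<G>"
 have "Ys b = w \<otimes> (u [^] (c * b) \<otimes> inv w)" unfolding Ys_def v_pow by (simp add: cj_def m_assoc)
 then show ?thesis using B by (simp add: cj_image_cj)
qed

lemma Ys_T: "cj (Ys b) ` T = T"
 unfolding Ys_act[OF Tc] w_inv_T u_pow_fixes_S by (rule w(2))

lemma w_blk: assumes x: "unit x" shows "\<exists>t. cj w ` blk x = blk t \<and> t * x \<doteq> c"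
 using w_step(1)[OF x] W_form[OF x] by blast

lemma w_inv_blk: assumes z: "unit z"
 shows "\<exists>y. cj (inv w) ` blk z = blk y \<and> unit y \<and> z * y \<doteq> c"
proof -
 obtain y where y: "unit y" "W y \<doteq> z" using w_surj[OF z] by blast
 show ?thesis
  by (metis w_step(1)[OF y(1)] y(2) blk_eq cong_trans[OF cong_scalar_right[OF cong_sym[OF y(2)]] W_form[OF y(1)]] y(1) act_inv[OF w_carrier blk_carrier])
qed

lemma Ys_S: assumes b: "unit b" shows "\<exists>t. cj (Ys b) ` S = blk t \<and> t * b \<doteq> 1"
proof -
 have cb: "unit (c * b)" by (rule unit_mult[OF c_unit b])
 obtain t where t: "cj w ` blk (c * b) = blk t" "t * (c * b) \<doteq> c" using w_blk[OF cb] by blast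
 have "cj (Ys b) ` S = blk t" using cj_blk[of "c * b" 0] t(1) by (simp add: blk_0 Ys_act[OF Sc] w_inv_S)
 moreover have "t * b \<doteq> 1"
  by (rule cancel[OF c_unit]) (use t(2) in \<open>simp add: ac_simps\<close>)
 ultimately show ?thesis by blast
qed

lemma Ys_blk: assumes z: "unit z"
 shows "int p dvd 1 + b * z \<Longrightarrow> cj (Ys b) ` blk z = S"
  and "unit (1 + b * z) \<Longrightarrow> \<exists>t. cj (Ys b) ` blk z = blk t \<and> t * (1 + b * z) \<doteq> z"
proof -
 obtain y where y: "cj (inv w) ` blk z = blk y" "unit y" "z * y \<doteq> c"
  using w_inv_blk[OF z] by blast
 have act: "cj (Ys b) ` blk z = cj w ` blk (c * b + y)"
  unfolding Ys_act[OF blk_carrier] y(1) cj_blk ..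
 have e: "z * (c * b + y) \<doteq> c * (1 + b * z)"
 proof -
  have "z * (c * b + y) = c * b * z + z * y" by (simp add: algebra_simps)
  also have "c * b * z + z * y \<doteq> c * b * z + c" by (rule cong_add[OF cong_refl y(3)])
  also have "c * b * z + c = c * (1 + b * z)" by (simp add: algebra_simps)
  finally show ?thesis .
 qed
 { assume "int p dvd 1 + b * z"
  then have "int p dvd c * (1 + b * z)" by simp
  then show "cj (Ys b) ` blk z = S" unfolding act by (metis blk_eq_T w(3) cong_dvd_iff[OF e] unit_mult[OF z]) }
 { assume u: "unit (1 + b * z)"
  have "unit (c * b + y)" using cong_dvd_iff[OF e] unit_mult[OF c_unit u] by auto
  then obtain t where t: "cj w ` blk (c * b + y) = blk t" "t * (c * b + y) \<doteq> c" using w_blk by blast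
  have "c * (t * (1 + b * z)) \<doteq> c * z"
  proof -
   have "c * (t * (1 + b * z)) = t * (c * (1 + b * z))" by simp
   also have "t * (c * (1 + b * z)) \<doteq> t * (z * (c * b + y))" by (rule cong_scalar_left[OF cong_sym[OF e]])
   also have "t * (z * (c * b + y)) = z * (t * (c * b + y))" by simp
   also have "z * (t * (c * b + y)) \<doteq> z * c" by (rule cong_scalar_left[OF t(2)])
   finally show ?thesis by (simp add: mult.commute)
  qed
  then show "\<exists>t. cj (Ys b) ` blk z = blk t \<and> t * (1 + b * z) \<doteq> z"
   unfolding act by (metis t(1) cancel[OF c_unit]) }
qed

context
 fixes a b :: int and n
 assumes ab: "a * b \<doteq> 1"
 defines "n \<equiv> Xs a \<otimes> (Ys (- b) \<otimes> Xs a)"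
begin

lemma n_closed: "n \<in> \<G>" by (simp add: n_def)

lemma n_act: "B \<subseteq> \<G> \<Longrightarrow> cj n ` B = cj (Xs a) ` (cj (Ys (- b)) ` (cj (Xs a) ` B))"
 unfolding n_def by (simp add: cj_image_cj)

lemma ab_units: "unit a" "unit b"
 using unit_of_inverse(2)[OF ab] unit_of_inverse(2)[of b a] ab by (simp_all add: mult.commute)

lemma n_S: "cj n ` S = T"
proof -
 have "unit (- b)" using ab_units by simp
 then obtain t where t: "cj (Ys (- b)) ` S = blk t" "t * - b \<doteq> 1" using Ys_S by blast
 have "b * (a + t) \<doteq> b * 0"
 proof -
  have "b * (a + t) = a * b - t * - b" by (simp add: algebra_simps)
  also have "a * b - t * - b \<doteq> 1 - 1" by (rule cong_diff[OF ab t(2)])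
  finally show ?thesis by simp
 qed
 then show ?thesis unfolding n_act[OF Sc] Xs_S t(1) Xs_blk by (metis blk_eq_T cong_0_iff cancel[OF ab_units(2)])
qed

lemma n_T: "cj n ` T = S"
proof -
 show ?thesis
  using cong_diff[OF cong_refl ab, of 1] Xs_blk[of a 0] Xs_S by (simp add: mult.commute cong_0_iff Ys_blk(1)[OF ab_units(1)] blk_0 n_act[OF Tc])
qed

lemma n_blk: assumes z: "unit z" shows "\<exists>t. cj n ` blk z = blk t \<and> t * z \<doteq> - (a ^ 2)"
proof (cases "int p dvd a + z")
 case True
 show ?thesis
  using Xs_blk[of a 0] True by (auto simp: blk_0 power2_eq_square distrib_left[symmetric] add.commute n_act[OF blk_carrier] Xs_blk blk_eq_T[OF True] Ys_T cong_iff_dvd_diff)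
next
 case y: False
 have e: "a * (1 + - b * (a + z)) \<doteq> - z"
 proof -
  have "a * (1 + - b * (a + z)) = a - (a * b) * (a + z)" by (simp add: algebra_simps)
  also have "a - (a * b) * (a + z) \<doteq> a - 1 * (a + z)"
   by (rule cong_diff[OF cong_refl cong_scalar_right[OF ab]])
  finally show ?thesis by simp
 qed
 have "unit (1 + - b * (a + z))" using cong_dvd_iff[OF e] z by auto
 then obtain t where t: "cj (Ys (- b)) ` blk (a + z) = blk t" "t * (1 + - b * (a + z)) \<doteq> a + z"
  using Ys_blk(2)[OF y] by blast
 have "cj n ` blk z = blk (a + t)" unfolding n_act[OF blk_carrier] Xs_blk t(1) ..
 moreover have "(a + t) * z \<doteq> - (a ^ 2)"
 proof -
  have "(a + t) * z = a * z - t * - z" by (simp add: algebra_simps)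
  also have "a * z - t * - z \<doteq> a * z - t * (a * (1 + - b * (a + z)))"
   by (rule cong_diff[OF cong_refl cong_scalar_left[OF cong_sym[OF e]]])
  also have "a * z - t * (a * (1 + - b * (a + z))) = a * z - a * (t * (1 + - b * (a + z)))" by simp
  also have "a * z - a * (t * (1 + - b * (a + z))) \<doteq> a * z - a * (a + z)"
   by (rule cong_diff[OF cong_refl cong_scalar_left[OF t(2)]])
  also have "a * z - a * (a + z) = - (a ^ 2)" by (simp add: power2_eq_square algebra_simps)
  finally show ?thesis .
 qed
 ultimately show ?thesis by blast
qed

lemma n_inv: "cj (inv n) ` S = T" "cj (inv n) ` T = S"
 using act_inv[OF n_closed Tc n_T] act_inv[OF n_closed Sc n_S] by auto

lemma cj_n_act: assumes x: "x \<in> \<G>" and B: "B \<subseteq> \<G>"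
 shows "cj (cj n x) ` B = cj n ` (cj x ` (cj (inv n) ` B))"
proof -
 have "cj n x = n \<otimes> (x \<otimes> inv n)" using x n_closed by (simp add: cj_def m_assoc)
 then show ?thesis using x B n_closed by (simp add: cj_image_cj)
qed

text \<open>Since \<open>n\<close> sends \<open>S\<close> to \<open>T\<close>, it sends
  \<open>u\<close> to some power of \<open>v\<close>. The exponent is read off from the block to
  which that power carries \<open>S\<close>, using that \<open>n\<close> acts on labels as
  \<open>- a ^ 2 / z\<close>.\<close>

lemma n_Xs: "cj n (Xs t) = Ys (- (b ^ 2) * t)"
proof -
 obtain i :: int where i: "cj n u = v [^] i" "unit i"
  using to_blk[OF n_closed, of 0] n_S unfolding blk_0 pt_0 by blast
 obtain s where s: "cj n ` blk 1 = blk s" "s * 1 \<doteq> - (a ^ 2)" using n_blk[OF unit_one] by blast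
 have "cj (cj n u) ` S = blk s" unfolding cj_n_act[OF u_carrier Sc] n_inv s(1)[symmetric]
  using cj_blk[of 1 0] by (simp add: blk_0)
 moreover obtain s' where s': "cj w ` blk i = blk s'" "s' * i \<doteq> c" using w_blk[OF i(2)] by blast
 have "v [^] i = w \<otimes> (u [^] i \<otimes> inv w)" unfolding v_pow by (simp add: cj_def m_assoc)
 then have "cj (v [^] i) ` S = cj w ` (cj (u [^] i) ` (cj (inv w) ` S))" using Sc by (simp add: cj_image_cj)
 then have "cj (v [^] i) ` S = blk s'" unfolding w_inv_S using s'(1) cj_blk[of i 0] by (simp add: blk_0)
 ultimately have "s \<doteq> s'" using i(1) blk_eq by metis
 then have si: "s * i \<doteq> c" using s'(2) by (metis cong_scalar_right cong_trans)
 have "i \<doteq> c * (- (b ^ 2))"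
 proof -
  have "1 ^ 2 * i \<doteq> (a * b) ^ 2 * i" by (metis cong_scalar_right[OF cong_pow[OF ab]] cong_sym)
  also have "(a * b) ^ 2 * i = - (b ^ 2) * (- (a ^ 2) * i)" by (simp add: power_mult_distrib)
  also have "- (b ^ 2) * (- (a ^ 2) * i) \<doteq> - (b ^ 2) * (s * 1 * i)"
   by (rule cong_scalar_left[OF cong_scalar_right[OF cong_sym[OF s(2)]]])
  also have "- (b ^ 2) * (s * 1 * i) \<doteq> - (b ^ 2) * c" using si by (intro cong_scalar_left) simp
  finally show ?thesis by (simp add: mult.commute)
 qed
 then have "i * t \<doteq> c * (- (b ^ 2) * t)" by (metis cong_scalar_right mult.assoc)
 then show ?thesis using pt_pow_eq[of 0] n_closed i(1) by (simp add: cj_int_pow int_pow_pow pt_0 Xs_def Ys_def)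
qed

lemma n_Ys: "cj n (Ys t) = Xs (- (a ^ 2) * t)"
proof -
 have nw: "n \<otimes> w \<in> \<G>" "cj (n \<otimes> w) ` S = S" using n_closed n_T w(2) Sc by (simp_all add: cj_image_cj[symmetric])
 obtain j :: int where "cj (n \<otimes> w) u = u [^] j" using to_S[OF nw] by blast
 then have j: "cj n v = u [^] j" unfolding v_def using n_closed by (simp add: cj_cj)
 obtain s where s: "cj w ` blk 1 = blk s" "s * 1 \<doteq> c" using w_blk[OF unit_one] by blast
 have sc: "s \<doteq> c" using s(2) by simp
 have su: "unit s" using c_unit cong_dvd_iff[OF sc] by simp
 obtain t' where t': "cj n ` blk s = blk t'" "t' * s \<doteq> - (a ^ 2)" using n_blk[OF su] by blast
 have "v = w \<otimes> (u \<otimes> inv w)" unfolding v_def by (simp add: cj_def m_assoc)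
 then have "cj v ` S = cj w ` (cj u ` (cj (inv w) ` S))" using Sc by (simp add: cj_image_cj)
 then have vS: "cj v ` S = blk s" unfolding w_inv_S using s(1) cj_blk[of 1 0] by (simp add: blk_0)
 have "cj (cj n v) ` T = blk t'" unfolding cj_n_act[OF v_carrier Tc] n_inv vS t'(1) ..
 moreover have "cj (u [^] j) ` T = blk j" using cj_blk[of j 0] by (simp add: blk_0)
 ultimately have "j \<doteq> t'" using j blk_eq by metis
 then have "j * c * t \<doteq> - (a ^ 2) * t"
  by (metis cong_mult[OF _ cong_sym[OF sc]] t'(2) cong_trans cong_scalar_right)
 then show ?thesis using u_pow_eq n_closed j by (simp add: mult.assoc cj_int_pow int_pow_pow Xs_def Ys_def)
qed

end

sublocale steinberg G p Xs Ys
proof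
 show "2 < p" by (rule p_odd)
 show "Xs (s + t) = Xs s \<otimes> Xs t" "Ys (s + t) = Ys s \<otimes> Ys t" for s t
  unfolding Xs_def Ys_def by (simp_all add: int_pow_mult distrib_left)
 show "Xs s = Xs t" if "s \<doteq> t" for s t unfolding Xs_def using that u_pow_eq by blast
 show "Ys s = Ys t" if "s \<doteq> t" for s t
  unfolding Ys_def using pt_pow_eq[of 0] cong_scalar_left[OF that] unfolding pt_0 by blast
qed (use n_Xs n_Ys in auto)

lemma ww_acts: assumes a: "unit a" shows "cj (ww a) ` S = T" "cj (ww a) ` T = S"
 unfolding ww_def using n_S[OF iv[OF a]] n_T[OF iv[OF a]] by auto

definition im where "im = Phi ` carrier (SL2 R)"

lemma im_subgroup: "subgroup im G"
proof -
 interpret h: group_hom "SL2 R" G Phi using SL2_group Phi_hom by (simp add: group_hom_def group_hom_axioms_def)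
 show ?thesis unfolding im_def by (rule h.img_is_subgroup)
qed

text \<open>The image of \<open>Phi\<close> times \<open>Z\<close> is a subgroup containing
  \<open>u\<close>, \<open>Z\<close> and an element carrying \<open>S\<close> to \<open>T\<close>.
  By \<open>block_cover_u_w\<close> it contains all \<open>p\<close>-elements, and these
  generate.\<close>

lemma im_Z: assumes g: "g \<in> \<G>" shows "\<exists>M\<in>carrier (SL2 R). \<exists>z\<in>Z. g = Phi M \<otimes> z"
proof -
 let ?K = "{h \<otimes> z | h z. h \<in> im \<and> z \<in> Z}"
 have ic: "im \<subseteq> \<G>" by (rule subgroup.subset[OF im_subgroup])
 have K: "subgroup ?K G"
 proof (rule subgroupI)
  show "?K \<subseteq> \<G>" using ic Z_carrier by auto
  show "?K \<noteq> {}" using subgroup.one_closed[OF im_subgroup] subgroup.one_closed[OF Z_subgroup] by blast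
  fix x assume "x \<in> ?K"
  then obtain h z where hz: "x = h \<otimes> z" "h \<in> im" "z \<in> Z" by blast
  have c: "h \<in> \<G>" "z \<in> \<G>" using hz ic Z_carrier by auto
  have iz: "inv z \<in> Z" using subgroup.m_inv_closed[OF Z_subgroup hz(3)] .
  show "inv x \<in> ?K"
   using c Z_comm[OF iz] subgroup.m_inv_closed[OF im_subgroup hz(2)] iz by (auto simp: inv_mult_group hz(1))
  fix y assume "y \<in> ?K"
  then obtain h' z' where hz': "y = h' \<otimes> z'" "h' \<in> im" "z' \<in> Z" by blast
  have c': "h' \<in> \<G>" "z' \<in> \<G>" using hz' ic Z_carrier by auto
  have "x \<otimes> y = h \<otimes> ((z \<otimes> h') \<otimes> z')" unfolding hz(1) hz'(1) using c c' by (simp add: m_assoc)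
  also have "z \<otimes> h' = h' \<otimes> z" by (rule Z_comm[OF hz(3) c'(1)])
  also have "h \<otimes> (h' \<otimes> z \<otimes> z') = (h \<otimes> h') \<otimes> (z \<otimes> z')" using c c' by (simp add: m_assoc)
  finally show "x \<otimes> y \<in> ?K"
   using subgroup.m_closed[OF im_subgroup hz(2) hz'(2)] subgroup.m_closed[OF Z_subgroup hz(3) hz'(3)] by blast
 qed
 have imK: "h \<in> ?K" if "h \<in> im" for h
 proof -
  have "h = h \<otimes> \<one>" using that ic by auto
  then show ?thesis using that subgroup.one_closed[OF Z_subgroup] by blast
 qed
 have ZK: "Z \<subseteq> ?K"
 proof
  fix z assume "z \<in> Z"
  moreover from this have "z = \<one> \<otimes> z" using Z_carrier by auto
  ultimately show "z \<in> ?K" using subgroup.one_closed[OF im_subgroup] by blast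
 qed
 have uK: "u \<in> ?K" and wK: "ww 1 \<in> ?K" using imK Phi_X[of 1] Phi_ww unfolding im_def Xs_def by auto
 have "cj (ww 1) x \<in> ?K" if "x \<in> ?K" for x
  unfolding cj_def
  by (rule subgroup.m_closed[OF K subgroup.m_closed[OF K wK that] subgroup.m_inv_closed[OF K wK]])
 then have "P \<subseteq> ?K" by (rule block_cover_u_w[OF K ZK uK ww_acts(1)[OF unit_one]])
 then show ?thesis using g generate_subgroup_incl[OF _ K] unfolding gen im_def by blast
qed

text \<open>In Bruhat form an element with lower left entry \<open>c'\<close> nonzero carries
  \<open>S\<close> to the block \<open>a / c'\<close>, and an upper triangular one carries
  \<open>T\<close> to the block \<open>a * b\<close>. Fixing both therefore forces a diagonal
  matrix.\<close>

lemma Phi_torus: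
 assumes M: "(a, b, c', d) \<in> carrier (SL2 R)" and f: "cj (Phi (a, b, c', d)) ` S = S" "cj (Phi (a, b, c', d)) ` T = T"
 shows "c' = 0" "b = 0" "a * d \<doteq> 1" "Phi (a, b, c', d) = hh a"
proof -
 have zero: "x = 0" if "x \<in> {0..int p - 1}" "int p dvd x" for x using that zdvd_not_zless[of x "int p"] by (cases "0 < x") auto
 have "int p dvd c'"
 proof (rule ccontr)
  assume c': "unit c'"
  have "cj (Phi (a, b, c', d)) ` S = cj (Xs (a * iv c')) ` (cj (ww (- iv c')) ` (cj (Xs (d * iv c')) ` S))"
   using c' Sc by (simp add: cj_image_cj)
  also have "\<dots> = blk (a * iv c')" using Xs_blk[of _ 0] ww_acts(1) unit_iv[OF c'] by (simp add: blk_0 Xs_S w)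
  finally show False using f(1) blk_ne_S by metis
 qed
 then show c0: "c' = 0" using M SL2_carrier zero by blast
 show ad: "a * d \<doteq> 1" using SL2_dt[OF M] c0 by simp
 have a: "unit a" by (rule unit_of_inverse(1)[OF ad])
 have m1: "cj (inv (ww 1)) ` T = S" by (rule act_inv[OF ww_closed Sc ww_acts(1)[OF unit_one]])
 have hT: "cj (hh a) ` T = T" unfolding hh_def using Tc m1 ww_acts(1)[OF a] by (simp add: cj_image_cj[symmetric])
 have "cj (Phi (a, b, c', d)) ` T = cj (Xs (a * b)) ` (cj (hh a) ` T)" using c0 cj_image_cj[OF Xs_closed hh_closed Tc] by simp
 also have "\<dots> = blk (a * b)" unfolding hT using Xs_blk[of _ 0] by (simp add: blk_0)
 finally have "cj (Phi (a, b, c', d)) ` T = blk (a * b)" .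
 from trans[OF sym[OF this] f(2)] show b0: "b = 0"
  by (metis iffD1[OF blk_T_iff] unit_mult[OF a, of b] M SL2_carrier zero)
 show "Phi (a, b, c', d) = hh a" using c0 b0 by (simp add: X_0)
qed

declare Phi.simps [simp del]

definition mone where "mone = (int p - 1, 0, 0, int p - 1)"

text \<open>A central image fixes all blocks, so the matrix is diagonal, and commuting with
  \<open>Xs 1\<close> forces \<open>a ^ 2 = 1\<close>.\<close>

lemma Phi_center:
 assumes M: "M \<in> carrier (SL2 R)" and C: "Phi M \<in> center G"
 shows "M = (1, 0, 0, 1) \<or> M = mone"
proof -
 obtain a b c' d where Md: "M = (a, b, c', d)" by (metis prod_cases4)
 have fx: "cj (Phi M) ` B = B" if "B \<subseteq> \<G>" for B
 proof -
  have "cj (Phi M) ` B = id ` B" using cj_center[OF C] that by (intro image_cong) auto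
  then show ?thesis by simp
 qed
 note t = Phi_torus[OF M[unfolded Md] fx[OF Sc, unfolded Md] fx[OF Tc, unfolded Md]]
 have "Xs (a ^ 2 * 1) = Xs 1" using cj_center[OF C Xs_closed] unfolding Md t(4) hh_X[OF t(3)] by blast
 then have a2: "a ^ 2 \<doteq> 1" by (simp add: iffD1[OF u_pow_eq] Xs_def)
 have sq: "x = 1 \<or> x = int p - 1" if x: "x \<in> {0..int p - 1}" and x2: "x ^ 2 \<doteq> 1" for x
 proof -
  have "int p dvd (x - 1) * (x + 1)" using x2 by (simp add: cong_iff_dvd_diff power2_eq_square algebra_simps)
  then have "int p dvd x - 1 \<or> int p dvd x + 1" using prime_dvd_mult_iff[of "int p"] prime by auto
  then show ?thesis
  proof
   assume "int p dvd x - 1"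
   moreover have "\<bar>x - 1\<bar> < int p" using x p_ge_2 by auto
   ultimately show ?thesis using dvd_imp_le_int[of "x - 1" "int p"] by fastforce
  next
   assume "int p dvd x + 1"
   then show ?thesis using x zdvd_imp_le by fastforce
  qed
 qed
 have "d \<doteq> a"
  by (metis a2 t(3) power2_eq_square cong_sym cong_trans cancel[OF unit_of_inverse(1)[OF t(3)]])
 moreover have r: "a \<in> {0..int p - 1}" "d \<in> {0..int p - 1}" using M Md SL2_carrier by blast+
 ultimately have "d = a" by (simp add: cong_def)
 then show ?thesis using sq[OF r(1) a2] t Md unfolding mone_def by blast
qed

lemma mone_carrier: "mone \<in> carrier (SL2 R)"
proof -
 show ?thesis using p_ge_2 by (simp add: algebra_simps mone_def cong_iff_dvd_diff SL2_carrier)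
qed

lemma Phi_one: "Phi (1, 0, 0, 1) = \<one>" by (simp add: Phi.simps hh_1 X_0)

lemma Phi_mone_sq: "Phi mone \<otimes> Phi mone = \<one>"
proof -
 have "Phi mone \<otimes> Phi mone = Phi (mm mone mone)" using Phi_mult SL2_dt mone_carrier by simp
 also have "\<dots> = Phi (1, 0, 0, 1)"
  by (rule Phi_cong) (simp add: mone_def cong_iff_dvd_diff algebra_simps)
 finally show ?thesis using Phi_one by simp
qed

text \<open>The image of minus the identity has square \<open>\<one>\<close>, while \<open>Z\<close>
  consists of \<open>p\<close>-elements with \<open>p\<close> odd.\<close>

lemma Phi_in_Z: assumes M: "M \<in> carrier (SL2 R)" and Z: "Phi M \<in> Z" shows "Phi M = \<one>"
proof -
 have "M = (1, 0, 0, 1) \<or> M = mone" using Phi_center[OF M] Z Z_center by blast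
 then show ?thesis
 proof
  assume "M = mone"
  then have "Phi M [^] (2::nat) = \<one>" using Phi_mone_sq by (simp add: numeral_2_eq_2)
  then show ?thesis using p_odd P_eq_one Z Z_P by fastforce
 qed (simp add: Phi_one)
qed

text \<open>An element fixing \<open>S\<close> and \<open>T\<close> is some \<open>hh a\<close> up
  to \<open>Z\<close> and scales \<open>u\<close> by \<open>a ^ 2\<close>. For \<open>p = 3\<close>
  this is always 1, against \<open>noncentral_scales\<close>.\<close>

lemma p_ge_5: "p \<ge> 5"
proof -
 have "p \<noteq> 3"
 proof
  assume p3: "p = 3"
  obtain h l where h: "h \<in> \<G>" "cj h ` S = S" "cj h ` T = T"
   "cj h u = u [^] (l::int)" "unit l" "\<not> l \<doteq> 1" by (rule noncentral_scales)
  obtain M z where Mz: "M \<in> carrier (SL2 R)" "z \<in> Z" "h = Phi M \<otimes> z" using im_Z[OF h(1)] by blast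
  obtain a b c' d where Md: "M = (a, b, c', d)" by (metis prod_cases4)
  have zc: "z \<in> \<G>" using Mz Z_carrier by blast
  have act: "cj (Phi M) ` B = cj h ` B" if "B \<in> BL" for B
  proof -
   have "cj h ` B = cj (Phi M) ` (cj z ` B)" unfolding Mz(3) using zc BL_carrier[OF that] by (simp add: cj_image_cj)
   then show ?thesis using BL_self[OF that subsetD[OF Z_BL[OF that] Mz(2)]] by simp
  qed
  have fS: "cj (Phi (a, b, c', d)) ` S = S" and fT: "cj (Phi (a, b, c', d)) ` T = T"
   using act[OF ST(1)] act[OF ST(2)] h(2,3) unfolding Md by metis+
  note t = Phi_torus[OF Mz(1)[unfolded Md] fS fT]
  have "cj h u = cj (Phi M) (cj z u)" unfolding Mz(3) using zc by (simp add: cj_cj)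
  also have "\<dots> = cj (hh a) (Xs 1)" using cj_by_Z[OF Mz(2)] t(4) Md unfolding Xs_def by simp
  also have "\<dots> = Xs (a ^ 2 * 1)" by (rule hh_X[OF t(3)])
  also have "\<dots> = u [^] (a ^ 2)" unfolding Xs_def by simp
  finally have "l \<doteq> a ^ 2" using h(4) u_pow_eq by metis
  then show False using p3 int_fermat[OF prime unit_of_inverse(1)[OF t(3)]] cong_trans h(6) by auto
 qed
 moreover have "p \<noteq> 4" using prime by auto
 ultimately show ?thesis using p_odd by simp
qed

lemma kernel_Phi: assumes "Phi mone = \<one>" shows "kernel (SL2 R) G Phi = center (SL2 R)"
proof
 show "kernel (SL2 R) G Phi \<subseteq> center (SL2 R)"
 proof
  fix M assume "M \<in> kernel (SL2 R) G Phi"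
  then have M: "M \<in> carrier (SL2 R)" "Phi M = \<one>" by (auto simp: kernel_def)
  have c: "M = (1, 0, 0, 1) \<or> M = mone" by (simp add: M(2) center_def Phi_center[OF M(1)])
  interpret residues "int p" R by unfold_locales (use odd in auto)
  have "M \<otimes>\<^bsub>SL2 R\<^esub> N = N \<otimes>\<^bsub>SL2 R\<^esub> M" for N
   using c by (cases N) (auto simp: mone_def SL2_def res_add_eq res_mult_eq mult.commute)
  then show "M \<in> center (SL2 R)" using M(1) unfolding center_def by blast
 qed
 show "center (SL2 R) \<subseteq> kernel (SL2 R) G Phi"
 proof
  fix M assume "M \<in> center (SL2 R)"
  then have M: "M \<in> carrier (SL2 R)" and cM: "\<And>N. N \<in> carrier (SL2 R) \<Longrightarrow> M \<otimes>\<^bsub>SL2 R\<^esub> N = N \<otimes>\<^bsub>SL2 R\<^esub> M"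
   by (auto simp: center_def)
  have "Phi M \<in> center G"
   unfolding center_def
  proof (intro CollectI conjI ballI)
   fix g assume "g \<in> \<G>"
   then obtain N z where N: "N \<in> carrier (SL2 R)" "z \<in> Z" "g = Phi N \<otimes> z" using im_Z by blast
   show "Phi M \<otimes> g = g \<otimes> Phi M"
    using hom_mult[OF Phi_hom M N(1)] hom_mult[OF Phi_hom N(1) M] cM[OF N(1)] Z_comm[OF N(2)] N(2) Z_carrier by (auto simp: comm_mult N(3))
  qed simp
  then show "M \<in> kernel (SL2 R) G Phi" using M assms Phi_one Phi_center[OF M] unfolding kernel_def by blast
 qed
qed

text \<open>The image of \<open>Phi\<close> meets \<open>Z\<close> trivially and generates the group
  together with it. Only the image of minus the identity decides between the two forms.\<close>

lemma SL2_or_PSL2: "G \<cong> SL2 R \<times>\<times> G\<lparr>carrier := Z\<rparr> \<or> G \<cong> PSL2 R \<times>\<times> G\<lparr>carrier := Z\<rparr>"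
proof (cases "Phi mone = \<one>")
 case True
 show ?thesis
  using central_product_factor_iso[OF SL2_group Phi_hom Z_subgroup Z_comm Phi_in_Z im_Z] unfolding kernel_Phi[OF True] PSL2_def by blast
next
 case False
 have "G \<cong> SL2 R \<times>\<times> G\<lparr>carrier := Z\<rparr>"
 proof (rule central_product_iso[OF SL2_group Phi_hom Z_subgroup Z_comm _ im_Z])
  fix M assume M: "M \<in> carrier (SL2 R)" "Phi M \<in> Z"
  then have "M = (1, 0, 0, 1)" using Phi_center Z_center Phi_in_Z[OF M] False by blast
  then show "M = \<one>\<^bsub>SL2 R\<^esub>"
  proof -
   interpret residues "int p" R by unfold_locales (use odd in auto)
   show ?thesis using \<open>M = (1, 0, 0, 1)\<close> by (simp add: SL2_def res_one_eq res_zero_eq)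
  qed
 qed
 then show ?thesis by blast
qed

end

context block_group begin

lemma Z_comm_group: "comm_group (G\<lparr>carrier := Z\<rparr>)"
proof -
 interpret Zg: group "G\<lparr>carrier := Z\<rparr>" by (rule subgroup_imp_group[OF Z_subgroup])
 show ?thesis by (rule Zg.group_comm_groupI) (use Z_comm Z_carrier in auto)
qed

lemma noncentral_torus_case:
 assumes "g \<in> \<G>" "cj g ` S = S" "cj g ` T = T" "S \<in> BL" "T \<in> BL" "T \<noteq> S" "g \<notin> center G"
 shows "p \<ge> 5 \<and> (G \<cong> SL2 (residue_ring (int p)) \<times>\<times> G\<lparr>carrier := Z\<rparr> \<or>
  G \<cong> PSL2 (residue_ring (int p)) \<times>\<times> G\<lparr>carrier := Z\<rparr>)"
proof -
 obtain u w where "torus_group G p Z BL S T u w" using torus_exists[OF assms] by blast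
 then interpret t: torus_group G p Z BL S T u w .
 obtain c where c: "unit c" "\<And>x. unit x \<Longrightarrow> t.W x * x \<doteq> c" using t.w_moebius by blast
 interpret m: moebius_torus G p Z BL S T u w c by unfold_locales (use c in auto)
 show ?thesis using m.p_ge_5 m.SL2_or_PSL2 by blast
qed

end

section \<open>The sharply 2-transitive case\<close>

context fin_group_prime begin

definition cp :: "'a \<Rightarrow> 'a set \<Rightarrow> 'a set" where "cp g B = {g [^] (i::int) \<otimes> b | i b. b \<in> B}"

lemma cpI: "b \<in> B \<Longrightarrow> g [^] (i::int) \<otimes> b \<in> cp g B" unfolding cp_def by blast

lemma cp_subgroup:
 assumes S: "subgroup S G" "commute_on S" and g: "g \<in> S" and B: "subgroup B G" "B \<subseteq> S"
 shows "subgroup (cp g B) G" "cp g B \<subseteq> S" "B \<subseteq> cp g B" "g \<in> cp g B"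
proof -
 have Sc: "S \<subseteq> \<G>" by (rule subgroup.subset[OF S(1)])
 have gc: "g \<in> \<G>" using g Sc by blast
 have gi: "g [^] (i::int) \<in> S" for i by (rule subgroup_int_pow_closed[OF S(1) g])
 have Bc: "b \<in> \<G>" if "b \<in> B" for b using that B Sc by blast
 have comm: "b \<otimes> g [^] (i::int) = g [^] i \<otimes> b" if "b \<in> B" for b i
  using commute_onD[OF S(2)] gi that B by blast
 show sub: "cp g B \<subseteq> S" unfolding cp_def using gi subgroup.m_closed[OF S(1)] B by blast
 show "B \<subseteq> cp g B"
 proof
  fix b assume b: "b \<in> B"
  then have "b = g [^] (0::int) \<otimes> b" using Bc by simp
  then show "b \<in> cp g B" using cpI[OF b] by metis
 qed
 have "g = g [^] (1::int) \<otimes> \<one>" using gc by simp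
 then show "g \<in> cp g B" using cpI[OF subgroup.one_closed[OF B(1)]] by metis
 show "subgroup (cp g B) G"
 proof (rule subgroupI)
  show "cp g B \<subseteq> \<G>" using sub Sc by blast
  show "cp g B \<noteq> {}" using \<open>g \<in> cp g B\<close> by blast
  fix x assume "x \<in> cp g B"
  then obtain i b where x: "x = g [^] (i::int) \<otimes> b" "b \<in> B" unfolding cp_def by blast
  have ib: "inv b \<in> B" by (rule subgroup.m_inv_closed[OF B(1) x(2)])
  have "inv x = inv b \<otimes> g [^] (- i)" unfolding x(1) using gc Bc[OF x(2)] by (simp add: inv_mult_group int_pow_neg)
  then show "inv x \<in> cp g B" by (metis comm[OF ib] cpI[OF ib])
  fix y assume "y \<in> cp g B"
  then obtain j c where y: "y = g [^] (j::int) \<otimes> c" "c \<in> B" unfolding cp_def by blast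
  have "x \<otimes> y = g [^] i \<otimes> ((b \<otimes> g [^] j) \<otimes> c)"
   unfolding x(1) y(1) using gc Bc[OF x(2)] Bc[OF y(2)] by (simp add: m_assoc)
  also have "b \<otimes> g [^] j = g [^] j \<otimes> b" by (rule comm[OF x(2)])
  also have "g [^] i \<otimes> (g [^] j \<otimes> b \<otimes> c) = g [^] (i + j) \<otimes> (b \<otimes> c)"
   using gc Bc[OF x(2)] Bc[OF y(2)] by (simp add: m_assoc int_pow_mult)
  finally show "x \<otimes> y \<in> cp g B" using cpI[OF subgroup.m_closed[OF B(1) x(2) y(2)]] by metis
 qed
qed

text \<open>The standard splitting of a cyclic subgroup whose order is the exponent: take
  \<open>B\<close> maximal among the subgroups meeting the powers of \<open>g\<close> trivially. If
  \<open>cp g B\<close> were not everything, an element \<open>z\<close> outside it with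
  \<open>z [^] p\<close> in \<open>B\<close> would allow a larger \<open>B\<close>.\<close>

lemma cyclic_complement:
 assumes S: "subgroup S G" "S \<subseteq> P" "commute_on S" and g: "g \<in> S"
  and max: "\<And>y. y \<in> S \<Longrightarrow> y [^] ord g = \<one>"
 shows "\<exists>B. subgroup B G \<and> B \<subseteq> S \<and> (\<forall>i::int. g [^] i \<in> B \<longrightarrow> g [^] i = \<one>) \<and> S \<subseteq> cp g B"
proof -
 have Sc: "S \<subseteq> \<G>" by (rule subgroup.subset[OF S(1)])
 have gc: "g \<in> \<G>" using g Sc by blast
 define F where "F = {B. subgroup B G \<and> B \<subseteq> S \<and> (\<forall>i::int. g [^] i \<in> B \<longrightarrow> g [^] i = \<one>)}"
 have "finite F"
  by (rule finite_subset[of _ "Pow S"]) (use subgroup_finite[OF S(1)] in \<open>auto simp: F_def\<close>)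
 moreover have "{\<one>} \<in> F" unfolding F_def using triv_subgroup subgroup.one_closed[OF S(1)] by auto
 ultimately obtain B where BF: "B \<in> F" and Bmax: "\<And>B'. B' \<in> F \<Longrightarrow> B \<subseteq> B' \<Longrightarrow> B' = B"
  using finite_has_maximal[of F] by (metis empty_iff)
 have B: "subgroup B G" "B \<subseteq> S" and Bg: "\<And>i::int. g [^] i \<in> B \<Longrightarrow> g [^] i = \<one>" using BF unfolding F_def by auto
 note D = cp_subgroup[OF S(1,3) g B]
 have "S \<subseteq> cp g B"
 proof (rule ccontr)
  assume "\<not> S \<subseteq> cp g B"
  then obtain y where y: "y \<in> S" "y \<notin> cp g B" by blast
  have yc: "y \<in> \<G>" using y Sc by blast
  obtain m where m: "y [^] (p ^ m) = \<one>" using y S(2) P_iff by blast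
  have ex: "y [^] (p ^ m) \<in> cp g B" unfolding m by (rule subgroup.one_closed[OF D(1)])
  define t where "t = (LEAST t. y [^] (p ^ t) \<in> cp g B)"
  have t1: "y [^] (p ^ t) \<in> cp g B" unfolding t_def by (rule LeastI[of "\<lambda>t. y [^] (p ^ t) \<in> cp g B", OF ex])
  obtain t' where t': "t = Suc t'" using t1 y yc by (cases t) auto
  \<comment> \<open>The last power of \<open>y\<close> in the chain of \<open>p\<close>-th powers
    that is still outside \<open>cp g B\<close>, so its own \<open>p\<close>-th power is
    inside.\<close>
  define x where "x = y [^] (p ^ t')"
  have x: "x \<in> S" "x \<notin> cp g B" "x \<in> \<G>"
   using subgroup_pow[OF S(1) y(1)] yc not_less_Least[of t' "\<lambda>t. y [^] (p ^ t) \<in> cp g B"] t' by (auto simp: t_def x_def)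
  obtain i b where ib: "x [^] p = g [^] (i::int) \<otimes> b" "b \<in> B"
   using t1 t' yc by (auto simp: nat_pow_pow mult.commute x_def cp_def)
  have bc: "b \<in> \<G>" using ib B Sc by blast
  obtain k where k: "ord g = p ^ k" using g S(2) unfolding p_elements_def by blast
  have "k \<noteq> 0" by (rule) (use max[OF x(1)] k x(3) x(2) subgroup.one_closed[OF D(1)] in auto)
  then obtain k' where k': "k = Suc k'" by (cases k) auto
  have comm: "a \<otimes> c = c \<otimes> a" if "a \<in> S" "c \<in> S" for a c by (rule commute_onD[OF S(3) that])
  have giS: "g [^] (j::int) \<in> S" for j by (rule subgroup_int_pow_closed[OF S(1) g])
  have bS: "b \<in> S" using ib B by blast
  \<comment> \<open>The exponent of \<open>S\<close> is \<open>p ^ k\<close>. Hence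
    \<open>g [^] i\<close>, raised to \<open>p ^ k'\<close>, lies in \<open>B\<close> and is
    trivial, which forces \<open>p\<close> to divide \<open>i\<close>.\<close>
  have "\<one> = (x [^] p) [^] (p ^ k')" using max[OF x(1)] k k' x(3) by (simp add: nat_pow_pow)
  also have "\<dots> = (g [^] i) [^] (p ^ k') \<otimes> b [^] (p ^ k')"
   unfolding ib(1) using comm[OF giS bS] gc bc by (intro pow_mult_distrib) auto
  finally have "(g [^] i) [^] (p ^ k') = inv (b [^] (p ^ k'))" using gc bc by (metis inv_equality int_pow_closed nat_pow_closed)
  then have "g [^] (i * int (p ^ k')) = \<one>"
   by (metis subgroup.m_inv_closed[OF B(1) subgroup_pow[OF B(1) ib(2)]] gc Bg int_pow_int[symmetric] int_pow_pow)
  then obtain l where l: "i = int p * l" using int_pow_eq_id[OF gc] k p_gt_0 k' by fastforce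
  \<comment> \<open>Dividing \<open>x\<close> by a \<open>p\<close>-th root of
    \<open>g [^] i\<close> moves its \<open>p\<close>-th power into \<open>B\<close>, while
    \<open>z\<close> stays outside \<open>cp g B\<close>.\<close>
  define z where "z = x \<otimes> g [^] (- l)"
  have z: "z \<in> S" "z \<in> \<G>" unfolding z_def using subgroup.m_closed[OF S(1) x(1) giS] x gc by auto
  have "z [^] p = x [^] p \<otimes> (g [^] (- l)) [^] p" unfolding z_def using comm[OF x(1) giS] x gc by (intro pow_mult_distrib) auto
  also have "(g [^] (- l)) [^] p = g [^] (- i)" using gc l by (simp add: int_pow_int[symmetric] int_pow_pow mult.commute del: int_pow_int)
  also have "x [^] p \<otimes> g [^] (- i) = b \<otimes> (g [^] i \<otimes> g [^] (- i))"
   unfolding ib(1) comm[OF giS bS] using bc gc by (simp add: m_assoc)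
  also have "\<dots> = b" using gc bc by (simp add: int_pow_mult[symmetric])
  finally have zp: "z [^] p \<in> B" using ib by simp
  have xz: "x = z \<otimes> g [^] l" unfolding z_def using x gc by (simp add: m_assoc int_pow_mult[symmetric])
  have zD: "z \<notin> cp g B"
   using subgroup.m_closed[OF D(1)] subgroup_int_pow_closed[OF D(1) D(4)] x by (auto simp: xz)
  note E = cp_subgroup[OF S(1,3) z(1) B]
  obtain n :: int where n: "g [^] n \<in> cp z B" "g [^] n \<noteq> \<one>"
   using zD E(4) D(3) Bmax E(3) E(1,2) unfolding F_def by blast
  then obtain j c where jc: "g [^] n = z [^] (j::int) \<otimes> c" "c \<in> B" unfolding cp_def by blast
  have zpj: "z [^] (int p * q) \<in> B" for q
   by (metis z int_pow_pow int_pow_int subgroup_int_pow_closed[OF B(1) zp])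
  show False
  proof (cases "int p dvd j")
   case True
   then have "g [^] n \<in> B" using zpj subgroup.m_closed[OF B(1)] jc(2) by (auto simp: jc(1))
   then show False using Bg n by blast
  next
   case False
   then obtain e q where q: "j * e = 1 + int p * q" using unit_inverse_lin by blast
   have "z [^] j = g [^] n \<otimes> inv c" using z jc B Sc by (auto simp: m_assoc)
   then have "(z [^] j) [^] e \<in> cp g B"
    by (metis cpI[OF subgroup.m_inv_closed[OF B(1) jc(2)]] subgroup_int_pow_closed[OF D(1)])
   then have "z \<otimes> z [^] (int p * q) \<otimes> inv (z [^] (int p * q)) \<in> cp g B"
    using z q subgroup.m_inv_closed[OF B(1) zpj] D(3) subgroup.m_closed[OF D(1)] by (auto simp: int_pow_pow int_pow_mult)
   then show False using zD z by (simp add: m_assoc)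
  qed
 qed
 then show ?thesis using B Bg by blast
qed

lemma max_order_exists:
 assumes S: "subgroup S G" "S \<subseteq> P"
 shows "\<exists>g\<in>S. \<forall>y\<in>S. y [^] ord g = \<one>"
proof -
 have "finite (ord ` S)" "ord ` S \<noteq> {}" using subgroup_finite[OF S(1)] subgroup.one_closed[OF S(1)] by auto
 then have "Max (ord ` S) \<in> ord ` S" by (rule Max_in)
 then obtain g where g: "g \<in> S" "ord g = Max (ord ` S)" by auto
 have "y [^] ord g = \<one>" if y: "y \<in> S" for y
 proof -
  obtain a b where ab: "ord y = p ^ a" "ord g = p ^ b" using y g(1) S(2) unfolding p_elements_def by blast
  have "ord y \<le> ord g" unfolding g(2) using y subgroup_finite[OF S(1)] by simp
  then show ?thesis using ab p_ge_2 y S(2) P_carrier pow_eq_id le_imp_power_dvd by fastforce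
 qed
 then show ?thesis using g by blast
qed

text \<open>The generator \<open>s\<close> comes from a cyclic decomposition: among the cyclic factors that are not
 contained in \<open>Z\<close>, it generates one of least order, and multiplying the other ones by powers of
 \<open>s\<close> moves them into \<open>Z\<close>.\<close>

lemma abelian_splitting:
 assumes "subgroup S G" "S \<subseteq> P" "commute_on S" "subgroup Z G" "\<not> S \<subseteq> Z"
  and "\<And>x y. x \<in> S \<Longrightarrow> x \<notin> Z \<Longrightarrow> y \<in> S \<Longrightarrow> \<exists>e::int. y \<otimes> x [^] e \<in> Z"
 shows "\<exists>s A. s \<in> S \<and> s \<notin> Z \<and> subgroup A G \<and> A \<subseteq> S \<inter> Z \<and> S \<subseteq> cp s A \<and>
  (\<forall>i::int. s [^] i \<in> A \<longrightarrow> s [^] i = \<one>)"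
 using assms
proof (induction "card S" arbitrary: S rule: less_induct)
 case (less S)
 note S = less(2,3,4) and Z = less(5) and SZ = less(6) and ind = less(7)
 have Sc: "S \<subseteq> \<G>" by (rule subgroup.subset[OF S(1)])
 obtain g where g: "g \<in> S" "\<And>y. y \<in> S \<Longrightarrow> y [^] ord g = \<one>" using max_order_exists[OF S(1,2)] by blast
 have gc: "g \<in> \<G>" using g Sc by blast
 obtain B where B: "subgroup B G" "B \<subseteq> S" "\<And>i::int. g [^] i \<in> B \<Longrightarrow> g [^] i = \<one>" "S \<subseteq> cp g B"
  using cyclic_complement[OF S g] by blast
 show ?case
 proof (cases "B \<subseteq> Z")
  case True
  have "g \<notin> Z"
  proof
   assume gZ: "g \<in> Z"
   show False using True subgroup.m_closed[OF Z] subgroup_int_pow_closed[OF Z gZ] B(4) SZ unfolding cp_def by blast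
  qed
  then show ?thesis using g(1) B True by blast
 next
  case False
  have "g \<noteq> \<one>"
  proof
   assume g1: "g = \<one>"
   have "y = \<one>" if "y \<in> S" for y using g(2)[OF that] Sc that unfolding g1 by auto
   then show False using subgroup.one_closed[OF Z] SZ by auto
  qed
  then have "g \<notin> B" using B(3)[of 1] gc by auto
  then have "card B < card S" using B(2) g(1) subgroup_finite[OF S(1)] by (metis psubset_card_mono psubsetI)
  moreover have cB: "commute_on B" using S(3) B(2) unfolding commute_on_def by blast
  moreover have "B \<subseteq> P" using B(2) S(2) by blast
  ultimately obtain s A where sA: "s \<in> B" "s \<notin> Z" "subgroup A G" "A \<subseteq> B \<inter> Z" "B \<subseteq> cp s A"
   "\<And>i::int. s [^] i \<in> A \<Longrightarrow> s [^] i = \<one>"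
   using ind B(2) less(1)[OF _ B(1) _ _ Z False] by blast
  have sS: "s \<in> S" using sA B by blast
  have sc: "s \<in> \<G>" using sS Sc by blast
  obtain e :: int where e: "g \<otimes> s [^] e \<in> Z" using ind[OF sS sA(2) g(1)] by blast
  define h where "h = g \<otimes> s [^] e"
  have seS: "s [^] (i::int) \<in> S" for i by (rule subgroup_int_pow_closed[OF S(1) sS])
  have h: "h \<in> S" "h \<in> Z" unfolding h_def using subgroup.m_closed[OF S(1) g(1) seS] e by auto
  have A: "A \<subseteq> S" "A \<subseteq> Z" "A \<subseteq> B" using sA B by auto
  note H = cp_subgroup[OF S(1,3) h(1) sA(3) A(1)]
  note K = cp_subgroup[OF S(1,3) sS H(1,2)]
  have "S \<subseteq> cp s (cp h A)"
  proof -
   have sK: "s [^] (i::int) \<in> cp s (cp h A)" for i by (rule subgroup_int_pow_closed[OF K(1,4)])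
   have "B \<subseteq> cp s (cp h A)"
   proof
    fix b assume "b \<in> B"
    then obtain i a where b: "b = s [^] (i::int) \<otimes> a" "a \<in> A" using sA(5) unfolding cp_def by blast
    then show "b \<in> cp s (cp h A)" using cpI[of a "cp h A" s i] H(3) by blast
   qed
   have hK: "h \<in> cp s (cp h A)" using K(3) H(4) by blast
   have "g = h \<otimes> s [^] (- e)" unfolding h_def using gc sc by (simp add: m_assoc int_pow_mult[symmetric])
   then show ?thesis
    using subgroup.m_closed[OF K(1) hK sK] subgroup.m_closed[OF K(1)] subgroup_int_pow_closed[OF K(1)] \<open>B \<subseteq> cp s (cp h A)\<close> B(4) unfolding cp_def[of g] by blast
  qed
  moreover have "s [^] i = \<one>" if i: "s [^] (i::int) \<in> cp h A" for i
  proof -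
   obtain j a where ja: "s [^] i = h [^] (j::int) \<otimes> a" "a \<in> A" using i unfolding cp_def by blast
   have ac: "a \<in> \<G>" using ja A Sc by blast
   have gs: "g \<otimes> s [^] e = s [^] e \<otimes> g" by (rule commute_onD[OF S(3) g(1) seS])
   have hj: "h [^] j = g [^] j \<otimes> s [^] (e * j)" unfolding h_def using int_pow_mult_distrib[OF gs gc] sc by (simp add: int_pow_pow)
   have sB: "s [^] (n::int) \<in> B" for n by (rule subgroup_int_pow_closed[OF B(1) sA(1)])
   have "g [^] j = s [^] i \<otimes> inv a \<otimes> s [^] (- (e * j))"
    using gc sc ac m_assoc int_pow_mult[symmetric] by (simp add: ja(1) hj)
   also have "\<dots> \<in> B" using subgroup.m_closed[OF B(1)] sB subgroup.m_inv_closed[OF B(1)] ja A by blast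
   finally have gj: "g [^] j = \<one>" by (rule B(3))
   \<comment> \<open>\<open>ord g\<close> divides \<open>j\<close> because
     \<open>g [^] j = \<one>\<close>, and \<open>ord g\<close> kills every element of
     \<open>S\<close>.\<close>
   have "s [^] (e * j) = \<one>"
    using pow_eq_id[OF sc] g(2)[OF sS] gj int_pow_eq_id[OF gc] int_pow_eq_id[OF sc] by auto
   then show ?thesis using ja(1) hj gj ac sA(6) ja(2) by auto
  qed
  ultimately show ?thesis
   using sS sA(2) H(1,2) subgroup.m_closed[OF Z] subgroup_int_pow_closed[OF Z h(2)] A unfolding cp_def by blast
 qed
qed

end

section \<open>The elements fixing no block\<close>

locale sharp_blocks = block_group +
 fixes S :: "'a set" and u :: 'a
 assumes sharp: "g \<in> \<G> \<Longrightarrow> B \<in> BL \<Longrightarrow> B' \<in> BL \<Longrightarrow> B \<noteq> B' \<Longrightarrow> cj g ` B = B \<Longrightarrow> cj g ` B' = B' \<Longrightarrow>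
   g \<in> center G"
  and S: "S \<in> BL" and u: "u \<in> S - Z"
begin

lemma cancel_assoc: "x \<in> \<G> \<Longrightarrow> y \<in> \<G> \<Longrightarrow> inv x \<otimes> (x \<otimes> y) = y"
  "x \<in> \<G> \<Longrightarrow> y \<in> \<G> \<Longrightarrow> x \<otimes> (inv x \<otimes> y) = y"
 by (simp_all add: m_assoc[symmetric])

lemma S_sub: "subgroup S G" and S_carrier: "S \<subseteq> \<G>" and u_S: "u \<in> S" and u_carrier [simp]: "u \<in> \<G>"
 using BL_subgroup[OF S] BL_carrier[OF S] u by auto

abbreviation C where "C \<equiv> center G"

lemma C_sub: "subgroup C G" by (rule normal_imp_subgroup[OF center_normal])

lemma act_mult: "g \<in> \<G> \<Longrightarrow> h \<in> \<G> \<Longrightarrow> B \<in> BL \<Longrightarrow> cj (g \<otimes> h) ` B = cj g ` (cj h ` B)"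
 using cj_image_cj BL_carrier by simp

lemma act_C: assumes "c \<in> C" "B \<in> BL" shows "cj c ` B = B"
proof -
 have "cj c ` B = id ` B" using cj_center[OF assms(1)] BL_carrier[OF assms(2)] by (intro image_cong) auto
 then show ?thesis by simp
qed

lemma act_cancel: "g \<in> \<G> \<Longrightarrow> A \<in> BL \<Longrightarrow> B \<in> BL \<Longrightarrow> cj g ` A = cj g ` B \<longleftrightarrow> A = B"
 using act_inj BL_carrier by blast

lemma act_inv_iff: "g \<in> \<G> \<Longrightarrow> A \<in> BL \<Longrightarrow> B \<in> BL \<Longrightarrow> cj (inv g) ` B = A \<longleftrightarrow> cj g ` A = B"
 using act_inv[of g A B] act_inv[of "inv g" B A] BL_carrier by auto

lemma C_in_Z: "c \<in> C \<Longrightarrow> c \<in> P \<Longrightarrow> c \<in> Z" using P_center by blast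

text \<open>Some power of \<open>t\<close> moves a second block \<open>T\<close> just as
  \<open>g\<close> does. The quotient fixes \<open>X\<close> and \<open>T\<close> and is central by
  sharpness.\<close>

lemma stabilizer:
 assumes g: "g \<in> \<G>" and X: "X \<in> BL" "cj g ` X = X" and t: "t \<in> X - Z"
 shows "\<exists>i<p. \<exists>c\<in>C. g = t [^] (i::nat) \<otimes> c"
proof -
 obtain T where T: "T \<in> BL" "T \<noteq> X" using third_block by blast
 have gT: "cj g ` T \<in> BL" "cj g ` T \<noteq> X" using BL_cj[OF T(1) g] act_cancel[OF g T(1) X(1)] X(2) T(2) by auto
 obtain i where i: "i < p" "cj (t [^] (i::nat)) ` T = cj g ` T" using moves_to[OF X(1) T t gT] by blast
 have tc: "t \<in> \<G>" "t \<in> X" using t BL_carrier[OF X(1)] by auto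
 let ?c = "inv (t [^] i) \<otimes> g"
 have ti: "t [^] i \<in> \<G>" using tc by simp
 have cX: "cj ?c ` X = X" and cT: "cj ?c ` T = T"
  using act_mult[OF inv_closed[OF ti] g T(1)] act_inv_iff[OF ti T(1) gT(1)] i(2) by (metis act_mult[OF inv_closed[OF ti] g X(1)] X(2) act_inv_iff[OF ti X(1) X(1)] BL_self[OF X(1) subgroup_pow[OF BL_subgroup[OF X(1)] tc(2)]])+
 have "?c \<in> C" by (rule sharp[OF _ X(1) T(1) T(2)[symmetric] cX cT]) (use g ti in simp)
 moreover have "g = t [^] i \<otimes> ?c" using g ti by (simp add: m_assoc[symmetric])
 ultimately show ?thesis using i(1) by blast
qed

text \<open>The preimage of the Frobenius kernel of the group modulo \<open>C\<close>. That it is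
  closed under products comes from the count in \<open>one_shift\<close>, in place of character
  theory.\<close>

definition E where "E = {g \<in> \<G>. g \<in> C \<or> (\<forall>B\<in>BL. cj g ` B \<noteq> B)}"

lemma E_carrier: "e \<in> E \<Longrightarrow> e \<in> \<G>" by (simp add: E_def)
lemma C_E: "c \<in> C \<Longrightarrow> c \<in> E" using center_carrier by (simp add: E_def)
lemma E_fix: "e \<in> E \<Longrightarrow> B \<in> BL \<Longrightarrow> cj e ` B = B \<Longrightarrow> e \<in> C" by (auto simp: E_def)

text \<open>Among the \<open>p\<close> cosets modulo \<open>C\<close> of elements that move \<open>X\<close> to \<open>Y\<close>, each of the other \<open>p - 1\<close>
 blocks is fixed by exactly one, and no two of these coincide.\<close>

lemma one_shift:
 assumes X: "X \<in> BL" and Y: "Y \<in> BL" and ne: "X \<noteq> Y"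
 shows "\<exists>g\<in>\<G>. cj g ` X = Y \<and> (\<forall>B\<in>BL. cj g ` B \<noteq> B) \<and>
  (\<forall>e\<in>\<G>. cj e ` X = Y \<longrightarrow> (\<forall>B\<in>BL. cj e ` B \<noteq> B) \<longrightarrow> (\<exists>c\<in>C. e = g \<otimes> c))"
proof -
 obtain g where g: "g \<in> \<G>" "cj g ` X = Y" using transitive[OF X Y] by blast
 obtain t where t: "t \<in> X - Z" "t \<in> \<G>" using noncentral_in_block[OF X] by blast
 define n where "n i = g \<otimes> t [^] (i::nat)" for i
 have n: "n i \<in> \<G>" for i unfolding n_def using g t by simp
 have nX: "cj (n i) ` X = Y" for i
  using act_mult[OF g(1) _ X] t g(2) BL_self[OF X subgroup_pow[OF BL_subgroup[OF X]]] by (simp add: n_def)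
 define I where "I = {i \<in> {..<p}. \<exists>B\<in>BL. cj (n i) ` B = B}"
 define f where "f i = (SOME B. B \<in> BL \<and> cj (n i) ` B = B)" for i
 have f: "f i \<in> BL" "cj (n i) ` f i = f i" "f i \<noteq> X" "f i \<noteq> Y" if "i \<in> I" for i
 proof -
  have "\<exists>B. B \<in> BL \<and> cj (n i) ` B = B" using that unfolding I_def by blast
  then have "f i \<in> BL \<and> cj (n i) ` f i = f i" unfolding f_def by (rule someI_ex)
  then show "f i \<in> BL" "cj (n i) ` f i = f i" "f i \<noteq> X" "f i \<noteq> Y"
   using ne act_cancel[OF n X Y] nX by metis+
 qed
 have uniq: "i = j" if "i < p" "j < p" "B \<in> BL" "B \<noteq> X" "cj (n i) ` B = B" "cj (n j) ` B = B" for i j B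
 proof -
  have "cj g ` (cj (t [^] i) ` B) = cj g ` (cj (t [^] j) ` B)"
   using that(5,6) act_mult[OF g(1) _ that(3)] t by (simp add: n_def)
  then have "cj (t [^] i) ` B = cj (t [^] j) ` B"
   by (rule iffD1[OF act_cancel[OF g(1) BL_cj[OF that(3)] BL_cj[OF that(3)]], rotated 2]) (use t in simp_all)
  then show ?thesis
   using moves_distinct[OF X that(3,4) t(1), of i j] moves_distinct[OF X that(3,4) t(1), of j i] that(1,2)
   by (metis linorder_neqE_nat trans_less_add2)
 qed
 have "bij_betw f I (BL - {X, Y})"
 proof (rule bij_betw_imageI)
  show "inj_on f I"
  proof (rule inj_onI)
   fix i j assume ij: "i \<in> I" "j \<in> I" "f i = f j"
   then show "i = j" using uniq[of i j "f i"] f[OF ij(1)] f[OF ij(2)] unfolding I_def by auto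
  qed
  show "f ` I = BL - {X, Y}"
  proof
   show "f ` I \<subseteq> BL - {X, Y}" using f by blast
   show "BL - {X, Y} \<subseteq> f ` I"
   proof
    fix B assume B: "B \<in> BL - {X, Y}"
    then have B: "B \<in> BL" "B \<noteq> X" "B \<noteq> Y" by auto
    have gB: "cj (inv g) ` B \<in> BL" using BL_cj[OF B(1)] g by simp
    obtain i where i: "i < p" "cj (t [^] (i::nat)) ` B = cj (inv g) ` B"
     by (metis act_inv_iff[OF g(1) X B(1)] g(2) B(3) moves_to[OF X B(1,2) t(1) gB])
    have nB: "cj (n i) ` B = B"
     using act_mult[OF g(1) _ B(1)] t i(2) act_mult[OF g(1) _ B(1), of "inv g"] g(1) BL_carrier[OF B(1)] by (simp add: n_def)
    then have iI: "i \<in> I" using i B(1) unfolding I_def by blast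
    show "B \<in> f ` I" using iI sharp[OF n f(1)[OF iI] B(1) _ f(2)[OF iI] nB] act_C[OF _ X] nX[of i] ne by blast
   qed
  qed
 qed
 then have "card I = card (BL - {X, Y})" by (rule bij_betw_same_card)
 also have "\<dots> = p - 1" using BL_card X Y ne by simp
 finally have "card ({..<p} - I) = 1"
  using p_gt_0 by (subst card_Diff_subset) (auto simp: I_def)
 then obtain i0 where i0: "{..<p} - I = {i0}" by (metis card_1_singletonE)
 then have i0p: "i0 < p" "i0 \<notin> I" by auto
 have ni0: "cj (n i0) ` B \<noteq> B" if "B \<in> BL" for B using i0p that unfolding I_def by blast
 have fin: "\<exists>c\<in>C. e = n i0 \<otimes> c" if e: "e \<in> \<G>" "cj e ` X = Y" "\<And>B. B \<in> BL \<Longrightarrow> cj e ` B \<noteq> B" for e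
 proof -
  obtain i c where ic: "i < p" "c \<in> C" "inv g \<otimes> e = t [^] i \<otimes> c"
   using act_mult[OF inv_closed[OF g(1)] e(1) X] e(2) act_inv_iff[OF g(1) X Y] g(2) stabilizer[OF _ X _ t(1), of "inv g \<otimes> e"] g(1) e(1) by auto
  have cc: "c \<in> \<G>" by (rule center_carrier[OF ic(2)])
  have en: "e = n i \<otimes> c"
  proof -
   have "e = g \<otimes> (inv g \<otimes> e)" using g e by (simp add: m_assoc[symmetric])
   then show ?thesis unfolding ic(3) n_def using g t cc by (simp add: m_assoc)
  qed
  have "i \<notin> I"
  proof
   assume "i \<in> I"
   then show False using f[of i] act_mult[OF n cc] act_C[OF ic(2)] e(3) by (simp add: en)
  qed
  then show ?thesis using i0 ic(1) en ic(2) by auto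
 qed
 show ?thesis
 proof (rule bexI[of _ "n i0"], intro conjI ballI impI)
  show "cj (n i0) ` X = Y" by (rule nX)
  show "\<And>B. B \<in> BL \<Longrightarrow> cj (n i0) ` B \<noteq> B" by (rule ni0)
  show "\<exists>c\<in>C. e = n i0 \<otimes> c" if "e \<in> \<G>" "cj e ` X = Y" "\<forall>B\<in>BL. cj e ` B \<noteq> B" for e
   by (rule fin[OF that(1,2)]) (use that(3) in blast)
 qed (rule n)
qed

text \<open>If \<open>X\<close> is fixed, both elements lie in \<open>C\<close>. Otherwise both move
  every block, and by \<open>one_shift\<close> such elements with a prescribed image of
  \<open>X\<close> form a single coset of \<open>C\<close>.\<close>

lemma E_same:
 assumes e: "e \<in> E" and f: "f \<in> E" and X: "X \<in> BL" and eq: "cj e ` X = cj f ` X"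
 shows "\<exists>c\<in>C. f = e \<otimes> c"
proof (cases "cj e ` X = X")
 case True
 then have ec: "e \<in> C" "f \<in> C" using E_fix e f X eq by auto
 have "inv e \<otimes> f \<in> C" using subgroup.m_closed[OF C_sub subgroup.m_inv_closed[OF C_sub ec(1)] ec(2)] .
 moreover have "f = e \<otimes> (inv e \<otimes> f)" using E_carrier e f by (simp add: m_assoc[symmetric])
 ultimately show ?thesis by blast
next
 case False
 have ec: "e \<in> \<G>" "f \<in> \<G>" using E_carrier e f by auto
 have nf: "cj e ` B \<noteq> B" "cj f ` B \<noteq> B" if "B \<in> BL" for B
  using False eq act_C[OF _ X] e f that by (auto simp: E_def)
 obtain g where g: "g \<in> \<G>"
  "\<And>h. h \<in> \<G> \<Longrightarrow> cj h ` X = cj e ` X \<Longrightarrow> (\<And>B. B \<in> BL \<Longrightarrow> cj h ` B \<noteq> B) \<Longrightarrow> \<exists>c\<in>C. h = g \<otimes> c"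
  using one_shift[OF X BL_cj[OF X ec(1)]] False by metis
 obtain c where c: "c \<in> C" "e = g \<otimes> c" using g(2)[OF ec(1) refl nf(1)] by blast
 obtain d where d: "d \<in> C" "f = g \<otimes> d" using g(2)[OF ec(2) eq[symmetric] nf(2)] by blast
 show ?thesis
  by (metis g(1) c d center_carrier m_assoc cancel_assoc c(2) subgroup.m_closed[OF C_sub subgroup.m_inv_closed[OF C_sub c(1)] d(1)])
qed

text \<open>If \<open>e \<otimes> f\<close> fixes some block \<open>B\<close>, then
  \<open>inv e\<close> and \<open>f\<close> agree on \<open>B\<close>. By \<open>E_same\<close> they
  differ by an element of \<open>C\<close>, so the product lies in \<open>C\<close>.\<close>

lemma E_subgroup: "subgroup E G"
proof (rule subgroupI)
 show "E \<subseteq> \<G>" using E_carrier by blast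
 show "E \<noteq> {}" using C_E subgroup.one_closed[OF C_sub] by blast
 have inv: "inv e \<in> E" if e: "e \<in> E" for e
 proof (cases "e \<in> C")
  case True then show ?thesis using C_E subgroup.m_inv_closed[OF C_sub] by blast
 next
  case False
  have ec: "e \<in> \<G>" by (rule E_carrier[OF e])
  have "cj (inv e) ` B \<noteq> B" if "B \<in> BL" for B
   using act_inv_iff[OF ec that that] e False that unfolding E_def by blast
  then show ?thesis using ec unfolding E_def by blast
 qed
 then show "\<And>e. e \<in> E \<Longrightarrow> inv e \<in> E" .
 fix e f assume ef: "e \<in> E" "f \<in> E"
 have c: "e \<in> \<G>" "f \<in> \<G>" using ef E_carrier by auto
 show "e \<otimes> f \<in> E"
 proof (cases "\<exists>B\<in>BL. cj (e \<otimes> f) ` B = B")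
  case True
  then obtain B where B: "B \<in> BL" "cj e ` (cj f ` B) = B" using act_mult[OF c] by metis
  show ?thesis
   using act_inv_iff[OF c(1) BL_cj[OF B(1) c(2)] B(1)] B(2) E_same[OF inv[OF ef(1)] ef(2) B(1)] c center_carrier C_E m_assoc[symmetric] by fastforce
 next
  case False
  then show ?thesis using c unfolding E_def by blast
 qed
qed

lemma E_cj: assumes g: "g \<in> \<G>" and e: "e \<in> E" shows "cj g e \<in> E"
proof (cases "e \<in> C")
 case True
 show ?thesis by (metis cj_self[OF g center_carrier[OF True]] center_comm[OF True g] e)
next
 case False
 have ec: "e \<in> \<G>" by (rule E_carrier[OF e])
 have "cj (cj g e) ` B \<noteq> B" if B: "B \<in> BL" for B
 proof
  assume "cj (cj g e) ` B = B"
  have B': "cj (inv g) ` B \<in> BL" using BL_cj[OF B] g by simp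
  have "cj g ` (cj e ` (cj (inv g) ` B)) = cj (cj g e) ` B"
   using g ec m_assoc cj_image_cj[OF g, of "e \<otimes> inv g"] cj_image_cj[OF ec, of "inv g"] BL_carrier[OF B] by (simp add: cj_def)
  also have "\<dots> = cj g ` (cj (inv g) ` B)"
   using \<open>cj (cj g e) ` B = B\<close> act_mult[OF g inv_closed[OF g] B] g BL_carrier[OF B] by simp
  finally have "cj e ` (cj (inv g) ` B) = cj (inv g) ` B" using act_cancel[OF g BL_cj[OF B' ec] B'] by blast
  then show False using E_fix[OF e B'] False by blast
 qed
 then show ?thesis using g ec unfolding E_def by simp
qed

lemma E_transitive: assumes "X \<in> BL" "Y \<in> BL" shows "\<exists>e\<in>E. cj e ` X = Y"
proof (cases "X = Y")
 case True
 then show ?thesis using subgroup.one_closed[OF E_subgroup] BL_carrier[OF assms(1)] by (intro bexI[of _ \<one>]) auto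
next
 case False
 then show ?thesis using one_shift[OF assms False] unfolding E_def by blast
qed

text \<open>Equality in the quotient by \<open>C\<close>, carried as a relation so that conjugation
  and the action on blocks stay those of the group itself.\<close>

definition eqC where "eqC e f \<longleftrightarrow> (\<exists>c\<in>C. f = e \<otimes> c)"

lemma eqC_refl: "e \<in> \<G> \<Longrightarrow> eqC e e"
 unfolding eqC_def using subgroup.one_closed[OF C_sub] by force

lemma eqC_sym: "e \<in> \<G> \<Longrightarrow> eqC e f \<Longrightarrow> eqC f e"
proof -
 assume e: "e \<in> \<G>" and "eqC e f"
 then obtain c where c: "c \<in> C" "f = e \<otimes> c" unfolding eqC_def by blast
 then have "e = f \<otimes> inv c" using e center_carrier by (simp add: m_assoc)
 then show ?thesis unfolding eqC_def using subgroup.m_inv_closed[OF C_sub c(1)] by blast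
qed

lemma eqC_trans: "e \<in> \<G> \<Longrightarrow> eqC e f \<Longrightarrow> eqC f h \<Longrightarrow> eqC e h"
proof -
 assume e: "e \<in> \<G>" and "eqC e f" "eqC f h"
 then obtain c d where c: "c \<in> C" "f = e \<otimes> c" "d \<in> C" "h = f \<otimes> d" unfolding eqC_def by blast
 then show ?thesis unfolding eqC_def by (metis e center_carrier subgroup.m_closed[OF C_sub c(1,3)] m_assoc)
qed

lemma eqC_mult:
 assumes c: "e \<in> \<G>" "e' \<in> \<G>" and eq: "eqC e f" "eqC e' f'"
 shows "eqC (e \<otimes> e') (f \<otimes> f')"
proof -
 obtain a b where ab: "a \<in> C" "f = e \<otimes> a" "b \<in> C" "f' = e' \<otimes> b" using eq unfolding eqC_def by blast
 have abc: "a \<in> \<G>" "b \<in> \<G>" using ab center_carrier by auto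
 have "f \<otimes> f' = e \<otimes> ((a \<otimes> e') \<otimes> b)" unfolding ab using c abc by (simp add: m_assoc)
 also have "a \<otimes> e' = e' \<otimes> a" by (rule center_comm[OF ab(1) c(2)])
 also have "e \<otimes> (e' \<otimes> a \<otimes> b) = (e \<otimes> e') \<otimes> (a \<otimes> b)" using c abc by (simp add: m_assoc)
 finally show ?thesis unfolding eqC_def using subgroup.m_closed[OF C_sub ab(1,3)] by blast
qed

lemma eqC_cj:
 assumes g: "g \<in> \<G>" and e: "e \<in> \<G>" and eq: "eqC e f"
 shows "eqC (cj g e) (cj g f)"
proof -
 obtain c where c: "c \<in> C" "f = e \<otimes> c" using eq unfolding eqC_def by blast
 have cc: "c \<in> \<G>" by (rule center_carrier[OF c(1)])
 show ?thesis unfolding c(2) eqC_def by (metis cj_self[OF g cc] center_comm[OF c(1) g] g e cc c(1) cj_mult)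
qed

lemma eqC_C: "e \<in> \<G> \<Longrightarrow> c \<in> C \<Longrightarrow> eqC e (e \<otimes> c)" unfolding eqC_def by blast

lemma eqC_act: "e \<in> \<G> \<Longrightarrow> eqC e f \<Longrightarrow> B \<in> BL \<Longrightarrow> cj f ` B = cj e ` B"
 unfolding eqC_def using act_mult act_C center_carrier by metis

text \<open>If \<open>s\<close> commutes with \<open>e\<close> modulo \<open>C\<close>, it fixes the
  image of \<open>S\<close> under \<open>e\<close> as well as \<open>S\<close>. As \<open>s\<close>
  is not central, sharpness makes these two blocks equal, and \<open>e\<close> fixes
  \<open>S\<close>.\<close>

lemma E_fixed:
 assumes e: "e \<in> E" and s: "s \<in> S" "s \<notin> Z" and eq: "eqC e (cj s e)"
 shows "e \<in> C"
proof -
 have ec: "e \<in> \<G>" by (rule E_carrier[OF e])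
 have sc: "s \<in> \<G>" using s S_carrier by blast
 have sS: "cj s ` S = S" by (rule BL_self[OF S s(1)])
 have eS: "cj e ` S \<in> BL" by (rule BL_cj[OF S ec])
 have "cj s ` (cj e ` S) = cj (s \<otimes> e) ` S" using act_mult[OF sc ec S] by simp
 also have "s \<otimes> e = cj s e \<otimes> s" using sc ec by (simp add: cj_def m_assoc)
 also have "cj (cj s e \<otimes> s) ` S = cj (cj s e) ` S" using act_mult[OF _ sc S] sc ec sS by simp
 also have "\<dots> = cj e ` S" by (rule eqC_act[OF ec eq S])
 finally have f: "cj s ` (cj e ` S) = cj e ` S" .
 show ?thesis using sharp[OF sc S eS] sS f C_in_Z BL_P[OF S] s E_fix[OF e S] by blast
qed

lemma u_pow_S: "u [^] (i::int) \<in> S" by (rule subgroup_int_pow_closed[OF S_sub u_S])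

lemma u_pow_Z: "u [^] (i::int) \<in> Z \<longleftrightarrow> int p dvd i"
 by (rule int_pow_in_Z[OF S u])

text \<open>\<open>E\<close> is transitive on the blocks and the stabilizer of \<open>S\<close>
  consists of powers of \<open>u\<close> times \<open>C\<close>. So every element is a product of
  one from \<open>E\<close>, a power of \<open>u\<close> and a central one.\<close>

lemma normalized:
 assumes N: "N \<subseteq> \<G>" and E: "\<And>e n. e \<in> E \<Longrightarrow> n \<in> N \<Longrightarrow> cj e n \<in> N" and un: "\<And>n. n \<in> N \<Longrightarrow> cj u n \<in> N"
  and g: "g \<in> \<G>" and n: "n \<in> N"
 shows "cj g n \<in> N"
proof -
 obtain e where e: "e \<in> E" "cj e ` S = cj g ` S" using E_transitive[OF S BL_cj[OF S g]] by blast
 have ec: "e \<in> \<G>" by (rule E_carrier[OF e(1)])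
 obtain i c where ic: "c \<in> C" "inv e \<otimes> g = u [^] (i::nat) \<otimes> c"
  by (metis act_mult[OF inv_closed[OF ec] g S] act_inv_iff[OF ec S BL_cj[OF S g]] e(2) stabilizer[OF _ S _ u] g ec inv_closed m_closed)
 have "g = e \<otimes> (inv e \<otimes> g)" using g ec by (simp add: m_assoc[symmetric])
 then have ge: "g = e \<otimes> (u [^] i \<otimes> c)" unfolding ic(2) .
 have nc: "n \<in> \<G>" using n N by blast
 have ui: "cj (u [^] (j::nat)) m \<in> N" if "m \<in> N" for j m
  using that
 proof (induction j arbitrary: m)
  case 0 then show ?case using N by auto
 next
  case (Suc j)
  have "cj (u [^] Suc j) m = cj (u [^] j) (cj u m)" using Suc(2) N by (auto simp: cj_cj)
  then show ?case using Suc un by simp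
 qed
 have "cj g n = cj e (cj (u [^] i) (cj c n))" using ec nc by (simp add: center_carrier[OF ic(1)] cj_cj ge)
 also have "cj c n = n" by (rule cj_center[OF ic(1) nc])
 finally show ?thesis using E[OF e(1) ui[OF n]] by simp
qed

text \<open>Conjugates of \<open>n0\<close> by powers of \<open>u\<close> carry \<open>S\<close> to
  all other blocks. Every block is then conjugate to \<open>S\<close> under \<open>N\<close>, so
  \<open>N\<close> times \<open>S\<close> is a subgroup containing all
  \<open>p\<close>-elements.\<close>

lemma transitive_complement:
 assumes N: "subgroup N G" and nn: "\<And>g n. g \<in> \<G> \<Longrightarrow> n \<in> N \<Longrightarrow> cj g n \<in> N"
  and n0: "n0 \<in> N" "cj n0 ` S \<noteq> S"
 shows "Y \<in> BL \<Longrightarrow> \<exists>n\<in>N. cj n ` S = Y" and "g \<in> \<G> \<Longrightarrow> \<exists>n\<in>N. \<exists>s\<in>S. g = n \<otimes> s"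
proof -
 have Nc: "N \<subseteq> \<G>" by (rule subgroup.subset[OF N])
 have n0c: "n0 \<in> \<G>" using n0 Nc by blast
 show tr: "\<exists>n\<in>N. cj n ` S = Y" if Y: "Y \<in> BL" for Y
 proof (cases "Y = S")
  case True
  then show ?thesis using subgroup.one_closed[OF N] S_carrier by (intro bexI[of _ \<one>]) auto
 next
  case False
  obtain i where i: "cj (u [^] (i::nat)) ` (cj n0 ` S) = Y"
   using moves_to[OF S BL_cj[OF S n0c] n0(2) u Y False] by blast
  have ui: "u [^] i \<in> \<G>" "u [^] i \<in> S" using subgroup_pow[OF S_sub u_S] by auto
  have "cj (cj (u [^] i) n0) ` (cj (u [^] i) ` S) = Y"
   using n0c i act_mult[OF _ ui(1) S, of "cj (u [^] i) n0"] act_mult[OF ui(1) n0c S] by (simp add: cj_def m_assoc)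
  then show ?thesis by (metis BL_self[OF S ui(2)] nn[OF ui(1) n0(1)])
 qed
 let ?K = "{n \<otimes> s | n s. n \<in> N \<and> s \<in> S}"
 have K: "subgroup ?K G"
 proof (rule subgroupI)
  show "?K \<subseteq> \<G>" using Nc S_carrier by auto
  show "?K \<noteq> {}" using subgroup.one_closed[OF N] u_S by blast
  fix x assume "x \<in> ?K"
  then obtain n s where ns: "x = n \<otimes> s" "n \<in> N" "s \<in> S" by blast
  have c: "n \<in> \<G>" "s \<in> \<G>" using ns Nc S_carrier by auto
  have si: "inv s \<in> S" "inv s \<in> \<G>" "inv x = cj (inv s) (inv n) \<otimes> inv s"
   using subgroup.m_inv_closed[OF S_sub ns(3)] c unfolding ns(1) by (auto simp: cj_def inv_mult_group m_assoc)
  then show "inv x \<in> ?K" using si nn[OF si(2) subgroup.m_inv_closed[OF N ns(2)]] by blast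
  fix y assume "y \<in> ?K"
  then obtain n' s' where ns': "y = n' \<otimes> s'" "n' \<in> N" "s' \<in> S" by blast
  have "x \<otimes> y = (n \<otimes> cj s n') \<otimes> (s \<otimes> s')"
   using c ns' Nc S_carrier by (fastforce simp: cj_def m_assoc cancel_assoc ns(1))
  then show "x \<otimes> y \<in> ?K"
   using subgroup.m_closed[OF S_sub ns(3) ns'(3)] subgroup.m_closed[OF N ns(2) nn[OF c(2) ns'(2)]] by blast
 qed
 have "P \<subseteq> ?K"
 proof
  fix x assume "x \<in> P"
  then obtain B where B: "B \<in> BL" "x \<in> B" using BL_cover by blast
  obtain n where n: "n \<in> N" "cj n ` S = B" using tr[OF B(1)] by blast
  obtain s where s: "s \<in> S" "x = cj n s" using B(2) n(2) by blast
  have c: "n \<in> \<G>" "s \<in> \<G>" using n s Nc S_carrier by auto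
  have "x = (n \<otimes> cj s (inv n)) \<otimes> s" unfolding s(2) using c by (simp add: cj_def m_assoc)
  then show "x \<in> ?K"
   using s(1) subgroup.m_closed[OF N n(1) nn[OF c(2) subgroup.m_inv_closed[OF N n(1)]]] by blast
 qed
 then show "\<exists>n\<in>N. \<exists>s\<in>S. g = n \<otimes> s" if "g \<in> \<G>" for g
  using that generate_subgroup_incl[OF _ K] unfolding gen by blast
qed

end

section \<open>Squares and commutators modulo the center\<close>

context sharp_blocks begin

lemma eqC_iff: "e \<in> \<G> \<Longrightarrow> f \<in> \<G> \<Longrightarrow> eqC e f \<longleftrightarrow> inv e \<otimes> f \<in> C"
 unfolding eqC_def by (metis center_carrier cancel_assoc)

lemma eqC_mem_C: assumes "e \<in> \<G>" "eqC e f" "f \<in> C" shows "e \<in> C"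
proof -
 obtain c where c: "c \<in> C" "f = e \<otimes> c" using assms(2) unfolding eqC_def by blast
 show ?thesis
  using assms(1) center_carrier[OF c(1)] subgroup.m_closed[OF C_sub assms(3) subgroup.m_inv_closed[OF C_sub c(1)]] by (simp add: m_assoc c(2))
qed

text \<open>The commutator; it is multiplicative in an argument as soon as the relevant commutator
  is central.\<close>

definition bt where "bt e f = cj e f \<otimes> inv f"

lemma bt_closed: "e \<in> \<G> \<Longrightarrow> f \<in> \<G> \<Longrightarrow> bt e f \<in> \<G>" by (simp add: bt_def)

lemma bt_one_iff: "e \<in> \<G> \<Longrightarrow> f \<in> \<G> \<Longrightarrow> bt e f = \<one> \<longleftrightarrow> e \<otimes> f = f \<otimes> e"
 unfolding bt_def using cj_self[of e f] by (metis cj_closed inv_equality inv_closed r_inv)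

lemma bt_mult_right:
 assumes c: "e \<in> \<G>" "f \<in> \<G>" "g \<in> \<G>" and b: "bt e g \<in> C"
 shows "bt e (f \<otimes> g) = bt e f \<otimes> bt e g"
 using c cj_mult inv_mult_group m_assoc center_comm[OF b] by (simp add: bt_def)

lemma bt_mult_left:
 assumes c: "e \<in> \<G>" "f \<in> \<G>" "g \<in> \<G>" and b: "bt f g \<in> C"
 shows "bt (e \<otimes> f) g = bt e g \<otimes> bt f g"
proof -
 have bc: "bt f g \<in> \<G>" using c by (rule_tac bt_closed)
 have "cj f g = bt f g \<otimes> g" unfolding bt_def using c by (simp add: m_assoc)
 then show ?thesis
  using cj_self[OF c(1) bc] by (simp add: cj_cj[symmetric] cj_mult m_assoc center_comm[OF b] c bt_closed bt_def[of "e \<otimes> f"] bt_def[of e])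
qed

lemma bt_cj: "a \<in> \<G> \<Longrightarrow> e \<in> \<G> \<Longrightarrow> f \<in> \<G> \<Longrightarrow> bt (cj a e) (cj a f) = cj a (bt e f)"
proof -
 assume c: "a \<in> \<G>" "e \<in> \<G>" "f \<in> \<G>"
 have "cj (cj a e) (cj a f) = cj a (cj e f)"
 proof -
  have "cj a e \<otimes> a = a \<otimes> e" using c by (simp add: cj_def m_assoc)
  then show ?thesis using c by (simp add: cj_cj)
 qed
 then show ?thesis unfolding bt_def using c by (simp add: cj_mult cj_inv)
qed

end

locale sharp_blocks_elem = sharp_blocks +
 fixes x assumes x: "x \<in> E" "x \<notin> center G"
begin

text \<open>Modulo \<open>p\<close>, the indices label exactly the nontrivial cosets of
  \<open>C\<close> in \<open>E\<close>: conjugation by \<open>u\<close> permutes them in one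
  \<open>p\<close>-cycle. Multiplication in the quotient becomes a question about indices.\<close>

definition X :: "int \<Rightarrow> 'a" where "X i = cj (u [^] i) x"

lemma x_carrier [simp]: "x \<in> \<G>" by (rule E_carrier[OF x(1)])
lemma X_E: "X i \<in> E" unfolding X_def by (rule E_cj[OF _ x(1)]) simp
lemma X_carrier [simp]: "X i \<in> \<G>" by (rule E_carrier[OF X_E])
lemma X_0: "X 0 = x" by (simp add: X_def)
lemma cj_X: "cj (u [^] (i::int)) (X j) = X (i + j)" unfolding X_def by (simp add: cj_cj int_pow_mult)

lemma X_notin_C: "X i \<notin> C"
proof
 assume a: "X i \<in> C"
 have "x = cj (u [^] (- i)) (X i)" by (simp add: cj_X X_0)
 also have "\<dots> = X i" using cj_self center_comm[OF a] by simp
 finally show False using a x(2) by simp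
qed

lemma X_period: assumes "i \<doteq> j" shows "X i = X j"
proof -
 have z: "u [^] (i - j) \<in> Z" by (metis assms u_pow_Z cong_iff_dvd_diff)
 have "X i = cj (u [^] (i - j)) (X j)" by (simp add: cj_X)
 then show ?thesis using cj_by_Z[OF z] by simp
qed

lemma X_eqC: assumes "eqC (X i) (X j)" shows "i \<doteq> j"
proof -
 have "eqC (cj (u [^] (- i)) (X i)) (cj (u [^] (- i)) (X j))" by (rule eqC_cj[OF _ _ assms]) simp_all
 then have "int p dvd j - i" using X_def E_fixed[OF x(1) u_pow_S] x(2) u_pow_Z unfolding cj_X by fastforce
 then show ?thesis by (simp add: cong_iff_dvd_diff dvd_diff_commute)
qed

lemma X_cover: assumes f: "f \<in> E" "f \<notin> C" shows "\<exists>i. eqC (X i) f"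
proof -
 have fc: "f \<in> \<G>" by (rule E_carrier[OF f(1)])
 have n: "cj x ` S \<noteq> S" "cj f ` S \<noteq> S" using E_fix[OF _ S] f x by auto
 obtain i where i: "cj (u [^] (i::nat)) ` (cj x ` S) = cj f ` S"
  using moves_to[OF S BL_cj[OF S x_carrier] n(1) u BL_cj[OF S fc] n(2)] by blast
 have ui: "u [^] i \<in> \<G>" "u [^] i \<in> S" using subgroup_pow[OF S_sub u_S] by auto
 have "cj (X (int i)) ` S = cj f ` S"
  using i act_mult[OF _ ui(1) S, of "X (int i)"] act_mult[OF ui(1) x_carrier S] BL_self[OF S ui(2)] by (simp add: int_pow_int cj_def m_assoc X_def)
 from E_same[OF X_E f(1) S this] show ?thesis unfolding eqC_def by blast
qed

lemma E_eq_X_inv: "\<exists>k c. c \<in> C \<and> inv x = X k \<otimes> c"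
 using subgroup.m_inv_closed[OF E_subgroup x(1)] subgroup.m_inv_closed[OF C_sub, of "inv x"] x(2) X_cover by (fastforce simp: eqC_def)

text \<open>Let \<open>inv x = X k \<otimes> c\<close>. Conjugating by \<open>u [^] k\<close> gives
  \<open>inv (X k) = X (2 * k) \<otimes> c\<close>, while inverting the relation gives
  \<open>inv (X k) = x \<otimes> c\<close>. So \<open>2 * k\<close> is 0 modulo \<open>p\<close>,
  hence so is \<open>k\<close> for odd \<open>p\<close>, and the inverse of \<open>x\<close> is
  \<open>x\<close> up to \<open>C\<close>.\<close>

lemma X_square: assumes odd: "2 < p" shows "X i \<otimes> X i \<in> C"
proof -
 obtain k c where c: "c \<in> C" "inv x = X k \<otimes> c" using E_eq_X_inv by blast
 have cc: "c \<in> \<G>" by (rule center_carrier[OF c(1)])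
 have cjc: "cj g c = c" if "g \<in> \<G>" for g using cj_self[OF that cc] center_comm[OF c(1) that] by simp
 have "inv (X k) = cj (u [^] k) (inv x)" unfolding X_def by (simp add: cj_inv)
 also have "\<dots> = X (2 * k) \<otimes> c" unfolding c(2) using cc cjc by (simp add: cj_mult cj_X)
 finally have 1: "inv (X k) = X (2 * k) \<otimes> c" .
 have "X k = inv x \<otimes> inv c" unfolding c(2) using cc by (simp add: m_assoc)
 then have "0 \<doteq> 2 * k"
  using cc 1 inv_mult_group center_comm[OF c(1) x_carrier] X_0 X_eqC eqC_refl by simp
 then have "int p dvd k"
  using odd zdvd_imp_le[of "int p" 2] prime_dvd_mult_iff[of "int p"] prime by (auto simp: cong_iff_dvd_diff)
 then have "inv x = x \<otimes> c" by (metis c(2) X_0 X_period cong_0_iff)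
 then have xx: "x \<otimes> x \<in> C"
  by (metis cc subgroup.m_inv_closed[OF C_sub c(1)] inv_equality m_assoc m_closed r_inv x_carrier)
 have "X i \<otimes> X i = cj (u [^] i) (x \<otimes> x)" unfolding X_def by (simp add: cj_mult)
 also have "\<dots> = x \<otimes> x" using cj_self center_comm[OF xx] by simp
 finally show ?thesis using xx by simp
qed

lemma E_square: assumes odd: "2 < p" and f: "f \<in> E" shows "f \<otimes> f \<in> C"
proof (cases "f \<in> C")
 case True then show ?thesis using subgroup.m_closed[OF C_sub] by blast
next
 case False
 then obtain i where i: "eqC (X i) f" using X_cover f by blast
 have "eqC (f \<otimes> f) (X i \<otimes> X i)" by (simp add: eqC_mult i eqC_sym[rotated])
 then show ?thesis by (simp add: eqC_mem_C[OF _ _ X_square[OF odd]] E_carrier[OF f])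
qed

text \<open>A group in which all squares are trivial is commutative; here this is applied modulo
  \<open>C\<close>, with the squares written out as central factors.\<close>

lemma bt_C: assumes odd: "2 < p" and ef: "e \<in> E" "f \<in> E" shows "bt e f \<in> C"
proof -
 have c: "e \<in> \<G>" "f \<in> \<G>" using ef E_carrier by auto
 have sq: "inv (g \<otimes> g) \<in> C" if "g \<in> E" for g using subgroup.m_inv_closed[OF C_sub E_square[OF odd that]] .
 have ie: "inv e = inv (e \<otimes> e) \<otimes> e" "inv f = inv (f \<otimes> f) \<otimes> f" using c by (simp_all add: inv_mult_group m_assoc)
 have "bt e f = e \<otimes> f \<otimes> (inv e \<otimes> inv f)" unfolding bt_def cj_def using c by (simp add: m_assoc)
 also have "inv e \<otimes> inv f = inv (e \<otimes> e) \<otimes> ((e \<otimes> inv (f \<otimes> f)) \<otimes> f)" by (subst ie(1), subst ie(2)) (use c in \<open>simp add: m_assoc\<close>)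
 also have "e \<otimes> inv (f \<otimes> f) = inv (f \<otimes> f) \<otimes> e" by (rule center_comm[OF sq[OF ef(2)] c(1), symmetric])
 also have "e \<otimes> f \<otimes> (inv (e \<otimes> e) \<otimes> (inv (f \<otimes> f) \<otimes> e \<otimes> f)) =
   ((e \<otimes> f) \<otimes> (inv (e \<otimes> e) \<otimes> inv (f \<otimes> f))) \<otimes> (e \<otimes> f)" using c by (simp add: m_assoc)
 also have "(e \<otimes> f) \<otimes> (inv (e \<otimes> e) \<otimes> inv (f \<otimes> f)) = (inv (e \<otimes> e) \<otimes> inv (f \<otimes> f)) \<otimes> (e \<otimes> f)"
  by (rule center_comm[OF subgroup.m_closed[OF C_sub sq[OF ef(1)] sq[OF ef(2)]], symmetric]) (use c in simp)
 also have "\<dots> \<otimes> (e \<otimes> f) = (inv (e \<otimes> e) \<otimes> inv (f \<otimes> f)) \<otimes> ((e \<otimes> f) \<otimes> (e \<otimes> f))" using c by (simp add: m_assoc)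
 finally show ?thesis
  using subgroup.m_closed[OF C_sub subgroup.m_closed[OF C_sub sq[OF ef(1)] sq[OF ef(2)]]
    E_square[OF odd subgroup.m_closed[OF E_subgroup ef]]] by simp
qed

definition bX where "bX j = bt (X 0) (X j)"

text \<open>The commutator pairing on \<open>E / C\<close> is invariant under \<open>u\<close>; from \<open>X 0 \<otimes> X 1 \<in> X k C\<close> it follows
 that \<open>j \<mapsto> bX j\<close> has period \<open>2 k - 1\<close>.\<close>

lemma dichotomy_odd:
 assumes odd: "2 < p"
 shows "(\<forall>e\<in>E. \<forall>f\<in>E. e \<otimes> f = f \<otimes> e) \<or>
  (p = 3 \<and> eqC (X 0 \<otimes> X 1) (X 2) \<and> X 0 \<otimes> X 1 \<noteq> X 1 \<otimes> X 0)"
proof -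
 have sqX: "X i \<otimes> X i \<in> C" for i by (rule X_square[OF odd])
 have btc: "bt (X i) (X j) \<in> C" for i j by (rule bt_C[OF odd X_E X_E])
 have btX: "bt (X i) (X j) = bX (j - i)" for i j
 proof -
  have "bt (X i) (X j) = bt (cj (u [^] i) (X 0)) (cj (u [^] i) (X (j - i)))" by (simp add: cj_X)
  also have "\<dots> = bX (j - i)" using cj_self[OF _ bt_closed] center_comm[OF btc] by (simp add: bt_cj bX_def)
  finally show ?thesis .
 qed
 have bXC: "bX j \<in> C" for j unfolding bX_def by (rule btc)
 have bXc: "bX j \<in> \<G>" for j by (rule center_carrier[OF bXC])
 have b1: "bt (X 0 \<otimes> X 0) (X j) = \<one>" for j using bt_one_iff center_comm[OF sqX] by simp
 \<comment> \<open>Exchanging the arguments inverts a commutator, and \<open>bX j\<close> has square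
   \<open>\<one>\<close> because the square of \<open>X 0\<close> is central.\<close>
 have neg: "bX (- j) = bX j" for j
 proof -
  have "bX (- j) = bt (X j) (X 0)" by (simp add: btX)
  also have "\<dots> = inv (bX j)" unfolding bX_def bt_def cj_def by (simp add: inv_mult_group m_assoc)
  also have "\<dots> = bX j"
   using bXc bt_mult_left[OF _ _ _ btc, of "X 0" 0 j] b1[of j] by (simp add: inv_equality bX_def)
  finally show ?thesis .
 qed
 have b0: "bX 0 = \<one>" unfolding bX_def using bt_one_iff by simp
 have comm: "\<forall>e\<in>E. \<forall>f\<in>E. e \<otimes> f = f \<otimes> e" if all: "\<And>j. bX j = \<one>"
 proof (intro ballI)
  fix e f assume ef: "e \<in> E" "f \<in> E"
  have c: "e \<in> \<G>" "f \<in> \<G>" using ef E_carrier by auto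
  show "e \<otimes> f = f \<otimes> e"
  proof (cases "e \<in> C \<or> f \<in> C")
   case True
   then show ?thesis using center_comm[of e f] center_comm[of f e] c by metis
  next
   case False
   then obtain i j a b where ij: "a \<in> C" "e = X i \<otimes> a" "b \<in> C" "f = X j \<otimes> b"
    using X_cover ef unfolding eqC_def by meson
   have ac: "a \<in> \<G>" "b \<in> \<G>" using ij center_carrier by auto
   have 1: "X j \<otimes> X i = X i \<otimes> X j" by (metis btX all bt_one_iff X_carrier)
   have 2: "f \<otimes> X i = X i \<otimes> f" unfolding ij(4)
    by (rule comm_mult[OF X_carrier X_carrier ac(2) 1[symmetric] center_comm[OF ij(3) X_carrier, symmetric], symmetric])
   show ?thesis by (simp add: comm_mult[OF c(2) X_carrier ac(1) 2 center_comm[OF ij(1) c(2), symmetric]] ij(2))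
  qed
 qed
 have "X 0 \<otimes> X 1 \<in> E" by (rule subgroup.m_closed[OF E_subgroup X_E X_E])
 moreover have "X 0 \<otimes> X 1 \<notin> C"
 proof
  assume a: "X 0 \<otimes> X 1 \<in> C"
  have "X 1 = X 0 \<otimes> (inv (X 0 \<otimes> X 0) \<otimes> (X 0 \<otimes> X 1))"
   by (simp add: cancel_assoc inv_mult_group m_assoc)
  then show False
   using subgroup.m_closed[OF C_sub subgroup.m_inv_closed[OF C_sub sqX] a] X_eqC odd by (fastforce simp: cong_def eqC_def)
 qed
 ultimately obtain k where "eqC (X k) (X 0 \<otimes> X 1)" using X_cover by blast
 then have k: "eqC (X 0 \<otimes> X 1) (X k)" by (rule eqC_sym[rotated]) simp
 then obtain c where c: "c \<in> C" "X k = X 0 \<otimes> X 1 \<otimes> c" unfolding eqC_def by blast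
 have cc: "c \<in> \<G>" by (rule center_carrier[OF c(1)])
 have bc: "bt (X j) c = \<one>" for j using bt_one_iff[OF X_carrier cc] center_comm[OF c(1)] by simp
 have step: "bX (k - j) = bX j \<otimes> bX (j - 1)" for j
 proof -
  have "bX (k - j) = bt (X j) (X 0) \<otimes> bt (X j) (X 1)"
   using btX[of j k] c(2) bt_mult_right[OF _ _ _ btc] bt_closed bt_mult_right cc bc subgroup.one_closed[OF C_sub] by fastforce
  also have "\<dots> = bX (- j) \<otimes> bX (- (j - 1))" unfolding btX by simp
  finally show ?thesis unfolding neg .
 qed
 \<comment> \<open>Apply \<open>step\<close> at \<open>i + k\<close> and at
   \<open>1 - (i + k)\<close>: by \<open>neg\<close> both right-hand sides are the same product in
   opposite order.\<close>
 have per: "bX (i + (2 * k - 1)) = bX i" for i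
 proof -
  have "bX (k - (i + k)) = bX (i + k) \<otimes> bX (i + k - 1)" by (rule step)
  moreover have "bX (k - (1 - (i + k))) = bX (1 - (i + k)) \<otimes> bX (1 - (i + k) - 1)" by (rule step)
  ultimately have "bX (k - (1 - (i + k))) = bX (k - (i + k))"
   using neg[of "i + k - 1"] neg[of "i + k"] center_comm[OF bXC bXc] by fastforce
  then show ?thesis using neg[of i] by (simp add: algebra_simps)
 qed
 show ?thesis
 proof (cases "int p dvd 2 * k - 1")
  case False
  then obtain e where e: "(2 * k - 1) * e \<doteq> 1"
   using unit_inverse by blast
  have pern: "bX (int n * (2 * k - 1)) = \<one>" for n
  proof (induction n)
   case 0 then show ?case using b0 by simp
  next
   case (Suc n)
   have "int (Suc n) * (2 * k - 1) = int n * (2 * k - 1) + (2 * k - 1)" by (simp add: algebra_simps)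
   then show ?case using per Suc by metis
  qed
  have "bX j = \<one>" for j
  proof -
   define n where "n = nat ((e * j) mod int p)"
   have n: "int n = (e * j) mod int p" unfolding n_def using odd by simp
   have "int n * (2 * k - 1) \<doteq> (e * j) * (2 * k - 1)" by (rule cong_scalar_right) (simp add: n)
   also have "(e * j) * (2 * k - 1) = ((2 * k - 1) * e) * j" by simp
   also have "((2 * k - 1) * e) * j \<doteq> 1 * j" using e by (rule cong_scalar_right)
   finally have "X (int n * (2 * k - 1)) = X j" by (intro X_period) simp
   then show ?thesis using pern[of n] unfolding bX_def by simp
  qed
  then show ?thesis using comm by blast
 next
  case True
  \<comment> \<open>Now \<open>k\<close> is one half modulo \<open>p\<close>. Shifting and composing
    \<open>X 0 \<otimes> X 1 = X k\<close> modulo \<open>C\<close> gives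
    \<open>X 0 \<otimes> X 2 = X 1\<close> and then \<open>X 0 \<otimes> X 1 = X 2\<close> and
    \<open>X (- 1) = X 0 \<otimes> X 1\<close>. Hence \<open>- 1\<close> and \<open>2\<close> are
    congruent and \<open>p = 3\<close>.\<close>
  then have k1: "X (2 * k) = X 1" by (intro X_period) (simp add: cong_iff_dvd_diff)
  have cjk: "eqC (X i \<otimes> X (i + 1)) (X (i + k))" for i
  proof -
   have "eqC (cj (u [^] i) (X 0 \<otimes> X 1)) (cj (u [^] i) (X k))" by (rule eqC_cj[OF _ _ k]) simp_all
   then show ?thesis by (simp add: cj_mult cj_X)
  qed
  have "eqC (X k \<otimes> X (k + 1)) (X 1)" using cjk[of k] k1 by simp
  moreover have "eqC (X 0 \<otimes> X 1 \<otimes> (X 1 \<otimes> X 2)) (X k \<otimes> X (k + 1))"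
   by (rule eqC_mult[OF _ _ k]) (use cjk[of 1] in \<open>simp_all add: add.commute\<close>)
  ultimately have "eqC (X 0 \<otimes> X 1 \<otimes> (X 1 \<otimes> X 2)) (X 1)" using eqC_trans by (metis X_carrier m_closed)
  moreover have "eqC (X 0 \<otimes> X 2) (X 0 \<otimes> X 1 \<otimes> (X 1 \<otimes> X 2))"
   using m_assoc center_comm[OF sqX] eqC_C[OF _ sqX[of 1], of "X 0 \<otimes> X 2"] by simp
  ultimately have 02: "eqC (X 0 \<otimes> X 2) (X 1)" using eqC_trans by (metis X_carrier m_closed)
  have cj02: "eqC (X i \<otimes> X (i + 2)) (X (i + 1))" for i
  proof -
   have "eqC (cj (u [^] i) (X 0 \<otimes> X 2)) (cj (u [^] i) (X 1))" by (rule eqC_cj[OF _ _ 02]) simp_all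
   then show ?thesis by (simp add: cj_mult cj_X)
  qed
  have 01: "eqC (X 0 \<otimes> X 1) (X 2)"
  proof -
   have 1: "eqC (X 0 \<otimes> X 1) (X 0 \<otimes> (X 0 \<otimes> X 2))"
    by (simp add: eqC_mult[OF _ _ eqC_refl 02] eqC_sym[rotated])
   show ?thesis
    using center_comm[OF sqX[of 0], of "X 2"] eqC_C[OF X_carrier sqX] m_assoc eqC_trans[OF _ 1] eqC_sym[rotated] by fastforce
  qed
  have "eqC (X (- 1) \<otimes> X 1 \<otimes> X 1) (X 0 \<otimes> X 1)" by (rule eqC_mult[OF _ _ _ eqC_refl]) (use cj02[of "- 1"] in simp_all)
  then have "eqC (X (- 1)) (X 0 \<otimes> X 1)"
   by (metis eqC_C[OF X_carrier sqX[of 1], of "- 1"] eqC_trans m_assoc X_carrier)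
  then have "- 1 \<doteq> 2" by (metis eqC_trans 01 X_carrier X_eqC)
  then have "int p dvd 3" by (simp add: cong_iff_dvd_diff)
  then have "p dvd 3" by (metis int_dvd_int_iff of_nat_numeral)
  then have p3: "p = 3" using odd by (auto dest: dvd_imp_le)
  show ?thesis
  proof (cases "X 0 \<otimes> X 1 = X 1 \<otimes> X 0")
   case False then show ?thesis using p3 01 by blast
  next
   case True
   have 1: "bX 1 = \<one>" unfolding bX_def using bt_one_iff True by simp
   have "bX j = \<one>" for j
   proof -
    have "j \<doteq> 0 \<or> j \<doteq> 1 \<or> j \<doteq> - 1" by (auto simp: cong_def p3)
    then show ?thesis by (metis X_period b0 1 neg[of 1] bX_def)
   qed
   then show ?thesis using comm by blast
  qed
 qed
qed

text \<open>There are only the cosets of \<open>\<one>\<close>, \<open>X 0\<close> and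
  \<open>X 1\<close>, and \<open>X 0 \<otimes> X 1\<close> can lie in none but the first. So
  \<open>X 1\<close> is the inverse of \<open>X 0\<close> up to \<open>C\<close>, and all elements
  commute.\<close>

lemma commutative_even:
 assumes p2: "p = 2" shows "\<forall>e\<in>E. \<forall>f\<in>E. e \<otimes> f = f \<otimes> e"
proof -
 have X01: "eqC (X i) f \<Longrightarrow> eqC (X 0) f \<or> eqC (X 1) f" for i f
 proof -
  have "i \<doteq> 0 \<or> i \<doteq> 1" unfolding p2 by (auto simp: cong_def)
  then show "eqC (X i) f \<Longrightarrow> eqC (X 0) f \<or> eqC (X 1) f" using X_period by metis
 qed
 have "X 0 \<otimes> X 1 \<in> C"
 proof (rule ccontr)
  assume n: "X 0 \<otimes> X 1 \<notin> C"
  have "eqC (X 0) (X 0 \<otimes> X 1) \<or> eqC (X 1) (X 0 \<otimes> X 1)"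
   by (metis X_cover n X01 subgroup.m_closed[OF E_subgroup X_E X_E])
  then show False
  proof
   assume "eqC (X 0) (X 0 \<otimes> X 1)"
   then show False by (simp add: X_notin_C eqC_iff cancel_assoc)
  next
   assume "eqC (X 1) (X 0 \<otimes> X 1)"
   then obtain c where c: "c \<in> C" "X 0 \<otimes> X 1 = X 1 \<otimes> c" unfolding eqC_def by blast
   show False using c center_carrier center_comm[OF c(1) X_carrier, symmetric] X_notin_C by auto
  qed
 qed
 then obtain d where d: "d \<in> C" "X 0 \<otimes> X 1 = d" by blast
 have x0: "X 0 \<otimes> X 1 = X 1 \<otimes> X 0"
 proof -
  have "X 1 = inv (X 0) \<otimes> d" unfolding d(2)[symmetric] by (simp add: cancel_assoc)
  then show ?thesis by (simp add: center_carrier[OF d(1)] m_assoc center_comm[OF d(1) X_carrier] cancel_assoc)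
 qed
 have form: "\<exists>y\<in>{\<one>, X 0, X 1}. \<exists>c\<in>C. e = y \<otimes> c" if e: "e \<in> E" for e
 proof (cases "e \<in> C")
  case True
  then show ?thesis using center_carrier by simp
 next
  case False
  then show ?thesis using X_cover e X01 unfolding eqC_def by blast
 qed
 show ?thesis
 proof (intro ballI)
  fix e f assume ef: "e \<in> E" "f \<in> E"
  obtain y c where y: "y \<in> {\<one>, X 0, X 1}" "c \<in> C" "e = y \<otimes> c" using form[OF ef(1)] by blast
  obtain y' c' where y': "y' \<in> {\<one>, X 0, X 1}" "c' \<in> C" "f = y' \<otimes> c'" using form[OF ef(2)] by blast
  have cr: "y \<in> \<G>" "y' \<in> \<G>" "c \<in> \<G>" "c' \<in> \<G>" "e \<in> \<G>" "f \<in> \<G>" and yy: "y \<otimes> y' = y' \<otimes> y"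
   using y y' center_carrier y(1) y'(1) x0 by auto
  have 1: "y \<otimes> f = f \<otimes> y" unfolding y'(3) by (rule comm_mult[OF cr(1,2,4) yy center_comm[OF y'(2) cr(1), symmetric]])
  show "e \<otimes> f = f \<otimes> e"
   by (simp add: comm_mult[OF cr(6,1,3) 1[symmetric] center_comm[OF y(2) cr(6), symmetric]] y(3))
 qed
qed

end

section \<open>Recognition of semidirect products and of the normal factors\<close>

context group begin

text \<open>The action is conjugation by powers of \<open>s\<close>, pulled back along
  \<open>\<psi>\<close>; it depends on the exponent modulo \<open>q\<close> only because
  \<open>s [^] q = \<one>\<close>. The hypothesis \<open>triv\<close> expresses at once that the
  product of the two factors is free and that it meets \<open>A\<close> trivially.\<close>

lemma semidirect_iso:
 fixes N0 :: "('c, 'd) monoid_scheme" and \<psi> :: "'c \<Rightarrow> 'a"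
 assumes N0: "group N0" and \<psi>: "\<psi> \<in> hom N0 G" and inj: "inj_on \<psi> (carrier N0)"
  and s: "s \<in> \<G>" and q: "q > 0" "s [^] (q::nat) = \<one>"
  and norm: "\<And>n. n \<in> carrier N0 \<Longrightarrow> cj s (\<psi> n) \<in> \<psi> ` carrier N0"
   "\<And>n. n \<in> carrier N0 \<Longrightarrow> cj (inv s) (\<psi> n) \<in> \<psi> ` carrier N0"
  and A: "subgroup A G" and central: "\<And>a g. a \<in> A \<Longrightarrow> g \<in> \<G> \<Longrightarrow> a \<otimes> g = g \<otimes> a"
  and triv: "\<And>n i. n \<in> carrier N0 \<Longrightarrow> \<psi> n \<otimes> s [^] (i::int) \<in> A \<Longrightarrow> n = \<one>\<^bsub>N0\<^esub> \<and> int q dvd i"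
  and surj: "\<And>g. g \<in> \<G> \<Longrightarrow> \<exists>n\<in>carrier N0. \<exists>i::int. \<exists>a\<in>A. g = \<psi> n \<otimes> s [^] i \<otimes> a"
 shows "\<exists>\<phi>. \<phi> \<in> hom (integer_mod_group q) (AutoGroup N0) \<and>
  (\<forall>j\<in>carrier (integer_mod_group q). \<forall>n\<in>carrier N0. \<psi> (\<phi> j n) = cj (s [^] j) (\<psi> n)) \<and>
  G \<cong> semidirect_product N0 (integer_mod_group q) \<phi> \<times>\<times> G\<lparr>carrier := A\<rparr>"
proof -
 let ?N = "carrier N0" and ?Q = "integer_mod_group q"
 interpret N0: group N0 by (rule N0)
 have \<psi>c: "\<psi> n \<in> \<G>" if "n \<in> ?N" for n using hom_in_carrier[OF \<psi> that] .
 have cjN: "cj (s [^] (i::int)) y \<in> \<psi> ` ?N" if "y \<in> \<psi> ` ?N" for i y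
 proof -
  have c: "y \<in> \<G>" if "y \<in> \<psi> ` ?N" for y using that \<psi>c by blast
  have pow: "cj (t [^] (m::nat)) y \<in> \<psi> ` ?N"
   if t: "t \<in> \<G>" and st: "\<And>y. y \<in> \<psi> ` ?N \<Longrightarrow> cj t y \<in> \<psi> ` ?N" and y: "y \<in> \<psi> ` ?N" for t m y
   using y
  proof (induction m arbitrary: y)
   case 0 then show ?case using c by simp
  next
   case (Suc m)
   have "cj (t [^] Suc m) y = cj (t [^] m) (cj t y)" using t c[OF Suc(2)] by (simp add: cj_cj)
   then show ?case using Suc st by metis
  qed
  show ?thesis
  proof (cases i rule: int_cases2)
   case (nonneg m)
   then show ?thesis using pow[OF s _ that, of m] norm(1) by (auto simp: int_pow_int)
  next
   case (nonpos m)
   then show ?thesis using s pow[OF inv_closed[OF s] _ that, of m] norm(2) int_pow_neg_int nat_pow_inv by fastforce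
  qed
 qed
 define \<theta> where "\<theta> = inv_into ?N \<psi>"
 define \<phi> where "\<phi> j = (\<lambda>n\<in>?N. \<theta> (cj (s [^] (j::int)) (\<psi> n)))" for j
 have \<phi>c: "\<phi> j n \<in> ?N" and \<psi>\<phi>: "\<psi> (\<phi> j n) = cj (s [^] j) (\<psi> n)" if "n \<in> ?N" for j n
  using cjN that by (auto simp: inv_into_into f_inv_into_f \<theta>_def \<phi>_def)
 have eqI: "m = n" if "m \<in> ?N" "n \<in> ?N" "\<psi> m = \<psi> n" for m n using inj_onD[OF inj that(3,1,2)] .
 have sc: "s [^] (j::int) \<in> \<G>" for j using s by simp
 have \<phi>\<phi>: "\<phi> i (\<phi> j n) = \<phi> (i + j) n" if "n \<in> ?N" for i j n
  by (rule eqI) (use that \<phi>c \<psi>\<phi> \<psi>c s in \<open>simp_all add: cj_cj int_pow_mult\<close>)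
 have \<phi>0: "\<phi> 0 n = n" if "n \<in> ?N" for n
  by (rule eqI) (use that \<phi>c \<psi>\<phi> \<psi>c in simp_all)
 have \<phi>m: "\<phi> j (m \<otimes>\<^bsub>N0\<^esub> n) = \<phi> j m \<otimes>\<^bsub>N0\<^esub> \<phi> j n" if "m \<in> ?N" "n \<in> ?N" for j m n
  by (rule eqI) (use that \<phi>c \<psi>\<phi> \<psi>c sc hom_mult[OF \<psi>] in \<open>simp_all add: cj_mult\<close>)
 have per: "s [^] (i mod int q) = s [^] i" for i :: int
 proof -
  have "s [^] i = s [^] (i mod int q + int q * (i div int q))" by simp
  also have "\<dots> = s [^] (i mod int q) \<otimes> (s [^] int q) [^] (i div int q)"
   using s by (simp only: int_pow_mult int_pow_pow)
  finally show ?thesis using q s by (simp add: int_pow_int)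
 qed
 have \<phi>per: "\<phi> (i mod int q) = \<phi> i" for i unfolding \<phi>_def per ..
 have Bij: "\<phi> j \<in> Bij ?N" for j
 proof -
  have "bij_betw (\<phi> j) ?N ?N"
   by (rule bij_betw_byWitness[where f' = "\<phi> (- j)"]) (use \<phi>\<phi> \<phi>0 \<phi>c in auto)
  then show ?thesis unfolding Bij_def \<phi>_def by simp
 qed
 have auto: "\<phi> j \<in> auto N0" for j unfolding auto_def using Bij \<phi>c \<phi>m by (auto simp: hom_def)
 have hom: "\<phi> \<in> hom ?Q (AutoGroup N0)"
 proof (rule homI)
  show "\<phi> i \<in> carrier (AutoGroup N0)" for i using auto by (simp add: AutoGroup_def)
  fix i j
  have "\<phi> i \<otimes>\<^bsub>AutoGroup N0\<^esub> \<phi> j = compose ?N (\<phi> i) (\<phi> j)" using Bij by (simp add: AutoGroup_def BijGroup_def)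
  also have "\<dots> = \<phi> (i + j)"
  proof
   fix n show "compose ?N (\<phi> i) (\<phi> j) n = \<phi> (i + j) n"
   proof (cases "n \<in> ?N")
    case True
    then show ?thesis by (simp add: \<phi>\<phi>[OF True] compose_def)
   qed (simp add: compose_def \<phi>_def)
  qed
  finally show "\<phi> (i \<otimes>\<^bsub>?Q\<^esub> j) = \<phi> i \<otimes>\<^bsub>AutoGroup N0\<^esub> \<phi> j" using \<phi>per by simp
 qed
 let ?K = "semidirect_product N0 ?Q \<phi>" and ?F = "\<lambda>(n, j). \<psi> n \<otimes> s [^] (j::int)"
 have K: "group ?K" by (rule group_semidirect_product[OF N0 group_integer_mod_group hom])
 have carK: "carrier ?K = ?N \<times> {0..<int q}" using q by (simp add: semidirect_product_def carrier_integer_mod_group)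
 have Fh: "?F \<in> hom ?K G"
 proof (rule homI)
  fix x assume "x \<in> carrier ?K"
  then show "?F x \<in> \<G>" using \<psi>c sc unfolding carK by auto
 next
  fix x y assume "x \<in> carrier ?K" "y \<in> carrier ?K"
  then obtain n i m j where xy: "x = (n, i)" "y = (m, j)" "n \<in> ?N" "m \<in> ?N" unfolding carK by auto
  have "?F (x \<otimes>\<^bsub>?K\<^esub> y) = \<psi> n \<otimes> cj (s [^] i) (\<psi> m) \<otimes> (s [^] i \<otimes> s [^] j)"
   using hom_mult[OF \<psi> xy(3) \<phi>c[OF xy(4)]] \<psi>\<phi>[OF xy(4)] s by (simp add: semidirect_product_def per int_pow_mult xy)
  also have "\<dots> = \<psi> n \<otimes> s [^] i \<otimes> (\<psi> m \<otimes> s [^] j)"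
  proof -
   have "inv (s [^] i) \<otimes> (s [^] i \<otimes> s [^] j) = s [^] j" using sc by (simp add: m_assoc[symmetric])
   then show ?thesis using \<psi>c[OF xy(3)] \<psi>c[OF xy(4)] sc unfolding cj_def by (simp add: m_assoc)
  qed
  finally show "?F (x \<otimes>\<^bsub>?K\<^esub> y) = ?F x \<otimes> ?F y" unfolding xy by simp
 qed
 have "G \<cong> ?K \<times>\<times> G\<lparr>carrier := A\<rparr>"
 proof (rule central_product_iso[OF K Fh A central])
  fix x assume x: "x \<in> carrier ?K" "?F x \<in> A"
  then obtain n j where nj: "x = (n, j)" "n \<in> ?N" "0 \<le> j" "j < int q" unfolding carK by auto
  then have "n = \<one>\<^bsub>N0\<^esub> \<and> int q dvd j" using triv x(2) by simp
  moreover from this have "j = 0" using nj zdvd_not_zless[of j "int q"] by (cases "j = 0") auto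
  ultimately show "x = \<one>\<^bsub>?K\<^esub>" unfolding nj(1) by (simp add: semidirect_product_def)
 next
  fix g assume "g \<in> \<G>"
  then obtain n i a where g: "n \<in> ?N" "a \<in> A" "g = \<psi> n \<otimes> s [^] (i::int) \<otimes> a" using surj by blast
  have "(n, i mod int q) \<in> carrier ?K" unfolding carK using g(1) q by simp
  moreover have "g = ?F (n, i mod int q) \<otimes> a" using g(3) per by simp
  ultimately show "\<exists>x\<in>carrier ?K. \<exists>a\<in>A. g = ?F x \<otimes> a" using g(2) by blast
 qed
 then show ?thesis using hom \<psi>\<phi> by blast
qed

end

lemma group_elementary_abelian_2: "group (elementary_abelian_2 r)"
 unfolding elementary_abelian_2_def by simp

lemma elementary_abelian_2_carrier: "carrier (elementary_abelian_2 r) = (\<Pi>\<^sub>E i\<in>{..<r}. {0, 1})"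
proof -
 have "{0..<int 2} = {0, 1}" by auto
 then show ?thesis unfolding elementary_abelian_2_def by (simp add: carrier_integer_mod_group)
qed

lemma elementary_abelian_2_card: "card (carrier (elementary_abelian_2 r)) = 2 ^ r"
 unfolding elementary_abelian_2_carrier by (simp add: card_PiE numeral_2_eq_2)

lemma (in group) hom_inj_onI:
 assumes "group K" "f \<in> hom K G" "\<And>k. k \<in> carrier K \<Longrightarrow> f k = \<one> \<Longrightarrow> k = \<one>\<^bsub>K\<^esub>"
 shows "inj_on f (carrier K)"
proof -
 interpret group_hom K G f using assms by (simp add: group_hom_def group_hom_axioms_def)
 show ?thesis using inj_on_one_iff assms(3) by blast
qed

text \<open>A basis is found by maximality: take the largest \<open>r\<close> with an embedding into
  \<open>N\<close>. An element outside the image could serve as the value on one more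
  coordinate.\<close>

lemma (in group) elementary_abelian_2_parametrization:
 assumes N: "subgroup N G" "finite N" and sq: "\<And>n. n \<in> N \<Longrightarrow> n \<otimes> n = \<one>"
 shows "\<exists>r \<psi>. \<psi> \<in> hom (elementary_abelian_2 r) G \<and> inj_on \<psi> (carrier (elementary_abelian_2 r)) \<and>
  \<psi> ` carrier (elementary_abelian_2 r) = N"
proof -
 let ?EA = "\<lambda>r. elementary_abelian_2 r"
 let ?P = "\<lambda>r. \<exists>\<psi>. \<psi> \<in> hom (?EA r) G \<and> inj_on \<psi> (carrier (?EA r)) \<and> \<psi> ` carrier (?EA r) \<subseteq> N"
 have Nc: "n \<in> carrier G" if "n \<in> N" for n using subgroup.mem_carrier[OF N(1) that] .
 have inv: "inv n = n" if "n \<in> N" for n using sq[OF that] Nc[OF that] by (intro inv_equality) auto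
 have comm: "m \<otimes> n = n \<otimes> m" if "m \<in> N" "n \<in> N" for m n
  by (metis inv subgroup.m_closed[OF N(1) that] that Nc inv_mult_group)
 have 0: "?P 0" using elementary_abelian_2_carrier subgroup.one_closed[OF N(1)] by (auto simp: hom_def)
 have bd: "r \<le> card N" if h: "?P r" for r
 proof -
  obtain \<psi> where \<psi>: "inj_on \<psi> (carrier (?EA r))" "\<psi> ` carrier (?EA r) \<subseteq> N" using h by blast
  have "2 ^ r \<le> card N" using card_inj_on_le[OF \<psi> N(2)] by (simp add: elementary_abelian_2_card)
  then show ?thesis using less_exp[of r] by linarith
 qed
 define r where "r = (GREATEST r. ?P r)"
 have rmax: "k \<le> r" if "?P k" for k unfolding r_def by (rule Greatest_le_nat[of ?P k, OF that bd])
 obtain \<psi> where \<psi>: "\<psi> \<in> hom (?EA r) G" "inj_on \<psi> (carrier (?EA r))" "\<psi> ` carrier (?EA r) \<subseteq> N"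
  using GreatestI_nat[of ?P 0, OF 0 bd] unfolding r_def by blast
 have "\<psi> ` carrier (?EA r) = N"
 proof (rule ccontr)
  assume "\<psi> ` carrier (?EA r) \<noteq> N"
  then obtain y where y: "y \<in> N" "y \<notin> \<psi> ` carrier (?EA r)" using \<psi>(3) by blast
  have yc: "y \<in> carrier G" by (rule Nc[OF y(1)])
  define \<psi>' where "\<psi>' f = \<psi> (restrict f {..<r}) \<otimes> (if f r = 1 then y else \<one>)" for f
  have vals: "f i \<in> {0, 1}" if "f \<in> carrier (?EA (Suc r))" "i < Suc r" for f i
   by (rule PiE_mem[OF that(1)[unfolded elementary_abelian_2_carrier]]) (use that(2) in simp)
  have res: "restrict f {..<r} \<in> carrier (?EA r)" if "f \<in> carrier (?EA (Suc r))" for f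
   unfolding elementary_abelian_2_carrier restrict_PiE_iff using vals[OF that] less_SucI by blast
  have val: "f r = 0 \<or> f r = 1" if "f \<in> carrier (?EA (Suc r))" for f
   using vals[OF that lessI] by blast
  have \<psi>N: "\<psi> g \<in> N" if "g \<in> carrier (?EA r)" for g using \<psi>(3) that by blast
  have "?P (Suc r)"
  proof (intro exI conjI)
   show img: "\<psi>' ` carrier (?EA (Suc r)) \<subseteq> N"
    unfolding \<psi>'_def using \<psi>N[OF res] y(1) subgroup.m_closed[OF N(1)] subgroup.one_closed[OF N(1)] by auto
   show hom: "\<psi>' \<in> hom (?EA (Suc r)) G"
   proof (rule homI)
    show "\<psi>' f \<in> carrier G" if "f \<in> carrier (?EA (Suc r))" for f using img that Nc by blast
    fix f g assume fg: "f \<in> carrier (?EA (Suc r))" "g \<in> carrier (?EA (Suc r))"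
    let ?h = "f \<otimes>\<^bsub>?EA (Suc r)\<^esub> g"
    let ?a = "\<psi> (restrict f {..<r})" and ?b = "\<psi> (restrict g {..<r})"
    have "restrict ?h {..<r} = restrict f {..<r} \<otimes>\<^bsub>?EA r\<^esub> restrict g {..<r}"
     unfolding elementary_abelian_2_def by auto
    then have 1: "\<psi> (restrict ?h {..<r}) = ?a \<otimes> ?b" using hom_mult[OF \<psi>(1) res[OF fg(1)] res[OF fg(2)]] by simp
    have 2: "?h r = (f r + g r) mod 2" unfolding elementary_abelian_2_def by simp
    have ab: "?a \<in> N" "?b \<in> N" "?a \<in> carrier G" "?b \<in> carrier G" using \<psi>N res fg Nc by auto
    have yb: "y \<otimes> ?b = ?b \<otimes> y" by (rule comm[OF y(1) ab(2)])
    have yyb: "y \<otimes> (?b \<otimes> y) = ?b"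
     using yb[symmetric] sq[OF y(1)] ab yc by (simp add: m_assoc[symmetric])
    show "\<psi>' ?h = \<psi>' f \<otimes> \<psi>' g"
     using val[OF fg(1)] val[OF fg(2)] ab yc yb yyb unfolding \<psi>'_def 1 2 by (auto simp: m_assoc)
   qed
   show "inj_on \<psi>' (carrier (?EA (Suc r)))"
   proof (rule hom_inj_onI[OF group_elementary_abelian_2 hom])
    fix f assume f: "f \<in> carrier (?EA (Suc r))" "\<psi>' f = \<one>"
    have c: "\<psi> (restrict f {..<r}) \<in> carrier G" using \<psi>N[OF res[OF f(1)]] Nc by blast
    have fr: "f r = 0"
     using val[OF f(1)] f(2) c yc inv_equality inv_inv inv_closed inv[OF y(1)] y(2) res[OF f(1)] imageI by (auto simp: \<psi>'_def)
    then have "\<psi> (restrict f {..<r}) = \<psi> \<one>\<^bsub>?EA r\<^esub>"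
     using f(2) c by (simp add: hom_one[OF \<psi>(1) group_elementary_abelian_2 is_group] \<psi>'_def)
    from inj_onD[OF \<psi>(2) this res[OF f(1)] monoid.one_closed[OF group.is_monoid[OF group_elementary_abelian_2]]]
    have e: "restrict f {..<r} = \<one>\<^bsub>?EA r\<^esub>" .
    have fi: "f i = 0" if "i < Suc r" for i
    proof (cases "i = r")
     case False
     then have "restrict f {..<r} i = 0" unfolding e elementary_abelian_2_def using that by simp
     then show ?thesis using that False by simp
    qed (use fr in simp)
    show "f = \<one>\<^bsub>?EA (Suc r)\<^esub>"
    proof
     fix i show "f i = \<one>\<^bsub>?EA (Suc r)\<^esub> i"
     proof (cases "i < Suc r")
      case True
      then show ?thesis using fi[OF True] by (simp add: elementary_abelian_2_def)
     next
      case False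
      then show ?thesis
       using PiE_arb[OF f(1)[unfolded elementary_abelian_2_carrier], of i] by (simp add: elementary_abelian_2_def)
     qed
    qed
   qed
  qed
  then show False using rmax[of "Suc r"] by simp
 qed
 then show ?thesis using \<psi> by blast
qed

context group begin

lemma quaternion_hom:
 assumes c: "i \<in> \<G>" "j \<in> \<G>" "k \<in> \<G>" "z \<in> \<G>"
  and ijk: "i \<otimes> j = k" "j \<otimes> k = i" "k \<otimes> i = j"
  and sq: "i \<otimes> i = z" "j \<otimes> j = z" "k \<otimes> k = z"
 defines "\<psi> \<equiv> \<lambda>(a, b, c, d). if a = 1 then \<one> else if a = - 1 then z else if b = 1 then i
   else if b = - 1 then z \<otimes> i else if c = 1 then j else if c = - 1 then z \<otimes> j
   else if d = (1::int) then k else z \<otimes> (k :: 'a)"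
 shows "\<psi> \<in> hom Q8 G"
  and "z \<otimes> z = \<one>"
  and "\<psi> ` carrier Q8 = {\<one>, z, i, z \<otimes> i, j, z \<otimes> j, k, z \<otimes> k}"
  and "\<lbrakk>\<one> \<noteq> z; \<one> \<notin> {i, j, k}; z \<notin> {i, j, k}\<rbrakk> \<Longrightarrow> inj_on \<psi> (carrier Q8)"
  and "j \<otimes> i = z \<otimes> k"
proof -
 have zc: "i \<otimes> z = z \<otimes> i" "j \<otimes> z = z \<otimes> j" "k \<otimes> z = z \<otimes> k" and r: "j \<otimes> i = z \<otimes> k" "k \<otimes> j = z \<otimes> i" "i \<otimes> k = z \<otimes> j"
  using c sq ijk by (metis m_assoc)+
 show "j \<otimes> i = z \<otimes> k" by (rule r(1))
 \<comment> \<open>The three cyclic products and the common square already force \<open>z\<close> to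
   be an involution or trivial: \<open>i j j k\<close> equals \<open>i (j i) = k i = j\<close>, and
   it also equals \<open>z i k = z z j\<close>.\<close>
 have "j = i \<otimes> ((j \<otimes> j) \<otimes> k)" by (metis ijk c m_assoc)
 also have "\<dots> = (z \<otimes> z) \<otimes> j" unfolding sq by (metis c m_assoc zc r)
 finally have "\<one> \<otimes> j = (z \<otimes> z) \<otimes> j" using c by simp
 then show zz: "z \<otimes> z = \<one>" using c by simp
 have zzt: "z \<otimes> (z \<otimes> t) = t" if "t \<in> \<G>" for t using zz c that by (simp add: m_assoc[symmetric])
 have zt: "i \<otimes> (z \<otimes> t) = z \<otimes> (i \<otimes> t)" "j \<otimes> (z \<otimes> t) = z \<otimes> (j \<otimes> t)" "k \<otimes> (z \<otimes> t) = z \<otimes> (k \<otimes> t)"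
  if "t \<in> \<G>" for t
  using zc c that by (metis m_assoc)+
 note rules = zc r ijk sq zz zzt zt m_assoc
 show hom: "\<psi> \<in> hom Q8 G"
 proof (rule homI)
  show "\<psi> q \<in> \<G>" for q using c unfolding \<psi>_def by (cases q) simp
  fix q q' assume "q \<in> carrier Q8" "q' \<in> carrier Q8"
  then have "q \<in> {(1, 0, 0, 0), (- 1, 0, 0, 0), (0, 1, 0, 0), (0, - 1, 0, 0), (0, 0, 1, 0), (0, 0, - 1, 0), (0, 0, 0, 1), (0, 0, 0, - 1)}"
   "q' \<in> {(1, 0, 0, 0), (- 1, 0, 0, 0), (0, 1, 0, 0), (0, - 1, 0, 0), (0, 0, 1, 0), (0, 0, - 1, 0), (0, 0, 0, 1), (0, 0, 0, - 1)}"
   by (simp_all add: Q8_def)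
  moreover have "q \<otimes>\<^bsub>Q8\<^esub> q' = quat_mult q q'" by (simp add: Q8_def)
  ultimately show "\<psi> (q \<otimes>\<^bsub>Q8\<^esub> q') = \<psi> q \<otimes> \<psi> q'"
   unfolding \<psi>_def by (elim insertE emptyE) (simp_all add: c rules)
 qed
 show "\<psi> ` carrier Q8 = {\<one>, z, i, z \<otimes> i, j, z \<otimes> j, k, z \<otimes> k}"
  unfolding Q8_def \<psi>_def by simp
 assume n: "\<one> \<noteq> z" "\<one> \<notin> {i, j, k}" "z \<notin> {i, j, k}"
 show "inj_on \<psi> (carrier Q8)"
 proof (rule hom_inj_onI[OF group_Q8 hom])
  have zn: "z \<otimes> t \<noteq> \<one>" if "t \<in> {i, j, k}" for t
  proof
   assume "z \<otimes> t = \<one>"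
   then have "z \<otimes> t = z \<otimes> z" using zz by simp
   then show False using that c n by auto
  qed
  have n': "z \<noteq> \<one>" "i \<noteq> \<one>" "j \<noteq> \<one>" "k \<noteq> \<one>" using n by auto
  fix q assume q: "q \<in> carrier Q8" and "\<psi> q = \<one>"
  moreover have "q \<in> {(1, 0, 0, 0), (- 1, 0, 0, 0), (0, 1, 0, 0), (0, - 1, 0, 0), (0, 0, 1, 0), (0, 0, - 1, 0), (0, 0, 0, 1), (0, 0, 0, - 1)}" "\<one>\<^bsub>Q8\<^esub> = (1, 0, 0, 0)"
   using q by (auto simp: Q8_def)
  ultimately show "q = \<one>\<^bsub>Q8\<^esub>" by (auto simp: zn insertE emptyE n' \<psi>_def)
 qed
qed

lemma central_subgroup_comm_group:
 assumes A: "subgroup A G" and "\<And>a g. a \<in> A \<Longrightarrow> g \<in> \<G> \<Longrightarrow> a \<otimes> g = g \<otimes> a"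
 shows "comm_group (G\<lparr>carrier := A\<rparr>)"
proof -
 interpret A: group "G\<lparr>carrier := A\<rparr>" by (rule subgroup_imp_group[OF A])
 show ?thesis by (rule A.group_comm_groupI) (use assms subgroup.mem_carrier[OF A] in auto)
qed

end

locale sharp_split = sharp_blocks +
 fixes A assumes A: "subgroup A G" "A \<subseteq> S \<inter> Z" and S_cp: "S \<subseteq> cp u A"
  and u_A: "u [^] (i::int) \<in> A \<Longrightarrow> u [^] i = \<one>"
begin

text \<open>\<open>S\<close> is the product of the powers of \<open>u\<close> with the central group
  \<open>A\<close>, and the group is \<open>N\<close> times \<open>S\<close> with trivial
  intersection. So \<open>A\<close> splits off as a direct factor. The exponent \<open>k\<close> is
  positive because \<open>u\<close> is not in \<open>Z\<close>.\<close>

lemma split_semidirect: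
 fixes N0 :: "('c, 'd) monoid_scheme" and \<psi> :: "'c \<Rightarrow> 'a"
 assumes N0: "group N0" and \<psi>: "\<psi> \<in> hom N0 G" "inj_on \<psi> (carrier N0)" "\<psi> ` carrier N0 = N"
  and nn: "\<And>g n. g \<in> \<G> \<Longrightarrow> n \<in> N \<Longrightarrow> cj g n \<in> N"
  and n0: "n0 \<in> N" "cj n0 ` S \<noteq> S" and NS: "N \<inter> S \<subseteq> {\<one>}"
 shows "\<exists>k \<phi>. k > 0 \<and> \<phi> \<in> hom (integer_mod_group (p ^ k)) (AutoGroup N0) \<and> u [^] (p ^ k) = \<one> \<and>
  (\<forall>j\<in>carrier (integer_mod_group (p ^ k)). \<forall>n\<in>carrier N0. \<psi> (\<phi> j n) = cj (u [^] j) (\<psi> n)) \<and>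
  G \<cong> semidirect_product N0 (integer_mod_group (p ^ k)) \<phi> \<times>\<times> G\<lparr>carrier := A\<rparr>"
proof -
 obtain k where k: "ord u = p ^ k" using u_S BL_P[OF S] by (auto simp: p_elements_def)
 have up: "u [^] (p ^ k) = \<one>" using pow_ord_eq_1[OF u_carrier] k by simp
 have NG: "subgroup N G"
 proof -
  interpret group_hom N0 G \<psi> using N0 \<psi>(1) by (simp add: group_hom_def group_hom_axioms_def)
  show ?thesis using img_is_subgroup \<psi>(3) by simp
 qed
 have AS: "a \<in> S" "a \<in> \<G>" if "a \<in> A" for a using that A S_carrier by auto
 have "\<exists>\<phi>. \<phi> \<in> hom (integer_mod_group (p ^ k)) (AutoGroup N0) \<and>
  (\<forall>j\<in>carrier (integer_mod_group (p ^ k)). \<forall>n\<in>carrier N0. \<psi> (\<phi> j n) = cj (u [^] j) (\<psi> n)) \<and>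
  G \<cong> semidirect_product N0 (integer_mod_group (p ^ k)) \<phi> \<times>\<times> G\<lparr>carrier := A\<rparr>"
 proof (rule semidirect_iso[OF N0 \<psi>(1,2) u_carrier _ up _ _ A(1)])
  show "p ^ k > 0" using p_gt_0 by simp
  show "cj u (\<psi> n) \<in> \<psi> ` carrier N0" "cj (inv u) (\<psi> n) \<in> \<psi> ` carrier N0" if "n \<in> carrier N0" for n
   unfolding \<psi>(3) using nn that \<psi>(3) by auto
  show "a \<otimes> g = g \<otimes> a" if "a \<in> A" "g \<in> \<G>" for a g using Z_comm that A by blast
  show "n = \<one>\<^bsub>N0\<^esub> \<and> int (p ^ k) dvd i" if n: "n \<in> carrier N0" "\<psi> n \<otimes> u [^] (i::int) \<in> A" for n i
  proof -
   have nc: "\<psi> n \<in> N" "\<psi> n \<in> \<G>" using n \<psi>(3) hom_in_carrier[OF \<psi>(1)] by auto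
   have "\<psi> n = \<psi> n \<otimes> u [^] i \<otimes> inv (u [^] i)" using nc by (simp add: m_assoc)
   also have "\<dots> \<in> S" using subgroup.m_closed[OF S_sub AS(1)[OF n(2)] subgroup.m_inv_closed[OF S_sub u_pow_S]] .
   finally have 1: "\<psi> n = \<one>" using nc(1) NS by blast
   then show ?thesis
    using n(2) u_A int_pow_eq_id[OF u_carrier] k inj_onD[OF \<psi>(2) _ n(1) monoid.one_closed[OF group.is_monoid[OF N0]]] hom_one[OF \<psi>(1) N0 is_group] by fastforce
  qed
  show "\<exists>n\<in>carrier N0. \<exists>i::int. \<exists>a\<in>A. g = \<psi> n \<otimes> u [^] i \<otimes> a" if g: "g \<in> \<G>" for g
  proof -
   obtain n s where ns: "n \<in> N" "s \<in> S" "g = n \<otimes> s" using transitive_complement(2)[OF NG nn n0 g] by blast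
   obtain m where m: "m \<in> carrier N0" "n = \<psi> m" using ns(1) \<psi>(3) by blast
   obtain i a where s: "a \<in> A" "s = u [^] (i::int) \<otimes> a" using S_cp ns(2) unfolding cp_def by blast
   have "g = \<psi> m \<otimes> u [^] i \<otimes> a" unfolding ns(3) m(2) s(2)
    using AS(2)[OF s(1)] hom_in_carrier[OF \<psi>(1) m(1)] by (simp add: m_assoc)
   then show ?thesis using m(1) s(1) by blast
  qed
 qed
 then show ?thesis using up k ord_eq_1[of u] u subgroup.one_closed[OF Z_subgroup] by auto
qed

end

section \<open>The normal subgroup regular on the blocks\<close>

context sharp_blocks_elem begin

text \<open>On a commutative \<open>E\<close> the map \<open>e \<mapsto> bt u e\<close> is an
  endomorphism, and a value in \<open>C\<close> forces \<open>e\<close> into \<open>C\<close>, where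
  the map is trivial. Its image, the commutator of \<open>u\<close> with \<open>E\<close>, therefore
  meets \<open>C\<close> trivially.\<close>

lemma commutative_complement:
 assumes comm: "\<And>e f. e \<in> E \<Longrightarrow> f \<in> E \<Longrightarrow> e \<otimes> f = f \<otimes> e"
 shows "\<exists>N. subgroup N G \<and> N \<subseteq> E \<and> N \<inter> C \<subseteq> {\<one>} \<and> (\<forall>g\<in>\<G>. \<forall>n\<in>N. cj g n \<in> N) \<and>
  (\<exists>n\<in>N. cj n ` S \<noteq> S)"
proof -
 define N where "N = bt u ` E"
 have Ec: "e \<in> \<G>" if "e \<in> E" for e by (rule E_carrier[OF that])
 have btE: "bt u e \<in> E" if "e \<in> E" for e
  unfolding bt_def by (rule subgroup.m_closed[OF E_subgroup E_cj[OF u_carrier that] subgroup.m_inv_closed[OF E_subgroup that]])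
 have NE: "N \<subseteq> E" unfolding N_def using btE by blast
 have mult: "bt u (e \<otimes> f) = bt u e \<otimes> bt u f" if ef: "e \<in> E" "f \<in> E" for e f
  using Ec ef cj_mult inv_mult_group m_assoc comm[OF btE[OF ef(2)] subgroup.m_inv_closed[OF E_subgroup ef(1)]] by (simp add: bt_def)
 have NG: "subgroup N G"
 proof (rule subgroupI)
  show "N \<subseteq> \<G>" using NE Ec by blast
  show "N \<noteq> {}" unfolding N_def using x by blast
  fix a assume "a \<in> N"
  then obtain e where e: "e \<in> E" "a = bt u e" unfolding N_def by blast
  have ie: "inv e \<in> E" by (rule subgroup.m_inv_closed[OF E_subgroup e(1)])
  have "bt u (inv e) \<otimes> bt u e = \<one>" using mult[OF ie e(1)] Ec[OF e(1)] bt_def by fastforce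
  then show "inv a \<in> N" using Ec bt_closed e(1) ie by (simp add: inv_equality e(2) N_def)
  fix b assume "b \<in> N"
  then obtain f where f: "f \<in> E" "b = bt u f" unfolding N_def by blast
  show "a \<otimes> b \<in> N" unfolding e(2) f(2) mult[OF e(1) f(1), symmetric] N_def
   using subgroup.m_closed[OF E_subgroup e(1) f(1)] by blast
 qed
 have fixed: "e \<in> C" if e: "e \<in> E" "bt u e \<in> C" for e
 proof (rule E_fixed[OF e(1) u_S])
  show "u \<notin> Z" using u by blast
  show "eqC e (cj u e)"
   using Ec[OF e(1)] e(2) m_assoc center_comm[OF e(2) Ec[OF e(1)]] unfolding bt_def eqC_def by fastforce
 qed
 have NC: "N \<inter> C \<subseteq> {\<one>}"
 proof
  fix n assume "n \<in> N \<inter> C"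
  then obtain e where e: "e \<in> E" "n = bt u e" "n \<in> C" unfolding N_def by blast
  show "n \<in> {\<one>}" using fixed e center_comm[of e u] bt_one_iff[OF u_carrier Ec[OF e(1)]] by simp
 qed
 have nn: "cj g n \<in> N" if "g \<in> \<G>" "n \<in> N" for g n
 proof (rule normalized[OF _ _ _ that])
  show "N \<subseteq> \<G>" using NE Ec by blast
  show "cj e m \<in> N" if em: "e \<in> E" "m \<in> N" for e m
  proof -
   have mE: "m \<in> E" using em NE by blast
   show ?thesis by (metis cj_self[OF Ec[OF em(1)] Ec[OF mE]] comm[OF em(1) mE] em)
  qed
  show "cj u m \<in> N" if m: "m \<in> N" for m
  proof -
   obtain e where e: "e \<in> E" "m = bt u e" using m unfolding N_def by blast
   show ?thesis using Ec[OF e(1)] E_cj[OF u_carrier e(1)] by (simp add: cj_mult cj_inv e(2) bt_def N_def)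
  qed
 qed
 have "bt u x \<notin> C" using fixed x by blast
 then show ?thesis using E_fix[OF btE[OF x(1)] S] NG NE NC nn x(1) unfolding N_def by blast
qed

end

context sharp_blocks begin

text \<open>By \<open>E_same\<close> two elements of \<open>N\<close> with the same effect on
  \<open>S\<close> differ by an element of \<open>C\<close>, which must be trivial. Together with
  transitivity, \<open>N\<close> corresponds to the blocks.\<close>

lemma regular_card:
 assumes N: "subgroup N G" and NE: "N \<subseteq> E" and NC: "N \<inter> C \<subseteq> {\<one>}"
  and nn: "\<And>g n. g \<in> \<G> \<Longrightarrow> n \<in> N \<Longrightarrow> cj g n \<in> N" and n0: "n0 \<in> N" "cj n0 ` S \<noteq> S"
 shows "m \<in> N \<Longrightarrow> n \<in> N \<Longrightarrow> cj m ` S = cj n ` S \<Longrightarrow> m = n" and "card N = p + 1"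
proof -
 show inj: "m = n" if mn: "m \<in> N" "n \<in> N" "cj m ` S = cj n ` S" for m n
 proof -
  obtain c where c: "c \<in> C" "n = m \<otimes> c" using E_same[OF _ _ S mn(3)] mn NE by blast
  show "m = n"
   using center_carrier[OF c(1)] subgroup.m_closed[OF N subgroup.m_inv_closed[OF N mn(1)] mn(2)] c(1) NC c(2) cancel_assoc subgroup.mem_carrier[OF N] mn by auto
 qed
 have "bij_betw (\<lambda>n. cj n ` S) N BL"
 proof (rule bij_betw_imageI)
  show "inj_on (\<lambda>n. cj n ` S) N" using inj by (rule inj_onI)
  show "(\<lambda>n. cj n ` S) ` N = BL"
   using BL_cj[OF S] subgroup.mem_carrier[OF N] transitive_complement(1)[OF N nn n0] by blast
 qed
 then show "card N = p + 1" using bij_betw_same_card BL_card by metis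
qed

end

context sharp_split begin

lemma C_pow_u: "u [^] (i::int) \<in> C \<longleftrightarrow> int p dvd i"
 using C_in_Z u_pow_S BL_P[OF S] u_pow_Z Z_center by auto

text \<open>\<open>N\<close> corresponds to the blocks through its effect on \<open>S\<close>,
  compatibly with conjugation by \<open>u\<close>. Nonzero vectors are thus the blocks other than
  \<open>S\<close>, which \<open>u\<close> permutes in one cycle of length
  \<open>p = 2 ^ r - 1\<close>.\<close>

lemma singer_case:
 assumes N: "subgroup N G" and NE: "N \<subseteq> E" and NC: "N \<inter> C \<subseteq> {\<one>}"
  and nn: "\<And>g n. g \<in> \<G> \<Longrightarrow> n \<in> N \<Longrightarrow> cj g n \<in> N" and n0: "n0 \<in> N" "cj n0 ` S \<noteq> S"
  and sq: "\<And>n. n \<in> N \<Longrightarrow> n \<otimes> n = \<one>"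
 shows "\<exists>r k \<phi>. p = 2 ^ r - 1 \<and> k > 0 \<and> acts_as_singer_cycle r (integer_mod_group (p ^ k)) \<phi> \<and>
  G \<cong> semidirect_product (elementary_abelian_2 r) (integer_mod_group (p ^ k)) \<phi> \<times>\<times> G\<lparr>carrier := A\<rparr>"
proof -
 obtain r \<psi> where \<psi>: "\<psi> \<in> hom (elementary_abelian_2 r) G" "inj_on \<psi> (carrier (elementary_abelian_2 r))"
  "\<psi> ` carrier (elementary_abelian_2 r) = N"
  using elementary_abelian_2_parametrization[OF N subgroup_finite[OF N] sq] by blast
 let ?V = "elementary_abelian_2 r"
 interpret V: group ?V by (rule group_elementary_abelian_2)
 have reg1: "m = n" if "m \<in> N" "n \<in> N" "cj m ` S = cj n ` S" for m n
  by (rule regular_card(1)[OF N NE NC _ n0 that]) (rule nn)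
 have "2 ^ r = p + 1"
  by (metis card_image[OF \<psi>(2)] \<psi>(3) elementary_abelian_2_card regular_card(2)[OF N NE NC _ n0] nn)
 then have pr: "p = 2 ^ r - 1" by simp
 have Nc: "n \<in> \<G>" if "n \<in> N" for n using subgroup.mem_carrier[OF N that] .
 have NS: "N \<inter> S \<subseteq> {\<one>}" using E_fix[OF _ S BL_self[OF S]] NE NC by auto
 obtain k \<phi> where k: "k > 0" "\<phi> \<in> hom (integer_mod_group (p ^ k)) (AutoGroup ?V)" "u [^] (p ^ k) = \<one>"
  and \<phi>: "\<And>j n. j \<in> carrier (integer_mod_group (p ^ k)) \<Longrightarrow> n \<in> carrier ?V \<Longrightarrow> \<psi> (\<phi> j n) = cj (u [^] j) (\<psi> n)"
  and iso: "G \<cong> semidirect_product ?V (integer_mod_group (p ^ k)) \<phi> \<times>\<times> G\<lparr>carrier := A\<rparr>"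
  using split_semidirect[OF V.is_group \<psi> nn n0 NS] by blast
 let ?Q = "integer_mod_group (p ^ k)"
 interpret h: group_hom ?Q "AutoGroup ?V" \<phi>
  using k(2) V.AutoGroup by (simp add: group_hom_def group_hom_axioms_def)
 have 1: "1 \<in> carrier ?Q" using one_less_power[of p k] k(1) p_ge_2 by simp
 have auto: "\<phi> j \<in> auto ?V" if "j \<in> carrier ?Q" for j using h.hom_closed[OF that] by (simp add: AutoGroup_def)
 have cl: "\<phi> j n \<in> carrier ?V" if "j \<in> carrier ?Q" "n \<in> carrier ?V" for j n
  using auto[OF that(1)] that(2) unfolding auto_def hom_def by blast
 have pw: "\<phi> 1 [^]\<^bsub>AutoGroup ?V\<^esub> n = \<phi> (int n mod int (p ^ k))" for n :: nat
  using h.hom_nat_pow[OF 1, of n] by simp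
 \<comment> \<open>The acting cyclic group may have order larger than \<open>p\<close>, but a power
   of \<open>u\<close> acts trivially precisely if it is central. So the order of the induced
   automorphism is exactly \<open>p\<close>.\<close>
 have id_iff: "\<phi> 1 [^]\<^bsub>AutoGroup ?V\<^esub> n = \<one>\<^bsub>AutoGroup ?V\<^esub> \<longleftrightarrow> p dvd n" for n :: nat
 proof -
  define j where "j = int n mod int (p ^ k)"
  have jc: "j \<in> carrier ?Q" by (simp add: carrier_integer_mod_group j_def)
  have pj: "int p dvd j \<longleftrightarrow> p dvd n" unfolding j_def by (simp add: k(1) dvd_mod_iff)
  have "\<phi> j = \<one>\<^bsub>AutoGroup ?V\<^esub> \<longleftrightarrow> int p dvd j"
  proof
   assume e: "\<phi> j = \<one>\<^bsub>AutoGroup ?V\<^esub>"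
   obtain m where m: "m \<in> carrier ?V" "n0 = \<psi> m" using n0(1) \<psi>(3) by blast
   have "cj (u [^] j) n0 = n0" using m(1) \<phi>[OF jc m(1)] m(2) by (simp add: AutoGroup_def BijGroup_def e)
   then have "cj (u [^] j) ` (cj n0 ` S) = cj n0 ` (cj (u [^] j) ` S)"
    using cj_self Nc n0(1) act_mult[OF _ Nc[OF n0(1)] S, of "u [^] j"] act_mult[OF Nc[OF n0(1)] _ S, of "u [^] j"] by simp
   moreover have uS: "cj (u [^] j) ` S = S" by (rule BL_self[OF S u_pow_S])
   ultimately have "cj (u [^] j) ` (cj n0 ` S) = cj n0 ` S" by simp
   then show "int p dvd j" using sharp[OF _ S BL_cj[OF S Nc[OF n0(1)]] n0(2)[symmetric] uS] C_pow_u by simp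
  next
   assume "int p dvd j"
   then have uC: "u [^] j \<in> C" using C_pow_u by blast
   have "\<phi> j m = m" if m: "m \<in> carrier ?V" for m
    using cj_center[OF uC hom_in_carrier[OF \<psi>(1) m]] inj_onD[OF \<psi>(2) _ cl[OF jc m] m] by (simp add: \<phi>[OF jc m])
   then show "\<phi> j = \<one>\<^bsub>AutoGroup ?V\<^esub>"
    using auto[OF jc] by (simp add: extensionalityI[of _ "carrier ?V"] auto_def Bij_def AutoGroup_def BijGroup_def)
  qed
  then show ?thesis unfolding pw pj[symmetric] j_def .
 qed
 \<comment> \<open>A power of \<open>u\<close> carrying the block of \<open>\<psi> v\<close> to that
   of \<open>\<psi> w\<close> conjugates \<open>\<psi> v\<close> to an element of \<open>N\<close>
   with the same effect on \<open>S\<close> as \<open>\<psi> w\<close>, hence to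
   \<open>\<psi> w\<close> itself.\<close>
 have trans: "\<exists>n. (\<phi> 1 ^^ n) v = w"
  if vw: "v \<in> carrier ?V - {\<one>\<^bsub>?V\<^esub>}" "w \<in> carrier ?V - {\<one>\<^bsub>?V\<^esub>}" for v w
 proof -
  have nt: "\<psi> t \<in> N" "cj (\<psi> t) ` S \<noteq> S" if t: "t \<in> carrier ?V - {\<one>\<^bsub>?V\<^esub>}" for t
  proof -
   show tN: "\<psi> t \<in> N" using t \<psi>(3) by blast
   show "cj (\<psi> t) ` S \<noteq> S"
    using inj_onD[OF \<psi>(2), of t "\<one>\<^bsub>?V\<^esub>"] t hom_one[OF \<psi>(1) V.is_group is_group] E_fix[OF subsetD[OF NE tN] S] NC tN by auto
  qed
  have vc: "\<psi> v \<in> \<G>" "\<psi> w \<in> \<G>" using nt vw Nc by auto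
  obtain i where i: "cj (u [^] (i::nat)) ` (cj (\<psi> v) ` S) = cj (\<psi> w) ` S"
   using moves_to[OF S BL_cj[OF S vc(1)] nt(2)[OF vw(1)] u BL_cj[OF S vc(2)] nt(2)[OF vw(2)]] by blast
  have it: "(\<phi> 1 ^^ n) v \<in> carrier ?V \<and> \<psi> ((\<phi> 1 ^^ n) v) = cj (u [^] n) (\<psi> v)" for n
  proof (induction n)
   case 0 then show ?case using vw vc by simp
  next
   case (Suc n)
   show ?case by (simp add: \<phi>[OF 1] Suc vc cl[OF 1] cj_cj nat_pow_Suc2[symmetric])
  qed
  have ui: "u [^] i \<in> \<G>" "u [^] i \<in> S" using subgroup_pow[OF S_sub u_S] by auto
  have "cj (cj (u [^] i) (\<psi> v)) ` (cj (u [^] i) ` S) = cj (\<psi> w) ` S"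
   using vc i act_mult[OF _ ui(1) S, of "cj (u [^] i) (\<psi> v)"] act_mult[OF ui(1) vc(1) S] by (simp add: cj_def m_assoc)
  then show ?thesis
   using it[of i] inj_onD[OF \<psi>(2), of "(\<phi> 1 ^^ i) v" w] vw by (auto simp: BL_self[OF S ui(2)] reg1[OF nn[OF ui(1) nt(1)[OF vw(1)]] nt(1)[OF vw(2)]])
 qed
 have "singer_cycle r (\<phi> 1)"
  unfolding singer_cycle_def by (metis h.hom_closed[OF 1] trans group.ord_unique[OF V.AutoGroup h.hom_closed[OF 1], of p] id_iff pr)
 moreover have "generate ?Q {1} = carrier ?Q"
 proof -
  have "generate ?Q {1} = {i mod int (p ^ k) | i. i \<in> UNIV}"
   by (simp add: group.generate_pow[OF group_integer_mod_group 1] int_pow_integer_mod_group)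
  also have "\<dots> = carrier ?Q"
  proof
   show "{i mod int (p ^ k) | i. i \<in> UNIV} \<subseteq> carrier ?Q" by (auto simp: carrier_integer_mod_group)
   show "carrier ?Q \<subseteq> {i mod int (p ^ k) | i. i \<in> UNIV}"
   proof
    fix i assume "i \<in> carrier ?Q"
    then have "i = i mod int (p ^ k)" using p_gt_0 unfolding carrier_integer_mod_group by simp
    then show "i \<in> {i mod int (p ^ k) | i. i \<in> UNIV}" by blast
   qed
  qed
  finally show ?thesis .
 qed
 ultimately have "acts_as_singer_cycle r ?Q \<phi>" unfolding acts_as_singer_cycle_def using k(2) 1 by blast
 then show ?thesis using pr k(1) iso by blast
qed

lemma cyclic_case:
 assumes N: "subgroup N G" and NE: "N \<subseteq> E" and NC: "N \<inter> C \<subseteq> {\<one>}"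
  and nn: "\<And>g n. g \<in> \<G> \<Longrightarrow> n \<in> N \<Longrightarrow> cj g n \<in> N" and n0: "n0 \<in> N" "cj n0 ` S \<noteq> S"
  and p2: "p = 2"
 shows "\<exists>k \<phi>. k > 0 \<and> \<phi> \<in> hom (integer_mod_group (p ^ k)) (AutoGroup (integer_mod_group 3)) \<and>
  G \<cong> semidirect_product (integer_mod_group 3) (integer_mod_group (p ^ k)) \<phi> \<times>\<times> G\<lparr>carrier := A\<rparr>"
proof -
 have cN: "card N = 3" using regular_card(2)[OF N NE NC nn n0] p2 by simp
 have n0c: "n0 \<in> \<G>" using subgroup.mem_carrier[OF N n0(1)] .
 have "ord n0 dvd 3" by (metis subgroup_pow_card[OF N n0(1)] cN pow_eq_id[OF n0c])
 moreover have "ord n0 \<noteq> 1" "prime (3::nat)" using ord_eq_1[OF n0c] n0(2) S_carrier by auto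
 ultimately have o3: "ord n0 = 3" using prime_nat_iff by blast
 define \<psi> where "\<psi> i = n0 [^] (i::int)" for i
 have per: "n0 [^] (i mod 3) = n0 [^] (i::int)" for i using int_pow_eq[OF n0c, of "i mod 3" i] o3 by simp
 have hom: "\<psi> \<in> hom (integer_mod_group 3) G"
  by (rule homI) (use n0c per in \<open>simp_all add: \<psi>_def int_pow_mult\<close>)
 have inj: "inj_on \<psi> (carrier (integer_mod_group 3))"
 proof (rule hom_inj_onI[OF group_integer_mod_group hom])
  fix i assume i: "i \<in> carrier (integer_mod_group 3)" "\<psi> i = \<one>"
  then show "i = \<one>\<^bsub>integer_mod_group 3\<^esub>"
   using int_pow_eq_id[OF n0c] o3 i(1) by (auto simp: carrier_integer_mod_group \<psi>_def)
 qed
 have img: "\<psi> ` carrier (integer_mod_group 3) = N"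
 proof (rule card_subset_eq[OF subgroup_finite[OF N]])
  show "\<psi> ` carrier (integer_mod_group 3) \<subseteq> N" unfolding \<psi>_def using subgroup_int_pow_closed[OF N n0(1)] by blast
  show "card (\<psi> ` carrier (integer_mod_group 3)) = card N" using card_image[OF inj] cN by (simp add: carrier_integer_mod_group)
 qed
 have NS: "N \<inter> S \<subseteq> {\<one>}" using E_fix[OF _ S BL_self[OF S]] NE NC by auto
 show ?thesis using split_semidirect[OF group_integer_mod_group hom inj img nn n0 NS] by blast
qed

end

locale sharp_split_elem = sharp_split + sharp_blocks_elem
begin

lemma quaternion_case:
 assumes p3: "p = 3" and e: "eqC (X 0 \<otimes> X 1) (X 2)" and nc: "X 0 \<otimes> X 1 \<noteq> X 1 \<otimes> X 0"
 shows "\<exists>k \<phi>. k > 0 \<and> \<phi> \<in> hom (integer_mod_group (p ^ k)) (AutoGroup Q8) \<and>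
  G \<cong> semidirect_product Q8 (integer_mod_group (p ^ k)) \<phi> \<times>\<times> G\<lparr>carrier := A\<rparr>"
proof -
 obtain l where l: "l \<in> C" "X 2 = X 0 \<otimes> X 1 \<otimes> l" using e unfolding eqC_def by blast
 have lc: "l \<in> \<G>" by (rule center_carrier[OF l(1)])
 have cjl: "cj g l = l" if "g \<in> \<G>" for g using cj_self[OF that lc] center_comm[OF l(1) that] by simp
 have X3: "X 3 = X 0" "X 4 = X 1" using X_period[of 3 0] X_period[of 4 1] p3 by (simp_all add: cong_def)
 \<comment> \<open>The central factor \<open>l\<close> is absorbed into the generators: the relation
   \<open>X 2 = X 0 \<otimes> X 1 \<otimes> l\<close>, valid up to \<open>C\<close> without
   \<open>l\<close>, becomes the exact relation
   \<open>y i \<otimes> y (i + 1) = y (i + 2)\<close>.\<close>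
 define y where "y i = X i \<otimes> l" for i
 have yc [simp]: "y i \<in> \<G>" for i unfolding y_def using lc by simp
 have yE: "y i \<in> E" and yC: "y i \<notin> C" for i
  using subgroup.m_closed[OF E_subgroup X_E C_E[OF l(1)]] X_notin_C eqC_mem_C[OF X_carrier eqC_C[OF X_carrier l(1)]] by (auto simp: y_def)
 have rel: "y i \<otimes> y (i + 1) = y (i + 2)" for i
 proof -
  have "X (i + 2) = cj (u [^] i) (X 2)" by (simp add: cj_X)
  also have "\<dots> = X i \<otimes> X (i + 1) \<otimes> l" unfolding l(2) using lc cjl by (simp add: cj_mult cj_X)
  finally have "y (i + 2) = X i \<otimes> ((X (i + 1) \<otimes> l) \<otimes> l)"
   using lc by (simp add: m_assoc y_def)
  also have "X (i + 1) \<otimes> l = l \<otimes> X (i + 1)" by (metis center_comm[OF l(1) X_carrier])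
  finally show ?thesis unfolding y_def using lc by (simp add: m_assoc)
 qed
 define z where "z = y 0 \<otimes> y 0"
 have zC: "z \<in> C" unfolding z_def using E_square[OF _ yE] p3 by simp
 have zcr: "z \<in> \<G>" by (rule center_carrier[OF zC])
 have cjy: "cj (u [^] (i::int)) (y j) = y (i + j)" for i j unfolding y_def using lc cjl by (simp add: cj_mult cj_X)
 have sq: "y i \<otimes> y i = z" for i
 proof -
  have "y i \<otimes> y i = cj (u [^] i) z" unfolding z_def using cjy[of i 0] by (simp add: cj_mult)
  also have "\<dots> = z" using cj_self[OF _ zcr] center_comm[OF zC] by simp
  finally show ?thesis .
 qed
 have y3: "y 3 = y 0" "y 4 = y 1" unfolding y_def X3 by simp_all
 have r0: "y 0 \<otimes> y 1 = y 2" and r1: "y 1 \<otimes> y 2 = y 0" and r2: "y 2 \<otimes> y 0 = y 1"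
  using rel[of 0] rel[of 1] rel[of 2] y3 by simp_all
 note Q = quaternion_hom[OF yc yc yc zcr r0 r1 r2 sq sq sq]
 let ?\<psi> = "\<lambda>(a, b, c, d). if a = 1 then \<one> else if a = - 1 then z else if b = 1 then y 0
   else if b = - 1 then z \<otimes> y 0 else if c = 1 then y 1 else if c = - 1 then z \<otimes> y 1
   else if d = (1::int) then y 2 else z \<otimes> y 2"
 let ?N = "{\<one>, z, y 0, z \<otimes> y 0, y 1, z \<otimes> y 1, y 2, z \<otimes> y 2}"
 \<comment> \<open>If \<open>z\<close> were trivial, \<open>y 0\<close> and \<open>y 1\<close> would
   commute, and so would \<open>X 0\<close> and \<open>X 1\<close>, which differ from them by
   central factors.\<close>
 have z1: "\<one> \<noteq> z"
 proof
  assume "\<one> = z"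
  then have yy: "y 1 \<otimes> y 0 = y 0 \<otimes> y 1" using Q(5) r0 by (simp add: \<open>\<one> = z\<close>[symmetric])
  have X: "X 0 = y 0 \<otimes> inv l" "X 1 = y 1 \<otimes> inv l" and il: "inv l \<in> C" "inv l \<in> \<G>"
   using lc subgroup.m_inv_closed[OF C_sub l(1)] by (auto simp: m_assoc y_def)
  have 1: "y 0 \<otimes> X 1 = X 1 \<otimes> y 0" unfolding X by (rule comm_mult[OF yc yc il(2) yy[symmetric] center_comm[OF il(1) yc, symmetric]])
  show False
   by (metis nc X(1) comm_mult[OF X_carrier yc il(2) 1[symmetric] center_comm[OF il(1) X_carrier, symmetric]])
 qed
 have one: "\<one> \<notin> {y 0, y 1, y 2}" "z \<notin> {y 0, y 1, y 2}"
  using yC subgroup.one_closed[OF C_sub] zC by (metis empty_iff insert_iff)+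
 have inj: "inj_on ?\<psi> (carrier Q8)" by (rule Q(4)[OF z1 one])
 have NG: "subgroup ?N G"
 proof -
  interpret group_hom Q8 G ?\<psi> using group_Q8 Q(1) by (simp add: group_hom_def group_hom_axioms_def)
  show ?thesis using img_is_subgroup Q(3) by simp
 qed
 have yN: "y i \<in> ?N" for i
 proof -
  have "i \<doteq> 0 \<or> i \<doteq> 1 \<or> i \<doteq> 2" by (auto simp: cong_def p3)
  then show ?thesis using X_period by (auto simp: y_def)
 qed
 have zyN: "z \<otimes> y i \<in> ?N" for i by (rule subgroup.m_closed[OF NG _ yN]) simp
 have Nc: "?N \<subseteq> \<G>" by (rule subgroup.subset[OF NG])
 have nn: "cj g n \<in> ?N" if g: "g \<in> \<G>" "n \<in> ?N" for g n
 proof (rule normalized[OF Nc _ _ g])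
  show "cj u n \<in> ?N" if n: "n \<in> ?N" for n
  proof -
   have cz: "cj u z = z" using cj_self[OF u_carrier zcr] center_comm[OF zC u_carrier] by simp
   have cy: "cj u (y i) = y (1 + i)" for i using cjy[of 1 i] by simp
   have czy: "cj u (z \<otimes> y i) = z \<otimes> y (1 + i)" for i using cz cy zcr by (simp add: cj_mult)
   show ?thesis using n disjE exE cz cy yN czy zyN by fastforce
  qed
  show "cj f n \<in> ?N" if f: "f \<in> E" and n: "n \<in> ?N" for f n
  proof (cases "f \<in> C")
   case True
   show ?thesis by (metis n cj_center[OF True subsetD[OF Nc n]])
  next
   case False
   then obtain i where "eqC (X i) f" using X_cover f by blast
   then obtain c where c: "c \<in> C" "f = y i \<otimes> c"
    using eqC_sym[OF X_carrier eqC_C[OF X_carrier l(1)]] eqC_trans yc unfolding y_def eqC_def by blast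
   have ncr: "n \<in> \<G>" by (rule subsetD[OF Nc n])
   have "cj f n = cj (y i) (cj c n)" unfolding c(2) using ncr center_carrier[OF c(1)] by (simp add: cj_cj)
   also have "\<dots> \<in> ?N"
    by (metis cj_center[OF c(1) ncr] cj_def subgroup.m_closed[OF NG subgroup.m_closed[OF NG yN n] subgroup.m_inv_closed[OF NG yN]])
   finally show ?thesis .
  qed
 qed
 have n0: "y 0 \<in> ?N" "cj (y 0) ` S \<noteq> S" using E_fix[OF yE S] yC by auto
 have NS: "?N \<inter> S \<subseteq> {\<one>}"
 proof
  fix n assume n: "n \<in> ?N \<inter> S"
  have nS: "cj n ` S = S" and nP: "n \<in> P" using n BL_self[OF S] BL_P[OF S] by auto
  have "n = \<one> \<or> n = z"
   using n E_fix[OF yE S] yC nS subgroup.m_closed[OF E_subgroup C_E[OF zC] yE] E_fix[OF _ S nS] center_comm[OF zC yc] eqC_mem_C[OF yc eqC_C[OF yc zC]] by fastforce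
  moreover have "n \<noteq> z"
  \<comment> \<open>The square of \<open>z\<close> is \<open>\<one>\<close>, and \<open>S\<close>
    consists of 3-elements.\<close>
  proof
   assume "n = z"
   then have "n [^] (2::nat) = \<one>" using Q(2) zcr by (simp add: numeral_2_eq_2)
   then show False using P_eq_one[OF nP] p3 \<open>n = z\<close> z1 by fastforce
  qed
  ultimately show "n \<in> {\<one>}" by simp
 qed
 show ?thesis using split_semidirect[OF group_Q8 Q(1) inj Q(3) nn n0 NS] by blast
qed

end

section \<open>Assembly of the cases\<close>

context block_group begin

lemma sharp_case:
 assumes sharp: "\<And>g B B'. g \<in> \<G> \<Longrightarrow> B \<in> BL \<Longrightarrow> B' \<in> BL \<Longrightarrow> B \<noteq> B' \<Longrightarrow> cj g ` B = B \<Longrightarrow>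
  cj g ` B' = B' \<Longrightarrow> g \<in> center G"
 shows "(\<exists>r k \<phi> A. p = 2 ^ r - 1 \<and> p \<ge> 3 \<and> k > 0 \<and>
   acts_as_singer_cycle r (integer_mod_group (p ^ k)) \<phi> \<and>
   subgroup A G \<and> A \<subseteq> Z \<and> comm_group (G\<lparr>carrier := A\<rparr>) \<and>
   G \<cong> semidirect_product (elementary_abelian_2 r) (integer_mod_group (p ^ k)) \<phi> \<times>\<times> G\<lparr>carrier := A\<rparr>)
  \<or> (p = 3 \<and> (\<exists>k \<phi> A. k > 0 \<and> \<phi> \<in> hom (integer_mod_group (3 ^ k)) (AutoGroup Q8) \<and>
   subgroup A G \<and> A \<subseteq> Z \<and> comm_group (G\<lparr>carrier := A\<rparr>) \<and>
   G \<cong> semidirect_product Q8 (integer_mod_group (3 ^ k)) \<phi> \<times>\<times> G\<lparr>carrier := A\<rparr>))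
  \<or> (p = 2 \<and> (\<exists>k \<phi> A. k > 0 \<and> \<phi> \<in> hom (integer_mod_group (2 ^ k)) (AutoGroup (integer_mod_group 3)) \<and>
   subgroup A G \<and> A \<subseteq> Z \<and> comm_group (G\<lparr>carrier := A\<rparr>) \<and>
   G \<cong> semidirect_product (integer_mod_group 3) (integer_mod_group (2 ^ k)) \<phi> \<times>\<times> G\<lparr>carrier := A\<rparr>))"
proof -
 obtain S T where ST: "S \<in> BL" "T \<in> BL" "T \<noteq> S" using third_block by metis
 have SZ: "\<not> S \<subseteq> Z" using Z_BL[OF ST(1)] BL_ne_Z[OF ST(1)] by blast
 \<comment> \<open>The index of \<open>Z\<close> in \<open>S\<close> is the prime \<open>p\<close>,
   so any element outside \<open>Z\<close> generates \<open>S\<close> modulo \<open>Z\<close>; this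
   is what \<open>abelian_splitting\<close> asks for.\<close>
 have ind: "\<exists>e::int. y \<otimes> x [^] e \<in> Z" if x: "x \<in> S" "x \<notin> Z" and y: "y \<in> S" for x y
 proof -
  obtain i z where iz: "z \<in> Z" "y = x [^] (i::nat) \<otimes> z" using block_elements[OF ST(1) _ y, of x] x by blast
  have xc: "x \<in> \<G>" "z \<in> \<G>" using x(1) BL_carrier[OF ST(1)] iz Z_carrier by auto
  have "y \<otimes> x [^] (- int i) = z" by (simp add: Z_comm[OF iz(1), symmetric] xc int_pow_neg_int m_assoc iz(2))
  then show ?thesis using iz(1) by metis
 qed
 obtain s A where sA: "s \<in> S" "s \<notin> Z" "subgroup A G" "A \<subseteq> S \<inter> Z" "S \<subseteq> cp s A"
  "\<And>i::int. s [^] i \<in> A \<Longrightarrow> s [^] i = \<one>"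
  using abelian_splitting[OF BL_subgroup[OF ST(1)] BL_P[OF ST(1)] BL_comm[OF ST(1)] Z_subgroup SZ ind] by blast
 interpret B: sharp_split G p Z BL S s A
  by unfold_locales (use sharp ST sA subgroup.subset[OF sA(3)] subgroup.m_closed[OF sA(3)]
   subgroup.one_closed[OF sA(3)] subgroup.m_inv_closed[OF sA(3)] in auto)
 obtain x where x: "x \<in> B.E" "cj x ` S = T" using B.E_transitive[OF ST(1,2)] by blast
 have "x \<notin> center G" using B.act_C[OF _ ST(1)] x(2) ST(3) by auto
 interpret X: sharp_split_elem G p Z BL S s A x by unfold_locales (use x \<open>x \<notin> center G\<close> in auto)
 have AZ: "A \<subseteq> Z" using sA by blast
 have "comm_group (G\<lparr>carrier := A\<rparr>)"
  by (rule central_subgroup_comm_group[OF sA(3)]) (use AZ Z_comm in blast)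
 note AC = sA(3) AZ this
 have dich: "(\<forall>e\<in>B.E. \<forall>f\<in>B.E. e \<otimes> f = f \<otimes> e) \<or>
  (p = 3 \<and> B.eqC (X.X 0 \<otimes> X.X 1) (X.X 2) \<and> X.X 0 \<otimes> X.X 1 \<noteq> X.X 1 \<otimes> X.X 0)"
  using X.dichotomy_odd X.commutative_even p_ge_2 by (metis le_neq_implies_less)
 show ?thesis
 proof (cases "\<forall>e\<in>B.E. \<forall>f\<in>B.E. e \<otimes> f = f \<otimes> e")
  case False
  then have q: "p = 3" "B.eqC (X.X 0 \<otimes> X.X 1) (X.X 2)" "X.X 0 \<otimes> X.X 1 \<noteq> X.X 1 \<otimes> X.X 0" using dich by auto
  obtain k \<phi> where k: "k > 0" "\<phi> \<in> hom (integer_mod_group (p ^ k)) (AutoGroup Q8)"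
   "G \<cong> semidirect_product Q8 (integer_mod_group (p ^ k)) \<phi> \<times>\<times> G\<lparr>carrier := A\<rparr>"
   using X.quaternion_case[OF q] by blast
  show ?thesis
   by (rule disjI2, rule disjI1, rule conjI[OF q(1)], rule exI[of _ k], rule exI[of _ \<phi>], rule exI[of _ A],
    intro conjI k[unfolded q(1)] AC)
 next
  case True
  then have comm: "\<And>e f. e \<in> B.E \<Longrightarrow> f \<in> B.E \<Longrightarrow> e \<otimes> f = f \<otimes> e" by blast
  obtain N n0 where N: "subgroup N G" "N \<subseteq> B.E" "N \<inter> center G \<subseteq> {\<one>}"
   "\<And>g n. g \<in> \<G> \<Longrightarrow> n \<in> N \<Longrightarrow> cj g n \<in> N" "n0 \<in> N" "cj n0 ` S \<noteq> S"
   using X.commutative_complement[OF comm] by blast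
  show ?thesis
  proof (cases "p = 2")
   case True
   obtain k \<phi> where k: "k > 0" "\<phi> \<in> hom (integer_mod_group (p ^ k)) (AutoGroup (integer_mod_group 3))"
    "G \<cong> semidirect_product (integer_mod_group 3) (integer_mod_group (p ^ k)) \<phi> \<times>\<times> G\<lparr>carrier := A\<rparr>"
    using B.cyclic_case[OF N True] by blast
   show ?thesis
    by (rule disjI2, rule disjI2, rule conjI[OF True], rule exI[of _ k], rule exI[of _ \<phi>], rule exI[of _ A],
     intro conjI k[unfolded True] AC)
  next
   case False
   then have odd: "2 < p" using p_ge_2 by simp
   \<comment> \<open>The square lies in the center by \<open>E_square\<close> and in
     \<open>N\<close>, and these meet trivially.\<close>
   have "n \<otimes> n = \<one>" if n: "n \<in> N" for n
    using X.E_square[OF odd subsetD[OF N(2) n]] subgroup.m_closed[OF N(1) n n] N(3) by blast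
   then obtain r k \<phi> where r: "p = 2 ^ r - 1" "k > 0" "acts_as_singer_cycle r (integer_mod_group (p ^ k)) \<phi>"
    "G \<cong> semidirect_product (elementary_abelian_2 r) (integer_mod_group (p ^ k)) \<phi> \<times>\<times> G\<lparr>carrier := A\<rparr>"
    using B.singer_case[OF N] by blast
   have "p \<ge> 3" using odd by simp
   show ?thesis
    by (rule disjI1, rule exI[of _ r], rule exI[of _ k], rule exI[of _ \<phi>], rule exI[of _ A],
     intro conjI r AC \<open>p \<ge> 3\<close>)
  qed
 qed
qed

end

context fin_group_prime begin

lemma p_group_case:
 assumes gen: "\<G> = generate G P" and eq: "Pr G p = bd" and P: "subgroup P G"
 shows "(\<exists>m. order G = p ^ m) \<and> card (rcosets\<^bsub>G\<^esub> (center G)) = p ^ 2"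
proof -
 have "generate G P \<subseteq> P" by (rule generate_subgroup_incl[OF subset_refl P])
 then have all: "\<G> = P" using gen P_subset by blast
 have "pe \<G> = \<G>" using pe_carrier_G all by simp
 then have Z: "Zp \<G> = center G" unfolding Zp_def center_def by simp
 have "card (rcosets\<^bsub>G\<^esub> (center G)) * card (center G) = card \<G>"
  using lagrange[OF normal_imp_subgroup[OF center_normal]] unfolding order_def .
 also have "\<dots> = p\<^sup>2 * card (center G)" using equality_cases(2)[OF eq] Z all by simp
 finally have "card (rcosets\<^bsub>G\<^esub> (center G)) = p\<^sup>2"
  using subgroup_card_pos[OF normal_imp_subgroup[OF center_normal]] by simp
 moreover have "\<exists>m. order G = p ^ m" unfolding order_def all by (rule p_subgroup_card[OF P subset_refl])
 ultimately show ?thesis by blast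
qed

end

theorem theorem5p2:
 fixes G :: "('a, 'b) monoid_scheme" and p :: nat and Q :: "'a set"
 assumes "group G" and "finite (carrier G)" and "prime p"
  and "carrier G = O_upper_p' G p"
  and "Pr G p = (real p ^ 2 + real p - 1) / real p ^ 3"
  and "Q = O_lower_p G p"
 shows
  "((\<exists>m. order G = p ^ m) \<and> card (rcosets\<^bsub>G\<^esub> (center G)) = p ^ 2)
   \<or> (p \<ge> 5 \<and> comm_group (G\<lparr>carrier := Q\<rparr>) \<and>
    (G \<cong> SL2 (residue_ring (int p)) \<times>\<times> G\<lparr>carrier := Q\<rparr> \<or>
     G \<cong> PSL2 (residue_ring (int p)) \<times>\<times> G\<lparr>carrier := Q\<rparr>))
   \<or> (\<exists>r k \<phi> A. p = 2 ^ r - 1 \<and> p \<ge> 3 \<and> k > 0 \<and>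
    acts_as_singer_cycle r (integer_mod_group (p ^ k)) \<phi> \<and>
    subgroup A G \<and> A \<subseteq> Q \<and> comm_group (G\<lparr>carrier := A\<rparr>) \<and>
    G \<cong> semidirect_product (elementary_abelian_2 r) (integer_mod_group (p ^ k)) \<phi>
       \<times>\<times> G\<lparr>carrier := A\<rparr>)
   \<or> (p = 3 \<and> (\<exists>k \<phi> A. k > 0 \<and>
    \<phi> \<in> hom (integer_mod_group (3 ^ k)) (AutoGroup Q8) \<and>
    subgroup A G \<and> A \<subseteq> Q \<and> comm_group (G\<lparr>carrier := A\<rparr>) \<and>
    G \<cong> semidirect_product Q8 (integer_mod_group (3 ^ k)) \<phi> \<times>\<times> G\<lparr>carrier := A\<rparr>))
   \<or> (p = 2 \<and> (\<exists>k \<phi> A. k > 0 \<and>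
    \<phi> \<in> hom (integer_mod_group (2 ^ k)) (AutoGroup (integer_mod_group 3)) \<and>
    subgroup A G \<and> A \<subseteq> Q \<and> comm_group (G\<lparr>carrier := A\<rparr>) \<and>
    G \<cong> semidirect_product (integer_mod_group 3) (integer_mod_group (2 ^ k)) \<phi>
       \<times>\<times> G\<lparr>carrier := A\<rparr>))"
  (is "?p_group \<or> ?linear \<or> ?singer \<or> ?quaternion \<or> ?cyclic")
proof -
 interpret group G by (rule assms(1))
 interpret fin_group_prime G p by unfold_locales (use assms(2,3) in auto)
 have gen: "carrier G = generate G (p_elements G p)" using assms(4) by (simp add: O_upper_p'_def)
 have eq: "Pr G p = bd" using assms(5) by (simp add: bd_def)
 show ?thesis
 proof (cases "subgroup (p_elements G p) G")
  case True
  then show ?thesis using p_group_case[OF gen eq] by blast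
 next
  case False
  interpret B: block_group G p "Zp (carrier G)" "ce (carrier G) ` (p_elements G p - Zp (carrier G))"
   by (rule block_structure[OF gen eq False])
  let ?BL = "ce (carrier G) ` (p_elements G p - Zp (carrier G))"
  have Z: "Zp (carrier G) = Q" using B.Z_O_lower assms(6) by simp
  show ?thesis
  proof (cases "\<exists>g S T. g \<in> carrier G \<and> S \<in> ?BL \<and> T \<in> ?BL \<and> T \<noteq> S \<and> cj g ` S = S \<and> cj g ` T = T \<and> g \<notin> center G")
   case True
   then obtain g S T where "g \<in> carrier G" "cj g ` S = S" "cj g ` T = T" "S \<in> ?BL" "T \<in> ?BL" "T \<noteq> S" "g \<notin> center G"
    by auto
   from B.noncentral_torus_case[OF this] B.Z_comm_group have ?linear unfolding Z by simp
   then show ?thesis by (rule disjI2[OF disjI1])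
  next
   case False
   have "?singer \<or> ?quaternion \<or> ?cyclic"
    unfolding Z[symmetric] by (rule B.sharp_case) (use False in blast)
   then show ?thesis by (rule disjI2[OF disjI2])
  qed
 qed
qed

end
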